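(* Let $S$ be a set of $n$ closed line segments in $\mathbb{R}^2$ with pairwise disjoint interiors, let $C(S)=\bigcup_{s\in S}C_S(s)$, where $C_S(s)$ is the covering of $V_S(s)$ by triangles defined in the context, and let $p$ be any point in $\mathbb{R}^2$ that is not on the boundary of any triangle in $C(S)$. If $m_p$ is the number of segments in $S$ (partially) visible from $p$ and $m'_p$ is the number of triangles in $C(S)$ that contain $p$, then $$m_p\le m'_p\le 2m_p .$$
   Context: Standing assumptions: no segment of $S$ is vertical (so a point is "above" a segment $s$ if it is above the line containing $s$), and $S$ contains four segments that define a rectangle containing all other elements of $S$ in its interior (so all visibility regions considered are bounded). Visibility. Points $p,q$ are visible (w.r.t. $S$) if the open segment $pq$ intersects no element of $S$. A segment $s\in S$ is (partially) visible from $p$ if some $q\in s$ is visible from $p$. $V_S(p)=\{q\in\mathbb{R}^2 : p,q \text{ visible}\}$ and $V_S(s)=\bigcup_{q\in s}V_S(q)$. For $p\in s$, $V^+_S(p)$ and $V^+_S(s)$ denote the parts of $V_S(p)$ and $V_S(s)$ in the halfplane bounded from below by the supporting line of $s$. Graphs. The visibility graph $\mathit{VG}(S)$ has as vertices the $2n$ endpoints of segments of $S$, with an edge $pq$ iff the open segment $pq$ intersects no (closed) segment of $S$. The extended visibility graph $\mathit{EVG}(S)$ is obtained from $\mathit{VG}(S)$ as follows: for each directed edge $uv$ of $\mathit{VG}(S)$, extend a segment from $v$ in direction $\overrightarrow{uv}$ until it meets an element of $S$ at a point $w$; add the vertex $w$ (if not present) and the edge $vw$. The visibility space partition $\mathit{VSP}(S)$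 is the planar subdivision obtained by removing from $\mathbb{R}^2$ the union of the edges of $\mathit{EVG}(S)$ and the segments of $S$. Active edges. For $p\in s$, an active edge of $V^+_S(p)$ is an edge $e$ of the polygon $V^+_S(p)$ (not on the supporting line of $s$) that is collinear with $p$ and such that the interior of $V^+_S(p)$ is to the right of $e$. Its lower endpoint $q$ (the one closer to $p$) is an endpoint of some segment of $S$. Definition of $C_S(s)$. $C_S(s)=C^+_S(s)\cup C^-_S(s)$, where $C^+_S(s)$ is the set of triangles generated as follows and $C^-_S(s)$ is obtained by the symmetric procedure (the same procedure after rotating the plane by $180^\circ$) for the part of $V_S(s)$ on the other side of $s$. Let $p_1,\ldots,p_{m'_s}$ be the vertices of $\mathit{VSP}(S)$ on $s$ in left-to-right order, so $p_1$ and $p_{m'_s}$ are the left and right endpoints of $s$. Initially $p=p_1$: the polygon $V^+_S(p_1)$, whose boundary alternates between subsegments of elements of $S$ and segments collinear with $p_1$, is decomposed into the non-overlapping triangles having apex $p_1$ and opposite side one of these subsegments of elements of $S$; these triangles are put in $C^+_S(s)$, and every active edge $e$ of $V^+_S(p_1)$ gets $\mathrm{start}(e)=p_1$. Then $p$ sweeps $s$ from left to right; during the sweep an active edge stays collinear with $p$ and its (fixed) lower endpoint $q$. On reaching $p_i$, $i\ge 2$, the edges $e'$ of $\mathit{EVG}(S)$ incident on $p_i$ are processed one at a time. If $e'$ is collinear with an active edge $e$ with lower endpoint $q$, the triangle $\Delta_e$ is added to $C^+_S(s)$: it is the region swept by $e$ as $p$ moves from $\mathrm{start}(e)$ to $p_i$,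 i.e. its lowest vertex is $q$, two of its sides lie on the line through $q$ and $p_i$ and on the line through $q$ and $\mathrm{start}(e)$, and its third side lies on the segment of $S$ that contains the other endpoint of $e$ (the one furthest from $p_i$). The polygon $V^+_S(p)$ is then updated near $e$, and each new active edge $f$ thereby created (possibly again with lower endpoint $q$) gets $\mathrm{start}(f)=p_i$. In particular at the right endpoint $p_{m'_s}$ of $s$ each active edge generates a triangle that is added to $C^+_S(s)$. Triangles generated for different segments $s$ are counted as different elements of $C(S)$.
   Formalization: Here p lies in the bounding rectangle (outside it m'_p=0<m_p); where another segment touches s at p_i, i≥2, the part of V^+_S(p_i) newly visible there is also cut into triangles with apex p_i (else m_p≤m'_p can fail); segments of S count as edges of VG(S). *)

theory Defs
  imports "HOL-Analysis.Analysis"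
begin

type_synonym pt = "real^2"

text \<open>A non-vertical segment is the pair of its left and its right endpoint.\<close>

type_synonym sgmt = "pt \<times> pt"

definition seg :: "sgmt \<Rightarrow> pt set" where
  "seg s = closed_segment (fst s) (snd s)"

definition nonvertical :: "sgmt \<Rightarrow> bool" where
  "nonvertical s \<longleftrightarrow> fst s $ 1 < snd s $ 1"

definition disjoint_interiors :: "sgmt set \<Rightarrow> bool" where
  "disjoint_interiors S \<longleftrightarrow>
     pairwise (\<lambda>s t. open_segment (fst s) (snd s) \<inter> open_segment (fst t) (snd t) = {}) S"

definition bounding_rectangle :: "sgmt set \<Rightarrow> pt \<Rightarrow> pt \<Rightarrow> pt \<Rightarrow> pt \<Rightarrow> bool" where
  "bounding_rectangle S A B C D \<longleftrightarrow>
     B \<noteq> A \<and> D \<noteq> A \<and> (B - A) \<bullet> (D - A) = 0 \<and> C = B + (D - A) \<and>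
     (let R = {closed_segment A B, closed_segment B C, closed_segment C D, closed_segment D A}
      in R \<subseteq> seg ` S \<and>
         (\<forall>s\<in>S. seg s \<notin> R \<longrightarrow> seg s \<subseteq> interior (convex hull {A, B, C, D})))"

definition cross :: "pt \<Rightarrow> pt \<Rightarrow> real" where
  "cross u v = u $ 1 * v $ 2 - u $ 2 * v $ 1"

definition obstacles :: "sgmt set \<Rightarrow> pt set" where
  "obstacles S = \<Union> (seg ` S)"

definition endpoints :: "sgmt set \<Rightarrow> pt set" where
  "endpoints S = fst ` S \<union> snd ` S"

definition visible :: "sgmt set \<Rightarrow> pt \<Rightarrow> pt \<Rightarrow> bool" where
  "visible S p q \<longleftrightarrow> open_segment p q \<inter> obstacles S = {}"

definition seg_visible :: "sgmt set \<Rightarrow> pt \<Rightarrow> sgmt \<Rightarrow> bool" where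
  "seg_visible S p s \<longleftrightarrow> (\<exists>q\<in>seg s. visible S p q)"

definition vis_region :: "sgmt set \<Rightarrow> pt \<Rightarrow> pt set" where
  "vis_region S p = {q. visible S p q}"

text \<open>As \<open>fst s\<close> is the left endpoint, \<open>cross (snd s - fst s) (q - fst s)\<close> is positive iff
  \<open>q\<close> lies strictly above the supporting line of \<open>s\<close>.\<close>

definition vis_above :: "sgmt set \<Rightarrow> sgmt \<Rightarrow> pt \<Rightarrow> pt set" where
  "vis_above S s p = {q \<in> vis_region S p. 0 \<le> cross (snd s - fst s) (q - fst s)}"

text \<open>The elements of \<open>S\<close> are themselves edges of the visibility graph, although their relative
  interiors meet \<open>S\<close>; without their extensions the visibility polygon would change
  combinatorially, as its apex crosses the supporting line of a segment, at a point which is not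
  a vertex of the partition.\<close>

definition vg_edge :: "sgmt set \<Rightarrow> pt \<Rightarrow> pt \<Rightarrow> bool" where
  "vg_edge S u v \<longleftrightarrow> u \<noteq> v \<and> u \<in> endpoints S \<and> v \<in> endpoints S \<and>
     (visible S u v \<or> (u, v) \<in> S \<or> (v, u) \<in> S)"

text \<open>There is no extension edge if the ray beyond \<open>v\<close> misses \<open>S\<close> or starts along an element
  of \<open>S\<close>.\<close>

definition extension_edge :: "sgmt set \<Rightarrow> pt \<Rightarrow> pt \<Rightarrow> bool" where
  "extension_edge S v w \<longleftrightarrow>
     (\<exists>u k. vg_edge S u v \<and> 0 < k \<and> w = v + k *\<^sub>R (v - u) \<and>
            w \<in> obstacles S \<and> visible S v w)"

definition evg_edges :: "sgmt set \<Rightarrow> (pt \<times> pt) set" where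
  "evg_edges S = {(u, v). vg_edge S u v \<or> extension_edge S u v}"

text \<open>Vertices of the subdivision: ends of edges, and points where two edges cross or touch.
  The elements of \<open>S\<close> are among the edges.\<close>

definition vsp_vertices :: "sgmt set \<Rightarrow> pt set" where
  "vsp_vertices S =
     fst ` evg_edges S \<union> snd ` evg_edges S \<union>
     {x. \<exists>e\<in>evg_edges S. \<exists>e'\<in>evg_edges S.
           closed_segment (fst e) (snd e) \<inter> closed_segment (fst e') (snd e') = {x}}"

definition vertices_on :: "sgmt set \<Rightarrow> sgmt \<Rightarrow> pt list" where
  "vertices_on S s = sorted_key_list_of_set (\<lambda>x. x $ 1) (vsp_vertices S \<inter> seg s)"

text \<open>The segment from \<open>q\<close> to \<open>w\<close> is collinear with \<open>p\<close>, its lower end is \<open>q\<close>, and the visibility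
  polygon lies, locally, to the right but not to the left of it.\<close>

definition right_side_edge :: "sgmt set \<Rightarrow> sgmt \<Rightarrow> pt \<Rightarrow> pt \<Rightarrow> pt \<Rightarrow> bool" where
  "right_side_edge S s p q w \<longleftrightarrow>
     q \<in> open_segment p w \<and> 0 < cross (snd s - fst s) (q - fst s) \<and>
     (\<forall>z\<in>open_segment q w. \<exists>e>0. \<forall>y\<in>ball z e.
        (cross (w - p) (y - p) < 0 \<longrightarrow> y \<in> vis_above S s p) \<and>
        (0 < cross (w - p) (y - p) \<longrightarrow> y \<notin> vis_above S s p))"

text \<open>An edge of a polygon is maximal among the segments on its boundary.\<close>

definition active_edge :: "sgmt set \<Rightarrow> sgmt \<Rightarrow> pt \<Rightarrow> pt \<Rightarrow> pt \<Rightarrow> bool" where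
  "active_edge S s p q w \<longleftrightarrow> right_side_edge S s p q w \<and>
     (\<forall>q' w'. right_side_edge S s p q' w' \<and> closed_segment q w \<subseteq> closed_segment q' w'
        \<longrightarrow> q' = q \<and> w' = w)"

text \<open>Between consecutive vertices the active edges are identified by their lower endpoints.\<close>

definition active_between :: "sgmt set \<Rightarrow> sgmt \<Rightarrow> pt \<Rightarrow> pt \<Rightarrow> pt set" where
  "active_between S s a b = {q. \<forall>x\<in>open_segment a b. \<exists>w. active_edge S s x q w}"

text \<open>The region swept by the active edge with lower endpoint \<open>q\<close> while the apex moves from \<open>a\<close>
  to \<open>b\<close>. The closure adds the limit positions of the edge at \<open>a\<close> and \<open>b\<close>, where it may be part of
  a longer edge or be blocked by another endpoint on the same line.\<close>

definition swept_triangle :: "sgmt set \<Rightarrow> sgmt \<Rightarrow> pt \<Rightarrow> pt \<Rightarrow> pt \<Rightarrow> pt set" where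
  "swept_triangle S s q a b =
     closure (\<Union>x\<in>open_segment a b. \<Union>w\<in>{w. active_edge S s x q w}. closed_segment q w)"

definition evg_collinear :: "sgmt set \<Rightarrow> pt \<Rightarrow> pt \<Rightarrow> bool" where
  "evg_collinear S b q \<longleftrightarrow>
     (\<exists>e\<in>evg_edges S. (b = fst e \<or> b = snd e) \<and> collinear {q, fst e, snd e})"

text \<open>In \<open>sweep S s start ps\<close> the apex has reached the first element of \<open>ps\<close> and \<open>start q\<close> is
  the start of the active edge with lower endpoint \<open>q\<close>.\<close>

fun sweep :: "sgmt set \<Rightarrow> sgmt \<Rightarrow> (pt \<Rightarrow> pt) \<Rightarrow> pt list \<Rightarrow> pt set set" where
  "sweep S s start (a # b # ps) =
     (let A = active_between S s a b;
          ended = {q \<in> A. evg_collinear S b q \<or> ps = []}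
      in (\<lambda>q. swept_triangle S s q (start q) b) ` ended \<union>
         sweep S s (\<lambda>q. if q \<in> A - ended then start q else b) (b # ps))"
| "sweep S s start _ = {}"

text \<open>Decomposition of a polygon \<open>N\<close> that is star-shaped around \<open>a\<close> into the triangles with apex
  \<open>a\<close> over the subsegments of elements of \<open>S\<close> on its boundary. Subsegments that are collinear
  with \<open>a\<close> do not span a triangle.\<close>

definition fan :: "sgmt set \<Rightarrow> pt \<Rightarrow> pt set \<Rightarrow> pt set set" where
  "fan S a N =
     {convex hull (insert a I) | I t.
        t \<in> S \<and> I \<in> components (seg t \<inter> frontier N) \<and> \<not> collinear (insert a I)}"

text \<open>The part of the visibility polygon of \<open>a\<close> that is not visible from the points of \<open>s\<close>
  immediately to the left of \<open>a\<close>. It has empty interior, and \<open>fan\<close> yields no triangle for it,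
  unless another segment touches \<open>s\<close> at \<open>a\<close> from above (disjoint interiors allow this). In that
  case the polygon jumps at \<open>a\<close>: the part hidden until then by the touching segment appears
  without being swept by any active edge. For the triangles to cover what \<open>s\<close> sees, it is
  decomposed in the same way as the initial polygon.\<close>

definition jump_region :: "sgmt set \<Rightarrow> sgmt \<Rightarrow> pt \<Rightarrow> pt set" where
  "jump_region S s a =
     {y \<in> vis_above S s a. \<exists>e>0. \<forall>x\<in>seg s. x $ 1 < a $ 1 \<and> dist x a < e \<longrightarrow> \<not> visible S x y}"

definition cover_above :: "sgmt set \<Rightarrow> sgmt \<Rightarrow> pt set set" where
  "cover_above S s =
     fan S (fst s) (vis_above S s (fst s)) \<union>
     sweep S s (\<lambda>_. fst s) (vertices_on S s) \<union>
     (\<Union>a \<in> set (vertices_on S s) - {fst s}. fan S a (jump_region S s a))"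

text \<open>Rotation by 180 degrees exchanges left and right endpoints.\<close>

definition rot :: "sgmt \<Rightarrow> sgmt" where
  "rot s = (- snd s, - fst s)"

definition cover_below :: "sgmt set \<Rightarrow> sgmt \<Rightarrow> pt set set" where
  "cover_below S s = (\<lambda>T. uminus ` T) ` cover_above (rot ` S) (rot s)"

definition cover :: "sgmt set \<Rightarrow> sgmt \<Rightarrow> pt set set" where
  "cover S s = cover_above S s \<union> cover_below S s"

text \<open>Triangles are tagged with the segment that generates them, so that those of different
  segments are different elements.\<close>

definition all_triangles :: "sgmt set \<Rightarrow> (sgmt \<times> pt set) set" where
  "all_triangles S = (SIGMA s:S. cover S s)"

end

theory Submission
  imports Defs
begin

text \<open>If \<open>p\<close> is on no frontier, then \<open>p\<close> is on no segment and on the supporting line of no segment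
  that it sees. The triangles of \<open>s\<close> that contain such a \<open>p\<close> correspond to the maximal intervals of \<open>s\<close>
  visible from \<open>p\<close>: each triangle determines the point \<open>x\<close> where \<open>p\<close> enters the visibility region of the
  sweeping point, that is, the clockwise end of the interval as seen from \<open>p\<close>. An interval that starts
  at the clockwise end of \<open>s\<close> is charged to the clockwise side of \<open>s\<close>. Every other interval starts at \<open>x\<close>
  because some segment ends at a point \<open>q\<close> of the line of sight from \<open>p\<close> to \<open>x\<close>; it is charged to the
  counterclockwise side of the front-most such segment, which \<open>p\<close> sees. The charging is injective, so
  each visible segment pays for at most two triangles, and a visible segment has at least one visible
  interval.\<close>

section \<open>Orientation and visibility\<close>

text \<open>\<open>active_edge\<close> speaks about whole neighbourhoods and about maximality, which
  is hard to follow along a sweep. It is replaced by \<open>act\<close>, a condition on the line of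
  sight from \<open>x\<close> to \<open>q\<close> and on the segments at \<open>q\<close>. The two
  agree for every apex in the interior of \<open>s\<close> at which no edge of the extended
  visibility graph is collinear with \<open>q\<close>, and near such apexes \<open>act\<close> does
  not change. The obstacle on the side of the triangles is that they are closures: a point of a
  triangle is only a limit of visible points. Genericity repairs this, since the first blocker of a
  line of sight from a generic point is never tangent to it and so hides a whole sector on one side.
  For the lower bound, a point of \<open>s\<close> that \<open>p\<close> sees is moved left as long
  as it stays visible; it stops at the left end of \<open>s\<close>, at a touching segment, or at a
  point from which \<open>p\<close> is hidden, and these three cases lead to the three families of
  triangles. Everything below \<open>s\<close> follows from the upper side by
  \<open>scene_rot\<close>.\<close>

definition ori :: "pt \<Rightarrow> pt \<Rightarrow> pt \<Rightarrow> real" where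
  "ori a b c = cross (b - a) (c - a)"

lemmas ori_simps = ori_def cross_def

lemma ori_same [simp]: "ori a a b = 0" "ori a b a = 0" "ori a b b = 0"
  by (auto simp: ori_simps algebra_simps)

lemma ori_rotate: "ori a b c = ori b c a"
  by (simp add: ori_simps algebra_simps)

lemma ori_swap: "ori b a c = - ori a b c" "ori a c b = - ori a b c"
  by (simp_all add: ori_simps algebra_simps)

lemma ori_uminus [simp]: "ori (- a) (- b) (- c) = ori a b c"
  by (simp add: ori_simps algebra_simps)

text \<open>\<open>ori\<close> is twice a signed area, hence affine in each argument separately.
  These three rules replace coordinates in most later computations.\<close>

lemma ori_line3: "ori u v (a + k *\<^sub>R (b - a)) = (1 - k) * ori u v a + k * ori u v b"
  by (simp add: ori_simps algebra_simps)

lemma ori_line2: "ori u (a + k *\<^sub>R (b - a)) v = (1 - k) * ori u a v + k * ori u b v"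
  by (simp add: ori_simps algebra_simps)

lemma ori_line1: "ori (a + k *\<^sub>R (b - a)) u v = (1 - k) * ori a u v + k * ori b u v"
  by (simp add: ori_simps algebra_simps)

lemma ori_cross_dir: "ori u v (a + r *\<^sub>R d) = ori u v a + r * cross (v - u) d"
  by (simp add: ori_simps algebra_simps)

text \<open>\<open>k\<close> is read off from whichever coordinate of \<open>b - a\<close> is
  nonzero, so vertical lines are covered as well.\<close>

lemma ori_zeroD:
  assumes "ori a b c = 0" "a \<noteq> b"
  obtains k where "c = a + k *\<^sub>R (b - a)"
proof -
  have *: "(b$1 - a$1) * (c$2 - a$2) = (b$2 - a$2) * (c$1 - a$1)"
    using assms(1) by (simp add: ori_simps)
  have "b$1 - a$1 \<noteq> 0 \<or> b$2 - a$2 \<noteq> 0"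
    using assms(2) by (auto simp: vec_eq_iff forall_2)
  then show ?thesis
  proof
    assume n: "b$1 - a$1 \<noteq> 0"
    define k where "k = (c$1 - a$1) / (b$1 - a$1)"
    have k: "k * (b$1 - a$1) = c$1 - a$1" using n by (simp add: k_def)
    have "(b$1 - a$1) * (k * (b$2 - a$2)) = (b$1 - a$1) * (c$2 - a$2)"
      using k * by (metis mult.commute mult.left_commute)
    then have "k * (b$2 - a$2) = c$2 - a$2" using n by simp
    with k show ?thesis by (intro that[of k]) (simp add: vec_eq_iff forall_2)
  next
    assume n: "b$2 - a$2 \<noteq> 0"
    define k where "k = (c$2 - a$2) / (b$2 - a$2)"
    have k: "k * (b$2 - a$2) = c$2 - a$2" using n by (simp add: k_def)
    have "(b$2 - a$2) * (k * (b$1 - a$1)) = (b$2 - a$2) * (c$1 - a$1)"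
      using k * by (metis mult.commute mult.left_commute)
    then have "k * (b$1 - a$1) = c$1 - a$1" using n by simp
    with k show ?thesis by (intro that[of k]) (simp add: vec_eq_iff forall_2)
  qed
qed

lemma collinear_iff_ori: "collinear {a, b, c} \<longleftrightarrow> ori a b c = 0"
proof
  assume "collinear {a, b, c}"
  then obtain u where u: "\<forall>x\<in>{a,b,c}. \<forall>y\<in>{a,b,c}. \<exists>k. x - y = k *\<^sub>R u"
    unfolding collinear_def by blast
  then obtain k l where "b - a = k *\<^sub>R u" "c - a = l *\<^sub>R u" by blast
  then show "ori a b c = 0" by (simp add: ori_def cross_def)
next
  assume o: "ori a b c = 0"
  show "collinear {a, b, c}"
  proof (cases "a = b")
    case True then show ?thesis by simp
  next
    case False
    then obtain k where k: "c = a + k *\<^sub>R (b - a)" using ori_zeroD o by blast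
    show ?thesis
      unfolding collinear_def
    proof (rule exI[of _ "b - a"], intro ballI)
      have line: "\<exists>r. x = a + r *\<^sub>R (b - a)" if "x \<in> {a, b, c}" for x
        using that k by (metis add.right_neutral add_diff_cancel_left' add_diff_eq insertE
            scaleR_one scaleR_zero_left singletonD)
      fix x y assume "x \<in> {a, b, c}" "y \<in> {a, b, c}"
      then obtain r q where "x = a + r *\<^sub>R (b - a)" "y = a + q *\<^sub>R (b - a)"
        using line by blast
      then have "x - y = (r - q) *\<^sub>R (b - a)" by (simp add: scaleR_left_diff_distrib)
      then show "\<exists>c. x - y = c *\<^sub>R (b - a)" by blast
    qed
  qed
qed

lemma in_closed_iff: "z \<in> closed_segment a b \<longleftrightarrow> (\<exists>k. 0 \<le> k \<and> k \<le> 1 \<and> z = a + k *\<^sub>R (b - a))"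
  for z :: pt
  by (auto simp: in_segment algebra_simps)

lemma in_open_iff: "z \<in> open_segment a b \<longleftrightarrow> a \<noteq> b \<and> (\<exists>k. 0 < k \<and> k < 1 \<and> z = a + k *\<^sub>R (b - a))"
  for z :: pt
  by (auto simp: in_segment algebra_simps)

lemma in_closedI: "0 \<le> k \<Longrightarrow> k \<le> 1 \<Longrightarrow> a + k *\<^sub>R (b - a) \<in> closed_segment a b" for a :: pt
  unfolding in_closed_iff by (rule exI[of _ k]) simp

lemma in_openI: "a \<noteq> b \<Longrightarrow> 0 < k \<Longrightarrow> k < 1 \<Longrightarrow> a + k *\<^sub>R (b - a) \<in> open_segment a b" for a :: pt
  unfolding in_open_iff by (intro conjI exI[of _ k]) simp_all

lemma tendsto_cross [tendsto_intros]:
  assumes "(f \<longlongrightarrow> a) F" "(g \<longlongrightarrow> b) F"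
  shows "((\<lambda>x. cross (f x) (g x)) \<longlongrightarrow> cross a b) F"
  unfolding cross_def by (intro tendsto_intros assms)

lemma tendsto_ori [tendsto_intros]:
  assumes "(f \<longlongrightarrow> a) F" "(g \<longlongrightarrow> b) F" "(h \<longlongrightarrow> c) F"
  shows "((\<lambda>x. ori (f x) (g x) (h x)) \<longlongrightarrow> ori a b c) F"
  unfolding ori_def by (intro tendsto_intros assms)

lemma continuous_on_ori [continuous_intros]:
  assumes "continuous_on A f" "continuous_on A g" "continuous_on A h"
  shows "continuous_on A (\<lambda>x. ori (f x) (g x) (h x))"
  using assms unfolding continuous_on_def by (auto intro: tendsto_ori)

text \<open>Along \<open>a b\<close> the affine function \<open>ori u v\<close> changes sign
  strictly, so it has an inner zero. That zero lies on the line through \<open>u\<close> and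
  \<open>v\<close>, and the second sign change places it strictly between them.\<close>

lemma segments_cross:
  assumes "ori u v a * ori u v b < 0" "ori a b u * ori a b v < 0"
  shows "open_segment a b \<inter> open_segment u v \<noteq> {}"
proof -
  have neq: "a \<noteq> b" "u \<noteq> v" using assms by (auto simp: zero_less_mult_iff)
  \<comment> \<open>\<open>l\<close> is the zero of the affine function \<open>ori u v\<close> along
    \<open>a b\<close>.\<close>
  define l where "l = ori u v a / (ori u v a - ori u v b)"
  define z where "z = a + l *\<^sub>R (b - a)"
  have l: "0 < l" "l < 1" using assms(1) by (auto simp: l_def mult_less_0_iff field_simps)
  have d: "ori u v a - ori u v b \<noteq> 0" using assms(1) by (auto simp: mult_less_0_iff)
  have "ori u v z = ori u v a - l * (ori u v a - ori u v b)"
    unfolding z_def ori_line3 by (simp add: algebra_simps)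
  then have "ori u v z = 0" using d by (simp add: l_def)
  then obtain k where k: "z = u + k *\<^sub>R (v - u)" using ori_zeroD neq by blast
  have "ori a b z = 0" unfolding z_def ori_line3 by simp
  then have k0: "(1 - k) * ori a b u + k * ori a b v = 0" unfolding k ori_line3 .
  define f g where "f = ori a b u" and "g = ori a b v"
  have fg: "f * g < 0" "k * (f - g) = f" "(1 - k) * (f - g) = - g"
    using assms(2) k0 by (simp_all add: f_def g_def algebra_simps)
  have "0 < k \<and> 0 < 1 - k"
  proof (cases "0 < f")
    case True
    then have "g < 0" using fg by (auto simp: mult_less_0_iff)
    then show ?thesis using True fg(2,3)
      by (metis diff_gt_0_iff_gt less_trans neg_0_less_iff_less zero_less_mult_pos2)
  next
    case False
    then have "f < 0" "0 < g" using fg(1) by (auto simp: mult_less_0_iff)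
    then have "0 < k * (g - f)" "0 < (1 - k) * (g - f)" "0 < g - f"
      using fg(2,3) by (auto simp: algebra_simps)
    then show ?thesis by (metis zero_less_mult_pos2)
  qed
  then have "0 < k" "k < 1" by auto
  then have "z \<in> open_segment u v" using k neq by (auto simp: in_open_iff)
  moreover have "z \<in> open_segment a b" using l neq z_def by (auto simp: in_open_iff)
  ultimately show ?thesis by blast
qed

lemma seg_convex: "convex (seg t)" and seg_compact: "compact (seg t)" and seg_closed: "closed (seg t)"
  and seg_ends [simp]: "fst t \<in> seg t" "snd t \<in> seg t"
  by (auto simp: seg_def)

lemma seg_sub: "a \<in> seg t \<Longrightarrow> b \<in> seg t \<Longrightarrow> closed_segment a b \<subseteq> seg t"
  using seg_convex convex_contains_segment by blast

text \<open>Along \<open>t\<close> the function \<open>ori u v\<close> is affine in the parameter,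
  and it vanishes at two different parameters.\<close>

lemma seg_subset_line:
  assumes "a \<in> seg t" "b \<in> seg t" "a \<noteq> b" "ori u v a = 0" "ori u v b = 0" "c \<in> seg t"
  shows "ori u v c = 0"
proof -
  obtain k l where k: "a = fst t + k *\<^sub>R (snd t - fst t)" and l: "b = fst t + l *\<^sub>R (snd t - fst t)"
    using assms(1,2) unfolding seg_def in_closed_iff by blast
  let ?f = "ori u v (fst t)" and ?g = "ori u v (snd t)"
  have e: "(1 - k) * ?f + k * ?g = 0" "(1 - l) * ?f + l * ?g = 0"
    using assms(4,5) unfolding k l ori_line3 by auto
  have "k \<noteq> l" using assms(3) k l by auto
  moreover have "(k - l) * (?g - ?f) = 0" using e by (simp add: algebra_simps)
  ultimately have "?g = ?f" by simp
  then have "?g = 0" "?f = 0" using e by (auto simp: algebra_simps)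
  then show ?thesis using assms(6) unfolding seg_def in_closed_iff by (auto simp: ori_line3)
qed

section \<open>Visibility and its stability under perturbation\<close>

lemma visible_sym: "visible S a b = visible S b a"
  by (simp add: visible_def open_segment_commute)

lemma visible_refl [simp]: "visible S a a"
  by (simp add: visible_def)

lemma visible_sub:
  assumes "visible S a b" "open_segment c d \<subseteq> open_segment a b"
  shows "visible S c d"
  using assms unfolding visible_def by blast

lemma open_sub_open_left: "z \<in> closed_segment a b \<Longrightarrow> open_segment a z \<subseteq> open_segment a b" for a :: pt
  by (metis ends_in_segment(1) subset_open_segment order_refl equals0D open_segment_idem subsetI
      closed_segment_subset convex_closed_segment empty_subsetI)

lemma visible_prefix:
  assumes "visible S a b" "z \<in> closed_segment a b"
  shows "visible S a z"
  using visible_sub assms open_sub_open_left by blast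

text \<open>If \<open>a\<close> is off \<open>t\<close>, the two compact sets have positive
  distance, which survives a small change of the far end. If \<open>a\<close> is on
  \<open>t\<close>, then \<open>t\<close> consists of two pieces issuing from \<open>a\<close>;
  neither points in the direction of \<open>z\<close>, and this is an open condition.\<close>

lemma eventually_clear:
  assumes "seg t \<inter> closed_segment a z \<subseteq> {a}" "z \<noteq> a" and P: "(P \<longlongrightarrow> z) F"
  shows "\<forall>\<^sub>F n in F. seg t \<inter> open_segment a (P n) = {}"
proof (cases "a \<in> seg t")
  case False
  then have disj: "seg t \<inter> closed_segment a z = {}" using assms(1) by blast
  obtain e where e: "e > 0" "\<And>x y. x \<in> seg t \<Longrightarrow> y \<in> closed_segment a z \<Longrightarrow> e \<le> dist x y"
    using separate_compact_closed[OF seg_compact closed_segment disj] by blast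
  have "\<forall>\<^sub>F n in F. dist (P n) z < e" using P e(1) by (simp add: tendstoD)
  then show ?thesis
  proof (rule eventually_mono)
    fix n assume d: "dist (P n) z < e"
    show "seg t \<inter> open_segment a (P n) = {}"
    proof (rule ccontr)
      assume "\<not> ?thesis"
      then obtain c where "c \<in> seg t" "c \<in> open_segment a (P n)" by blast
      then obtain k where c: "c \<in> seg t" "0 < k" "k < 1" "c = a + k *\<^sub>R (P n - a)"
        unfolding in_open_iff by blast
      \<comment> \<open>The point of \<open>a z\<close> with the same parameter as \<open>c\<close>:
        it is at most as far from \<open>c\<close> as \<open>z\<close> is from
        \<open>P n\<close>.\<close>
      define c' where "c' = a + k *\<^sub>R (z - a)"
      have "c' \<in> closed_segment a z" using c(2,3) unfolding in_closed_iff c'_def by (intro exI[of _ k]) auto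
      then have "e \<le> dist c c'" using e c by blast
      moreover have "c - c' = k *\<^sub>R (P n - z)" by (simp add: c c'_def algebra_simps)
      then have "dist c c' = k * dist (P n) z" using c by (simp add: dist_norm)
      then have "dist c c' \<le> dist (P n) z" using c by (simp add: mult_left_le_one_le)
      ultimately show False using d by linarith
    qed
  qed
next
  case True
  have ray: "\<forall>\<^sub>F n in F. closed_segment a e \<inter> open_segment a (P n) = {}" if e: "e \<in> seg t" for e
  proof (cases "e = a")
    case True
    then show ?thesis by (simp add: open_segment_def)
  next
    case False
    \<comment> \<open>The whole closed ray through \<open>e\<close>: an intersection of
      \<open>a e\<close> with \<open>a (P n)\<close> forces \<open>P n\<close> itself onto
      it.\<close>
    define R where "R = {y. ori a e y = 0 \<and> 0 \<le> (y - a) \<bullet> (e - a)}"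
    have "closed R" unfolding R_def
      by (intro closed_Collect_conj closed_Collect_eq closed_Collect_le continuous_intros)
    have "z \<notin> R"
    proof
      assume "z \<in> R"
      then have "ori a e z = 0" and in0: "0 \<le> (z - a) \<bullet> (e - a)" by (auto simp: R_def)
      then obtain k where k: "z = a + k *\<^sub>R (e - a)"
        using ori_zeroD False by metis
      have "0 \<le> k * ((e - a) \<bullet> (e - a))" using in0 k by simp
      moreover have "0 < (e - a) \<bullet> (e - a)" using False by simp
      ultimately have "0 \<le> k" by (simp add: zero_le_mult_iff)
      then have "k > 0" using assms(2) k by (cases "k = 0") auto
      \<comment> \<open>The minimum keeps the point on both \<open>a e\<close> and
        \<open>a z\<close>.\<close>
      define m where "m = min 1 k"
      have m: "0 < m" "m \<le> 1" "m \<le> k" using \<open>k > 0\<close> by (auto simp: m_def)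
      have "a + m *\<^sub>R (e - a) \<in> closed_segment a e" using m by (intro in_closedI) auto
      then have "a + m *\<^sub>R (e - a) \<in> seg t" using seg_sub[OF True e] by blast
      moreover have "a + m *\<^sub>R (e - a) = a + (m / k) *\<^sub>R (z - a)"
        using \<open>k > 0\<close> by (simp add: k)
      then have "a + m *\<^sub>R (e - a) \<in> closed_segment a z"
        unfolding in_closed_iff using m \<open>k > 0\<close> by (intro exI[of _ "m / k"]) auto
      moreover have "a + m *\<^sub>R (e - a) \<noteq> a" using m False by simp
      ultimately show False using assms(1) by blast
    qed
    then have "\<forall>\<^sub>F n in F. P n \<in> - R"
      using P \<open>closed R\<close> by (metis ComplI closed_open topological_tendstoD open_Compl)
    then show ?thesis
    proof (rule eventually_mono)
      fix n assume n: "P n \<in> - R"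
      show "closed_segment a e \<inter> open_segment a (P n) = {}"
      proof (rule ccontr)
        assume "\<not> ?thesis"
        then obtain k l where kl: "0 \<le> k" "0 < l" "a + k *\<^sub>R (e - a) = a + l *\<^sub>R (P n - a)"
          by (auto simp: in_open_iff in_closed_iff)
        then have "(1/l) *\<^sub>R (k *\<^sub>R (e - a)) = P n - a" by simp
        then have "P n = a + (k / l) *\<^sub>R (e - a)" by (simp add: algebra_simps)
        then have "P n \<in> R" using kl by (simp add: R_def ori_line3)
        then show False using n by blast
      qed
    qed
  qed
  have sub: "seg t \<subseteq> closed_segment a (fst t) \<union> closed_segment a (snd t)"
    using Un_closed_segment[OF True[unfolded seg_def]] unfolding seg_def
    by (auto simp: closed_segment_commute)
  from ray[OF seg_ends(1)] ray[OF seg_ends(2)] show ?thesis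
    by eventually_elim (use sub in blast)
qed

lemma eventually_visible:
  assumes "finite S" "\<And>t. t \<in> S \<Longrightarrow> \<forall>\<^sub>F n in F. seg t \<inter> open_segment a (P n) = {}"
  shows "\<forall>\<^sub>F n in F. visible S a (P n)"
proof -
  have "\<forall>\<^sub>F n in F. \<forall>t\<in>S. seg t \<inter> open_segment a (P n) = {}"
    using assms by (simp add: eventually_ball_finite)
  then show ?thesis by eventually_elim (auto simp: visible_def obstacles_def)
qed

text \<open>Visibility of the limit \<open>z\<close> alone would not do, because a segment through
  \<open>z\<close> may obstruct the lines of sight to nearby points; hence \<open>z\<close> has to
  be off the obstacles.\<close>

lemma eventually_visible_open:
  assumes "finite S" "visible S a z" "z \<notin> obstacles S" "z \<noteq> a" "(P \<longlongrightarrow> z) F"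
  shows "\<forall>\<^sub>F n in F. visible S a (P n)"
proof (rule eventually_visible[OF assms(1)])
  fix t assume "t \<in> S"
  then have "seg t \<inter> closed_segment a z \<subseteq> {a}"
    using assms(2,3) by (auto simp: visible_def obstacles_def open_segment_def)
  then show "\<forall>\<^sub>F n in F. seg t \<inter> open_segment a (P n) = {}"
    using eventually_clear assms(4,5) by blast
qed

text \<open>The part of \<open>t\<close> from \<open>z0\<close> to \<open>z2\<close> starts on the
  line of sight and leaves it to one side, so it crosses every line of sight to points near
  \<open>z\<close> on that side. A positive product of two values of \<open>ori\<close> expresses
  "same side" without a case distinction.\<close>

lemma hidden_side:
  assumes "t \<in> S" "z0 \<in> open_segment a z" "z0 \<in> seg t" "z2 \<in> seg t" and P: "(P \<longlongrightarrow> z) F"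
  shows "\<forall>\<^sub>F n in F. 0 < ori a z z2 * ori a z (P n) \<longrightarrow> \<not> visible S a (P n)"
proof (cases "ori a z z2 = 0")
  case True then show ?thesis by simp
next
  case nz: False
  obtain k where k: "a \<noteq> z" "0 < k" "k < 1" "z0 = a + k *\<^sub>R (z - a)"
    using assms(2) by (auto simp: in_open_iff)
  have za: "ori z0 z2 a = k * ori a z z2" unfolding k(4) ori_line1 by (simp add: ori_rotate[of a z z2])
  have zz: "ori z0 z2 z = - (1 - k) * ori a z z2"
    unfolding k(4) ori_line1 by (simp add: ori_swap(2)[of a z2 z] algebra_simps)
  have "((\<lambda>n. ori z0 z2 a * ori z0 z2 (P n)) \<longlongrightarrow> ori z0 z2 a * ori z0 z2 z) F"
    by (intro tendsto_intros P)
  moreover have "ori z0 z2 a * ori z0 z2 z < 0"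
  proof -
    have "0 < ori a z z2 * ori a z z2" using nz not_real_square_gt_zero by blast
    have "ori z0 z2 a * ori z0 z2 z = - (k * (1 - k) * (ori a z z2 * ori a z z2))"
      unfolding za zz by (simp add: algebra_simps)
    moreover have "0 < k * (1 - k) * (ori a z z2 * ori a z z2)" 
      by (rule mult_pos_pos[OF mult_pos_pos]) (use k in linarith, use k in linarith, fact)
    ultimately show ?thesis by linarith
  qed
  ultimately have e1: "\<forall>\<^sub>F n in F. ori z0 z2 a * ori z0 z2 (P n) < 0"
    by (rule order_tendstoD)
  have "((\<lambda>n. ori a z z2 * ori a (P n) z2) \<longlongrightarrow> ori a z z2 * ori a z z2) F"
    by (intro tendsto_intros P)
  moreover have "0 < ori a z z2 * ori a z z2" using nz by (auto simp: zero_less_mult_iff linorder_neq_iff)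
  ultimately have e2: "\<forall>\<^sub>F n in F. 0 < ori a z z2 * ori a (P n) z2"
    by (rule order_tendstoD)
  show ?thesis using e1 e2
  proof eventually_elim
    case (elim n)
    show ?case
    proof
      assume same: "0 < ori a z z2 * ori a z (P n)"
      have "ori a (P n) z0 = - k * ori a z (P n)"
        unfolding k(4) ori_line3 by (simp add: ori_swap(2)[of a "P n" z])
      then have "ori a (P n) z0 * ori a (P n) z2 = - k * (ori a z (P n) * ori a (P n) z2)" by simp
      moreover have "0 < ori a z (P n) * ori a (P n) z2"
        using same elim(2) by (auto simp: zero_less_mult_iff)
      ultimately have "ori a (P n) z0 * ori a (P n) z2 < 0" using k by (simp add: mult_less_0_iff)
      then have "open_segment a (P n) \<inter> open_segment z0 z2 \<noteq> {}"
        using segments_cross elim(1) by blast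
      moreover have "open_segment z0 z2 \<subseteq> seg t"
        using seg_sub[OF assms(3,4)] by (auto simp: open_segment_def)
      ultimately show "\<not> visible S a (P n)" using assms(1) by (auto simp: visible_def obstacles_def)
    qed
  qed
qed

section \<open>Supporting lines and the first obstacle on a ray\<close>

lemma on_support [simp]: "x \<in> seg s \<Longrightarrow> ori (fst s) (snd s) x = 0"
  unfolding seg_def in_closed_iff by (auto simp: ori_line3)

text \<open>This links the order on \<open>s\<close> with rotation: for \<open>q\<close> above
  \<open>s\<close>, points of \<open>s\<close> further to the right than \<open>x\<close> lie on the
  right of the line from \<open>x\<close> to \<open>q\<close>.\<close>

lemma ori_along:
  assumes "x \<in> seg s"
  shows "ori x q (x + k *\<^sub>R (snd s - fst s)) = - k * ori (fst s) (snd s) q"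
proof -
  have "ori x q (x + k *\<^sub>R (snd s - fst s)) = - k * (ori (fst s) (snd s) q - ori (fst s) (snd s) x)"
    by (simp add: ori_simps algebra_simps)
  then show ?thesis using assms by simp
qed

lemma seg_other:
  assumes "x \<in> seg s" "y \<in> seg s"
  obtains k where "y = x + k *\<^sub>R (snd s - fst s)"
proof -
  obtain k l where kl: "x = fst s + k *\<^sub>R (snd s - fst s)" "y = fst s + l *\<^sub>R (snd s - fst s)"
    using assms unfolding seg_def in_closed_iff by blast
  have "y = x + (l - k) *\<^sub>R (snd s - fst s)" unfolding kl by (simp add: algebra_simps)
  then show ?thesis using that by blast
qed

text \<open>A nearest point exists by compactness once the segments through \<open>a\<close> are
  left out, since these would make \<open>a\<close> itself the nearest point. The assumption
  \<open>away\<close> ensures that they contribute nothing else.\<close>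

lemma first_obstacle:
  assumes "finite S" "a \<noteq> b" "c0 \<in> closed_segment a b" "c0 \<noteq> a" "c0 \<in> obstacles S"
    and away: "\<And>t. t \<in> S \<Longrightarrow> a \<in> seg t \<Longrightarrow> seg t \<inter> closed_segment a b \<subseteq> {a}"
  obtains z where "z \<in> closed_segment a b" "z \<noteq> a" "z \<in> obstacles S" "visible S a z"
proof -
  define K where "K = (\<Union>t\<in>{t\<in>S. a \<notin> seg t}. seg t \<inter> closed_segment a b)"
  have "compact K" unfolding K_def
    using assms(1) by (intro compact_UN) (auto intro: seg_compact compact_Int)
  moreover have "c0 \<in> K"
  proof -
    obtain t0 where "t0 \<in> S" "c0 \<in> seg t0" using assms(5) by (auto simp: obstacles_def)
    then show ?thesis using assms(3,4) away[of t0] unfolding K_def by blast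
  qed
  ultimately obtain z where z: "z \<in> K" "\<And>y. y \<in> K \<Longrightarrow> dist a z \<le> dist a y"
    using distance_attains_inf[of K a] compact_imp_closed by (metis empty_iff)
  have zs: "z \<in> closed_segment a b" "z \<noteq> a" "z \<in> obstacles S"
    using z(1) by (auto simp: K_def obstacles_def)
  have "visible S a z"
  proof (rule ccontr)
    assume "\<not> visible S a z"
    then obtain c t where c: "c \<in> open_segment a z" "t \<in> S" "c \<in> seg t"
      by (auto simp: visible_def obstacles_def)
    have cab: "c \<in> open_segment a b" using open_sub_open_left[OF zs(1)] c(1) by blast
    then have cc: "c \<in> closed_segment a b" "c \<noteq> a" by (auto simp: open_segment_def)
    then have "a \<notin> seg t" using away c by blast
    then have "c \<in> K" unfolding K_def using c cc by blast
    then have "dist a z \<le> dist a c" using z by blast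
    then show False using c(1) by (metis dist_in_open_segment dist_commute not_le)
  qed
  then show ?thesis using that zs by blast
qed

text \<open>An inner point \<open>z\<close> of a collinear segment has points of that segment on
  both sides, in particular just before it as seen from \<open>a\<close>. So a point that is seen
  first on a collinear segment must be an endpoint of it.\<close>

lemma collinear_open_near:
  assumes "z \<in> open_segment (fst t) (snd t)" "z \<in> closed_segment a b" "z \<noteq> a"
    and line: "\<And>c. c \<in> seg t \<Longrightarrow> ori a b c = 0"
  shows "open_segment a z \<inter> seg t \<noteq> {}"
proof -
  obtain k where k: "0 < k" "k \<le> 1" "z = a + k *\<^sub>R (b - a)" "a \<noteq> b"
  proof -
    from assms(2) obtain k where k: "0 \<le> k" "k \<le> 1" "z = a + k *\<^sub>R (b - a)"
      unfolding in_closed_iff by blast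
    then have "k \<noteq> 0" "a \<noteq> b" using assms(3) by auto
    then show ?thesis using that k by auto
  qed
  obtain m where m: "0 < m" "m < 1" "z = fst t + m *\<^sub>R (snd t - fst t)" "fst t \<noteq> snd t"
    using assms(1) unfolding in_open_iff by blast
  have "ori a b (fst t) = 0" "ori a b (snd t) = 0" using line by auto
  then obtain f g where fg: "fst t = a + f *\<^sub>R (b - a)" "snd t = a + g *\<^sub>R (b - a)"
    using ori_zeroD k(4) by metis
  have "f \<noteq> g" using m(4) fg by auto
  have "z = a + (f + m * (g - f)) *\<^sub>R (b - a)" unfolding m(3) fg by (simp add: algebra_simps)
  then have kk: "k = f + m * (g - f)" using k by simp
  have near: "\<exists>c \<in> open_segment a z. c \<in> seg t"
    if e: "e \<in> seg t" "e = a + h *\<^sub>R (b - a)" "h < k" for e h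
  proof -
    \<comment> \<open>The maximum keeps the point in front of \<open>a\<close> even if the end
      \<open>e\<close> lies behind \<open>a\<close>.\<close>
    define r where "r = max (k / 2) h"
    have r: "0 < r" "r < k" "h \<le> r" using k that by (auto simp: r_def)
    define c where "c = a + r *\<^sub>R (b - a)"
    have "c = a + (r / k) *\<^sub>R (z - a)" using k by (simp add: c_def)
    then have 1: "c \<in> open_segment a z" unfolding in_open_iff using r k assms(3)
      by (intro conjI exI[of _ "r / k"]) auto
    have "c = e + ((r - h) / (k - h)) *\<^sub>R (z - e)"
    proof -
      have "z - e = (k - h) *\<^sub>R (b - a)" unfolding k(3) e(2) by (simp add: algebra_simps)
      then have "((r - h) / (k - h)) *\<^sub>R (z - e) = (r - h) *\<^sub>R (b - a)" using e(3) by simp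
      then show ?thesis unfolding c_def e(2) by (simp add: scaleR_left_diff_distrib)
    qed
    moreover have "0 \<le> (r - h) / (k - h)" "(r - h) / (k - h) \<le> 1" using r e(3) by auto
    ultimately have "c \<in> closed_segment e z" unfolding in_closed_iff by blast
    moreover have "z \<in> seg t" using assms(1) by (auto simp: seg_def open_segment_def)
    ultimately have "c \<in> seg t" using seg_sub e(1) by blast
    with 1 show ?thesis by blast
  qed
  show ?thesis
  proof (cases "f < g")
    case True
    then have "f < k" using kk m by simp
    then show ?thesis using near[OF _ fg(1)] seg_ends(1)[of t] by blast
  next
    case False
    then have "m * (f - g) < 1 * (f - g)" using m \<open>f \<noteq> g\<close> by (intro mult_strict_right_mono) auto
    then have "g < k" using kk by (simp add: algebra_simps)
    then show ?thesis using near[OF _ fg(2)] seg_ends(2)[of t] by blast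
  qed
qed

lemma endpoint_or_open:
  assumes "z \<in> seg t" "t \<in> S"
  shows "z \<in> endpoints S \<or> z \<in> open_segment (fst t) (snd t)"
  using assms by (auto simp: seg_def open_segment_def endpoints_def)

text \<open>Active edges through their lower endpoint \<open>q\<close>: every segment at \<open>q\<close> lies to the left of the line
  from \<open>x\<close> to \<open>q\<close>, so it is the right side that is visible beyond \<open>q\<close>.\<close>

definition act :: "sgmt set \<Rightarrow> sgmt \<Rightarrow> pt \<Rightarrow> pt \<Rightarrow> bool" where
  "act S s x q \<longleftrightarrow> q \<in> endpoints S \<and> 0 < ori (fst s) (snd s) q \<and> visible S x q \<and>
     (\<forall>t\<in>S. q \<in> seg t \<longrightarrow> (\<forall>z\<in>seg t. z \<noteq> q \<longrightarrow> 0 < ori x q z))"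

text \<open>The only facts about the rectangle that are used, in a form invariant under the half turn. The
  condition \<open>inner_side\<close> puts every point of a segment on the frontier of some triangle.\<close>

locale scene =
  fixes S :: "sgmt set" and H :: "pt set"
  assumes finite_S: "finite S"
    and nonvert: "s \<in> S \<Longrightarrow> fst s $ 1 < snd s $ 1"
    and disj: "s \<in> S \<Longrightarrow> t \<in> S \<Longrightarrow> s \<noteq> t \<Longrightarrow>
      open_segment (fst s) (snd s) \<inter> open_segment (fst t) (snd t) = {}"
    and convex_H: "convex H" and bounded_H: "bounded H"
    and obstacles_H: "obstacles S \<subseteq> H"
    and frontier_H: "frontier H \<subseteq> obstacles S"
    and inner_side: "p \<in> obstacles S \<Longrightarrow> \<exists>s\<in>S. p \<in> seg s \<and>
      (p \<noteq> snd s \<and> (\<exists>m\<in>H. 0 < ori (fst s) (snd s) m) \<or>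
       p \<noteq> fst s \<and> (\<exists>m\<in>H. ori (fst s) (snd s) m < 0))"
begin

lemma ends_neq: "s \<in> S \<Longrightarrow> fst s \<noteq> snd s"
  using nonvert by fastforce

lemma endpoint_obstacle: "q \<in> endpoints S \<Longrightarrow> q \<in> obstacles S"
  unfolding endpoints_def obstacles_def using seg_ends by blast

lemma touching_endpoint:
  assumes "s \<in> S" "t \<in> S" "s \<noteq> t" "x \<in> open_segment (fst s) (snd s)" "x \<in> seg t"
  shows "x = fst t \<or> x = snd t"
  using assms disj[OF assms(1-3)] by (auto simp: seg_def open_segment_def)

context
  fixes s x q
  assumes s: "s \<in> S" and x: "x \<in> open_segment (fst s) (snd s)" and above: "0 < ori (fst s) (snd s) q"
begin

lemma xs: "x \<in> seg s"
  using x by (auto simp: seg_def open_segment_def)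

lemma x_neq_q: "x \<noteq> q"
  using xs above by auto

lemma on_line_s: "c \<in> seg s \<Longrightarrow> ori x q c = 0 \<Longrightarrow> c = x"
proof -
  assume c: "c \<in> seg s" "ori x q c = 0"
  then obtain k where "c = x + k *\<^sub>R (snd s - fst s)" using seg_other[OF xs] by blast
  then show "c = x" using ori_along[OF xs, of q k] above c(2) by auto
qed

text \<open>Such a \<open>t\<close> differs from \<open>s\<close>, since the line through
  \<open>x\<close> and \<open>q\<close> meets \<open>s\<close> only in \<open>x\<close>. As
  interiors are disjoint, \<open>t\<close> ends in \<open>x\<close>, so \<open>t\<close> itself is
  the required edge.\<close>

lemma apex_touch_evg:
  assumes "t \<in> S" "x \<in> seg t" "c \<in> seg t" "c \<noteq> x" "ori x q c = 0"
  shows "evg_collinear S x q"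
proof -
  have "t \<noteq> s" using on_line_s assms by blast
  then have e: "x = fst t \<or> x = snd t" using touching_endpoint[OF s assms(1) _ x assms(2)] by auto
  have "vg_edge S (fst t) (snd t)"
    using assms(1) ends_neq by (auto simp: vg_edge_def endpoints_def)
  moreover have "ori q (fst t) (snd t) = 0"
  proof -
    have "ori x q (fst t) = 0" "ori x q (snd t) = 0"
      using seg_subset_line[OF assms(2,3) assms(4)[symmetric] _ assms(5)] by simp_all
    then have "ori q x (fst t) = 0" "ori q x (snd t) = 0" using ori_swap(1)[of q x "fst t"] ori_swap(1)[of q x "snd t"] by simp_all
    then show ?thesis using e ori_swap(2)[of q "fst t" x] by auto
  qed
  ultimately show ?thesis unfolding evg_collinear_def
    using e by (intro bexI[of _ t]) (auto simp: collinear_iff_ori evg_edges_def)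
qed

text \<open>The edge from \<open>z2\<close> to \<open>z1\<close>, prolonged beyond
  \<open>z1\<close>, stops in \<open>x\<close>, because \<open>x\<close> lies on \<open>s\<close>
  and nothing is in between.\<close>

lemma extension_evg:
  assumes "vg_edge S z2 z1" "visible S x z1" "z1 \<in> open_segment x z2" "ori x q z1 = 0"
  shows "evg_collinear S x q"
proof -
  obtain k where k: "0 < k" "k < 1" "z1 = x + k *\<^sub>R (z2 - x)" "x \<noteq> z2"
    using assms(3) by (auto simp: in_open_iff)
  have "z1 - z2 = (k - 1) *\<^sub>R (z2 - x)" "x - z1 = - k *\<^sub>R (z2 - x)" unfolding k(3)
    by (simp_all add: algebra_simps)
  \<comment> \<open>\<open>k / (1 - k)\<close> is the ratio of the distances from \<open>z1\<close>
    to \<open>x\<close> and from \<open>z2\<close> to \<open>z1\<close>.\<close>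
  moreover have "k / (1 - k) * (k - 1) = - k" using k(2) by (simp add: field_simps)
  ultimately have "x - z1 = (k / (1 - k)) *\<^sub>R (z1 - z2)" by simp
  then have "x = z1 + (k / (1 - k)) *\<^sub>R (z1 - z2)" by (simp add: algebra_simps)
  moreover have "0 < k / (1 - k)" using k by simp
  moreover have "x \<in> obstacles S" using xs s by (auto simp: obstacles_def)
  ultimately have "extension_edge S z1 x"
    unfolding extension_edge_def using assms(1,2) visible_sym by blast
  then have "(z1, x) \<in> evg_edges S" by (simp add: evg_edges_def)
  moreover have "collinear {q, z1, x}" unfolding collinear_iff_ori using assms(4) ori_rotate[of x q z1] by simp
  ultimately show ?thesis unfolding evg_collinear_def by (intro bexI[of _ "(z1, x)"]) auto
qed

text \<open>Several endpoints on an unobstructed line through \<open>x\<close> produce an edge of the extended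
  visibility graph that ends in \<open>x\<close>: the two endpoints nearest to \<open>x\<close> see each other, or are joined
  by an element of \<open>S\<close>, and the nearest one sees \<open>x\<close>.\<close>

lemma blocked_evg:
  assumes "q \<in> endpoints S" "\<not> visible S x q"
    and tangent: "\<And>t z c. t \<in> S \<Longrightarrow> z \<in> open_segment (fst t) (snd t) \<Longrightarrow> z \<in> open_segment x q \<Longrightarrow>
      c \<in> seg t \<Longrightarrow> ori x q c = 0"
  shows "evg_collinear S x q"
proof (rule ccontr)
  assume no: "\<not> evg_collinear S x q"
  have line: "ori x q c = 0" if "c \<in> closed_segment x q" for c
    using that by (auto simp: in_closed_iff ori_line3)
  have "q \<in> obstacles S" using assms(1) endpoint_obstacle by blast
  obtain z1 where z1: "z1 \<in> closed_segment x q" "z1 \<noteq> x" "z1 \<in> obstacles S" "visible S x z1"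
  proof (rule first_obstacle[OF finite_S x_neq_q, of q])
    show "q \<in> closed_segment x q" "q \<noteq> x" "q \<in> obstacles S"
      using x_neq_q \<open>q \<in> obstacles S\<close> by auto
    show "seg t \<inter> closed_segment x q \<subseteq> {x}" if "t \<in> S" "x \<in> seg t" for t
      using apex_touch_evg[OF that] no line by blast
  qed (use that in blast)
  have "z1 \<noteq> q" using z1(4) assms(2) by blast
  then have z1o: "z1 \<in> open_segment x q" using z1 by (auto simp: open_segment_def)
  have clear1: "c \<notin> open_segment x z1" if "c \<in> seg t" "t \<in> S" for c t
    using z1(4) that by (auto simp: visible_def obstacles_def)
  have z1e: "z1 \<in> endpoints S" "t \<in> S \<Longrightarrow> z1 \<in> seg t \<Longrightarrow> z1 = fst t \<or> z1 = snd t" for t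
  proof -
    have *: "z1 \<notin> open_segment (fst t) (snd t)" if t: "t \<in> S" for t
    proof
      assume "z1 \<in> open_segment (fst t) (snd t)"
      then have "open_segment x z1 \<inter> seg t \<noteq> {}"
        using collinear_open_near[of z1 t x q] z1 tangent[OF t _ z1o] by blast
      then show False using clear1 t by blast
    qed
    then show "z1 \<in> endpoints S" using z1(3) endpoint_or_open[of z1 _ S] unfolding obstacles_def by blast
    show "t \<in> S \<Longrightarrow> z1 \<in> seg t \<Longrightarrow> z1 = fst t \<or> z1 = snd t" for t
      using * by (auto simp: seg_def open_segment_def)
  qed
  obtain k where k: "0 < k" "k < 1" "z1 = x + k *\<^sub>R (q - x)" using z1o by (auto simp: in_open_iff)
  \<comment> \<open>An endpoint beyond \<open>z1\<close> on the line that is joined to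
    \<open>z1\<close> by an edge gives an extension edge that ends in \<open>x\<close>.\<close>
  have final: "z2 \<in> endpoints S \<Longrightarrow> False"
    if z2: "z2 = x + l *\<^sub>R (q - x)" "k < l" "visible S z1 z2 \<or> (z1, z2) \<in> S \<or> (z2, z1) \<in> S" for z2 l
  proof -
    assume e: "z2 \<in> endpoints S"
    have "z1 = x + (k / l) *\<^sub>R (z2 - x)" unfolding z2(1) k(3) using z2(2) k(1) by simp
    moreover have "z2 \<noteq> x" using z2 k x_neq_q by auto
    ultimately have "z1 \<in> open_segment x z2" unfolding in_open_iff using k z2(2)
      by (intro conjI exI[of _ "k / l"]) auto
    moreover from this have "z1 \<noteq> z2" by (auto simp: open_segment_def)
    then have "vg_edge S z2 z1" using e z1e(1) z2(3) visible_sym by (auto simp: vg_edge_def)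
    ultimately show False using extension_evg z1(4) line z1(1) no by blast
  qed
  \<comment> \<open>A segment leaving \<open>z1\<close> along the line towards \<open>q\<close>
    would have its other end beyond \<open>z1\<close>, which \<open>final\<close> excludes; that end
    cannot be before \<open>z1\<close>, as the segment would then hide \<open>z1\<close> from
    \<open>x\<close>.\<close>
  have away: "seg t \<inter> closed_segment z1 q \<subseteq> {z1}" if t: "t \<in> S" "z1 \<in> seg t" for t
  proof (rule ccontr)
    assume "\<not> ?thesis"
    then obtain c where c: "c \<in> seg t" "c \<in> closed_segment z1 q" "c \<noteq> z1" by blast
    have "closed_segment z1 q \<subseteq> closed_segment x q" using z1(1) by (simp add: closed_segment_subset)
    then have "ori x q c = 0" using line c(2) by blast
    then have l: "ori x q e = 0" if "e \<in> seg t" for e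
      using seg_subset_line[OF t(2) c(1) c(3)[symmetric] _ _ that, of x q] line[OF z1(1)] \<open>ori x q c = 0\<close> by simp
    define z2 where "z2 = (if z1 = fst t then snd t else fst t)"
    have z2: "z2 \<in> seg t" "(z1, z2) \<in> S \<or> (z2, z1) \<in> S" "z1 \<noteq> z2" "z2 \<in> endpoints S"
      using z1e(2)[OF t] t(1) ends_neq[OF t(1)] by (auto simp: z2_def endpoints_def)
    obtain h where h: "z2 = x + h *\<^sub>R (q - x)" using ori_zeroD[OF l[OF z2(1)] x_neq_q] by blast
    have "k < h"
    proof (rule ccontr)
      assume "\<not> k < h"
      then have "h < k" using z2(3) h k by (cases "h = k") auto
      define r where "r = max (k/2) h"
      have r: "0 < r" "r < k" "h \<le> r" using k \<open>h < k\<close> by (auto simp: r_def)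
      define d where "d = x + r *\<^sub>R (q - x)"
      have "d = x + (r / k) *\<^sub>R (z1 - x)" using k by (simp add: d_def)
      then have "d \<in> open_segment x z1" unfolding in_open_iff using r k z1(2)
        by (intro conjI exI[of _ "r / k"]) auto
      moreover have "d = z2 + ((r - h) / (k - h)) *\<^sub>R (z1 - z2)"
      proof -
        have "z1 - z2 = (k - h) *\<^sub>R (q - x)" unfolding k(3) h by (simp add: algebra_simps)
        then have "((r - h) / (k - h)) *\<^sub>R (z1 - z2) = (r - h) *\<^sub>R (q - x)" using \<open>h < k\<close> by simp
        then show ?thesis unfolding d_def h by (simp add: scaleR_left_diff_distrib)
      qed
      then have "d \<in> closed_segment z2 z1" unfolding in_closed_iff using r \<open>h < k\<close>
        by (intro exI[of _ "(r - h) / (k - h)"]) auto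
      then have "d \<in> seg t" using seg_sub[OF z2(1) t(2)] by blast
      ultimately show False using clear1 t by blast
    qed
    then show False using final h z2 by blast
  qed
  \<comment> \<open>The next obstacle after \<open>z1\<close>. By \<open>final\<close> it is no
    endpoint, so by \<open>tangent\<close> it is an inner point of a segment lying in the line, and
    that segment would have been met earlier.\<close>
  obtain z2 where z2: "z2 \<in> closed_segment z1 q" "z2 \<noteq> z1" "z2 \<in> obstacles S" "visible S z1 z2"
  proof (rule first_obstacle[OF finite_S \<open>z1 \<noteq> q\<close> _ _ \<open>q \<in> obstacles S\<close> away])
    show "q \<in> closed_segment z1 q" "q \<noteq> z1" using \<open>z1 \<noteq> q\<close> by auto
  qed (use that in auto)
  obtain j where j: "0 < j" "j \<le> 1" "z2 = z1 + j *\<^sub>R (q - z1)"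
  proof -
    from z2(1) obtain j where j: "0 \<le> j" "j \<le> 1" "z2 = z1 + j *\<^sub>R (q - z1)"
      unfolding in_closed_iff by blast
    moreover have "j \<noteq> 0" using z2(2) j(3) by auto
    ultimately show ?thesis by (intro that[of j]) auto
  qed
  have z2l: "z2 = x + (k + j * (1 - k)) *\<^sub>R (q - x)" unfolding j(3) k(3) by (simp add: algebra_simps)
  have "k < k + j * (1 - k)" using j k by simp
  then have "z2 \<notin> endpoints S" using final z2l z2(4) by blast
  then obtain t where t: "t \<in> S" "z2 \<in> open_segment (fst t) (snd t)" "z2 \<noteq> q"
    using z2(3) endpoint_or_open[of z2 _ S] assms(1) unfolding obstacles_def by blast
  have "closed_segment z1 q \<subseteq> closed_segment x q" using z1(1) by (simp add: closed_segment_subset)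
  moreover have "z2 \<noteq> x" using z2l \<open>k < k + j * (1 - k)\<close> k x_neq_q by auto
  ultimately have "z2 \<in> open_segment x q" using z2(1) t(3) by (auto simp: open_segment_def)
  then have l: "ori x q c = 0" if "c \<in> seg t" for c using tangent t that by blast
  have "ori z1 q c = 0" if "c \<in> seg t" for c
    unfolding k(3) ori_line1 using l[OF that] by simp
  then have "open_segment z1 z2 \<inter> seg t \<noteq> {}"
    using collinear_open_near[OF t(2) z2(1,2)] by blast
  then show False using z2(4) t(1) by (auto simp: visible_def obstacles_def)
qed

end

end

section \<open>Active edges\<close>

lemma vis_above_iff: "y \<in> vis_above S s p \<longleftrightarrow> visible S p y \<and> 0 \<le> ori (fst s) (snd s) y"
  by (simp add: vis_above_def vis_region_def ori_def)

text \<open>The balls of the definition become neighbourhood filters, so that conditions valid near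
  a point can be combined by \<open>eventually_elim\<close>.\<close>

lemma right_side_edge_iff:
  "right_side_edge S s p q w \<longleftrightarrow> q \<in> open_segment p w \<and> 0 < ori (fst s) (snd s) q \<and>
     (\<forall>z\<in>open_segment q w. \<forall>\<^sub>F y in nhds z.
        (ori p w y < 0 \<longrightarrow> y \<in> vis_above S s p) \<and> (0 < ori p w y \<longrightarrow> y \<notin> vis_above S s p))"
  unfolding right_side_edge_def eventually_nhds_metric ori_def
  by (simp add: dist_commute Ball_def)

lemma tendsto_scale_at_right: "((\<lambda>k. z + k *\<^sub>R v) \<longlongrightarrow> z) (at_right (0::real))" for z v :: pt
  by (rule tendsto_eq_intros | simp)+

text \<open>An affine function that vanishes at an inner point of a segment but not on all of it has
  opposite strict signs at the two ends.\<close>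

lemma opposite_ends:
  assumes "z \<in> open_segment (fst t) (snd t)" "ori a b z = 0" "c \<in> seg t" "ori a b c \<noteq> 0"
  shows "ori a b (fst t) * ori a b (snd t) < 0"
proof -
  obtain m where m: "0 < m" "m < 1" "z = fst t + m *\<^sub>R (snd t - fst t)"
    using assms(1) unfolding in_open_iff by blast
  obtain l where l: "c = fst t + l *\<^sub>R (snd t - fst t)"
    using assms(3) unfolding seg_def in_closed_iff by blast
  define f g where "f = ori a b (fst t)" and "g = ori a b (snd t)"
  have e: "(1 - m) * f + m * g = 0" using assms(2) unfolding m ori_line3 f_def g_def by simp
  have n: "(1 - l) * f + l * g \<noteq> 0" using assms(4) unfolding l ori_line3 f_def g_def by simp
  have "f \<noteq> 0" using e n m by auto
  have "f * g * m = - ((1 - m) * (f * f))" using e by algebra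
  moreover have "0 < f * f" using \<open>f \<noteq> 0\<close> not_real_square_gt_zero[of f] by blast
  then have "0 < (1 - m) * (f * f)" using m mult_pos_pos[of "1 - m" "f * f"] by simp
  ultimately have "f * g * m < 0" by linarith
  then show ?thesis using m unfolding f_def g_def by (simp add: mult_less_0_iff)
qed

lemma closed_in_open:
  fixes x :: pt
  assumes "z \<in> open_segment x w" "c \<in> closed_segment x z" "c \<noteq> x"
  shows "c \<in> open_segment x w"
proof -
  obtain a where a: "0 \<le> a" "a \<le> 1" "c = x + a *\<^sub>R (z - x)"
    using assms(2) unfolding in_closed_iff by blast
  obtain b where b: "0 < b" "b < 1" "z = x + b *\<^sub>R (w - x)" "x \<noteq> w"
    using assms(1) unfolding in_open_iff by blast
  have "a \<noteq> 0" using a(3) assms(3) by auto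
  then have "0 < a * b" using a b by simp
  moreover have "a * b \<le> 1 * b" using a b by (intro mult_right_mono) auto
  then have "a * b < 1" using b by linarith
  moreover have "c = x + (a * b) *\<^sub>R (w - x)" unfolding a(3) b(3) by simp
  ultimately show ?thesis using in_openI[OF b(4)] by blast
qed

text \<open>Segments that meet the line of sight stay weakly to its left, so they cannot meet a line
  of sight turned to the right. All others are avoided by a small perturbation anyway.\<close>

lemma right_visible:
  assumes "finite S" "z \<in> open_segment x w" "0 < ori (fst s) (snd s) z"
    and left: "\<And>t c e. t \<in> S \<Longrightarrow> c \<in> seg t \<Longrightarrow> c \<in> open_segment x w \<Longrightarrow> e \<in> seg t \<Longrightarrow> 0 \<le> ori x w e"
  shows "\<forall>\<^sub>F y in nhds z. ori x w y < 0 \<longrightarrow> y \<in> vis_above S s x"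
proof -
  have zx: "z \<noteq> x" using assms(2) by (auto simp: open_segment_def)
  have "\<forall>\<^sub>F y in nhds z. \<forall>t\<in>S. ori x w y < 0 \<longrightarrow> seg t \<inter> open_segment x y = {}"
  proof (intro eventually_ball_finite assms(1) ballI)
    fix t assume t: "t \<in> S"
    show "\<forall>\<^sub>F y in nhds z. ori x w y < 0 \<longrightarrow> seg t \<inter> open_segment x y = {}"
    proof (cases "seg t \<inter> closed_segment x z \<subseteq> {x}")
      case True
      have "\<forall>\<^sub>F y in nhds z. seg t \<inter> open_segment x y = {}"
        by (rule eventually_clear[OF True zx]) (rule filterlim_ident)
      then show ?thesis by eventually_elim simp
    next
      case False
      then obtain c where c: "c \<in> seg t" "c \<in> closed_segment x z" "c \<noteq> x" by blast
      have "c \<in> open_segment x w" using closed_in_open[OF assms(2) c(2,3)] .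
      then have nr: "0 \<le> ori x w e" if "e \<in> seg t" for e using left t c(1) that by blast
      show ?thesis
      proof (intro always_eventually allI impI)
        fix y assume y: "ori x w y < 0"
        show "seg t \<inter> open_segment x y = {}"
        proof (rule ccontr)
          assume "\<not> ?thesis"
          then obtain d where "d \<in> seg t" "d \<in> open_segment x y" by blast
          then obtain k where k: "d \<in> seg t" "0 < k" "d = x + k *\<^sub>R (y - x)"
            unfolding in_open_iff by blast
          have "ori x w d = k * ori x w y" unfolding k(3) ori_line3 by simp
          then have "ori x w d < 0" using k y by (simp add: mult_less_0_iff)
          then show False using nr[OF k(1)] by simp
        qed
      qed
    qed
  qed
  moreover have "\<forall>\<^sub>F y in nhds z. 0 < ori (fst s) (snd s) y"
    by (rule order_tendstoD(1)[OF _ assms(3)]) (intro tendsto_intros filterlim_ident)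
  ultimately show ?thesis
    by eventually_elim (auto simp: vis_above_iff visible_def obstacles_def)
qed

lemma left_hidden:
  assumes "t \<in> S" "u \<in> seg t" "e \<in> seg t" "u \<in> open_segment x z" "0 < ori x z e"
  shows "\<forall>\<^sub>F y in nhds z. 0 < ori x z y \<longrightarrow> y \<notin> vis_above S s x"
proof -
  have "\<forall>\<^sub>F y in nhds z. 0 < ori x z e * ori x z y \<longrightarrow> \<not> visible S x y"
    using hidden_side[OF assms(1,4,2,3) filterlim_ident] .
  then show ?thesis by eventually_elim (use assms(5) in \<open>auto simp: vis_above_iff zero_less_mult_iff\<close>)
qed

lemma ori_ray: "z = x + k *\<^sub>R (w - x) \<Longrightarrow> ori x z y = k * ori x w y"
  by (simp add: ori_line2)

text \<open>The right side is visible because nothing on the line reaches to the right, and the left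
  side is hidden by the segment that leaves the line at \<open>q\<close> towards
  \<open>e\<close>.\<close>

lemma rse_intro:
  assumes "finite S" "x \<in> seg s" "q \<in> open_segment x w" "0 < ori (fst s) (snd s) q"
    and left: "\<And>t c e. t \<in> S \<Longrightarrow> c \<in> seg t \<Longrightarrow> c \<in> open_segment x w \<Longrightarrow> e \<in> seg t \<Longrightarrow> 0 \<le> ori x w e"
    and t: "t \<in> S" "q \<in> seg t" "e \<in> seg t" "0 < ori x w e"
  shows "right_side_edge S s x q w"
  unfolding right_side_edge_iff
proof (intro conjI ballI assms(3,4))
  fix z assume z: "z \<in> open_segment q w"
  obtain k where k: "0 < k" "k < 1" "q = x + k *\<^sub>R (w - x)" "x \<noteq> w"
    using assms(3) unfolding in_open_iff by blast
  obtain m where m: "0 < m" "m < 1" "z = q + m *\<^sub>R (w - q)"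
    using z unfolding in_open_iff by blast
  define j where "j = k + m * (1 - k)"
  have "0 < (1 - m) * (1 - k)" using k m by simp
  then have j: "k < j" "j < 1" using k m by (auto simp: j_def algebra_simps)
  have zj: "z = x + j *\<^sub>R (w - x)" unfolding m(3) k(3) j_def by (simp add: algebra_simps)
  have zo: "z \<in> open_segment x w" unfolding zj using j k by (intro in_openI) auto
  have "0 < k * ori (fst s) (snd s) w" using assms(4) unfolding k(3) ori_line3 using assms(2) by simp
  then have "0 < ori (fst s) (snd s) w" using k by (simp add: zero_less_mult_iff)
  then have "0 < ori (fst s) (snd s) z" unfolding zj ori_line3 using assms(2) j k by simp
  then have r: "\<forall>\<^sub>F y in nhds z. ori x w y < 0 \<longrightarrow> y \<in> vis_above S s x"
    using right_visible[OF assms(1) zo] left by blast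
  have "q = x + (k / j) *\<^sub>R (z - x)" unfolding zj k(3) using j k by simp
  moreover have "x + (k / j) *\<^sub>R (z - x) \<in> open_segment x z"
    using j k zo by (intro in_openI) (auto simp: open_segment_def)
  ultimately have qz: "q \<in> open_segment x z" by simp
  have "0 < ori x z e" using ori_ray[OF zj] t(4) j k by simp
  then have "\<forall>\<^sub>F y in nhds z. 0 < ori x z y \<longrightarrow> y \<notin> vis_above S s x"
    using left_hidden t qz by blast
  then have "\<forall>\<^sub>F y in nhds z. 0 < ori x w y \<longrightarrow> y \<notin> vis_above S s x"
    by eventually_elim (use ori_ray[OF zj] j k in \<open>auto simp: zero_less_mult_iff\<close>)
  with r show "\<forall>\<^sub>F y in nhds z. (ori x w y < 0 \<longrightarrow> y \<in> vis_above S s x) \<and>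
     (0 < ori x w y \<longrightarrow> y \<notin> vis_above S s x)"
    by eventually_elim blast
qed

text \<open>A segment reaching from \<open>c\<close> to the right would hide the points right of the
  edge beyond \<open>c\<close>, although these are visible by definition of the edge.\<close>

lemma rse_no_right:
  assumes rse: "right_side_edge S s x q w"
    and t: "t \<in> S" "c \<in> seg t" "c \<in> open_segment x w" "e \<in> seg t"
  shows "0 \<le> ori x w e"
proof (rule ccontr)
  assume "\<not> ?thesis"
  then have neg: "ori x w e < 0" by simp
  obtain k where k: "0 < k" "k < 1" "q = x + k *\<^sub>R (w - x)" "x \<noteq> w"
    using rse unfolding right_side_edge_iff in_open_iff by blast
  obtain l where l: "0 < l" "l < 1" "c = x + l *\<^sub>R (w - x)"
    using t(3) unfolding in_open_iff by blast
  \<comment> \<open>Beyond both \<open>q\<close> and \<open>c\<close> but before \<open>w\<close>,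
    so that \<open>z\<close> is on the edge and behind \<open>c\<close>.\<close>
  define j where "j = (max k l + 1) / 2"
  have j: "k < j" "l < j" "j < 1" using k l by (auto simp: j_def)
  define z where "z = x + j *\<^sub>R (w - x)"
  have "z = q + ((j - k) / (1 - k)) *\<^sub>R (w - q)"
  proof -
    have "w - q = (1 - k) *\<^sub>R (w - x)" unfolding k(3) by (simp add: algebra_simps)
    then have "((j - k) / (1 - k)) *\<^sub>R (w - q) = (j - k) *\<^sub>R (w - x)" using k by simp
    then show ?thesis unfolding z_def by (simp add: k(3) scaleR_left_diff_distrib)
  qed
  moreover have "q \<noteq> w" using rse by (auto simp: right_side_edge_iff open_segment_def)
  ultimately have "z \<in> open_segment q w" using in_openI[of q w "(j - k) / (1 - k)"] j k by simp
  then have ev: "\<forall>\<^sub>F y in nhds z. ori x w y < 0 \<longrightarrow> y \<in> vis_above S s x"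
    using rse unfolding right_side_edge_iff by (auto elim: eventually_mono)
  let ?P = "\<lambda>h. z + h *\<^sub>R (e - z)"
  have P: "(?P \<longlongrightarrow> z) (at_right 0)" by (rule tendsto_scale_at_right)
  have zw: "ori x w z = 0" unfolding z_def ori_line3 by simp
  have 1: "\<forall>\<^sub>F h in at_right 0. ori x w (?P h) < 0 \<longrightarrow> ?P h \<in> vis_above S s x"
    using eventually_compose_filterlim[OF ev P] .
  have "z \<noteq> x" using k j by (simp add: z_def)
  have "c = x + (l / j) *\<^sub>R (z - x)" unfolding z_def l(3) using j l by simp
  moreover have "x + (l / j) *\<^sub>R (z - x) \<in> open_segment x z"
    using j l \<open>z \<noteq> x\<close> by (intro in_openI) auto
  ultimately have cz: "c \<in> open_segment x z" by simp
  have 2: "\<forall>\<^sub>F h in at_right 0. 0 < ori x z e * ori x z (?P h) \<longrightarrow> \<not> visible S x (?P h)"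
    using hidden_side[OF t(1) cz t(2,4) P] .
  have "\<forall>\<^sub>F h in at_right (0::real). 0 < h" by (rule eventually_at_right_less)
  with 1 2 have "\<forall>\<^sub>F h in at_right (0::real). False"
  proof eventually_elim
    case (elim h)
    have o: "ori x w (?P h) = h * ori x w e" unfolding ori_line3 zw by simp
    have "ori x z e * ori x z (?P h) = (j * ori x w e) * (j * (h * ori x w e))"
      using ori_ray[OF z_def] o by simp
    also have "\<dots> = j * j * h * (ori x w e * ori x w e)" by simp
    also have "0 < \<dots>" using elim(3) neg j k by (intro mult_pos_pos mult_neg_neg) auto
    finally have "\<not> visible S x (?P h)" using elim(2) by blast
    moreover have "ori x w (?P h) < 0" using o elim(3) neg by (simp add: mult_less_0_iff)
    ultimately show False using elim(1) by (auto simp: vis_above_iff)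
  qed
  then show False by simp
qed

section \<open>From geometric active edges to the condition \<open>act\<close>\<close>

context scene
begin

lemma act_endpoint:
  assumes "act S s x q" "t \<in> S" "q \<in> seg t"
  shows "q = fst t \<or> q = snd t"
proof (rule ccontr)
  assume "\<not> ?thesis"
  then have q: "q \<in> open_segment (fst t) (snd t)" "q \<noteq> fst t" "q \<noteq> snd t"
    using assms(3) by (auto simp: seg_def open_segment_def)
  have pos: "0 < ori x q (fst t)" "0 < ori x q (snd t)"
    using assms q seg_ends unfolding act_def by metis+
  then show False using opposite_ends[OF q(1), of x q "fst t"] by (auto simp: mult_less_0_iff)
qed

lemma act_other_end:
  assumes "act S s x q"
  obtains t e where "t \<in> S" "q \<in> seg t" "e \<in> seg t" "0 < ori x q e"
proof -
  obtain t where t: "t \<in> S" "q = fst t \<or> q = snd t" using assms by (auto simp: act_def endpoints_def)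
  then have "\<exists>e\<in>seg t. e \<noteq> q" using ends_neq[OF t(1)] seg_ends by metis
  moreover have "q \<in> seg t" using t by auto
  ultimately show ?thesis using that t(1) assms unfolding act_def by blast
qed

lemma act_clear_ray:
  assumes "act S s x q" "t \<in> S" "q \<in> seg t"
  shows "seg t \<inter> closed_segment q (q + k *\<^sub>R (q - x)) \<subseteq> {q}"
proof
  fix c assume c: "c \<in> seg t \<inter> closed_segment q (q + k *\<^sub>R (q - x))"
  then obtain m where m: "c = q + m *\<^sub>R ((q + k *\<^sub>R (q - x)) - q)"
    unfolding Int_iff in_closed_iff by blast
  have "ori x q c = 0" unfolding m by (simp add: ori_simps algebra_simps)
  then show "c \<in> {q}" using assms c unfolding act_def by force
qed

text \<open>It suffices that the piece beyond \<open>q\<close> is free: then every segment meeting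
  the line passes through \<open>q\<close>, and \<open>act\<close> puts it on the left.\<close>

lemma act_rse:
  assumes s: "s \<in> S" "x \<in> seg s" and a: "act S s x q" and k: "0 < k"
    and free: "open_segment q (q + k *\<^sub>R (q - x)) \<inter> obstacles S = {}"
  shows "right_side_edge S s x q (q + k *\<^sub>R (q - x))"
proof -
  let ?w = "q + k *\<^sub>R (q - x)"
  have xq: "x \<noteq> q" using a s unfolding act_def by (metis less_irrefl on_support)
  have q: "q = x + (1 / (1 + k)) *\<^sub>R (?w - x)"
  proof -
    have "?w - x = (1 + k) *\<^sub>R (q - x)" by (simp add: algebra_simps)
    then show ?thesis using k by simp
  qed
  have "?w - x = (1 + k) *\<^sub>R (q - x)" by (simp add: algebra_simps)
  then have "?w \<noteq> x" using k xq by (metis add_pos_pos eq_iff_diff_eq_0 less_irrefl scaleR_eq_0_iff zero_less_one)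
  then have qo: "q \<in> open_segment x ?w" using k by (subst q) (intro in_openI, auto)
  have os: "ori x ?w y = (1 + k) * ori x q y" for y
    by (simp add: ori_simps algebra_simps)
  obtain t e where t: "t \<in> S" "q \<in> seg t" "e \<in> seg t" "0 < ori x q e" using act_other_end[OF a] .
  show ?thesis
  proof (rule rse_intro[OF finite_S s(2) qo _ _ t(1-3)])
    show "0 < ori (fst s) (snd s) q" using a by (simp add: act_def)
    show "0 < ori x ?w e" using os t(4) k by simp
    fix t c e assume c: "t \<in> S" "c \<in> seg t" "c \<in> open_segment x ?w" "e \<in> seg t"
    have "closed_segment x q \<union> closed_segment q ?w = closed_segment x ?w"
      using qo by (intro Un_closed_segment) (auto simp: open_segment_def)
    then have "c \<in> open_segment x q \<or> c = q \<or> c \<in> open_segment q ?w"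
      using c(3) by (auto simp: open_segment_def)
    moreover have "c \<notin> open_segment x q" using a c by (auto simp: act_def visible_def obstacles_def)
    moreover have "c \<notin> open_segment q ?w" using free c by (auto simp: obstacles_def)
    ultimately have "q \<in> seg t" using c by auto
    then have "0 \<le> ori x q e" using a c(1,4) unfolding act_def by (cases "e = q") force+
    then show "0 \<le> ori x ?w e" using os k by simp
  qed
qed

text \<open>A segment at \<open>q\<close> lying in the line of sight must run away from
  \<open>x\<close>, otherwise it would hide \<open>q\<close>. Prolonged backwards beyond
  \<open>q\<close>, it reaches \<open>x\<close>.\<close>

lemma collinear_touch_evg:
  assumes s: "s \<in> S" "x \<in> open_segment (fst s) (snd s)" "0 < ori (fst s) (snd s) q"
    and vis: "visible S x q" and t: "t \<in> S" "q \<in> seg t" "z \<in> seg t" "z \<noteq> q" "ori x q z = 0"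
  shows "evg_collinear S x q"
proof -
  have xq: "x \<noteq> q" using x_neq_q s .
  have line: "ori x q c = 0" if "c \<in> seg t" for c
    using seg_subset_line[OF t(2,3) _ _ _ that, of x q] t(4,5) by simp
  have clear: "open_segment x q \<inter> seg t = {}" using vis t(1) by (auto simp: visible_def obstacles_def)
  have "q \<notin> open_segment (fst t) (snd t)"
    using collinear_open_near[of q t x q] line clear xq by auto
  then have q: "q = fst t \<or> q = snd t" using t(2) by (auto simp: seg_def open_segment_def)
  define e where "e = (if q = fst t then snd t else fst t)"
  have e: "e \<in> seg t" "(q, e) \<in> S \<or> (e, q) \<in> S" "e \<noteq> q" "e \<in> endpoints S" "q \<in> endpoints S"
    using q t(1) ends_neq[OF t(1)] by (auto simp: e_def endpoints_def)
  obtain h where h: "e = x + h *\<^sub>R (q - x)" using ori_zeroD[OF line[OF e(1)] xq] .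
  \<comment> \<open>Parameters are measured from \<open>x\<close>, with \<open>q\<close> at 1. An
    end before \<open>q\<close> would make \<open>t\<close> cover points of the line of
    sight.\<close>
  have "1 < h"
  proof (rule ccontr)
    assume "\<not> 1 < h"
    then have h1: "h < 1" using e(3) h by (cases "h = 1") auto
    define r where "r = max (1/2) h"
    have r: "0 < r" "r < 1" "h \<le> r" using h1 by (auto simp: r_def)
    define d where "d = x + r *\<^sub>R (q - x)"
    have "d \<in> open_segment x q" using r xq by (auto simp: d_def intro: in_openI)
    moreover have "d = e + ((r - h) / (1 - h)) *\<^sub>R (q - e)"
    proof -
      have "q - e = (1 - h) *\<^sub>R (q - x)" unfolding h by (simp add: algebra_simps)
      then have "((r - h) / (1 - h)) *\<^sub>R (q - e) = (r - h) *\<^sub>R (q - x)" using h1 by simp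
      then show ?thesis unfolding d_def h by (simp add: scaleR_left_diff_distrib)
    qed
    then have "d \<in> closed_segment e q" using r h1 in_closedI[of "(r - h) / (1 - h)" e q] by simp
    then have "d \<in> seg t" using seg_sub[OF e(1) t(2)] by blast
    ultimately show False using clear by blast
  qed
  then have "q = x + (1 / h) *\<^sub>R (e - x)" unfolding h by simp
  moreover have "x + (1 / h) *\<^sub>R (e - x) \<in> open_segment x e"
    using \<open>1 < h\<close> h xq by (intro in_openI) auto
  ultimately have "q \<in> open_segment x e" by simp
  moreover have "vg_edge S e q" using e by (auto simp: vg_edge_def)
  ultimately show ?thesis using extension_evg[OF s] vis by simp
qed

text \<open>A segment that meets the line before \<open>q\<close> cannot reach to the right, by
  \<open>rse_no_right\<close>, nor to the left, since the edge could then be prolonged towards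
  \<open>x\<close>; so it lies in the line. If such segments or endpoints hide \<open>q\<close> from
  \<open>x\<close>, or if a segment at \<open>q\<close> lies in the line, then there is an edge of
  the extended visibility graph in \<open>x\<close> on that line.\<close>

lemma active_imp_act:
  assumes s: "s \<in> S" "x \<in> open_segment (fst s) (snd s)" and active: "active_edge S s x q w"
    and no: "\<not> evg_collinear S x q"
  shows "act S s x q"
proof -
  have rse: "right_side_edge S s x q w" using active by (simp add: active_edge_def)
  have xs: "x \<in> seg s" using s by (auto simp: seg_def open_segment_def)
  have above: "0 < ori (fst s) (snd s) q" using rse by (simp add: right_side_edge_iff)
  obtain k where k: "0 < k" "k < 1" "q = x + k *\<^sub>R (w - x)" "x \<noteq> w"
    using rse unfolding right_side_edge_iff in_open_iff by blast
  have qo: "q \<in> open_segment x w" using rse by (simp add: right_side_edge_iff)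
  have xq: "x \<noteq> q" using qo by (auto simp: open_segment_def)
  have oq: "ori x q y = k * ori x w y" for y using ori_ray[OF k(3)] .
  have above_w: "0 < ori (fst s) (snd s) w"
    using above xs k(1) unfolding k(3) ori_line3 by (simp add: zero_less_mult_iff)
  note no_right = rse_no_right[OF rse]
  \<comment> \<open>Otherwise \<open>u\<close> would be the lower end of a longer edge with the same
    upper end, contrary to maximality.\<close>
  have no_left: "ori x w e = 0"
    if t: "t \<in> S" "u \<in> seg t" "u \<in> open_segment x q" "e \<in> seg t" for t u e
  proof (rule ccontr)
    assume "ori x w e \<noteq> 0"
    obtain l where l: "0 < l" "l < 1" "u = x + l *\<^sub>R (q - x)"
      using t(3) unfolding in_open_iff by blast
    have u: "u \<in> open_segment x w" using closed_in_open[OF qo] t(3) by (auto simp: open_segment_def)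
    then have "0 \<le> ori x w e" using no_right t by blast
    then have "0 < ori x w e" using \<open>ori x w e \<noteq> 0\<close> by simp
    have "0 < ori (fst s) (snd s) u" using above xs l unfolding l(3) ori_line3 by simp
    have "right_side_edge S s x u w"
      by (rule rse_intro[OF finite_S xs u _ _ t(1,2,4)]) (fact | rule no_right; assumption)+
    moreover have "closed_segment q w \<subseteq> closed_segment u w"
    proof -
      have lk: "l * k < k" using l k by simp
      then have lk1: "l * k < 1" using k by linarith
      have "q = u + ((k - l * k) / (1 - l * k)) *\<^sub>R (w - u)"
      proof -
        have ux: "u = x + (l * k) *\<^sub>R (w - x)" unfolding l(3) by (simp add: k(3))
        have "w - u = (1 - l * k) *\<^sub>R (w - x)" unfolding ux by (simp add: algebra_simps)
        then have e: "((k - l * k) / (1 - l * k)) *\<^sub>R (w - u) = (k - l * k) *\<^sub>R (w - x)"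
          using lk1 by simp
        show ?thesis unfolding e unfolding ux k(3) by (simp add: scaleR_left_diff_distrib)
      qed
      with lk lk1 have "q \<in> closed_segment u w"
        using in_closedI[of "(k - l * k) / (1 - l * k)" u w] k by simp
      then show ?thesis by (simp add: closed_segment_subset)
    qed
    ultimately have "u = q" using active unfolding active_edge_def by blast
    then show False using t(3) by (auto simp: open_segment_def)
  qed
  \<comment> \<open>Parameters at which the line is met by segments that do not lie in it; each such
    segment contributes at most one.\<close>
  define L where "L = (\<Union>t\<in>S. {l. x + l *\<^sub>R (w - x) \<in> seg t \<and> (\<exists>e\<in>seg t. ori x w e \<noteq> 0)})"
  have "finite L" unfolding L_def
  proof (intro finite_UN_I finite_S)
    fix t assume t: "t \<in> S"
    show "finite {l. x + l *\<^sub>R (w - x) \<in> seg t \<and> (\<exists>e\<in>seg t. ori x w e \<noteq> 0)}" (is "finite ?A")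
    proof (cases "?A = {}")
      case True
      show ?thesis unfolding True by simp
    next
      case False
      then obtain l where l: "l \<in> ?A" by blast
      have "?A \<subseteq> {l}"
      proof
        fix m assume m: "m \<in> ?A"
        then obtain e where e: "e \<in> seg t" "ori x w e \<noteq> 0" by blast
        show "m \<in> {l}"
        proof (rule ccontr)
          assume "m \<notin> {l}"
          then have "x + m *\<^sub>R (w - x) \<noteq> x + l *\<^sub>R (w - x)" using k(4) by simp
          then have "ori x w e = 0"
            using seg_subset_line[of "x + m *\<^sub>R (w - x)" t "x + l *\<^sub>R (w - x)" x w e] l m e(1)
            by (simp add: ori_line3)
          then show False using e(2) by blast
        qed
      qed
      then show ?thesis using finite_subset by blast
    qed
  qed
  \<comment> \<open>If nothing left the line at \<open>q\<close> to the left, then points just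
    beyond \<open>q\<close> would have visible points on both sides, but the left side of the edge
    is hidden.\<close>
  have left_at_q: "\<exists>t\<in>S. q \<in> seg t \<and> (\<exists>e\<in>seg t. 0 < ori x w e)"
  proof (rule ccontr)
    assume neg: "\<not> ?thesis"
    have "finite (insert 1 {l \<in> L. k < l})" using \<open>finite L\<close> by simp
    \<comment> \<open>The next transversal crossing after \<open>q\<close>. Inserting 1, the
      parameter of \<open>w\<close>, keeps \<open>z\<close> on the edge when there is none.\<close>
    define M where "M = Min (insert 1 {l \<in> L. k < l})"
    have M: "k < M" "M \<le> 1" unfolding M_def using k \<open>finite L\<close> by (auto simp: Min_gr_iff Min_le)
    have Ml: "M \<le> l" if "l \<in> L" "k < l" for l
      unfolding M_def using \<open>finite L\<close> that by (intro Min_le) auto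
    define j where "j = (k + M) / 2"
    have "k < j" "j < 1" "j < M" using M k by (simp_all add: j_def)
    then have j: "k < j" "j < 1" "l \<in> L \<Longrightarrow> k < l \<Longrightarrow> j < l" for l
      using Ml[of l] by linarith+
    define z where "z = x + j *\<^sub>R (w - x)"
    have zo: "z \<in> open_segment x w" unfolding z_def using j k by (intro in_openI) auto
    have zx: "z \<noteq> x" using zo by (auto simp: open_segment_def)
    have clear: "ori x w e = 0" if t: "t \<in> S" "c \<in> seg t" "c \<in> closed_segment x z" "c \<noteq> x" "e \<in> seg t" for t c e
    proof (rule ccontr)
      assume e: "ori x w e \<noteq> 0"
      obtain h where h: "0 \<le> h" "h \<le> 1" "c = x + h *\<^sub>R (z - x)"
        using t(3) unfolding in_closed_iff by blast
      then have c: "c = x + (h * j) *\<^sub>R (w - x)" by (simp add: z_def)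
      have "h \<noteq> 0" using h t(4) by auto
      then have hj: "0 < h * j" "h * j \<le> j" using h j k by (auto simp: mult_left_le_one_le)
      have co: "c \<in> open_segment x w" using closed_in_open[OF zo t(3,4)] .
      have "h * j \<in> L" using t(1,2,5) e c unfolding L_def by blast
      then have "h * j \<le> k" using j(3)[of "h * j"] hj by linarith
      have "c = x + (h * j / k) *\<^sub>R (q - x)" unfolding c k(3) using k by simp
      then have "c \<in> closed_segment x q" using in_closedI[of "h * j / k" x q] hj \<open>h * j \<le> k\<close> k by simp
      then have "c \<in> open_segment x q \<or> c = q" using t(4) by (auto simp: open_segment_def)
      then show False
      proof
        assume "c \<in> open_segment x q" then show False using no_left t e by blast
      next
        assume "c = q"
        moreover have "0 < ori x w e" using no_right[OF t(1,2) co t(5)] e by simp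
        ultimately show False using neg t by blast
      qed
    qed
    have "\<forall>\<^sub>F y in nhds z. \<forall>t\<in>S. ori x w y \<noteq> 0 \<longrightarrow> seg t \<inter> open_segment x y = {}"
    proof (intro eventually_ball_finite finite_S ballI)
      fix t assume t: "t \<in> S"
      show "\<forall>\<^sub>F y in nhds z. ori x w y \<noteq> 0 \<longrightarrow> seg t \<inter> open_segment x y = {}"
      proof (cases "seg t \<inter> closed_segment x z \<subseteq> {x}")
        case True
        have "\<forall>\<^sub>F y in nhds z. seg t \<inter> open_segment x y = {}"
          by (rule eventually_clear[OF True zx]) (rule filterlim_ident)
        then show ?thesis by eventually_elim simp
      next
        case False
        then have l: "ori x w e = 0" if "e \<in> seg t" for e using clear t that by blast
        show ?thesis
        proof (intro always_eventually allI impI)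
          fix y assume y: "ori x w y \<noteq> 0"
          show "seg t \<inter> open_segment x y = {}"
          proof (rule ccontr)
            assume "\<not> ?thesis"
            then obtain d where "d \<in> seg t" "d \<in> open_segment x y" by blast
            then obtain h where h: "d \<in> seg t" "0 < h" "d = x + h *\<^sub>R (y - x)"
              unfolding in_open_iff by blast
            have "ori x w d = h * ori x w y" unfolding h(3) ori_line3 by simp
            then show False using l[OF h(1)] h y by simp
          qed
        qed
      qed
    qed
    moreover have "0 < ori (fst s) (snd s) z" unfolding z_def ori_line3 using above_w j k xs by simp
    then have "\<forall>\<^sub>F y in nhds z. 0 < ori (fst s) (snd s) y"
      by (rule order_tendstoD(1)[rotated]) (intro tendsto_intros filterlim_ident)
    ultimately have ev: "\<forall>\<^sub>F y in nhds z. ori x w y \<noteq> 0 \<longrightarrow> y \<in> vis_above S s x"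
      by eventually_elim (auto simp: vis_above_iff visible_def obstacles_def)
    have "z = q + ((j - k) / (1 - k)) *\<^sub>R (w - q)"
    proof -
      have "w - q = (1 - k) *\<^sub>R (w - x)" unfolding k(3) by (simp add: algebra_simps)
      then have "((j - k) / (1 - k)) *\<^sub>R (w - q) = (j - k) *\<^sub>R (w - x)" using k by simp
      then show ?thesis unfolding z_def by (simp add: k(3) scaleR_left_diff_distrib)
    qed
    moreover have "q \<noteq> w" using qo by (auto simp: open_segment_def)
    ultimately have "z \<in> open_segment q w" using in_openI[of q w "(j - k) / (1 - k)"] j k by simp
    then have "\<forall>\<^sub>F y in nhds z. 0 < ori x w y \<longrightarrow> y \<notin> vis_above S s x"
      using rse unfolding right_side_edge_iff by (auto elim: eventually_mono)
    with ev have "\<forall>\<^sub>F y in nhds z. \<not> 0 < ori x w y" by eventually_elim auto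
    \<comment> \<open>The direction towards \<open>fst s\<close> leads to the left side of the
      line.\<close>
    then have "\<forall>\<^sub>F h in at_right 0. \<not> 0 < ori x w (z + h *\<^sub>R (fst s - x))"
      by (rule eventually_compose_filterlim) (rule tendsto_scale_at_right)
    moreover have "0 < ori x w (z + h *\<^sub>R (fst s - x))" if "0 < h" for h
    proof -
      obtain m' where m': "0 < m'" "x = fst s + m' *\<^sub>R (snd s - fst s)"
        using s(2) unfolding in_open_iff by blast
      have "x + (- m') *\<^sub>R (snd s - fst s) = fst s" using m'(2) by simp
      then have "ori x w (fst s) = m' * ori (fst s) (snd s) w" using ori_along[OF xs, of w "- m'"] by simp
      moreover have "ori x w (z + h *\<^sub>R (fst s - x)) = h * ori x w (fst s)"
        unfolding z_def by (simp add: ori_simps algebra_simps)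
      ultimately show ?thesis using that m' above_w by simp
    qed
    ultimately have "\<forall>\<^sub>F h in at_right (0::real). \<not> 0 < h" by (auto elim: eventually_mono)
    then have "\<forall>\<^sub>F h in at_right (0::real). False"
      using eventually_at_right_less[of "0::real"] by eventually_elim blast
    then show False by simp
  qed
  then obtain t0 e0 where t0: "t0 \<in> S" "q \<in> seg t0" "e0 \<in> seg t0" "0 < ori x w e0" by blast
  have qw: "ori x w q = 0" unfolding k(3) ori_line3 by simp
  have qe: "q \<in> endpoints S"
  proof (rule ccontr)
    assume "q \<notin> endpoints S"
    then have "q \<in> open_segment (fst t0) (snd t0)" using endpoint_or_open t0 by blast
    then have "ori x w (fst t0) * ori x w (snd t0) < 0"
      using opposite_ends[OF _ qw t0(3)] t0(4) by simp
    then show False using no_right[OF t0(1,2) qo] seg_ends[of t0]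
      by (metis mult_nonneg_nonneg not_le)
  qed
  have vis: "visible S x q"
  proof (rule ccontr)
    assume "\<not> visible S x q"
    moreover have "ori x q c = 0" if "t \<in> S" "z \<in> open_segment (fst t) (snd t)" "z \<in> open_segment x q" "c \<in> seg t"
      for t z c
    proof -
      have "z \<in> seg t" using that(2) by (auto simp: seg_def open_segment_def)
      then show ?thesis using no_left[OF that(1) _ that(3,4)] oq by simp
    qed
    ultimately show False using blocked_evg[OF s above qe] no by blast
  qed
  show ?thesis unfolding act_def
  proof (intro conjI ballI impI qe above vis)
    fix t z assume t: "t \<in> S" "q \<in> seg t" "z \<in> seg t" "z \<noteq> q"
    have "ori x q z \<noteq> 0" using collinear_touch_evg[OF s above vis t] no by blast
    moreover have "0 \<le> ori x w z" using no_right[OF t(1,2) qo t(3)] .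
    ultimately show "0 < ori x q z" using oq k(1) by (simp add: less_le)
  qed
qed

end

lemma in_openE:
  fixes z :: pt
  assumes "z \<in> open_segment a b"
  obtains k where "0 < k" "k < 1" "z = a + k *\<^sub>R (b - a)" "a \<noteq> b"
  using assms unfolding in_open_iff by (elim conjE exE)

lemma right_side_edge_scale:
  assumes "right_side_edge S s x q w" "q = x + k *\<^sub>R (w - x)" "w = x + l *\<^sub>R (v - x)" "0 < k" "0 < l"
    "z \<in> open_segment q w"
  shows "\<forall>\<^sub>F y in nhds z. (ori x v y < 0 \<longrightarrow> y \<in> vis_above S s x) \<and>
        (0 < ori x v y \<longrightarrow> y \<notin> vis_above S s x)"
proof -
  have "\<forall>\<^sub>F y in nhds z. (ori x w y < 0 \<longrightarrow> y \<in> vis_above S s x) \<and>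
        (0 < ori x w y \<longrightarrow> y \<notin> vis_above S s x)"
    using assms(1,6) unfolding right_side_edge_iff by blast
  then show ?thesis
    by (rule eventually_mono) (use ori_ray[OF assms(3)] assms(5) in
        \<open>auto simp: zero_less_mult_iff mult_less_0_iff\<close>)
qed

section \<open>Existence of maximal active edges\<close>

context scene
begin

lemma closed_H: "closed H"
  using frontier_H obstacles_H frontier_subset_eq by blast

lemma seg_H: "s \<in> S \<Longrightarrow> seg s \<subseteq> H"
  using obstacles_H by (auto simp: obstacles_def)

text \<open>A line of sight that leaves \<open>H\<close> passes through the frontier of
  \<open>H\<close>, which consists of obstacles. As \<open>H\<close> is closed, the crossing differs
  from the outer point \<open>y\<close>.\<close>

lemma visible_stays:
  assumes "visible S x y" "x + r *\<^sub>R (y - x) \<in> H" "0 < r" "r < 1"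
  shows "y \<in> H"
proof (rule ccontr)
  assume y: "y \<notin> H"
  let ?u = "x + r *\<^sub>R (y - x)"
  have "x \<noteq> y" using y assms(2) by auto
  have "closed_segment ?u y \<inter> frontier H \<noteq> {}"
    by (rule connected_Int_frontier) (use assms(2) y in auto)
  then obtain c where c: "c \<in> closed_segment ?u y" "c \<in> frontier H" by blast
  then have "c \<in> obstacles S" "c \<in> H" using frontier_H obstacles_H by auto
  then have "c \<noteq> y" using y by blast
  obtain k where k: "0 \<le> k" "k \<le> 1" "c = ?u + k *\<^sub>R (y - ?u)" using c(1) unfolding in_closed_iff by blast
  have "k \<noteq> 1" using k \<open>c \<noteq> y\<close> by auto
  then have "k < 1" using k by simp
  have "c = x + (r + k * (1 - r)) *\<^sub>R (y - x)" unfolding k(3) by (simp add: algebra_simps)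
  moreover have "0 < (1 - k) * (1 - r)" using \<open>k < 1\<close> assms by simp
  then have "r + k * (1 - r) < 1" by (simp add: algebra_simps)
  moreover have "0 \<le> k * (1 - r)" using k assms by simp
  then have "0 < r + k * (1 - r)" using assms by linarith
  ultimately have "c \<in> open_segment x y" using in_openI[OF \<open>x \<noteq> y\<close>] by simp
  then show False using assms(1) \<open>c \<in> obstacles S\<close> by (auto simp: visible_def)
qed

lemma snd_right:
  assumes s: "s \<in> S" "x \<in> open_segment (fst s) (snd s)" and above: "0 < ori (fst s) (snd s) q"
  shows "ori x q (snd s) < 0" "0 < ori x q (fst s)"
proof -
  have xs: "x \<in> seg s" using s by (auto simp: seg_def open_segment_def)
  obtain m where m: "0 < m" "m < 1" "x = fst s + m *\<^sub>R (snd s - fst s)"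
    using s(2) unfolding in_open_iff by blast
  have "x + (- m) *\<^sub>R (snd s - fst s) = fst s" "x + (1 - m) *\<^sub>R (snd s - fst s) = snd s"
    unfolding m(3) by (simp_all add: algebra_simps)
  then have "ori x q (fst s) = m * ori (fst s) (snd s) q" "ori x q (snd s) = - (1 - m) * ori (fst s) (snd s) q"
    using ori_along[OF xs, of q "- m"] ori_along[OF xs, of q "1 - m"] by simp_all
  then show "ori x q (snd s) < 0" "0 < ori x q (fst s)" using m above by (simp_all add: mult_less_0_iff)
qed

text \<open>Beyond \<open>H\<close> nothing could be visible to the right of the edge: the triangle spanned by \<open>x\<close>,
  \<open>q\<close> and the right endpoint of \<open>s\<close> lies in \<open>H\<close>, so lines of sight start inside \<open>H\<close> and cannot
  leave it.\<close>

lemma rse_in_H: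
  assumes s: "s \<in> S" "x \<in> open_segment (fst s) (snd s)"
    and rse: "right_side_edge S s x q w" and q: "q \<in> H" and z: "z \<in> open_segment q w"
  shows "z \<in> H"
proof (rule ccontr)
  assume zH: "z \<notin> H"
  have xs: "x \<in> seg s" using s by (auto simp: seg_def open_segment_def)
  have above: "0 < ori (fst s) (snd s) q" using rse by (simp add: right_side_edge_iff)
  obtain k where k: "0 < k" "k < 1" "q = x + k *\<^sub>R (w - x)" "x \<noteq> w"
    using rse unfolding right_side_edge_iff in_open_iff by blast
  obtain m where m: "0 < m" "m < 1" "z = q + m *\<^sub>R (w - q)" using z unfolding in_open_iff by blast
  define h where "h = 1 + m * ((1 - k) / k)"
  have h: "1 < h" using m k by (simp add: h_def)
  have zq: "z = x + h *\<^sub>R (q - x)"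
  proof -
    have "w - q = ((1 - k) / k) *\<^sub>R (q - x)"
    proof -
      have "w - q = (1 - k) *\<^sub>R (w - x)" unfolding k(3) by (simp add: algebra_simps)
      moreover have "q - x = k *\<^sub>R (w - x)" unfolding k(3) by simp
      ultimately show ?thesis using k by simp
    qed
    then show ?thesis unfolding m(3) h_def by (simp add: scaleR_left_distrib)
  qed
  have qw: "ori x w y * k = ori x q y" for y using ori_ray[OF k(3)] by simp
  \<comment> \<open>Moving from \<open>z\<close> towards the right endpoint of \<open>s\<close>
    leads to the right side of the edge, where points are visible.\<close>
  let ?P = "\<lambda>e. z + e *\<^sub>R (snd s - z)"
  have P: "(?P \<longlongrightarrow> z) (at_right 0)" by (rule tendsto_scale_at_right)
  have "ori x w z = 0" unfolding m(3) ori_line3 by (simp add: k(3) ori_line3)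
  then have "ori x w (?P e) = e * ori x w (snd s)" for e unfolding ori_line3 by simp
  moreover have "ori x w (snd s) < 0" using snd_right(1)[OF s above] qw[of "snd s"] k
    by (metis mult_less_0_iff not_less_iff_gr_or_eq)
  ultimately have neg: "ori x w (?P e) < 0" if "0 < e" for e using that by (simp add: mult_less_0_iff)
  have "\<forall>\<^sub>F y in nhds z. ori x w y < 0 \<longrightarrow> y \<in> vis_above S s x"
    using rse z unfolding right_side_edge_iff by (auto elim: eventually_mono)
  then have 1: "\<forall>\<^sub>F e in at_right 0. ori x w (?P e) < 0 \<longrightarrow> ?P e \<in> vis_above S s x"
    by (rule eventually_compose_filterlim) (rule P)
  have "\<forall>\<^sub>F y in nhds z. y \<in> - H" using closed_H zH
    by (intro eventually_nhds_in_open) auto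
  then have 2: "\<forall>\<^sub>F e in at_right 0. ?P e \<in> - H"
    by (rule eventually_compose_filterlim) (rule P)
  have 3: "\<forall>\<^sub>F e in at_right 0. e < (1::real)" by (rule order_tendstoD(2)[OF tendsto_ident_at]) simp
  have "\<forall>\<^sub>F e in at_right (0::real). False"
    using 1 2 3 eventually_at_right_less[of "0::real"]
  proof eventually_elim
    case (elim e)
    then have "visible S x (?P e)" using neg by (auto simp: vis_above_iff)
    moreover have "x + (1 / (h + 1)) *\<^sub>R (?P e - x) \<in> H"
    proof -
      \<comment> \<open>Barycentric weights of \<open>q\<close> and \<open>snd s\<close>. The factor
        \<open>1 / (h + 1)\<close> is small enough to make their sum at most 1, so the point lies in
        the triangle.\<close>
      define a b where "a = (1 - e) * h / (h + 1)" and "b = e / (h + 1)"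
      have ab: "0 \<le> a" "0 \<le> b" "a + b \<le> 1"
      proof -
        show "0 \<le> a" "0 \<le> b" using h elim by (auto simp: a_def b_def)
        have "a + b = ((1 - e) * h + e) / (h + 1)" by (simp add: a_def b_def add_divide_distrib)
        moreover have "0 \<le> e * h" using h elim by simp
        then have "(1 - e) * h + e \<le> h + 1" using elim(3) by (simp add: left_diff_distrib)
        ultimately show "a + b \<le> 1" using h by simp
      qed
      have "?P e - x = ((1 - e) * h) *\<^sub>R (q - x) + e *\<^sub>R (snd s - x)"
        unfolding zq by (simp add: algebra_simps)
      then have "(1 / (h + 1)) *\<^sub>R (?P e - x) = a *\<^sub>R (q - x) + b *\<^sub>R (snd s - x)"
        by (simp add: a_def b_def scaleR_right_distrib)
      then have "x + (1 / (h + 1)) *\<^sub>R (?P e - x) = (1 - a - b) *\<^sub>R x + a *\<^sub>R q + b *\<^sub>R snd s"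
        by (simp add: algebra_simps)
      moreover have "(1 - a - b) *\<^sub>R x + a *\<^sub>R q + b *\<^sub>R snd s \<in> convex hull {x, q, snd s}"
        unfolding convex_hull_3 mem_Collect_eq
        by (rule exI[of _ "1 - a - b"], rule exI[of _ a], rule exI[of _ b]) (use ab in simp)
      moreover have "convex hull {x, q, snd s} \<subseteq> H"
        using q xs seg_H[OF s(1)] seg_ends(2)[of s] by (intro hull_minimal convex_H) auto
      ultimately show ?thesis by auto
    qed
    ultimately have "?P e \<in> H" using visible_stays[of x "?P e" "1 / (h + 1)"] h by simp
    then show False using elim by simp
  qed
  then show False by simp
qed

text \<open>The upper end is the supremum of the possible lengths, which are bounded because edges
  stay in the bounded set \<open>H\<close>. An edge of supremal length is again an edge, as each of
  its inner points belongs to a shorter one. Below \<open>q\<close> it cannot be prolonged, since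
  there the line of sight is clear on both sides.\<close>

lemma act_imp_active:
  assumes s: "s \<in> S" "x \<in> open_segment (fst s) (snd s)" and a: "act S s x q"
  shows "\<exists>w. active_edge S s x q w"
proof -
  have xs: "x \<in> seg s" using s by (auto simp: seg_def open_segment_def)
  have above: "0 < ori (fst s) (snd s) q" using a by (simp add: act_def)
  have xq: "x \<noteq> q" using x_neq_q[OF s above] .
  have qH: "q \<in> H" using a endpoint_obstacle obstacles_H by (auto simp: act_def)
  let ?w = "\<lambda>k. q + k *\<^sub>R (q - x)"
  define K where "K = {k. 0 < k \<and> right_side_edge S s x q (?w k)}"
  have "\<exists>k. k \<in> K"
  \<comment> \<open>The length 1 is arbitrary: if the piece is not free, it is cut at its first
    obstacle.\<close>
  proof (cases "open_segment q (?w 1) \<inter> obstacles S = {}")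
    case True
    then have "1 \<in> K" using act_rse[OF s(1) xs a, of 1] by (simp add: K_def)
    then show ?thesis by blast
  next
    case False
    then obtain c where c: "c \<in> open_segment q (?w 1)" "c \<in> obstacles S" by blast
    have "q \<noteq> ?w 1" using xq by simp
    then obtain z where z: "z \<in> closed_segment q (?w 1)" "z \<noteq> q" "visible S q z"
      using first_obstacle[OF finite_S, of q "?w 1" c] c act_clear_ray[OF a, of _ 1]
      by (metis DiffD1 DiffD2 insertCI open_segment_def)
    obtain k where k: "0 \<le> k" "z = q + k *\<^sub>R (?w 1 - q)" using z(1) unfolding in_closed_iff by blast
    then have "k \<noteq> 0" "z = ?w k" using z(2) by auto
    then have "k \<in> K" using act_rse[OF s(1) xs a, of k] z(3) k by (simp add: K_def visible_def)
    then show ?thesis by blast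
  qed
  have wx: "?w k = x + (1 + k) *\<^sub>R (q - x)" for k by (simp add: algebra_simps)
  have qk: "q = x + (1 / (1 + k)) *\<^sub>R (?w k - x)" if "0 < k" for k
    unfolding wx using that by simp
  have wo: "?w m \<in> open_segment q (?w k)" if "0 < m" "m < k" for m k
  proof -
    have "?w m = q + (m / k) *\<^sub>R (?w k - q)" using that by simp
    moreover have "q \<noteq> ?w k" using that xq by simp
    ultimately show ?thesis using in_openI[of q "?w k" "m / k"] that by simp
  qed
  have "bdd_above K"
  proof -
    obtain B where B: "\<And>y. y \<in> H \<Longrightarrow> norm y \<le> B" using bounded_H bounded_iff by blast
    have "k \<le> 2 * (B + norm q) / norm (q - x)" if "k \<in> K" for k
    proof -
      have k: "0 < k" "right_side_edge S s x q (?w k)" using that by (auto simp: K_def)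
      \<comment> \<open>\<open>rse_in_H\<close> speaks about inner points of the edge only; the
        midpoint is bounded instead of the end.\<close>
      have "?w (k/2) \<in> H" using rse_in_H[OF s k(2) qH] wo[of "k/2" k] k by simp
      then have "norm (?w (k/2)) \<le> B" using B by blast
      moreover have "norm ((k/2) *\<^sub>R (q - x)) \<le> norm (?w (k/2)) + norm q"
        by (metis add_diff_cancel_left' norm_triangle_ineq4)
      ultimately have "k / 2 * norm (q - x) \<le> B + norm q" using k by simp
      then show ?thesis using xq by (simp add: field_simps)
    qed
    then show ?thesis by (rule bdd_aboveI)
  qed
  define k1 where "k1 = Sup K"
  have ub: "k \<le> k1" if "k \<in> K" for k unfolding k1_def using \<open>bdd_above K\<close> that by (rule cSup_upper[rotated])
  obtain k0 where k0: "k0 \<in> K" using \<open>\<exists>k. k \<in> K\<close> by blast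
  then have k1: "0 < k1" using ub[OF k0] by (auto simp: K_def)
  have open_param: "\<exists>m. 0 < m \<and> m < k \<and> z = ?w m" if zo: "z \<in> open_segment q (?w k)" and k: "0 < k" for z k
  proof -
    obtain m where m: "0 < m" "m < 1" "z = q + m *\<^sub>R (?w k - q)"
      by (rule in_openE[OF zo])
    have "z = ?w (m * k)" unfolding m(3) by simp
    moreover have "0 < m * k" "m * k < k" using m k by simp_all
    ultimately show ?thesis by blast
  qed
  have rse1: "right_side_edge S s x q (?w k1)" unfolding right_side_edge_iff
  proof (intro conjI ballI above)
    have "x \<noteq> ?w k1" using k1 xq unfolding wx by simp
    then show "q \<in> open_segment x (?w k1)"
      unfolding in_open_iff by (intro conjI exI[of _ "1 / (1 + k1)"] qk[OF k1]) (use k1 in auto)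
    fix z assume "z \<in> open_segment q (?w k1)"
    then obtain m where m: "0 < m" "m < k1" "z = ?w m" using open_param k1 by blast
    obtain k where k: "k \<in> K" "m < k"
      using less_cSup_iff[of K m] \<open>bdd_above K\<close> k0 m(2) unfolding k1_def by blast
    then have zk: "z \<in> open_segment q (?w k)" using wo m by blast
    have k': "0 < k" "right_side_edge S s x q (?w k)" using k by (auto simp: K_def)
    have e: "?w k = x + ((1 + k) / (1 + k1)) *\<^sub>R (?w k1 - x)" unfolding wx using k1 by simp
    show "\<forall>\<^sub>F y in nhds z. (ori x (?w k1) y < 0 \<longrightarrow> y \<in> vis_above S s x) \<and>
        (0 < ori x (?w k1) y \<longrightarrow> y \<notin> vis_above S s x)"
      by (rule right_side_edge_scale[OF k'(2) qk[OF k'(1)] e _ _ zk]) (use k1 k'(1) in simp_all)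
  qed
  have "active_edge S s x q (?w k1)" unfolding active_edge_def
  proof (rule conjI[OF rse1], intro allI impI)
    fix q' w' assume as: "right_side_edge S s x q' w' \<and> closed_segment q (?w k1) \<subseteq> closed_segment q' w'"
    then have rse: "right_side_edge S s x q' w'" and sub: "closed_segment q (?w k1) \<subseteq> closed_segment q' w'" by auto
    obtain a where a': "0 < a" "a < 1" "q' = x + a *\<^sub>R (w' - x)" "x \<noteq> w'"
      using rse unfolding right_side_edge_iff in_open_iff by blast
    have in_line: "\<exists>b. a \<le> b \<and> b \<le> 1 \<and> c = x + b *\<^sub>R (w' - x)" if cc: "c \<in> closed_segment q' w'" for c
    proof -
      obtain m where m: "0 \<le> m" "m \<le> 1" "c = q' + m *\<^sub>R (w' - q')" using cc unfolding in_closed_iff by blast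
      have "c = x + (a + m * (1 - a)) *\<^sub>R (w' - x)" unfolding m(3) a'(3) by (simp add: algebra_simps)
      moreover have "0 \<le> m * (1 - a)" "0 \<le> (1 - m) * (1 - a)" using m a' by simp_all
      then have "a \<le> a + m * (1 - a)" "a + m * (1 - a) \<le> 1" by (simp_all add: algebra_simps)
      ultimately show ?thesis by blast
    qed
    obtain b where b: "a \<le> b" "b \<le> 1" "q = x + b *\<^sub>R (w' - x)" using in_line sub by blast
    \<comment> \<open>An edge starting before \<open>q\<close> would have a hidden left side at some
      \<open>z\<close> before \<open>q\<close>, but all points near such a \<open>z\<close> are
      visible because \<open>x\<close> sees \<open>q\<close>.\<close>
    have "a = b"
    proof (rule ccontr)
      assume "a \<noteq> b"
      then have ab: "a < b" using b by simp
      define j where "j = (a + b) / 2"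
      have j: "a < j" "j < b" "j < 1" using ab b by (auto simp: j_def)
      define z where "z = x + j *\<^sub>R (w' - x)"
      have zx: "z \<noteq> x" using j a' by (simp add: z_def)
      have "w' - q' = (1 - a) *\<^sub>R (w' - x)" unfolding a'(3) by (simp add: algebra_simps)
      then have "((j - a) / (1 - a)) *\<^sub>R (w' - q') = (j - a) *\<^sub>R (w' - x)" using a' by simp
      then have "z = q' + ((j - a) / (1 - a)) *\<^sub>R (w' - q')"
        unfolding z_def by (simp add: a'(3) scaleR_left_diff_distrib)
      moreover have "q' \<noteq> w'" using rse by (auto simp: right_side_edge_iff open_segment_def)
      ultimately have "z \<in> open_segment q' w'" using in_openI[of q' w' "(j - a) / (1 - a)"] j a' by simp
      then have hid: "\<forall>\<^sub>F y in nhds z. 0 < ori x w' y \<longrightarrow> y \<notin> vis_above S s x"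
        using rse unfolding right_side_edge_iff by (auto elim: eventually_mono)
      have "z = x + (j / b) *\<^sub>R (q - x)" unfolding z_def b(3) using j a' by simp
      then have zo: "z \<in> open_segment x q" using in_openI[OF xq, of "j / b"] j a' by simp
      have clear: "seg t \<inter> closed_segment x z \<subseteq> {x}" if "t \<in> S" for t
        using closed_in_open[OF zo] a that by (auto simp: act_def visible_def obstacles_def)
      have "\<forall>\<^sub>F y in nhds z. visible S x y"
        by (rule eventually_visible[OF finite_S])
          (rule eventually_clear[OF clear zx filterlim_ident])
      moreover have "0 < ori (fst s) (snd s) w'"
        using rse a' xs unfolding right_side_edge_iff by (simp add: a'(3) ori_line3 zero_less_mult_iff)
      then have "0 < ori (fst s) (snd s) z" using xs j a' unfolding z_def ori_line3 by simp
      then have "\<forall>\<^sub>F y in nhds z. 0 < ori (fst s) (snd s) y"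
        by (rule order_tendstoD(1)[rotated]) (intro tendsto_intros filterlim_ident)
      ultimately have "\<forall>\<^sub>F y in nhds z. \<not> 0 < ori x w' y"
        using hid by eventually_elim (auto simp: vis_above_iff)
      then have "\<forall>\<^sub>F h in at_right 0. \<not> 0 < ori x w' (z + h *\<^sub>R (fst s - x))"
        by (rule eventually_compose_filterlim) (rule tendsto_scale_at_right)
      moreover have "0 < ori x w' (z + h *\<^sub>R (fst s - x))" if "0 < h" for h
      proof -
        have "0 < ori x w' (fst s)" using snd_right(2)[OF s above] ori_ray[OF b(3)] ab a'
          by (simp add: zero_less_mult_iff)
        moreover have "ori x w' (z + h *\<^sub>R (fst s - x)) = h * ori x w' (fst s)"
          unfolding z_def by (simp add: ori_simps algebra_simps)
        ultimately show ?thesis using that by simp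
      qed
      ultimately have "\<forall>\<^sub>F h in at_right (0::real). \<not> 0 < h" by (auto elim: eventually_mono)
      then have "\<forall>\<^sub>F h in at_right (0::real). False"
        using eventually_at_right_less[of "0::real"] by eventually_elim blast
      then show False by simp
    qed
    then have q': "q' = q" using a'(3) b(3) by simp
    obtain d where d: "d \<le> 1" "?w k1 = x + d *\<^sub>R (w' - x)" using in_line sub by blast
    have "w' = ?w (1 / a - 1)"
    proof -
      have "q - x = a *\<^sub>R (w' - x)" using a'(3) q' by simp
      then show ?thesis using a'(1) unfolding wx by simp
    qed
    then have "1 / a - 1 \<in> K" using rse q' a' by (simp add: K_def)
    then have "1 / a - 1 \<le> k1" by (rule ub)
    moreover have "k1 \<le> 1 / a - 1"
    proof -
      have "(1 + k1) *\<^sub>R (a *\<^sub>R (w' - x)) = d *\<^sub>R (w' - x)" using d(2) a'(3) q' unfolding wx by simp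
      then have "(1 + k1) * a = d" using a'(4) by simp
      then have "(1 + k1) * a \<le> 1" using d(1) by simp
      then show ?thesis using a' by (simp add: field_simps)
    qed
    ultimately show "q' = q \<and> w' = ?w k1" using q' \<open>w' = ?w (1 / a - 1)\<close> by simp
  qed
  then show ?thesis by blast
qed

text \<open>Both edges start in \<open>q\<close> and lie on one ray, so one contains the other, and
  maximality decides which.\<close>

lemma active_extends:
  assumes "active_edge S s x q w" "right_side_edge S s x q u"
  shows "u \<in> closed_segment q w"
proof (rule ccontr)
  assume nu: "u \<notin> closed_segment q w"
  have rse: "right_side_edge S s x q w" using assms(1) by (simp add: active_edge_def)
  obtain k where k: "0 < k" "k < 1" "q = x + k *\<^sub>R (w - x)" "x \<noteq> w"
    using rse unfolding right_side_edge_iff in_open_iff by blast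
  obtain l where l: "0 < l" "l < 1" "q = x + l *\<^sub>R (u - x)" "x \<noteq> u"
    using assms(2) unfolding right_side_edge_iff in_open_iff by blast
  have w: "w = q + ((1 - k) / k) *\<^sub>R (q - x)"
  proof -
    have "q - x = k *\<^sub>R (w - x)" using k(3) by simp
    then have e: "((1 - k) / k) *\<^sub>R (q - x) = (1 - k) *\<^sub>R (w - x)" using k(1) by simp
    show ?thesis unfolding e by (subst k(3)) (simp add: algebra_simps)
  qed
  have u: "u = q + ((1 - l) / l) *\<^sub>R (q - x)"
  proof -
    have "q - x = l *\<^sub>R (u - x)" using l(3) by simp
    then have e: "((1 - l) / l) *\<^sub>R (q - x) = (1 - l) *\<^sub>R (u - x)" using l(1) by simp
    show ?thesis unfolding e by (subst l(3)) (simp add: algebra_simps)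
  qed
  define a b where "a = (1 - k) / k" and "b = (1 - l) / l"
  have ab: "0 < a" "0 < b" using k l by (auto simp: a_def b_def)
  show False
  proof (cases "b \<le> a")
    case True
    have "u = q + (b / a) *\<^sub>R (w - q)" unfolding w u using ab by (simp add: a_def[symmetric] b_def[symmetric])
    then show False using nu in_closedI[of "b / a" q w] True ab by simp
  next
    case False
    have "w = q + (a / b) *\<^sub>R (u - q)" unfolding w u using ab by (simp add: a_def[symmetric] b_def[symmetric])
    then have "w \<in> closed_segment q u" using in_closedI[of "a / b" q u] False ab by simp
    then have "closed_segment q w \<subseteq> closed_segment q u" by (simp add: closed_segment_subset)
    then have "u = w" using assms unfolding active_edge_def by blast
    then show False using nu by simp
  qed
qed

end

section \<open>The sweep\<close>

lemma open_between:
  assumes "a \<in> seg s" "b \<in> seg s"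
  shows "open_segment a b \<subseteq> open_segment (fst s) (snd s)"
  using assms by (simp add: subset_open_segment seg_def)

lemma open_in_seg: "x \<in> open_segment (fst s) (snd s) \<Longrightarrow> x \<in> seg s"
  by (simp add: seg_def open_segment_def)

lemma eventually_probe:
  fixes x0 :: pt
  assumes "\<forall>\<^sub>F y in nhds x0. y \<in> seg s \<longrightarrow> Q y" "x0 \<in> seg s" "c \<in> seg s" "c \<noteq> x0"
  shows "\<exists>y\<in>open_segment x0 c. Q y"
proof -
  have "\<forall>\<^sub>F h in at_right 0. x0 + h *\<^sub>R (c - x0) \<in> seg s \<longrightarrow> Q (x0 + h *\<^sub>R (c - x0))"
    using assms(1) by (rule eventually_compose_filterlim) (rule tendsto_scale_at_right)
  moreover have "\<forall>\<^sub>F h in at_right 0. h < (1::real)"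
    by (rule order_tendstoD(2)[OF tendsto_ident_at]) simp
  ultimately have "\<forall>\<^sub>F h in at_right 0. x0 + h *\<^sub>R (c - x0) \<in> open_segment x0 c \<and> Q (x0 + h *\<^sub>R (c - x0))"
    using eventually_at_right_less[of "0::real"]
  proof eventually_elim
    case (elim h)
    then have o: "x0 + h *\<^sub>R (c - x0) \<in> open_segment x0 c" using assms(4) by (intro in_openI) auto
    then show ?case using elim open_between[OF assms(2,3)] open_in_seg by blast
  qed
  then show ?thesis using eventually_happens'[OF trivial_limit_at_right_real] by blast
qed

lemma sorted_first_less:
  "sorted_wrt (\<lambda>x y. x $ 1 < y $ 1) (a # b # l) \<Longrightarrow> x \<in> set (a # b # l) \<Longrightarrow> x = a \<or> b $ 1 \<le> (x :: pt) $ 1"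
  by auto

text \<open>The conditions at the two ends record why the edge started and stopped there. Together
  with the absence of events inside, they make overlapping intervals of one \<open>q\<close>
  coincide.\<close>

definition sweep_interval :: "sgmt set \<Rightarrow> sgmt \<Rightarrow> pt \<Rightarrow> pt \<Rightarrow> pt \<Rightarrow> bool" where
  "sweep_interval S s q a b \<longleftrightarrow> a \<in> seg s \<and> b \<in> seg s \<and> a $ 1 < b $ 1 \<and>
     (\<forall>x\<in>open_segment a b. act S s x q \<and> \<not> evg_collinear S x q) \<and>
     (b = snd s \<or> evg_collinear S b q) \<and> (a = fst s \<or> evg_collinear S a q)"

text \<open>A nonempty suffix of the list of vertices on \<open>s\<close>; the last condition says
  that no vertex to the right of its head is skipped.\<close>

definition vertex_chain :: "sgmt set \<Rightarrow> sgmt \<Rightarrow> pt list \<Rightarrow> bool" where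
  "vertex_chain S s l \<longleftrightarrow> sorted_wrt (\<lambda>x y. x $ 1 < y $ 1) l \<and> set l \<subseteq> seg s \<and> l \<noteq> [] \<and>
     last l = snd s \<and> (\<forall>x\<in>vsp_vertices S \<inter> seg s. hd l $ 1 \<le> x $ 1 \<longrightarrow> x \<in> set l)"

text \<open>The loop invariant of the sweep when it has reached \<open>a\<close>.\<close>

definition start_inv :: "sgmt set \<Rightarrow> sgmt \<Rightarrow> (pt \<Rightarrow> pt) \<Rightarrow> pt \<Rightarrow> bool" where
  "start_inv S s st a \<longleftrightarrow> (\<forall>q. st q \<in> seg s \<and> st q $ 1 \<le> a $ 1 \<and>
     (\<forall>x\<in>seg s. st q $ 1 < x $ 1 \<and> x $ 1 \<le> a $ 1 \<longrightarrow> act S s x q \<and> \<not> evg_collinear S x q) \<and>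
     ((\<exists>c\<in>seg s. a $ 1 < c $ 1 \<and> (\<forall>x\<in>open_segment a c. act S s x q)) \<longrightarrow>
        st q = fst s \<or> evg_collinear S (st q) q))"

lemma evg_collinear_vertex: "evg_collinear S x q \<Longrightarrow> x \<in> vsp_vertices S"
  unfolding evg_collinear_def vsp_vertices_def by blast

context scene
begin

lemma seg_param: 
  assumes "s \<in> S" "x \<in> seg s"
  shows "x = fst s + ((x $ 1 - fst s $ 1) / (snd s $ 1 - fst s $ 1)) *\<^sub>R (snd s - fst s)"
proof -
  obtain k where k: "x = fst s + k *\<^sub>R (snd s - fst s)" using assms(2) unfolding seg_def in_closed_iff by blast
  then have "x $ 1 - fst s $ 1 = k * (snd s $ 1 - fst s $ 1)" by simp
  then have "(x $ 1 - fst s $ 1) / (snd s $ 1 - fst s $ 1) = k" using nonvert[OF assms(1)] by simp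
  then show ?thesis using k by simp
qed

lemma seg_eqI: "s \<in> S \<Longrightarrow> x \<in> seg s \<Longrightarrow> y \<in> seg s \<Longrightarrow> x $ 1 = y $ 1 \<Longrightarrow> x = y"
  using seg_param by metis

lemma seg_bounds: "s \<in> S \<Longrightarrow> x \<in> seg s \<Longrightarrow> fst s $ 1 \<le> x $ 1 \<and> x $ 1 \<le> snd s $ 1"
proof -
  assume s: "s \<in> S" "x \<in> seg s"
  obtain k where k: "0 \<le> k" "k \<le> 1" "x = fst s + k *\<^sub>R (snd s - fst s)"
    using s(2) unfolding seg_def in_closed_iff by blast
  define d where "d = snd s $ 1 - fst s $ 1"
  have "0 < d" using nonvert[OF s(1)] by (simp add: d_def)
  then have "0 \<le> k * d" "k * d \<le> d" using k by (simp_all add: mult_left_le_one_le)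
  moreover have "x $ 1 = fst s $ 1 + k * d" unfolding k(3) d_def by simp
  moreover have "snd s $ 1 = fst s $ 1 + d" by (simp add: d_def)
  ultimately show ?thesis by linarith
qed

lemma open_between_iff:
  assumes s: "s \<in> S" "a \<in> seg s" "b \<in> seg s" and ab: "a $ 1 < b $ 1"
  shows "x \<in> open_segment a b \<longleftrightarrow> x \<in> seg s \<and> a $ 1 < x $ 1 \<and> x $ 1 < b $ 1"
proof
  assume x: "x \<in> open_segment a b"
  then obtain k where k: "0 < k" "k < 1" "x = a + k *\<^sub>R (b - a)" by (rule in_openE)
  have "x $ 1 - a $ 1 = k * (b $ 1 - a $ 1)" unfolding k(3) by simp
  moreover have "0 < k * (b $ 1 - a $ 1)" "k * (b $ 1 - a $ 1) < 1 * (b $ 1 - a $ 1)"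
    using k ab by (auto intro: mult_strict_right_mono)
  ultimately show "x \<in> seg s \<and> a $ 1 < x $ 1 \<and> x $ 1 < b $ 1"
    using open_between[OF s(2,3)] x open_in_seg by fastforce
next
  assume x: "x \<in> seg s \<and> a $ 1 < x $ 1 \<and> x $ 1 < b $ 1"
  define k where "k = (x $ 1 - a $ 1) / (b $ 1 - a $ 1)"
  have k: "0 < k" "k < 1" using x ab by (auto simp: k_def)
  have "a \<noteq> b" using ab by auto
  then have o: "a + k *\<^sub>R (b - a) \<in> open_segment a b" using k by (rule in_openI)
  have "x = a + k *\<^sub>R (b - a)"
  proof (rule seg_eqI[OF s(1)])
    show "x \<in> seg s" using x by blast
    show "a + k *\<^sub>R (b - a) \<in> seg s" using o open_between[OF s(2,3)] open_in_seg by blast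
    show "x $ 1 = (a + k *\<^sub>R (b - a)) $ 1" using ab by (simp add: k_def)
  qed
  then show "x \<in> open_segment a b" using o by simp
qed

text \<open>Each way in which \<open>act\<close> may change at \<open>x0\<close> leaves an edge of
  the extended visibility graph there: another segment touches \<open>s\<close> in
  \<open>x0\<close>, a segment at \<open>q\<close> becomes collinear with \<open>x0\<close>, or
  \<open>q\<close> is hidden only tangentially. Without these, all conditions are open, and a
  transversal blocker keeps hiding \<open>q\<close> on both sides of \<open>x0\<close>.\<close>

lemma act_locally_constant:
  assumes s: "s \<in> S" "x0 \<in> open_segment (fst s) (snd s)" and no: "\<not> evg_collinear S x0 q"
  shows "\<forall>\<^sub>F y in nhds x0. y \<in> seg s \<longrightarrow> act S s y q = act S s x0 q"
proof (cases "q \<in> endpoints S \<and> 0 < ori (fst s) (snd s) q")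
  case False
  then show ?thesis by (auto simp: act_def)
next
  case True
  then have qe: "q \<in> endpoints S" and above: "0 < ori (fst s) (snd s) q" by auto
  have xs: "x0 \<in> seg s" using open_in_seg s(2) .
  have xq: "x0 \<noteq> q" using x_neq_q[OF s above] .
  show ?thesis
  proof (cases "act S s x0 q")
    case act: True
    have vis0: "visible S q x0" using act visible_sym by (auto simp: act_def)
    have "\<forall>\<^sub>F y in nhds x0. \<forall>t\<in>S. y \<in> seg s \<longrightarrow> seg t \<inter> open_segment q y = {}"
    proof (intro eventually_ball_finite finite_S ballI)
      fix t assume t: "t \<in> S"
      show "\<forall>\<^sub>F y in nhds x0. y \<in> seg s \<longrightarrow> seg t \<inter> open_segment q y = {}"
      proof (cases "seg t \<inter> closed_segment q x0 \<subseteq> {q}")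
        case True
        have "\<forall>\<^sub>F y in nhds x0. seg t \<inter> open_segment q y = {}"
          by (rule eventually_clear[OF True xq]) (rule filterlim_ident)
        then show ?thesis by eventually_elim simp
      next
        case False
        \<comment> \<open>The only segments not controlled by \<open>eventually_clear\<close> pass
          through \<open>x0\<close>: either \<open>s\<close> itself, which lies below the line of
          sight, or one that ends in \<open>x0\<close> and makes \<open>x0 q\<close> a visibility
          edge.\<close>
        then have x0t: "x0 \<in> seg t"
          using vis0 t unfolding visible_def obstacles_def open_segment_def by blast
        have "t = s"
        proof (rule ccontr)
          assume "t \<noteq> s"
          then have "x0 \<in> endpoints S"
            using touching_endpoint[OF s(1) t _ s(2) x0t] t by (auto simp: endpoints_def)
          then have "vg_edge S x0 q" using qe xq vis0 visible_sym by (auto simp: vg_edge_def)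
          then have "(x0, q) \<in> evg_edges S" by (simp add: evg_edges_def)
          then have "evg_collinear S x0 q" unfolding evg_collinear_def
            by (intro bexI[of _ "(x0, q)"]) (auto simp: insert_commute)
          then show False using no by blast
        qed
        show ?thesis
        proof (intro always_eventually allI impI)
          fix y assume y: "y \<in> seg s"
          show "seg t \<inter> open_segment q y = {}"
          proof (rule ccontr)
            assume "\<not> ?thesis"
            then obtain c where c: "c \<in> seg s" "c \<in> open_segment q y" using \<open>t = s\<close> by blast
            obtain k where k: "0 < k" "k < 1" "c = q + k *\<^sub>R (y - q)" using c(2) by (rule in_openE)
            have "ori (fst s) (snd s) c = (1 - k) * ori (fst s) (snd s) q"
              unfolding k(3) ori_line3 using y by simp
            then show False using c(1) k above by simp
          qed
        qed
      qed
    qed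
    moreover have "\<forall>\<^sub>F y in nhds x0. \<forall>t\<in>S. q \<in> seg t \<longrightarrow> (\<forall>z\<in>seg t. z \<noteq> q \<longrightarrow> 0 < ori y q z)"
    proof (intro eventually_ball_finite finite_S ballI)
      fix t assume t: "t \<in> S"
      show "\<forall>\<^sub>F y in nhds x0. q \<in> seg t \<longrightarrow> (\<forall>z\<in>seg t. z \<noteq> q \<longrightarrow> 0 < ori y q z)"
      proof (cases "q \<in> seg t")
        case qt: True
        define e where "e = (if q = fst t then snd t else fst t)"
        have q: "q = fst t \<or> q = snd t" using act_endpoint[OF act t qt] .
        have e: "e \<in> seg t" "e \<noteq> q" using q ends_neq[OF t] by (auto simp: e_def)
        have "0 < ori x0 q e" using act t qt e by (auto simp: act_def)
        then have "\<forall>\<^sub>F y in nhds x0. 0 < ori y q e"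
          by (rule order_tendstoD(1)[rotated]) (intro tendsto_intros filterlim_ident)
        then show ?thesis
        proof (rule eventually_mono, intro impI ballI)
          fix y z assume y: "0 < ori y q e" and z: "z \<in> seg t" "z \<noteq> q"
          have "closed_segment q e = seg t" using q closed_segment_commute by (auto simp: e_def seg_def)
          then have "z \<in> closed_segment q e" using z(1) by simp
          then obtain k where k: "0 \<le> k" "z = q + k *\<^sub>R (e - q)" unfolding in_closed_iff by blast
          have "k \<noteq> 0" using k z(2) by auto
          then show "0 < ori y q z" unfolding k(2) ori_line3 using k(1) y by simp
        qed
      qed simp
    qed
    ultimately show ?thesis
    proof eventually_elim
      case (elim y)
      show ?case
      proof
        assume "y \<in> seg s"
        then have "visible S q y" using elim(1) by (auto simp: visible_def obstacles_def)
        then have "act S s y q" unfolding act_def using qe above elim(2) visible_sym by blast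
        then show "act S s y q = act S s x0 q" using act by blast
      qed
    qed
  next
    case nact: False
    have "\<forall>\<^sub>F y in nhds x0. y \<in> seg s \<longrightarrow> \<not> act S s y q"
    proof (cases "visible S x0 q")
      case True
      then obtain t z where t: "t \<in> S" "q \<in> seg t" "z \<in> seg t" "z \<noteq> q" "\<not> 0 < ori x0 q z"
        using nact qe above unfolding act_def by blast
      then have "ori x0 q z < 0" using collinear_touch_evg[OF s above True t(1-4)] no by linarith
      then have "\<forall>\<^sub>F y in nhds x0. ori y q z < 0"
        by (rule order_tendstoD(2)[rotated]) (intro tendsto_intros filterlim_ident)
      then show ?thesis
      proof eventually_elim
        case (elim y)
        then have "\<not> act S s y q" using t(1-4) unfolding act_def by fastforce
        then show ?case by blast
      qed
    next
      case nv: False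
      obtain t z c where t: "t \<in> S" "z \<in> open_segment (fst t) (snd t)" "z \<in> open_segment x0 q"
        "c \<in> seg t" "ori x0 q c \<noteq> 0"
        using blocked_evg[OF s above qe nv] no by blast
      have zt: "z \<in> seg t" using open_in_seg t(2) .
      have "ori x0 q z = 0" using t(3) by (auto elim!: in_openE simp: ori_line3)
      \<comment> \<open>The blocker has ends on both sides of the line, so it hides every nearby
        point off the line; points of \<open>s\<close> other than \<open>x0\<close> are all off
        it.\<close>
      then have opp: "ori x0 q (fst t) * ori x0 q (snd t) < 0" using opposite_ends t(2,4,5) by blast
      have zo: "z \<in> open_segment q x0" using t(3) by (simp add: open_segment_commute)
      have 1: "\<forall>\<^sub>F y in nhds x0. 0 < ori q x0 (fst t) * ori q x0 y \<longrightarrow> \<not> visible S q y"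
        using hidden_side[OF t(1) zo zt seg_ends(1) filterlim_ident] .
      have 2: "\<forall>\<^sub>F y in nhds x0. 0 < ori q x0 (snd t) * ori q x0 y \<longrightarrow> \<not> visible S q y"
        using hidden_side[OF t(1) zo zt seg_ends(2) filterlim_ident] .
      show ?thesis using 1 2
      proof eventually_elim
        case (elim y)
        show ?case
        proof
          assume y: "y \<in> seg s"
          show "\<not> act S s y q"
          proof (cases "y = x0")
            case True then show ?thesis using nact by simp
          next
            case False
            then have "ori x0 q y \<noteq> 0" using on_line_s[OF s above y] by blast
            then have "0 < ori q x0 (fst t) * ori q x0 y \<or> 0 < ori q x0 (snd t) * ori q x0 y"
              using opp unfolding ori_swap(1)[of q x0]
              by (auto simp: zero_less_mult_iff mult_less_0_iff linorder_neq_iff)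
            then have "\<not> visible S q y" using elim by blast
            then show ?thesis using visible_sym by (auto simp: act_def)
          qed
        qed
      qed
    qed
    then show ?thesis by eventually_elim (use nact in blast)
  qed
qed

lemma act_constant:
  assumes s: "s \<in> S" "a \<in> seg s" "b \<in> seg s" and no: "\<And>x. x \<in> open_segment a b \<Longrightarrow> \<not> evg_collinear S x q"
    and xy: "x \<in> open_segment a b" "y \<in> open_segment a b"
  shows "act S s x q = act S s y q"
proof (rule connected_local_const[of "open_segment a b" x y "\<lambda>x. act S s x q"])
  show "connected (open_segment a b)" by (intro convex_connected convex_open_segment)
  show "\<forall>u\<in>open_segment a b. \<forall>\<^sub>F v in at u within open_segment a b. act S s u q = act S s v q"
  proof
    fix u assume u: "u \<in> open_segment a b"
    have sub: "open_segment a b \<subseteq> open_segment (fst s) (snd s)" using open_between s by blast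
    have "\<forall>\<^sub>F v in nhds u. v \<in> seg s \<longrightarrow> act S s v q = act S s u q"
      using act_locally_constant[OF s(1) _ no[OF u]] u sub by blast
    then show "\<forall>\<^sub>F v in at u within open_segment a b. act S s u q = act S s v q"
      unfolding eventually_at_filter by eventually_elim (use sub open_in_seg in blast)
  qed
qed (use xy in auto)

text \<open>Together with \<open>act_beyond\<close> this carries an active edge across a vertex that
  is an event for other lower endpoints but not for \<open>q\<close>.\<close>

lemma act_at_limit:
  assumes s: "s \<in> S" "x0 \<in> open_segment (fst s) (snd s)" and no: "\<not> evg_collinear S x0 q"
    and c: "c \<in> seg s" "c \<noteq> x0" and act: "\<And>x. x \<in> open_segment x0 c \<Longrightarrow> act S s x q"
  shows "act S s x0 q"
  using eventually_probe[OF act_locally_constant[OF s no] open_in_seg[OF s(2)] c] act by blast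

lemma act_beyond:
  assumes s: "s \<in> S" "x0 \<in> open_segment (fst s) (snd s)" and no: "\<not> evg_collinear S x0 q"
    and c: "c \<in> seg s" "c \<noteq> x0" and act: "act S s x0 q"
    and clear: "\<And>x. x \<in> open_segment x0 c \<Longrightarrow> \<not> evg_collinear S x q" and x: "x \<in> open_segment x0 c"
  shows "act S s x q"
proof -
  obtain y where y: "y \<in> open_segment x0 c" "act S s y q = act S s x0 q"
    using eventually_probe[OF act_locally_constant[OF s no] open_in_seg[OF s(2)] c] by blast
  then show ?thesis using act_constant[OF s(1) open_in_seg[OF s(2)] c(1) clear x y(1)] act by blast
qed

lemma act_iff_active:
  assumes "s \<in> S" "x \<in> open_segment (fst s) (snd s)" "\<not> evg_collinear S x q"
  shows "(\<exists>w. active_edge S s x q w) \<longleftrightarrow> act S s x q"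
  using active_imp_act act_imp_active assms by blast

end

lemma sweep_step:
  "sweep S s st (a # b # ps) =
     (\<lambda>q. swept_triangle S s q (st q) b) ` {q \<in> active_between S s a b. evg_collinear S b q \<or> ps = []} \<union>
     sweep S s (\<lambda>q. if q \<in> active_between S s a b \<and> \<not> (evg_collinear S b q \<or> ps = []) then st q else b) (b # ps)"
  unfolding sweep.simps Let_def by (intro arg_cong2[where f="(\<union>)"] refl arg_cong2[where f="sweep S s"] ext) auto

text \<open>Keys have to be distinct on \<open>A\<close> only. This suits first coordinates, which
  separate the points of a nonvertical segment but not those of the plane.\<close>

lemma (in linorder) sorted_key_list_of_set_props:
  assumes "inj_on f A" "finite A"
  shows "set (sorted_key_list_of_set f A) = A" "sorted_wrt (<) (map f (sorted_key_list_of_set f A))"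
proof -
  interpret folding_insort_key "(\<le>)" "(<)" A f by unfold_locales (rule assms)
  show "set (sorted_key_list_of_set f A) = A" "sorted_wrt (<) (map f (sorted_key_list_of_set f A))"
    using assms by simp_all
qed

section \<open>Finiteness of the vertices, soundness and completeness of the sweep\<close>

context scene
begin

lemma finite_endpoints: "finite (endpoints S)"
  using finite_S by (simp add: endpoints_def)

text \<open>A directed edge has at most one extension, since the prolonging ray has at most one
  first obstacle.\<close>

lemma finite_evg: "finite (evg_edges S)"
proof -
  let ?E = "endpoints S"
  define W where "W u v = {w. \<exists>k>0. w = v + k *\<^sub>R (v - u) \<and> w \<in> obstacles S \<and> visible S v w}" for u v
  have W: "finite (W u v)" if uv: "u \<noteq> v" for u v
  proof -
    have "w = w'" if "w \<in> W u v" "w' \<in> W u v" for w w'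
    proof -
      \<comment> \<open>Of two obstacles on the ray, the nearer one hides the farther one from
        \<open>v\<close>.\<close>
      have *: False if k: "0 < k" "k < l" "v + k *\<^sub>R (v - u) \<in> obstacles S" "visible S v (v + l *\<^sub>R (v - u))" for k l
      proof -
        have "v + k *\<^sub>R (v - u) = v + (k / l) *\<^sub>R ((v + l *\<^sub>R (v - u)) - v)" using k by simp
        moreover have "v \<noteq> v + l *\<^sub>R (v - u)" using k uv by simp
        ultimately have "v + k *\<^sub>R (v - u) \<in> open_segment v (v + l *\<^sub>R (v - u))"
          using in_openI[of v "v + l *\<^sub>R (v - u)" "k / l"] k by simp
        then show False using k by (auto simp: visible_def)
      qed
      obtain k where k: "0 < k" "w = v + k *\<^sub>R (v - u)" "w \<in> obstacles S" "visible S v w"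
        using \<open>w \<in> W u v\<close> unfolding W_def by (elim CollectE exE conjE)
      obtain l where l: "0 < l" "w' = v + l *\<^sub>R (v - u)" "w' \<in> obstacles S" "visible S v w'"
        using \<open>w' \<in> W u v\<close> unfolding W_def by (elim CollectE exE conjE)
      have "\<not> k < l" using *[OF k(1), of l] k(3) l(4) unfolding k(2) l(2) by blast
      moreover have "\<not> l < k" using *[OF l(1), of k] l(3) k(4) unfolding k(2) l(2) by blast
      ultimately have "k = l" by linarith
      then show ?thesis using k(2) l(2) by simp
    qed
    then show ?thesis
      by (cases "W u v = {}") (simp, metis finite.emptyI finite.insertI finite_subset ex_in_conv singletonI subsetI)
  qed
  have "evg_edges S \<subseteq> ?E \<times> ?E \<union> (\<Union>p\<in>?E \<times> ?E. if fst p = snd p then {} else {snd p} \<times> W (fst p) (snd p))"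
  proof
    fix e assume "e \<in> evg_edges S"
    then obtain v w where e: "e = (v, w)" "vg_edge S v w \<or> extension_edge S v w" by (auto simp: evg_edges_def)
    from e(2) show "e \<in> ?E \<times> ?E \<union> (\<Union>p\<in>?E \<times> ?E. if fst p = snd p then {} else {snd p} \<times> W (fst p) (snd p))"
    proof
      assume "vg_edge S v w" then show ?thesis by (simp add: e(1) vg_edge_def)
    next
      assume "extension_edge S v w"
      then obtain u k where u: "vg_edge S u v" "0 < k" "w = v + k *\<^sub>R (v - u)" "w \<in> obstacles S" "visible S v w"
        unfolding extension_edge_def by blast
      then have "w \<in> W u v" unfolding W_def by blast
      moreover have "u \<noteq> v" "(u, v) \<in> ?E \<times> ?E" using u(1) by (auto simp: vg_edge_def)
      ultimately show ?thesis unfolding e(1) by (intro UnI2 UN_I[of "(u, v)"]) auto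
    qed
  qed
  moreover have "finite (?E \<times> ?E \<union> (\<Union>p\<in>?E \<times> ?E. if fst p = snd p then {} else {snd p} \<times> W (fst p) (snd p)))"
    using finite_endpoints W by (intro finite_UnI finite_UN_I finite_cartesian_product) auto
  ultimately show ?thesis by (rule finite_subset)
qed

text \<open>A pair of edges contributes at most one vertex, because only intersections in a single
  point count.\<close>

lemma finite_vsp: "finite (vsp_vertices S)"
proof -
  let ?A = "\<lambda>e. closed_segment (fst e) (snd e)"
  have "finite {x. ?A e \<inter> ?A e' = {x}}" for e e' :: "pt \<times> pt"
  proof (cases "\<exists>x. ?A e \<inter> ?A e' = {x}")
    case True
    then obtain x where "?A e \<inter> ?A e' = {x}" by blast
    then have "{x. ?A e \<inter> ?A e' = {x}} = {x}" by auto
    then show ?thesis by simp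
  qed simp
  then have "finite (\<Union>e\<in>evg_edges S. \<Union>e'\<in>evg_edges S. {x. ?A e \<inter> ?A e' = {x}})"
    using finite_evg by blast
  moreover have "{x. \<exists>e\<in>evg_edges S. \<exists>e'\<in>evg_edges S. ?A e \<inter> ?A e' = {x}} =
     (\<Union>e\<in>evg_edges S. \<Union>e'\<in>evg_edges S. {x. ?A e \<inter> ?A e' = {x}})" by blast
  ultimately show ?thesis unfolding vsp_vertices_def using finite_evg by simp
qed

lemma segment_evg: "s \<in> S \<Longrightarrow> s \<in> evg_edges S"
proof -
  assume s: "s \<in> S"
  then have "fst s \<in> endpoints S" "snd s \<in> endpoints S" by (simp_all add: endpoints_def)
  then have "vg_edge S (fst s) (snd s)" using s ends_neq by (simp add: vg_edge_def)
  then show ?thesis by (auto simp: evg_edges_def)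
qed

lemma endpoint_vertex: "q \<in> endpoints S \<Longrightarrow> q \<in> vsp_vertices S"
  using segment_evg unfolding endpoints_def vsp_vertices_def by blast

lemma vertices_on:
  assumes s: "s \<in> S"
  shows "set (vertices_on S s) = vsp_vertices S \<inter> seg s"
    and "vertex_chain S s (vertices_on S s)" and "hd (vertices_on S s) = fst s"
proof -
  let ?V = "vsp_vertices S \<inter> seg s"
  have inj: "inj_on (\<lambda>x. x $ 1) ?V" by (auto intro!: inj_onI dest: seg_eqI[OF s])
  have fin: "finite ?V" using finite_vsp by simp
  show set: "set (vertices_on S s) = ?V"
    unfolding vertices_on_def using inj fin by (rule sorted_key_list_of_set_props)
  have "sorted_wrt (<) (map (\<lambda>x. x $ 1) (vertices_on S s))"
    unfolding vertices_on_def using inj fin by (rule sorted_key_list_of_set_props)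
  then have sorted: "sorted_wrt (\<lambda>x y. x $ 1 < y $ 1) (vertices_on S s)" by (simp add: sorted_wrt_map)
  have ends: "fst s \<in> ?V" "snd s \<in> ?V"
    using endpoint_vertex s by (auto simp: endpoints_def)
  then have ne: "vertices_on S s \<noteq> []" using set by auto
  have hd: "hd (vertices_on S s) \<in> ?V" "last (vertices_on S s) \<in> ?V"
    using ne set by (metis hd_in_set, metis last_in_set)
  have "hd (vertices_on S s) $ 1 \<le> fst s $ 1"
    using sorted ne ends(1)[folded set] by (cases "vertices_on S s") (auto simp: less_imp_le)
  then show h: "hd (vertices_on S s) = fst s"
    using seg_bounds[OF s] hd(1) seg_eqI[OF s, of "hd (vertices_on S s)" "fst s"] by force
  have "snd s $ 1 \<le> last (vertices_on S s) $ 1"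
  proof -
    obtain ys y where y: "vertices_on S s = ys @ [y]" using ne by (metis rev_exhaust)
    then show ?thesis using sorted ends(2)[folded set] by (auto simp: sorted_wrt_append less_imp_le)
  qed
  then have l: "last (vertices_on S s) = snd s"
    using seg_bounds[OF s] hd(2) seg_eqI[OF s, of "last (vertices_on S s)" "snd s"] by force
  show "vertex_chain S s (vertices_on S s)"
    unfolding vertex_chain_def using sorted set ne l by auto
qed

lemma vertex_chain_Cons:
  assumes "s \<in> S" "vertex_chain S s (a # b # ps)"
  shows "a \<in> seg s" "b \<in> seg s" "a $ 1 < b $ 1" "vertex_chain S s (b # ps)"
    and "\<And>x q. x \<in> open_segment a b \<Longrightarrow> \<not> evg_collinear S x q"
    and "ps = [] \<longleftrightarrow> b = snd s"
    and "ps \<noteq> [] \<Longrightarrow> b \<in> open_segment (fst s) (snd s)"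
proof -
  show ab: "a \<in> seg s" "b \<in> seg s" "a $ 1 < b $ 1" using assms(2) by (auto simp: vertex_chain_def)
  show "vertex_chain S s (b # ps)"
    unfolding vertex_chain_def
  proof (intro conjI ballI impI)
    fix x assume x: "x \<in> vsp_vertices S \<inter> seg s" "hd (b # ps) $ 1 \<le> x $ 1"
    then have "x \<in> set (a # b # ps)" using assms(2) ab(3) unfolding vertex_chain_def by auto
    moreover have "x \<noteq> a" using x ab(3) by auto
    ultimately show "x \<in> set (b # ps)" by simp
  qed (use assms(2) in \<open>auto simp: vertex_chain_def\<close>)
  show "\<not> evg_collinear S x q" if "x \<in> open_segment a b" for x q
  proof
    assume "evg_collinear S x q"
    then have "x \<in> vsp_vertices S" by (rule evg_collinear_vertex)
    moreover have x: "x \<in> seg s" "a $ 1 < x $ 1" "x $ 1 < b $ 1"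
      using that open_between_iff[OF assms(1) ab] by auto
    ultimately have "x \<in> set (a # b # ps)" using assms(2) by (auto simp: vertex_chain_def)
    then have "x = a \<or> b $ 1 \<le> x $ 1"
      using sorted_first_less assms(2) unfolding vertex_chain_def by blast
    then show False using x by auto
  qed
  have last: "last (b # ps) = snd s" using assms(2) by (simp add: vertex_chain_def)
  have lt: "b $ 1 < snd s $ 1" if "ps \<noteq> []"
  proof -
    have "snd s \<in> set ps" using last that by (metis last.simps last_in_set)
    then show ?thesis using assms(2) by (auto simp: vertex_chain_def)
  qed
  then show "ps = [] \<longleftrightarrow> b = snd s" using last by auto
  show "b \<in> open_segment (fst s) (snd s)" if "ps \<noteq> []"
    using open_between_iff[OF assms(1) seg_ends nonvert[OF assms(1)]] ab lt[OF that]
      seg_bounds[OF assms(1) ab(1)] by auto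
qed

text \<open>Between consecutive vertices there is no event, so \<open>act\<close> is constant there:
  being active somewhere and being active everywhere coincide.\<close>

lemma active_between_iff:
  assumes "s \<in> S" "vertex_chain S s (a # b # ps)"
  shows "q \<in> active_between S s a b \<longleftrightarrow> (\<forall>x\<in>open_segment a b. act S s x q)"
    and "q \<in> active_between S s a b \<longleftrightarrow> (\<exists>x\<in>open_segment a b. act S s x q)"
proof -
  note vc = vertex_chain_Cons[OF assms]
  have sub: "open_segment a b \<subseteq> open_segment (fst s) (snd s)" using open_between vc by blast
  show 1: "q \<in> active_between S s a b \<longleftrightarrow> (\<forall>x\<in>open_segment a b. act S s x q)"
    unfolding active_between_def using act_iff_active[OF assms(1)] vc(5) sub by blast
  have "a \<noteq> b" using vc(3) by auto
  then have "open_segment a b \<noteq> {}" by simp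
  then show "q \<in> active_between S s a b \<longleftrightarrow> (\<exists>x\<in>open_segment a b. act S s x q)"
    unfolding 1 using act_constant[OF assms(1) vc(1,2,5)] by blast
qed

text \<open>Induction over the remaining vertices with the invariant \<open>start_inv\<close>. A
  start that is kept extends the interval through a vertex without event; a start that is reset to
  the current vertex is an event if the edge is active afterwards.\<close>

lemma sweep_sound:
  assumes s: "s \<in> S"
  shows "vertex_chain S s (a # ps) \<Longrightarrow> start_inv S s st a \<Longrightarrow> T \<in> sweep S s st (a # ps) \<Longrightarrow>
    \<exists>q c b. sweep_interval S s q c b \<and> T = swept_triangle S s q c b"
proof (induction ps arbitrary: a st)
  case Nil
  then show ?case by simp
next
  case (Cons b ps)
  note vc = vertex_chain_Cons[OF s Cons.prems(1)]
  note ab_iff = active_between_iff[OF s Cons.prems(1)]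
  note inv = Cons.prems(2)[unfolded start_inv_def, rule_format]
  have extend: "act S s x q \<and> \<not> evg_collinear S x q"
    if "q \<in> active_between S s a b" "x \<in> seg s" "st q $ 1 < x $ 1" "x $ 1 < b $ 1" for q x
  proof (cases "x $ 1 \<le> a $ 1")
    case True
    then show ?thesis using inv[of q] that by blast
  next
    case False
    then have "x \<in> open_segment a b" using that open_between_iff[OF s vc(1-3)] by auto
    then show ?thesis using ab_iff(1) that(1) vc(5) by blast
  qed
  define fin where "fin q \<longleftrightarrow> evg_collinear S b q \<or> ps = []" for q
  define st' where "st' q = (if q \<in> active_between S s a b \<and> \<not> fin q then st q else b)" for q
  consider (new) q where "q \<in> active_between S s a b" "fin q" "T = swept_triangle S s q (st q) b"
    | (later) "T \<in> sweep S s st' (b # ps)"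
    using Cons.prems(3) unfolding sweep_step fin_def st'_def by blast
  then show ?case
  proof cases
    case new
    have less: "st q $ 1 < b $ 1" using inv[of q] vc(3) by linarith
    have "sweep_interval S s q (st q) b" unfolding sweep_interval_def
    proof (intro conjI ballI)
      show "st q \<in> seg s" using inv[of q] by blast
      fix x assume "x \<in> open_segment (st q) b"
      then have "x \<in> seg s \<and> st q $ 1 < x $ 1 \<and> x $ 1 < b $ 1"
        using open_between_iff[OF s _ vc(2) less] inv[of q] by blast
      then show "act S s x q" "\<not> evg_collinear S x q" using extend new(1) by blast+
    next
      show "b = snd s \<or> evg_collinear S b q" using new(2) vc(6) by (auto simp: fin_def)
      have "\<exists>c\<in>seg s. a $ 1 < c $ 1 \<and> (\<forall>x\<in>open_segment a c. act S s x q)"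
        using new(1) ab_iff(1) vc by blast
      then show "st q = fst s \<or> evg_collinear S (st q) q" using inv[of q] by blast
    qed (use less vc in auto)
    then show ?thesis using new(3) by blast
  next
    case later
    have "start_inv S s st' b" unfolding start_inv_def
    proof (intro allI conjI)
      fix q
      show "st' q \<in> seg s" using inv[of q] vc by (simp add: st'_def)
      show "st' q $ 1 \<le> b $ 1" using inv[of q] vc by (auto simp: st'_def)
      show "\<forall>x\<in>seg s. st' q $ 1 < x $ 1 \<and> x $ 1 \<le> b $ 1 \<longrightarrow> act S s x q \<and> \<not> evg_collinear S x q"
      proof (intro ballI impI)
        fix x assume x: "x \<in> seg s" "st' q $ 1 < x $ 1 \<and> x $ 1 \<le> b $ 1"
        then have q: "q \<in> active_between S s a b" "\<not> fin q" "st' q = st q"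
          by (auto simp: st'_def split: if_splits)
        show "act S s x q \<and> \<not> evg_collinear S x q"
        proof (cases "x = b")
          case False
          then have "x $ 1 < b $ 1" using x seg_eqI[OF s _ vc(2)] by force
          then show ?thesis using extend q x by auto
        next
          case True
          have bo: "b \<in> open_segment (fst s) (snd s)" "\<not> evg_collinear S b q"
            using q(2) vc(7) by (auto simp: fin_def)
          have "a \<noteq> b" using vc(3) by auto
          then have "act S s b q" using act_at_limit[OF s bo vc(1)] ab_iff(1) q(1)
            by (simp add: open_segment_commute)
          then show ?thesis using True bo by simp
        qed
      qed
      \<comment> \<open>An edge that is active just after \<open>b\<close> without an event at
        \<open>b\<close> was already active before \<open>b\<close>, so its start has been kept and
        the old invariant applies.\<close>
      show "(\<exists>c\<in>seg s. b $ 1 < c $ 1 \<and> (\<forall>x\<in>open_segment b c. act S s x q)) \<longrightarrow>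
        st' q = fst s \<or> evg_collinear S (st' q) q"
      proof
        assume "\<exists>c\<in>seg s. b $ 1 < c $ 1 \<and> (\<forall>x\<in>open_segment b c. act S s x q)"
        then obtain c where c: "c \<in> seg s" "b $ 1 < c $ 1" "\<forall>x\<in>open_segment b c. act S s x q" by blast
        have "ps \<noteq> []" using c seg_bounds[OF s c(1)] vc(6) by auto
        show "st' q = fst s \<or> evg_collinear S (st' q) q"
        proof (cases "evg_collinear S b q")
          case True
          then show ?thesis by (simp add: st'_def fin_def)
        next
          case no: False
          have bo: "b \<in> open_segment (fst s) (snd s)" using \<open>ps \<noteq> []\<close> vc(7) by blast
          have "c \<noteq> b" using c(2) by auto
          then have "act S s b q" using act_at_limit[OF s bo no c(1)] c(3) by blast
          moreover have "a \<noteq> b" using vc(3) by auto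
          ultimately have all: "act S s x q" if "x \<in> open_segment b a" for x
            using act_beyond[OF s bo no vc(1) _ _ _ that] vc(5) open_segment_commute[of a b] by blast
          then have act: "q \<in> active_between S s a b" using ab_iff(1) open_segment_commute[of a b] by blast
          then have "st' q = st q" using no \<open>ps \<noteq> []\<close> by (simp add: st'_def fin_def)
          moreover have "\<exists>c\<in>seg s. a $ 1 < c $ 1 \<and> (\<forall>x\<in>open_segment a c. act S s x q)"
            using act ab_iff(1) vc by blast
          ultimately show ?thesis using inv[of q] by auto
        qed
      qed
    qed
    then show ?thesis using Cons.IH vc(4) later by blast
  qed
qed

text \<open>An edge that is active now is followed to its next event or to the end of
  \<open>s\<close>. Its start is the same at every vertex passed on the way, so the triangle
  produced there uses the present \<open>st q\<close>.\<close>

lemma sweep_complete_start: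
  assumes s: "s \<in> S"
  shows "vertex_chain S s (a # b # ps) \<Longrightarrow> q \<in> active_between S s a b \<Longrightarrow>
    \<exists>b'\<in>seg s. swept_triangle S s q (st q) b' \<in> sweep S s st (a # b # ps) \<and> b $ 1 \<le> b' $ 1"
proof (induction ps arbitrary: a b st)
  case Nil
  then show ?case using vertex_chain_Cons(2)[OF s Nil.prems(1)]
    by (intro bexI[of _ b]) (auto simp: sweep_step)
next
  case (Cons c ps)
  note vc = vertex_chain_Cons[OF s Cons.prems(1)]
  note vc' = vertex_chain_Cons[OF s vc(4)]
  show ?case
  proof (cases "evg_collinear S b q")
    case True
    then have "swept_triangle S s q (st q) b \<in> sweep S s st (a # b # c # ps)"
      using Cons.prems(2) unfolding sweep_step by blast
    then show ?thesis using vc(2) by blast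
  next
    case False
    have bo: "b \<in> open_segment (fst s) (snd s)" using vc(7) by simp
    have "a \<noteq> b" "c \<noteq> b" using vc(3) vc'(3) by auto
    then have "act S s b q" using act_at_limit[OF s bo False vc(1)]
      active_between_iff(1)[OF s Cons.prems(1)] Cons.prems(2) by (simp add: open_segment_commute)
    then have "\<forall>x\<in>open_segment b c. act S s x q"
      using act_beyond[OF s bo False vc'(2) \<open>c \<noteq> b\<close>] vc'(5) by blast
    then have "q \<in> active_between S s b c" using active_between_iff(1)[OF s vc(4)] by blast
    define st' where
      "st' = (\<lambda>q. if q \<in> active_between S s a b \<and> \<not> (evg_collinear S b q \<or> c # ps = []) then st q else b)"
    obtain b' where b': "b' \<in> seg s" "c $ 1 \<le> b' $ 1"
      "swept_triangle S s q (st' q) b' \<in> sweep S s st' (b # c # ps)"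
      using Cons.IH[OF vc(4) \<open>q \<in> active_between S s b c\<close>, of st'] by blast
    moreover have "st' q = st q" using Cons.prems(2) False by (simp add: st'_def)
    ultimately have "swept_triangle S s q (st q) b' \<in> sweep S s st (a # b # c # ps)"
      unfolding sweep_step[of S s st a b] st'_def[symmetric] by simp
    then show ?thesis using b' vc'(3) by (intro bexI[of _ b']) auto
  qed
qed

text \<open>Vertices up to \<open>x0\<close> are skipped, with no information on the starts except
  that they are not to the right of the current vertex. The step that passes \<open>x0\<close> finds
  the edge active and follows it.\<close>

lemma sweep_complete:
  assumes s: "s \<in> S" and x0: "x0 \<in> seg s" and c: "c \<in> seg s" "x0 $ 1 < c $ 1"
    and act: "\<And>x. x \<in> open_segment x0 c \<Longrightarrow> act S s x q"
  shows "vertex_chain S s (a # ps) \<Longrightarrow> (\<forall>q. st q \<in> seg s \<and> st q $ 1 \<le> a $ 1) \<Longrightarrow> a $ 1 \<le> x0 $ 1 \<Longrightarrow>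
    \<exists>d b. d \<in> seg s \<and> b \<in> seg s \<and> swept_triangle S s q d b \<in> sweep S s st (a # ps) \<and> d $ 1 \<le> x0 $ 1 \<and> x0 $ 1 < b $ 1"
proof (induction ps arbitrary: a st)
  case Nil
  then have "a = snd s" by (simp add: vertex_chain_def)
  then show ?case using Nil.prems(3) seg_bounds[OF s c(1)] c(2) by auto
next
  case (Cons b ps)
  note vc = vertex_chain_Cons[OF s Cons.prems(1)]
  show ?case
  proof (cases "x0 $ 1 < b $ 1")
    case True
    \<comment> \<open>The earlier of \<open>b\<close> and \<open>c\<close>, which yields an apex
      both in the current step and in the range where the edge is known to be active.\<close>
    define m where "m = (if b $ 1 \<le> c $ 1 then b else c)"
    have m: "m \<in> seg s" "x0 $ 1 < m $ 1" "m $ 1 \<le> b $ 1" "m $ 1 \<le> c $ 1" using True c vc by (auto simp: m_def)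
    then have "x0 \<noteq> m" by auto
    then obtain x where "x \<in> open_segment x0 m" by (metis all_not_in_conv open_segment_eq_empty)
    then have x: "x \<in> seg s" "x0 $ 1 < x $ 1" "x $ 1 < m $ 1" using open_between_iff[OF s x0 m(1,2)] by auto
    have "x \<in> open_segment x0 c" using x m open_between_iff[OF s x0 c] by auto
    then have "act S s x q" using act by blast
    moreover have "x \<in> open_segment a b" using x m Cons.prems(3) open_between_iff[OF s vc(1-3)] by auto
    ultimately have "q \<in> active_between S s a b" using active_between_iff(2)[OF s Cons.prems(1)] by blast
    then obtain b' where b': "b' \<in> seg s" "swept_triangle S s q (st q) b' \<in> sweep S s st (a # b # ps)" "b $ 1 \<le> b' $ 1"
      using sweep_complete_start[OF s Cons.prems(1)] by blast
    have "st q \<in> seg s" "st q $ 1 \<le> x0 $ 1" using Cons.prems(2,3) order_trans by blast+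
    then show ?thesis using b' True by (intro exI[of _ "st q"] exI[of _ b']) simp
  next
    case False
    let ?st = "\<lambda>q. if q \<in> active_between S s a b \<and> \<not> (evg_collinear S b q \<or> ps = []) then st q else b"
    have le: "st r $ 1 \<le> b $ 1" for r using Cons.prems(2) vc(3) by (meson less_imp_le order_trans)
    have "\<forall>q. ?st q \<in> seg s \<and> ?st q $ 1 \<le> b $ 1" using Cons.prems(2) vc(2) le by simp
    moreover have "b $ 1 \<le> x0 $ 1" using False by simp
    ultimately obtain d b' where "d \<in> seg s" "b' \<in> seg s" "swept_triangle S s q d b' \<in> sweep S s ?st (b # ps)"
      "d $ 1 \<le> x0 $ 1" "x0 $ 1 < b' $ 1"
      using Cons.IH[OF vc(4), of ?st] by blast
    then show ?thesis unfolding sweep_step by (intro exI[of _ d] exI[of _ b']) simp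
  qed
qed

lemma sweep_vertices_sound:
  assumes s: "s \<in> S" and T: "T \<in> sweep S s (\<lambda>_. fst s) (vertices_on S s)"
  obtains q a b where "sweep_interval S s q a b" "T = swept_triangle S s q a b"
proof -
  obtain ps where v: "vertices_on S s = fst s # ps"
    using vertices_on[OF s] by (metis list.collapse vertex_chain_def)
  have "start_inv S s (\<lambda>_. fst s) (fst s)" by (auto simp: start_inv_def)
  then show ?thesis using sweep_sound[OF s, of "fst s" ps] vertices_on(2)[OF s] T that unfolding v by blast
qed

lemma sweep_vertices_complete:
  assumes s: "s \<in> S" and x0: "x0 \<in> seg s" and c: "c \<in> seg s" "x0 $ 1 < c $ 1"
    and act: "\<And>x. x \<in> open_segment x0 c \<Longrightarrow> act S s x q"
  obtains d b where "d \<in> seg s" "b \<in> seg s" "d $ 1 \<le> x0 $ 1" "x0 $ 1 < b $ 1"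
    "swept_triangle S s q d b \<in> sweep S s (\<lambda>_. fst s) (vertices_on S s)"
proof -
  obtain ps where v: "vertices_on S s = fst s # ps"
    using vertices_on[OF s] by (metis list.collapse vertex_chain_def)
  show ?thesis using sweep_complete[OF assms, of "fst s" ps "\<lambda>_. fst s"] vertices_on(2)[OF s] that
    seg_bounds[OF s x0] unfolding v by auto
qed

text \<open>An end of one interval strictly inside the other would be an event there or an end of
  \<open>s\<close>; the first is excluded by definition, the second because intervals stay in
  \<open>s\<close>.\<close>

lemma sweep_interval_unique:
  assumes s: "s \<in> S" and 1: "sweep_interval S s q a b" and 2: "sweep_interval S s q a' b'"
    and x: "x \<in> open_segment a b" "x \<in> open_segment a' b'"
  shows "a = a'" "b = b'"
proof -
  note i1 = 1[unfolded sweep_interval_def] and i2 = 2[unfolded sweep_interval_def]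
  have ob: "y \<in> open_segment a b \<longleftrightarrow> y \<in> seg s \<and> a $ 1 < y $ 1 \<and> y $ 1 < b $ 1" for y
    using open_between_iff[OF s, of a b] i1 by blast
  have ob': "y \<in> open_segment a' b' \<longleftrightarrow> y \<in> seg s \<and> a' $ 1 < y $ 1 \<and> y $ 1 < b' $ 1" for y
    using open_between_iff[OF s, of a' b'] i2 by blast
  have x': "a $ 1 < x $ 1" "x $ 1 < b $ 1" "a' $ 1 < x $ 1" "x $ 1 < b' $ 1" using x ob ob' by auto
  have "\<not> a $ 1 < a' $ 1"
  proof
    assume "a $ 1 < a' $ 1"
    then have "a' \<in> open_segment a b" using ob i2 x' by auto
    then have "a' = fst s" using i1 i2 by blast
    then show False using \<open>a $ 1 < a' $ 1\<close> seg_bounds[OF s, of a] i1 by auto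
  qed
  moreover have "\<not> a' $ 1 < a $ 1"
  proof
    assume "a' $ 1 < a $ 1"
    then have "a \<in> open_segment a' b'" using ob' i1 x' by auto
    then have "a = fst s" using i1 i2 by blast
    then show False using \<open>a' $ 1 < a $ 1\<close> seg_bounds[OF s, of a'] i2 by auto
  qed
  ultimately show "a = a'" using seg_eqI[OF s, of a a'] i1 i2 by force
  have "\<not> b $ 1 < b' $ 1"
  proof
    assume "b $ 1 < b' $ 1"
    then have "b \<in> open_segment a' b'" using ob' i1 x' by auto
    then have "b = snd s" using i1 i2 by blast
    then show False using \<open>b $ 1 < b' $ 1\<close> seg_bounds[OF s, of b'] i2 by auto
  qed
  moreover have "\<not> b' $ 1 < b $ 1"
  proof
    assume "b' $ 1 < b $ 1"
    then have "b' \<in> open_segment a b" using ob i2 x' by auto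
    then have "b' = snd s" using i1 i2 by blast
    then show False using \<open>b' $ 1 < b $ 1\<close> seg_bounds[OF s, of b] i1 by auto
  qed
  ultimately show "b = b'" using seg_eqI[OF s, of b b'] i1 i2 by force
qed

end

section \<open>Fans\<close>

text \<open>From an interior point one can still move a little towards the boundary line, so the
  value at that point was strictly positive.\<close>

lemma halfplane_interior:
  assumes "T \<subseteq> {y. 0 \<le> ori u v y}" "u \<noteq> v" "p \<in> interior T"
  shows "0 < ori u v p"
proof -
  \<comment> \<open>The clockwise normal of \<open>v - u\<close>; moving along it decreases
    \<open>ori u v\<close>.\<close>
  define n :: pt where "n = vector [(v - u) $ 2, - ((v - u) $ 1)]"
  have "cross (v - u) n = - ((v - u) $ 1 * (v - u) $ 1 + (v - u) $ 2 * (v - u) $ 2)"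
    by (simp add: cross_def n_def algebra_simps)
  moreover have "(v - u) $ 1 \<noteq> 0 \<or> (v - u) $ 2 \<noteq> 0" using assms(2) by (auto simp: vec_eq_iff forall_2)
  then have "0 < (v - u) $ 1 * (v - u) $ 1 + (v - u) $ 2 * (v - u) $ 2"
    using sum_squares_gt_zero_iff by blast
  ultimately have neg: "cross (v - u) n < 0" by linarith
  have "\<forall>\<^sub>F y in nhds p. y \<in> interior T" using assms(3) by (intro eventually_nhds_in_open) auto
  then have "\<forall>\<^sub>F h in at_right 0. p + h *\<^sub>R n \<in> interior T"
    by (rule eventually_compose_filterlim) (rule tendsto_scale_at_right)
  then have "\<forall>\<^sub>F h in at_right (0::real). 0 < h \<and> p + h *\<^sub>R n \<in> interior T"
    using eventually_at_right_less[of "0::real"] by eventually_elim blast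
  then obtain h where h: "0 < h" "p + h *\<^sub>R n \<in> interior T"
    using eventually_happens'[OF trivial_limit_at_right_real] by blast
  then have "0 \<le> ori u v (p + h *\<^sub>R n)" using assms(1) interior_subset by blast
  then have "0 \<le> ori u v p + h * cross (v - u) n" by (simp add: ori_cross_dir)
  moreover have "h * cross (v - u) n < 0" using h neg by (simp add: mult_pos_neg)
  ultimately show ?thesis by linarith
qed

text \<open>The triangles are known only as parts of closures. This turns "interior to the closure
  of \<open>V\<close>" into an actual member of \<open>V\<close> near \<open>p\<close>, strictly on
  the side of \<open>e\<close>.\<close>

lemma closure_side:
  assumes p: "p \<in> interior (closure V)" and e: "ori a p e \<noteq> 0" and R: "\<forall>\<^sub>F y in nhds p. R y"
  shows "\<exists>v\<in>V. 0 < ori a p e * ori a p v \<and> R v"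
proof -
  obtain W where W: "open W" "p \<in> W" "\<And>y. y \<in> W \<Longrightarrow> R y" using R unfolding eventually_nhds by blast
  let ?Q = "{y. 0 < ori a p e * ori a p y}"
  have "open ?Q" by (intro open_Collect_less continuous_intros)
  have "\<forall>\<^sub>F y in nhds p. y \<in> W \<inter> interior (closure V)" using W p by (intro eventually_nhds_in_open) auto
  then have "\<forall>\<^sub>F h in at_right 0. p + h *\<^sub>R (e - p) \<in> W \<inter> interior (closure V)"
    by (rule eventually_compose_filterlim) (rule tendsto_scale_at_right)
  then have "\<forall>\<^sub>F h in at_right (0::real). 0 < h \<and> p + h *\<^sub>R (e - p) \<in> W \<inter> interior (closure V)"
    using eventually_at_right_less[of "0::real"] by eventually_elim blast
  then obtain h where h: "0 < h" "p + h *\<^sub>R (e - p) \<in> W \<inter> interior (closure V)"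
    using eventually_happens'[OF trivial_limit_at_right_real] by blast
  let ?y = "p + h *\<^sub>R (e - p)"
  have "0 < ori a p e * ori a p e" using e not_real_square_gt_zero by blast
  then have "0 < h * (ori a p e * ori a p e)" using h(1) by (rule mult_pos_pos[rotated])
  then have "?y \<in> ?Q" by (simp add: ori_line3 mult.left_commute)
  then have "?y \<in> closure V \<inter> (W \<inter> ?Q)" using h interior_subset by blast
  then have "V \<inter> (W \<inter> ?Q) \<noteq> {}" using open_Int_closure_eq_empty[of "W \<inter> ?Q" V] W(1) \<open>open ?Q\<close> by blast
  then show ?thesis using W(3) by blast
qed

text \<open>A component is a connected subset of a segment, hence convex, and the hull of a point
  and a convex set is the union of the segments joining them.\<close>

lemma fanE:
  assumes "T \<in> fan S a N"
  obtains t I where "t \<in> S" "I \<in> components (seg t \<inter> frontier N)" "T = convex hull (insert a I)" "convex I"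
    "\<And>y. y \<in> T \<Longrightarrow> y \<noteq> a \<Longrightarrow> \<exists>i\<in>I. \<exists>k. 0 < k \<and> k \<le> 1 \<and> y = a + k *\<^sub>R (i - a)"
proof -
  obtain t I where t: "t \<in> S" "I \<in> components (seg t \<inter> frontier N)" "T = convex hull (insert a I)"
    using assms unfolding fan_def by blast
  have "I \<subseteq> seg t" using in_components_subset[OF t(2)] by blast
  then have "collinear I" unfolding seg_def by (rule collinear_subset[OF collinear_closed_segment])
  then have cI: "convex I" using convex_connected_collinear in_components_connected[OF t(2)] by blast
  have ne: "I \<noteq> {}" using in_components_nonempty t(2) by blast
  have "\<exists>i\<in>I. \<exists>k. 0 < k \<and> k \<le> 1 \<and> y = a + k *\<^sub>R (i - a)" if y: "y \<in> T" "y \<noteq> a" for y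
  proof -
    from y(1) obtain u v i where u: "0 \<le> u" "0 \<le> v" "u + v = 1" "i \<in> convex hull I" "y = u *\<^sub>R a + v *\<^sub>R i"
      unfolding t(3) convex_hull_insert[OF ne] by blast
    have i: "i \<in> I" using u(4) hull_same[of convex I] cI by simp
    have uv: "u = 1 - v" using u(3) by simp
    have "y = a + v *\<^sub>R (i - a)" unfolding u(5) uv by (simp add: algebra_simps)
    moreover from this have "v \<noteq> 0" using y(2) by auto
    ultimately show ?thesis using i u by (intro bexI[of _ i] exI[of _ v]) auto
  qed
  then show ?thesis using that t cI by blast
qed

lemma star_closure:
  fixes a :: pt
  assumes i: "i \<in> closure N" and "0 < k" "k \<le> 1"
    and star: "\<And>y l. y \<in> N \<Longrightarrow> 0 < l \<Longrightarrow> l \<le> 1 \<Longrightarrow> a + l *\<^sub>R (y - a) \<in> V"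
  shows "a + k *\<^sub>R (i - a) \<in> closure V"
proof -
  obtain y where y: "\<And>n::nat. y n \<in> N" "y \<longlonglongrightarrow> i" using i closure_sequential by blast
  have "(\<lambda>n. a + k *\<^sub>R (y n - a)) \<longlonglongrightarrow> a + k *\<^sub>R (i - a)" by (intro tendsto_intros y(2))
  moreover have "a + k *\<^sub>R (y n - a) \<in> V" for n using star y(1) assms(2,3) by blast
  ultimately show ?thesis unfolding closure_sequential
    by (intro exI[of _ "\<lambda>n. a + k *\<^sub>R (y n - a)"]) blast
qed

lemma visible_scale: "visible S a y \<Longrightarrow> 0 \<le> l \<Longrightarrow> l \<le> 1 \<Longrightarrow> visible S a (a + l *\<^sub>R (y - a))"
  using visible_prefix in_closedI by blast

lemma frontier_in_closure: "frontier N \<subseteq> closure N"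
  by (simp add: frontier_def)

lemma fan_subset_closure:
  assumes T: "T \<in> fan S a N" and "y \<in> T" "y \<noteq> a" and N: "N \<subseteq> vis_region S a"
  shows "y \<in> closure (vis_region S a)"
proof -
  obtain t I where I: "I \<in> components (seg t \<inter> frontier N)"
    "\<And>y. y \<in> T \<Longrightarrow> y \<noteq> a \<Longrightarrow> \<exists>i\<in>I. \<exists>k. 0 < k \<and> k \<le> 1 \<and> y = a + k *\<^sub>R (i - a)"
    by (rule fanE[OF T]) blast
  obtain i k where i: "i \<in> I" "0 < k" "k \<le> 1" "y = a + k *\<^sub>R (i - a)" using I(2) assms(2,3) by blast
  have "i \<in> closure N" using i(1) in_components_subset[OF I(1)] frontier_in_closure by blast
  then show ?thesis unfolding i(4)
    by (rule star_closure) (use i N visible_scale in \<open>auto simp: vis_region_def\<close>)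
qed

text \<open>Two small opposite moves of \<open>p\<close> across the ray from \<open>a\<close> stay
  in \<open>T\<close>, so they lie on rays to points \<open>i1\<close> and \<open>i2\<close> of
  \<open>I\<close>. The ray through \<open>p\<close> then meets \<open>I\<close> strictly between
  these, at an inner point of \<open>t\<close>, and transversally.\<close>

lemma fan_ray:
  assumes T: "T \<in> fan S a N" and p: "p \<in> interior T" "p \<noteq> a"
  obtains t I i e k where "t \<in> S" "I \<in> components (seg t \<inter> frontier N)" "T = convex hull (insert a I)"
    "i \<in> I" "i \<in> open_segment (fst t) (snd t)" "e \<in> seg t" "ori a i e \<noteq> 0"
    "0 < k" "k \<le> 1" "p = a + k *\<^sub>R (i - a)"
proof -
  obtain t I where I: "t \<in> S" "I \<in> components (seg t \<inter> frontier N)" "T = convex hull (insert a I)" "convex I"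
    "\<And>y. y \<in> T \<Longrightarrow> y \<noteq> a \<Longrightarrow> \<exists>i\<in>I. \<exists>k. 0 < k \<and> k \<le> 1 \<and> y = a + k *\<^sub>R (i - a)"
    by (rule fanE[OF T]) blast
  \<comment> \<open>\<open>p - a\<close> turned counterclockwise by a right angle.\<close>
  define n :: pt where "n = vector [- ((p - a) $ 2), (p - a) $ 1]"
  have "cross (p - a) n = (p - a) $ 1 * (p - a) $ 1 + (p - a) $ 2 * (p - a) $ 2"
    by (simp add: cross_def n_def algebra_simps)
  moreover have "(p - a) $ 1 \<noteq> 0 \<or> (p - a) $ 2 \<noteq> 0" using p(2) by (auto simp: vec_eq_iff forall_2)
  ultimately have n: "0 < cross (p - a) n" using sum_squares_gt_zero_iff by metis
  have "\<forall>\<^sub>F y in nhds p. y \<in> interior T" using p by (intro eventually_nhds_in_open) auto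
  then have "\<forall>\<^sub>F h in at_right 0. p + h *\<^sub>R w \<in> interior T" for w
    by (rule eventually_compose_filterlim) (rule tendsto_scale_at_right)
  from this[of n] this[of "- n"] have "\<forall>\<^sub>F h in at_right (0::real). 0 < h \<and> p + h *\<^sub>R n \<in> T \<and> p + h *\<^sub>R (- n) \<in> T"
    using eventually_at_right_less[of "0::real"] by eventually_elim (use interior_subset in blast)
  then obtain h where h: "0 < h" "p + h *\<^sub>R n \<in> T" "p + h *\<^sub>R (- n) \<in> T"
    using eventually_happens'[OF trivial_limit_at_right_real] by blast
  have o: "ori a p (p + r *\<^sub>R n) = r * cross (p - a) n" for r by (simp add: ori_cross_dir)
  have o1: "ori a p (p + h *\<^sub>R n) \<noteq> 0" "ori a p (p + h *\<^sub>R (- n)) \<noteq> 0"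
    using o[of h] o[of "- h"] h(1) n by simp_all
  then have "p + h *\<^sub>R n \<noteq> a" "p + h *\<^sub>R (- n) \<noteq> a" by auto
  then obtain i1 k1 i2 k2 where i1: "i1 \<in> I" "0 < k1" "k1 \<le> 1" "p + h *\<^sub>R n = a + k1 *\<^sub>R (i1 - a)"
    and i2: "i2 \<in> I" "0 < k2" "k2 \<le> 1" "p + h *\<^sub>R (- n) = a + k2 *\<^sub>R (i2 - a)"
    using I(5)[OF h(2)] I(5)[OF h(3)] by blast
  \<comment> \<open>\<open>p\<close> is the midpoint of the two moved points; collecting the
    multiples of \<open>i1 - a\<close> and \<open>i2 - a\<close> gives a mean of \<open>i1\<close>
    and \<open>i2\<close> with weights proportional to \<open>k1\<close> and
    \<open>k2\<close>.\<close>
  define i where "i = i1 + (k2 / (k1 + k2)) *\<^sub>R (i2 - i1)"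
  define k where "k = (k1 + k2) / 2"
  have k: "0 < k" "k \<le> 1" using i1 i2 by (auto simp: k_def)
  have "2 *\<^sub>R p = (p + h *\<^sub>R n) + (p + h *\<^sub>R (- n))" by (simp add: scaleR_2)
  also have "\<dots> = 2 *\<^sub>R a + (k1 *\<^sub>R (i1 - a) + k2 *\<^sub>R (i2 - a))" unfolding i1(4) i2(4) by (simp add: scaleR_2)
  also have "k1 *\<^sub>R (i1 - a) + k2 *\<^sub>R (i2 - a) = (k1 + k2) *\<^sub>R (i - a)"
  proof -
    have "(k1 + k2) *\<^sub>R (i - a) = (k1 + k2) *\<^sub>R (i1 - a) + k2 *\<^sub>R (i2 - i1)"
      unfolding i_def using i1(2) i2(2) by (simp add: scaleR_right_distrib scaleR_right_diff_distrib)
    then show ?thesis by (simp add: algebra_simps)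
  qed
  finally have "2 *\<^sub>R p = 2 *\<^sub>R (a + k *\<^sub>R (i - a))" by (simp add: k_def scaleR_right_distrib)
  then have pk: "p = a + k *\<^sub>R (i - a)" by simp
  have e1: "ori a i i1 \<noteq> 0"
  proof
    assume "ori a i i1 = 0"
    then have "ori a p i1 = 0" using ori_ray[OF pk] by simp
    then have "ori a p (a + k1 *\<^sub>R (i1 - a)) = 0" by (simp add: ori_line3)
    then show False using o1 i1(4) by simp
  qed
  then have "i \<noteq> i1" by auto
  have it: "i1 \<in> seg t" "i2 \<in> seg t" using i1 i2 in_components_subset[OF I(2)] by auto
  have "i1 \<noteq> i2" using \<open>i \<noteq> i1\<close> by (auto simp: i_def)
  then have io: "i \<in> open_segment i1 i2" unfolding i_def using i1(2) i2(2) by (intro in_openI) auto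
  then have "i \<in> open_segment (fst t) (snd t)" using open_between[OF it] by blast
  moreover have "i \<in> I" using io I(4) i1(1) i2(1) by (meson convex_contains_open_segment subsetD)
  ultimately show ?thesis using that[of t I i i1 k] I(1-3) it(1) e1 k pk by blast
qed

text \<open>In contrast to \<open>hidden_side\<close>, the blocker is met at an inner point and
  transversally, so it reaches to both sides and hides a full neighbourhood.\<close>

lemma eventually_hidden_behind:
  assumes t: "t \<in> S" "c \<in> open_segment (fst t) (snd t)" "c \<in> open_segment a b" "e \<in> seg t" "ori a b e \<noteq> 0"
  shows "\<forall>\<^sub>F y in nhds b. \<not> visible S a y"
proof -
  have ct: "c \<in> seg t" using open_in_seg t(2) .
  obtain l where l: "0 < l" "l < 1" "c = a + l *\<^sub>R (b - a)" "a \<noteq> b" using t(3) by (rule in_openE)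
  have "ori a b c = 0" unfolding l(3) ori_line3 by simp
  then have opp: "ori a b (fst t) * ori a b (snd t) < 0" using opposite_ends t(2,4,5) by blast
  have 1: "\<forall>\<^sub>F y in nhds b. 0 < ori a b (fst t) * ori a b y \<longrightarrow> \<not> visible S a y"
    using hidden_side[OF t(1,3) ct seg_ends(1) filterlim_ident] .
  have 2: "\<forall>\<^sub>F y in nhds b. 0 < ori a b (snd t) * ori a b y \<longrightarrow> \<not> visible S a y"
    using hidden_side[OF t(1,3) ct seg_ends(2) filterlim_ident] .
  \<comment> \<open>Points exactly on the line belong to neither side. For them the projection on
    \<open>b - a\<close> shows that they are still behind \<open>c\<close>.\<close>
  have bb: "0 < (b - a) \<bullet> (b - a)" using l by simp
  then have "l * ((b - a) \<bullet> (b - a)) < (b - a) \<bullet> (b - a)" using l by simp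
  then have "\<forall>\<^sub>F y in nhds b. l * ((b - a) \<bullet> (b - a)) < (y - a) \<bullet> (b - a)"
    by (rule order_tendstoD(1)[rotated]) (intro tendsto_intros filterlim_ident)
  with 1 2 show ?thesis
  proof eventually_elim
    case (elim y)
    show ?case
    proof (cases "ori a b y = 0")
      case False
      then have "0 < ori a b (fst t) * ori a b y \<or> 0 < ori a b (snd t) * ori a b y"
        using opp by (auto simp: zero_less_mult_iff mult_less_0_iff linorder_neq_iff)
      then show ?thesis using elim by blast
    next
      case True
      then obtain m where m: "y = a + m *\<^sub>R (b - a)" using ori_zeroD l(4) by blast
      then have "l * ((b - a) \<bullet> (b - a)) < m * ((b - a) \<bullet> (b - a))" using elim(3) by simp
      then have lm: "l < m" using bb by simp
      have "c = a + (l / m) *\<^sub>R (y - a)" unfolding m l(3) using lm l by simp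
      moreover have "a \<noteq> y" using m lm l by simp
      ultimately have "c \<in> open_segment a y" using in_openI[of a y "l / m"] lm l by simp
      then show ?thesis using t(1) ct by (auto simp: visible_def obstacles_def)
    qed
  qed
qed

context scene
begin

text \<open>A ray leaves the bounded set \<open>H\<close> through its frontier, and the frontier
  consists of obstacles.\<close>

lemma ray_hits:
  assumes "a + d \<in> H" "d \<noteq> 0"
  shows "\<exists>r\<ge>1. a + r *\<^sub>R d \<in> obstacles S"
proof -
  let ?R = "(\<lambda>r. a + r *\<^sub>R d) ` {1..}"
  have "connected ?R" by (intro connected_continuous_image continuous_intros) simp
  moreover have "a + 1 *\<^sub>R d \<in> ?R" by (rule imageI) simp
  then have "?R \<inter> H \<noteq> {}" using assms(1) by auto
  moreover have "?R - H \<noteq> {}"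
  proof -
    obtain B where B: "\<And>y. y \<in> H \<Longrightarrow> norm y \<le> B" using bounded_H bounded_iff by blast
    have nd: "0 < norm d" using assms(2) by simp
    define r where "r = max 1 ((B + norm a + 1) / norm d)"
    have "(B + norm a + 1) / norm d \<le> r" "1 \<le> r" by (auto simp: r_def)
    then have "B + norm a + 1 \<le> r * norm d" using nd by (simp add: pos_divide_le_eq)
    moreover have "norm (r *\<^sub>R d) \<le> norm (a + r *\<^sub>R d) + norm a"
      by (metis add_diff_cancel_left' norm_triangle_ineq4)
    ultimately have "B < norm (a + r *\<^sub>R d)" using \<open>1 \<le> r\<close> by simp
    then have "a + r *\<^sub>R d \<notin> H" using B by force
    then show ?thesis using \<open>1 \<le> r\<close> by auto
  qed
  ultimately obtain c where "c \<in> ?R" "c \<in> frontier H" using connected_Int_frontier by blast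
  then show ?thesis using frontier_H by auto
qed

text \<open>The ray from \<open>a\<close> through \<open>p\<close> meets the opposite sides of both
  triangles at inner points of elements of \<open>S\<close>. The nearer of two different hits would
  hide a neighbourhood of the farther one, which is a limit of visible points. So the hits agree;
  disjoint interiors give the same segment, and then the same component.\<close>

lemma fan_unique:
  assumes T: "T \<in> fan S a N" "T' \<in> fan S a N" and p: "p \<in> interior T" "p \<in> interior T'" "p \<noteq> a"
    and N: "N \<subseteq> vis_region S a"
  shows "T = T'"
proof -
  obtain t I i e k where 1: "t \<in> S" "I \<in> components (seg t \<inter> frontier N)" "T = convex hull (insert a I)"
    "i \<in> I" "i \<in> open_segment (fst t) (snd t)" "e \<in> seg t" "ori a i e \<noteq> 0"
    "0 < k" "k \<le> 1" "p = a + k *\<^sub>R (i - a)" by (rule fan_ray[OF T(1) p(1,3)])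
  obtain t' I' i' e' k' where 2: "t' \<in> S" "I' \<in> components (seg t' \<inter> frontier N)" "T' = convex hull (insert a I')"
    "i' \<in> I'" "i' \<in> open_segment (fst t') (snd t')" "e' \<in> seg t'" "ori a i' e' \<noteq> 0"
    "0 < k'" "k' \<le> 1" "p = a + k' *\<^sub>R (i' - a)" by (rule fan_ray[OF T(2) p(2,3)])
  have front: "\<not> l' < l" if "t1 \<in> S" "j \<in> open_segment (fst t1) (snd t1)" "c \<in> seg t1" "ori a j c \<noteq> 0"
    "0 < l" "p = a + l *\<^sub>R (j - a)" "J' \<in> components (seg t2 \<inter> frontier N)" "j' \<in> J'"
    "0 < l'" "p = a + l' *\<^sub>R (j' - a)" for t1 j c l J' t2 j' l'
  proof
    assume less: "l' < l"
    have "l *\<^sub>R (j - a) = l' *\<^sub>R (j' - a)" using that(6,10) by simp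
    then have "(1 / l) *\<^sub>R (l *\<^sub>R (j - a)) = (1 / l) *\<^sub>R (l' *\<^sub>R (j' - a))" by simp
    then have "j - a = (l' / l) *\<^sub>R (j' - a)" using that(5) by simp
    then have j: "j = a + (l' / l) *\<^sub>R (j' - a)" by (simp add: algebra_simps)
    have "a \<noteq> j'" using that(10) p(3) by auto
    then have "j \<in> open_segment a j'" unfolding j using less that(5,9) by (intro in_openI) auto
    moreover have "ori a j' c \<noteq> 0" using ori_ray[OF j] that(4) by auto
    ultimately have "\<forall>\<^sub>F y in nhds j'. \<not> visible S a y"
      using eventually_hidden_behind that(1-3) by blast
    then obtain W where W: "open W" "j' \<in> W" "\<And>y. y \<in> W \<Longrightarrow> \<not> visible S a y"
      unfolding eventually_nhds by blast
    have "j' \<in> closure N" using that(7,8) in_components_subset frontier_in_closure by blast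
    then have "W \<inter> N \<noteq> {}" using W(1,2) open_Int_closure_eq_empty[of W N] by blast
    then show False using W(3) N by (auto simp: vis_region_def)
  qed
  have "k = k'"
    using front[OF 1(1,5-8,10) 2(2,4,8,10)] front[OF 2(1,5-8,10) 1(2,4,8,10)] by linarith
  have "k *\<^sub>R (i - a) = p - a" "k' *\<^sub>R (i' - a) = p - a" using 2(10) 1(10) by (metis add_diff_cancel_left')+
  then have "k *\<^sub>R (i - a) = k *\<^sub>R (i' - a)" using \<open>k = k'\<close> by simp
  then have "i - a = i' - a" using 1(8) by (metis less_irrefl scaleR_cancel_left)
  then have "i = i'" by simp
  then have "t = t'" using disj[OF 1(1) 2(1)] 1(5) 2(5) by blast
  then have "I = I'" using components_nonoverlap[OF 1(2)] 2(2) 1(4) 2(4) \<open>i = i'\<close> by blast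
  then show ?thesis using 1(3) 2(3) by simp
qed

text \<open>Exactly what \<open>generic_if_off_frontiers\<close> extracts from \<open>p\<close>
  being off all frontiers; the rest of the geometry uses only this.\<close>

definition generic :: "pt \<Rightarrow> bool" where
  "generic p \<longleftrightarrow> p \<in> H \<and> p \<notin> obstacles S \<and> (\<forall>t\<in>S. seg_visible S p t \<longrightarrow> ori (fst t) (snd t) p \<noteq> 0)"

text \<open>The first obstacle seen from \<open>p\<close> belongs to a segment visible from
  \<open>p\<close>. Its supporting line misses \<open>p\<close>, so that segment cannot lie in the
  line of sight.\<close>

lemma generic_block:
  assumes g: "generic p" and nv: "\<not> visible S p a"
  obtains z t e where "t \<in> S" "z \<in> seg t" "z \<in> open_segment p a" "visible S p z" "e \<in> seg t" "ori a p e \<noteq> 0"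
    "z \<noteq> a"
proof -
  have pa: "p \<noteq> a" using nv by auto
  obtain c where c: "c \<in> open_segment p a" "c \<in> obstacles S" using nv by (auto simp: visible_def)
  have c': "c \<in> closed_segment p a" "c \<noteq> p" using c(1) by (auto simp: open_segment_def)
  have away: "seg t \<inter> closed_segment p a \<subseteq> {p}" if "t \<in> S" "p \<in> seg t" for t
    using g that by (auto simp: generic_def obstacles_def)
  obtain z where z: "z \<in> closed_segment p a" "z \<noteq> p" "z \<in> obstacles S" "visible S p z"
    using first_obstacle[OF finite_S pa c' c(2) away] by blast
  have "z \<noteq> a" using z(4) nv by blast
  then have zo: "z \<in> open_segment p a" using z by (auto simp: open_segment_def)
  obtain t where t: "t \<in> S" "z \<in> seg t" using z(3) by (auto simp: obstacles_def)
  then have "seg_visible S p t" using z(4) by (auto simp: seg_visible_def)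
  then have no: "ori (fst t) (snd t) p \<noteq> 0" using g t(1) by (auto simp: generic_def)
  have "\<exists>e\<in>seg t. ori a p e \<noteq> 0"
  proof (rule ccontr)
    assume "\<not> ?thesis"
    then have "ori a p (fst t) = 0" "ori a p (snd t) = 0" by auto
    then obtain f g where fg: "fst t = a + f *\<^sub>R (p - a)" "snd t = a + g *\<^sub>R (p - a)"
      using ori_zeroD pa by metis
    have "ori (fst t) (snd t) p = 0" unfolding fg by (simp add: ori_simps algebra_simps)
    then show False using no by simp
  qed
  then show ?thesis using that t zo z(4) \<open>z \<noteq> a\<close> by blast
qed

text \<open>A blocker would be transversal and would hide one side of \<open>p\<close> near
  \<open>p\<close>, whereas density of the visible points near \<open>p\<close> supplies a visible
  point on that side.\<close>

lemma interior_closure_visible: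
  assumes g: "generic p" and a: "a \<noteq> p" and p: "p \<in> interior (closure (vis_region S a))"
  shows "visible S a p"
proof (rule ccontr)
  assume "\<not> visible S a p"
  then have "\<not> visible S p a" by (simp add: visible_sym)
  then obtain z t e where z: "t \<in> S" "z \<in> seg t" "z \<in> open_segment p a" "e \<in> seg t" "ori a p e \<noteq> 0"
    by (rule generic_block[OF g])
  have zo: "z \<in> open_segment a p" using z(3) by (simp add: open_segment_commute)
  have "\<forall>\<^sub>F y in nhds p. 0 < ori a p e * ori a p y \<longrightarrow> \<not> visible S a y"
    using hidden_side[OF z(1) zo z(2,4) filterlim_ident] .
  then obtain v where "v \<in> vis_region S a" "0 < ori a p e * ori a p v"
    "0 < ori a p e * ori a p v \<longrightarrow> \<not> visible S a v"
    using closure_side[OF p z(5)] by blast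
  then show False by (auto simp: vis_region_def)
qed

end

text \<open>Intersection of the lines through \<open>t\<close> and through \<open>a\<close>,
  \<open>b\<close>, given as the zero of the affine function \<open>ori a b\<close> along
  \<open>t\<close>. Being explicit, it is evidently continuous in \<open>b\<close>.\<close>

definition line_hit :: "sgmt \<Rightarrow> pt \<Rightarrow> pt \<Rightarrow> pt" where
  "line_hit t a b = fst t + (ori a b (fst t) / (ori a b (fst t) - ori a b (snd t))) *\<^sub>R (snd t - fst t)"

lemma line_hit_on_line:
  "ori a b (fst t) \<noteq> ori a b (snd t) \<Longrightarrow> ori a b (line_hit t a b) = 0"
  unfolding line_hit_def ori_line3 by (simp add: field_simps)

lemma line_hit_seg:
  assumes "ori a b (fst t) * ori a b (snd t) < 0"
  shows "line_hit t a b \<in> seg t"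
proof -
  define f g where "f = ori a b (fst t)" and "g = ori a b (snd t)"
  have "f * g < 0" using assms by (simp add: f_def g_def)
  then have "0 \<le> f / (f - g) \<and> f / (f - g) \<le> 1"
    by (auto simp: mult_less_0_iff divide_simps)
  then show ?thesis unfolding line_hit_def seg_def f_def g_def by (intro in_closedI) auto
qed

lemma line_hit_unique:
  assumes "z \<in> seg t" "ori a b z = 0" "ori a b (fst t) \<noteq> ori a b (snd t)"
  shows "line_hit t a b = z"
proof -
  obtain k where k: "z = fst t + k *\<^sub>R (snd t - fst t)" using assms(1) unfolding seg_def in_closed_iff by blast
  have "(1 - k) * ori a b (fst t) + k * ori a b (snd t) = 0" using assms(2) unfolding k ori_line3 .
  then have "k * (ori a b (fst t) - ori a b (snd t)) = ori a b (fst t)" by (simp add: algebra_simps)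
  then have "k = ori a b (fst t) / (ori a b (fst t) - ori a b (snd t))" using assms(3) by (simp add: field_simps)
  then show ?thesis unfolding line_hit_def k by simp
qed

section \<open>Fans cover what their apex sees\<close>

context scene
begin

text \<open>The rays from \<open>a\<close> in the directions \<open>d + \<theta> n\<close> with small \<open>\<theta> > 0\<close> avoid all endpoints, so the
  element of \<open>S\<close> they hit first is locally constant in \<open>\<theta>\<close>, hence constant; the hit points form a
  connected subset of the frontier and span a triangle that contains \<open>a + d\<close> in its closure.\<close>

lemma fan_cover:
  assumes dn: "cross d n \<noteq> 0"
    and N: "\<forall>\<^sub>F \<theta> in at_right 0. \<forall>r>0. a + r *\<^sub>R (d + \<theta> *\<^sub>R n) \<in> N \<longleftrightarrow> visible S a (a + r *\<^sub>R (d + \<theta> *\<^sub>R n))"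
    and vis: "\<forall>\<^sub>F \<theta> in at_right 0. visible S a (a + (d + \<theta> *\<^sub>R n))"
    and hits: "\<forall>\<^sub>F \<theta> in at_right 0. \<exists>r>0. a + r *\<^sub>R (d + \<theta> *\<^sub>R n) \<in> obstacles S"
  shows "\<exists>T\<in>fan S a N. a + d \<in> T"
proof -
  let ?D = "\<lambda>\<theta>::real. d + \<theta> *\<^sub>R n"
  have D0: "?D \<theta> \<noteq> 0" for \<theta>
  proof
    assume "?D \<theta> = 0"
    moreover have "cross (?D \<theta>) n = cross d n" by (simp add: cross_def algebra_simps)
    ultimately show False using dn by (simp add: cross_def)
  qed
  \<comment> \<open>An endpoint other than \<open>a\<close> lies on the line of at most one tilted
    direction, so small positive tilts avoid all of them.\<close>
  have generic: "\<forall>\<^sub>F \<theta> in at_right 0. \<forall>e\<in>endpoints S. e \<noteq> a \<longrightarrow> ori a (a + ?D \<theta>) e \<noteq> 0"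
  proof (intro eventually_ball_finite finite_endpoints ballI)
    fix e assume "e \<in> endpoints S"
    have o: "ori a (a + ?D \<theta>) e = cross d (e - a) + \<theta> * cross n (e - a)" for \<theta>
      by (simp add: ori_simps algebra_simps)
    show "\<forall>\<^sub>F \<theta> in at_right 0. e \<noteq> a \<longrightarrow> ori a (a + ?D \<theta>) e \<noteq> 0"
    proof (cases "cross d (e - a) = 0")
      case False
      have "((\<lambda>\<theta>. cross d (e - a) + \<theta> * cross n (e - a)) \<longlongrightarrow> cross d (e - a) + 0 * cross n (e - a)) (at_right 0)"
        by (intro tendsto_intros)
      then have "\<forall>\<^sub>F \<theta> in at_right 0. cross d (e - a) + \<theta> * cross n (e - a) \<noteq> 0"
        by (rule tendsto_imp_eventually_ne) (use False in simp)
      then show ?thesis by eventually_elim (use o in auto)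
    next
      case True
      have nz: "cross n (e - a) \<noteq> 0" if "e \<noteq> a"
      proof
        assume n0: "cross n (e - a) = 0"
        \<comment> \<open>Cramer's rule: only the zero vector has vanishing cross products with both
          \<open>d\<close> and \<open>n\<close>.\<close>
        have "cross d n * (e - a) $ 1 = n $ 1 * cross d (e - a) - d $ 1 * cross n (e - a)"
          "cross d n * (e - a) $ 2 = n $ 2 * cross d (e - a) - d $ 2 * cross n (e - a)"
          by (simp_all add: cross_def algebra_simps)
        then have "(e - a) $ 1 = 0" "(e - a) $ 2 = 0" using True n0 dn by simp_all
        then show False using that by (simp add: vec_eq_iff forall_2)
      qed
      from eventually_at_right_less[of "0::real"] show ?thesis
        by eventually_elim (use o True nz in simp)
    qed
  qed
  from N vis hits generic have "\<forall>\<^sub>F \<theta> in at_right 0.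
      (\<forall>r>0. a + r *\<^sub>R ?D \<theta> \<in> N \<longleftrightarrow> visible S a (a + r *\<^sub>R ?D \<theta>)) \<and> visible S a (a + ?D \<theta>) \<and>
      (\<exists>r>0. a + r *\<^sub>R ?D \<theta> \<in> obstacles S) \<and> (\<forall>e\<in>endpoints S. e \<noteq> a \<longrightarrow> ori a (a + ?D \<theta>) e \<noteq> 0)"
    by eventually_elim blast
  then obtain \<delta> where \<delta>: "0 < \<delta>"
    and N': "\<And>\<theta> r. 0 < \<theta> \<Longrightarrow> \<theta> < \<delta> \<Longrightarrow> 0 < r \<Longrightarrow> a + r *\<^sub>R ?D \<theta> \<in> N \<longleftrightarrow> visible S a (a + r *\<^sub>R ?D \<theta>)"
    and vis': "\<And>\<theta>. 0 < \<theta> \<Longrightarrow> \<theta> < \<delta> \<Longrightarrow> visible S a (a + ?D \<theta>)"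
    and hits': "\<And>\<theta>. 0 < \<theta> \<Longrightarrow> \<theta> < \<delta> \<Longrightarrow> \<exists>r>0. a + r *\<^sub>R ?D \<theta> \<in> obstacles S"
    and gen': "\<And>\<theta> e. 0 < \<theta> \<Longrightarrow> \<theta> < \<delta> \<Longrightarrow> e \<in> endpoints S \<Longrightarrow> e \<noteq> a \<Longrightarrow> ori a (a + ?D \<theta>) e \<noteq> 0"
    unfolding eventually_at_right_field by blast
  \<comment> \<open>The bound 1 loses nothing: \<open>a + ?D \<theta>\<close> is visible, so no
    obstacle comes strictly before it.\<close>
  define first where "first \<theta> t \<longleftrightarrow> t \<in> S \<and> (\<exists>r\<ge>1. a + r *\<^sub>R ?D \<theta> \<in> seg t \<and> visible S a (a + r *\<^sub>R ?D \<theta>))" for \<theta> t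
  \<comment> \<open>A segment that issues from \<open>a\<close> along the ray would hide
    \<open>a + ?D \<theta>\<close>.\<close>
  have no_apex: "c = a" if th: "0 < \<theta>" "\<theta> < \<delta>" and t: "t \<in> S" "a \<in> seg t" "c \<in> seg t" "c = a + r *\<^sub>R ?D \<theta>" "0 \<le> r" for \<theta> t c r
  proof (rule ccontr)
    assume "c \<noteq> a"
    then have r: "0 < r" using t(4,5) by (cases "r = 0") auto
    define m where "m = min (1/2) r"
    have m: "0 < m" "m < 1" "m \<le> r" using r by (auto simp: m_def)
    have "a + m *\<^sub>R ((a + ?D \<theta>) - a) \<in> open_segment a (a + ?D \<theta>)" using D0[of \<theta>] m by (intro in_openI) auto
    moreover have "a + (m / r) *\<^sub>R (c - a) \<in> closed_segment a c" using m r by (intro in_closedI) auto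
    then have "a + m *\<^sub>R ?D \<theta> \<in> closed_segment a c" using r by (simp add: t(4))
    then have "a + m *\<^sub>R ?D \<theta> \<in> seg t" using seg_sub[OF t(2,3)] by blast
    ultimately show False using vis'[OF th] t(1) by (auto simp: visible_def obstacles_def)
  qed
  have ex_first: "\<exists>t. first \<theta> t" if th: "0 < \<theta>" "\<theta> < \<delta>" for \<theta>
  proof -
    obtain r where r: "0 < r" "a + r *\<^sub>R ?D \<theta> \<in> obstacles S" using hits'[OF th] by blast
    let ?b = "a + r *\<^sub>R ?D \<theta>"
    have ab: "a \<noteq> ?b" using r D0[of \<theta>] by simp
    have away: "seg t \<inter> closed_segment a ?b \<subseteq> {a}" if t: "t \<in> S" "a \<in> seg t" for t
    proof
      fix c assume c: "c \<in> seg t \<inter> closed_segment a ?b"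
      then obtain k where k: "0 \<le> k" "c = a + k *\<^sub>R (?b - a)" unfolding Int_iff in_closed_iff by blast
      have "c = a + (k * r) *\<^sub>R ?D \<theta>" unfolding k(2) by simp
      then show "c \<in> {a}" using no_apex[OF th t, of c "k * r"] c k r by simp
    qed
    obtain z where z: "z \<in> closed_segment a ?b" "z \<noteq> a" "z \<in> obstacles S" "visible S a z"
      using first_obstacle[OF finite_S ab _ ab[symmetric] r(2) away] by auto
    obtain k where k: "0 \<le> k" "z = a + k *\<^sub>R (?b - a)" using z(1) unfolding in_closed_iff by blast
    have zk: "z = a + (k * r) *\<^sub>R ?D \<theta>" unfolding k(2) by simp
    have kr: "0 < k * r" using k r z(2) by (cases "k = 0") auto
    have "1 \<le> k * r"
    proof (rule ccontr)
      assume "\<not> 1 \<le> k * r"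
      then have "a + (k * r) *\<^sub>R ((a + ?D \<theta>) - a) \<in> open_segment a (a + ?D \<theta>)"
        using D0[of \<theta>] kr by (intro in_openI) auto
      then have "z \<in> open_segment a (a + ?D \<theta>)" by (simp add: zk)
      then show False using vis'[OF th] z(3) by (auto simp: visible_def)
    qed
    obtain t where "t \<in> S" "z \<in> seg t" using z(3) by (auto simp: obstacles_def)
    then have "first \<theta> t" unfolding first_def using z(4) \<open>1 \<le> k * r\<close> zk by blast
    then show ?thesis by blast
  qed
  have first_geo: "a \<notin> seg t \<and> ori (fst t) (snd t) a \<noteq> 0 \<and> ori a (a + ?D \<theta>) (fst t) * ori a (a + ?D \<theta>) (snd t) < 0
      \<and> a + r *\<^sub>R ?D \<theta> \<in> open_segment (fst t) (snd t) \<and> line_hit t a (a + ?D \<theta>) = a + r *\<^sub>R ?D \<theta>"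
    if th: "0 < \<theta>" "\<theta> < \<delta>" and t: "t \<in> S" "a + r *\<^sub>R ?D \<theta> \<in> seg t" "1 \<le> r" for \<theta> t r
  proof -
    let ?z = "a + r *\<^sub>R ?D \<theta>"
    have za: "?z \<noteq> a" using D0[of \<theta>] t(3) by simp
    have at: "a \<notin> seg t" using no_apex[OF th t(1) _ t(2), of r] za t(3) by auto
    have oz: "ori a (a + ?D \<theta>) ?z = 0" by (simp add: ori_simps algebra_simps)
    have e: "fst t \<in> endpoints S" "snd t \<in> endpoints S" using t(1) by (simp_all add: endpoints_def)
    have ne: "fst t \<noteq> a" "snd t \<noteq> a" using at seg_ends by metis+
    have f: "ori a (a + ?D \<theta>) (fst t) \<noteq> 0" "ori a (a + ?D \<theta>) (snd t) \<noteq> 0"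
      using gen'[OF th e(1) ne(1)] gen'[OF th e(2) ne(2)] by auto
    have "?z \<noteq> fst t" "?z \<noteq> snd t" using oz f by auto
    then have zo: "?z \<in> open_segment (fst t) (snd t)" using t(2) by (auto simp: seg_def open_segment_def)
    have opp: "ori a (a + ?D \<theta>) (fst t) * ori a (a + ?D \<theta>) (snd t) < 0"
      using opposite_ends[OF zo oz seg_ends(1) f(1)] .
    have "ori (fst t) (snd t) a \<noteq> 0"
    proof
      assume o: "ori (fst t) (snd t) a = 0"
      obtain k where k: "?z = fst t + k *\<^sub>R (snd t - fst t)" using t(2) unfolding seg_def in_closed_iff by blast
      have o2: "ori (fst t) (snd t) ?z = 0" unfolding k ori_line3 by simp
      obtain l m where lm: "a = fst t + l *\<^sub>R (snd t - fst t)" using ori_zeroD[OF o ends_neq[OF t(1)]] .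
      have "ori a ?z (fst t) = 0" unfolding k by (subst (1) lm) (simp add: ori_simps algebra_simps)
      moreover have "ori a ?z (fst t) = r * ori a (a + ?D \<theta>) (fst t)" by (simp add: ori_simps algebra_simps)
      ultimately show False using f(1) t(3) by simp
    qed
    moreover have "ori a (a + ?D \<theta>) (fst t) \<noteq> ori a (a + ?D \<theta>) (snd t)"
      using opp by (auto simp: mult_less_0_iff)
    then have "line_hit t a (a + ?D \<theta>) = ?z" using line_hit_unique[OF t(2) oz] by blast
    ultimately show ?thesis using at opp zo by blast
  qed
  have first_unique: "t = t'" if th: "0 < \<theta>" "\<theta> < \<delta>" and f: "first \<theta> t" "first \<theta> t'" for \<theta> t t'
  proof -
    obtain r where r: "t \<in> S" "1 \<le> r" "a + r *\<^sub>R ?D \<theta> \<in> seg t" "visible S a (a + r *\<^sub>R ?D \<theta>)"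
      using f(1) unfolding first_def by blast
    obtain r' where r': "t' \<in> S" "1 \<le> r'" "a + r' *\<^sub>R ?D \<theta> \<in> seg t'" "visible S a (a + r' *\<^sub>R ?D \<theta>)"
      using f(2) unfolding first_def by blast
    have less: False if "1 \<le> k" "k < l" "a + k *\<^sub>R ?D \<theta> \<in> seg u" "u \<in> S" "visible S a (a + l *\<^sub>R ?D \<theta>)" for k l u
    proof -
      have "a + (k / l) *\<^sub>R ((a + l *\<^sub>R ?D \<theta>) - a) \<in> open_segment a (a + l *\<^sub>R ?D \<theta>)"
        using that(1,2) D0[of \<theta>] by (intro in_openI) auto
      then have "a + k *\<^sub>R ?D \<theta> \<in> open_segment a (a + l *\<^sub>R ?D \<theta>)" using that(1,2) by simp
      then show False using that(3-5) by (auto simp: visible_def obstacles_def)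
    qed
    have "r = r'" using less[OF r(2) _ r(3,1) r'(4)] less[OF r'(2) _ r'(3,1) r(4)]
      by (cases r r' rule: linorder_cases) auto
    then have "a + r *\<^sub>R ?D \<theta> \<in> open_segment (fst t) (snd t) \<inter> open_segment (fst t') (snd t')"
      using first_geo[OF th r(1,3,2)] first_geo[OF th r'(1,3,2)] by blast
    then show ?thesis using disj[OF r(1) r'(1)] by blast
  qed
  have tendsto_D: "((\<lambda>\<theta>. a + ?D \<theta>) \<longlongrightarrow> a + ?D \<theta>0) (nhds \<theta>0)" for \<theta>0
    by (intro tendsto_intros filterlim_ident)
  \<comment> \<open>The hit point \<open>line_hit\<close> varies continuously. It stays on
    \<open>t\<close> because the ends keep opposite signs, on the ray because the inner product
    stays positive, and visible because no other segment meets the old line of sight outside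
    \<open>a\<close>.\<close>
  have local: "\<forall>\<^sub>F \<theta> in nhds \<theta>0. first \<theta> t" if th: "0 < \<theta>0" "\<theta>0 < \<delta>" and f: "first \<theta>0 t" for \<theta>0 t
  proof -
    obtain r where r: "t \<in> S" "1 \<le> r" "a + r *\<^sub>R ?D \<theta>0 \<in> seg t" "visible S a (a + r *\<^sub>R ?D \<theta>0)"
      using f unfolding first_def by blast
    let ?z = "a + r *\<^sub>R ?D \<theta>0"
    have geo: "a \<notin> seg t" "ori (fst t) (snd t) a \<noteq> 0" "?z \<in> open_segment (fst t) (snd t)"
      "ori a (a + ?D \<theta>0) (fst t) * ori a (a + ?D \<theta>0) (snd t) < 0" "line_hit t a (a + ?D \<theta>0) = ?z"
      using first_geo[OF th r(1,3,2)] by blast+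
    have za: "?z \<noteq> a" using geo(1) r(3) by metis
    have "ori a (a + ?D \<theta>0) (fst t) - ori a (a + ?D \<theta>0) (snd t) \<noteq> 0" using geo(4) by (auto simp: mult_less_0_iff)
    then have "((\<lambda>\<theta>. line_hit t a (a + ?D \<theta>)) \<longlongrightarrow> line_hit t a (a + ?D \<theta>0)) (nhds \<theta>0)"
      unfolding line_hit_def by (intro tendsto_intros tendsto_D)
    then have lim: "((\<lambda>\<theta>. line_hit t a (a + ?D \<theta>)) \<longlongrightarrow> ?z) (nhds \<theta>0)" unfolding geo(5) .
    have "((\<lambda>\<theta>. ori a (a + ?D \<theta>) (fst t) * ori a (a + ?D \<theta>) (snd t)) \<longlongrightarrow>
        ori a (a + ?D \<theta>0) (fst t) * ori a (a + ?D \<theta>0) (snd t)) (nhds \<theta>0)"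
      by (intro tendsto_intros tendsto_D)
    then have e1: "\<forall>\<^sub>F \<theta> in nhds \<theta>0. ori a (a + ?D \<theta>) (fst t) * ori a (a + ?D \<theta>) (snd t) < 0"
      using geo(4) by (rule order_tendstoD)
    have "0 < r * (?D \<theta>0 \<bullet> ?D \<theta>0)" using D0[of \<theta>0] r(2) by simp
    then have "0 < (?z - a) \<bullet> ?D \<theta>0" by simp
    moreover have "((\<lambda>\<theta>. (line_hit t a (a + ?D \<theta>) - a) \<bullet> ?D \<theta>) \<longlongrightarrow> (?z - a) \<bullet> ?D \<theta>0) (nhds \<theta>0)"
      by (intro tendsto_intros lim filterlim_ident)
    ultimately have e2: "\<forall>\<^sub>F \<theta> in nhds \<theta>0. 0 < (line_hit t a (a + ?D \<theta>) - a) \<bullet> ?D \<theta>"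
      using order_tendstoD(1) by blast
    have e3: "\<forall>\<^sub>F \<theta> in nhds \<theta>0. \<forall>u\<in>S. u \<noteq> t \<longrightarrow> seg u \<inter> open_segment a (line_hit t a (a + ?D \<theta>)) = {}"
    proof (intro eventually_ball_finite finite_S ballI)
      fix u assume u: "u \<in> S"
      show "\<forall>\<^sub>F \<theta> in nhds \<theta>0. u \<noteq> t \<longrightarrow> seg u \<inter> open_segment a (line_hit t a (a + ?D \<theta>)) = {}"
      proof (cases "u = t")
        case False
        have "?z \<notin> seg u"
        proof
          assume "?z \<in> seg u"
          then have "?z \<in> open_segment (fst u) (snd u)" using first_geo[OF th u _ r(2)] by blast
          then show False using disj[OF u r(1) False] geo(3) by blast
        qed
        moreover have "seg u \<inter> open_segment a ?z = {}"
          using r(4) u by (auto simp: visible_def obstacles_def)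
        ultimately have "seg u \<inter> closed_segment a ?z \<subseteq> {a}" by (auto simp: open_segment_def)
        then show ?thesis using eventually_clear[OF _ za lim] by simp
      qed simp
    qed
    have e4: "\<forall>\<^sub>F \<theta> in nhds \<theta>0. \<theta> \<in> {0<..<\<delta>}" using th by (intro eventually_nhds_in_open) auto
    show ?thesis using e1 e2 e3 e4
    proof eventually_elim
      case (elim \<theta>)
      let ?y = "line_hit t a (a + ?D \<theta>)"
      have yt: "?y \<in> seg t" using line_hit_seg elim(1) by blast
      have "ori a (a + ?D \<theta>) (fst t) \<noteq> ori a (a + ?D \<theta>) (snd t)" using elim(1) by (auto simp: mult_less_0_iff)
      then have "ori a (a + ?D \<theta>) ?y = 0" by (rule line_hit_on_line)
      moreover have "a \<noteq> a + ?D \<theta>" using D0[of \<theta>] by (metis add_cancel_right_right)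
      ultimately obtain \<rho> where \<rho>: "?y = a + \<rho> *\<^sub>R ((a + ?D \<theta>) - a)" by (rule ori_zeroD)
      have \<rho>': "?y = a + \<rho> *\<^sub>R ?D \<theta>" using \<rho> by simp
      have "?y - a = \<rho> *\<^sub>R ?D \<theta>" using \<rho>' by simp
      then have "0 < \<rho> * (?D \<theta> \<bullet> ?D \<theta>)" using elim(2) by simp
      then have \<rho>0: "0 < \<rho>" by (metis inner_ge_zero not_less zero_less_mult_iff)
      have clear_t: "seg t \<inter> open_segment a ?y = {}"
      proof (rule ccontr)
        assume "\<not> ?thesis"
        then obtain c where c: "c \<in> seg t" "c \<in> open_segment a ?y" by blast
        obtain k where k: "0 < k" "k < 1" "c = a + k *\<^sub>R (?y - a)" using c(2) by (rule in_openE)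
        have "ori (fst t) (snd t) c = (1 - k) * ori (fst t) (snd t) a" unfolding k(3) ori_line3 using yt by simp
        then show False using c(1) k geo(2) by simp
      qed
      have v: "visible S a ?y" using elim(3) clear_t by (auto simp: visible_def obstacles_def)
      have "1 \<le> \<rho>"
      proof (rule ccontr)
        assume "\<not> 1 \<le> \<rho>"
        then have "a + \<rho> *\<^sub>R ((a + ?D \<theta>) - a) \<in> open_segment a (a + ?D \<theta>)"
          using D0[of \<theta>] \<rho>0 by (intro in_openI) auto
        then show False using vis'[of \<theta>] elim(4) yt r(1) \<rho> by (auto simp: visible_def obstacles_def)
      qed
      then show "first \<theta> t" unfolding first_def using r(1) yt v \<rho>' by metis
    qed
  qed
  define \<theta>1 where "\<theta>1 = \<delta> / 2"
  have \<theta>1: "0 < \<theta>1" "\<theta>1 < \<delta>" using \<delta> by (auto simp: \<theta>1_def)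
  obtain t where t: "first \<theta>1 t" using ex_first[OF \<theta>1] by blast
  have all: "first \<theta> t" if th: "0 < \<theta>" "\<theta> < \<delta>" for \<theta>
  proof -
    have "first \<theta>1 t = first \<theta> t"
    proof (rule connected_local_const[of "{0<..<\<delta>}" \<theta>1 \<theta> "\<lambda>\<theta>. first \<theta> t"])
      show "\<forall>u\<in>{0<..<\<delta>}. \<forall>\<^sub>F v in at u within {0<..<\<delta>}. first u t = first v t"
      proof
        fix u assume u: "u \<in> {0<..<\<delta>}"
        then obtain t' where t': "first u t'" using ex_first[of u] by (meson greaterThanLessThan_iff)
        then have "\<forall>\<^sub>F v in nhds u. first v t'" using local u by auto
        then show "\<forall>\<^sub>F v in at u within {0<..<\<delta>}. first u t = first v t"
          unfolding eventually_at_filter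
        proof eventually_elim
          case (elim v)
          show ?case
          proof (intro impI)
            assume v: "v \<in> {0<..<\<delta>}"
            have u': "0 < u" "u < \<delta>" and v': "0 < v" "v < \<delta>" using u v by auto
            have "first u t \<longleftrightarrow> t = t'" using first_unique[OF u', of t t'] t' by blast
            moreover have "first v t \<longleftrightarrow> t = t'" using first_unique[OF v', of t t'] elim v by blast
            ultimately show "first u t = first v t" by blast
          qed
        qed
      qed
    qed (use \<theta>1 th in auto)
    then show ?thesis using t by blast
  qed
  define Z where "Z \<theta> = line_hit t a (a + ?D \<theta>)" for \<theta>
  have Z: "\<exists>r\<ge>1. Z \<theta> = a + r *\<^sub>R ?D \<theta> \<and> visible S a (a + r *\<^sub>R ?D \<theta>) \<and> Z \<theta> \<in> seg t \<and>
      ori a (a + ?D \<theta>) (fst t) - ori a (a + ?D \<theta>) (snd t) \<noteq> 0" if th: "\<theta> \<in> {0<..<\<delta>}" for \<theta>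
  proof -
    have th': "0 < \<theta>" "\<theta> < \<delta>" using th by auto
    obtain r where r: "t \<in> S" "1 \<le> r" "a + r *\<^sub>R ?D \<theta> \<in> seg t" "visible S a (a + r *\<^sub>R ?D \<theta>)"
      using all[OF th'] unfolding first_def by blast
    have "Z \<theta> = a + r *\<^sub>R ?D \<theta>" "ori a (a + ?D \<theta>) (fst t) * ori a (a + ?D \<theta>) (snd t) < 0"
      using first_geo[OF th' r(1,3,2)] unfolding Z_def by blast+
    then show ?thesis using r by (intro exI[of _ r]) (auto simp: mult_less_0_iff)
  qed
  have Z_ne: "ori a (a + ?D \<theta>) (fst t) - ori a (a + ?D \<theta>) (snd t) \<noteq> 0" if "\<theta> \<in> {0<..<\<delta>}" for \<theta>
    using Z[OF that] by blast
  have "continuous_on {0<..<\<delta>} Z" unfolding Z_def line_hit_def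
    by (intro continuous_intros ballI Z_ne)
  then have conn: "connected (Z ` {0<..<\<delta>})" by (intro connected_continuous_image) auto
  have front: "Z \<theta> \<in> seg t \<inter> frontier N" if th: "\<theta> \<in> {0<..<\<delta>}" for \<theta>
  proof -
    have th': "0 < \<theta>" "\<theta> < \<delta>" using th by auto
    obtain r where r: "1 \<le> r" "Z \<theta> = a + r *\<^sub>R ?D \<theta>" "visible S a (a + r *\<^sub>R ?D \<theta>)" "Z \<theta> \<in> seg t"
      using Z[OF th] by blast
    have "Z \<theta> \<in> N" using N'[OF th', of r] r by simp
    \<comment> \<open>Otherwise \<open>N\<close> would contain a point behind
      \<open>Z \<theta>\<close> on the same ray, visible through \<open>t\<close>.\<close>
    moreover have "Z \<theta> \<notin> interior N"
    proof
      assume "Z \<theta> \<in> interior N"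
      then have "\<forall>\<^sub>F y in nhds (Z \<theta>). y \<in> interior N" by (intro eventually_nhds_in_open) auto
      then have "\<forall>\<^sub>F h in at_right 0. Z \<theta> + h *\<^sub>R ?D \<theta> \<in> interior N"
        by (rule eventually_compose_filterlim) (rule tendsto_scale_at_right)
      then have "\<forall>\<^sub>F h in at_right (0::real). 0 < h \<and> Z \<theta> + h *\<^sub>R ?D \<theta> \<in> interior N"
        using eventually_at_right_less[of "0::real"] by eventually_elim blast
      then obtain h where h: "0 < h" "Z \<theta> + h *\<^sub>R ?D \<theta> \<in> interior N"
        using eventually_happens'[OF trivial_limit_at_right_real] by blast
      have e: "Z \<theta> + h *\<^sub>R ?D \<theta> = a + (r + h) *\<^sub>R ?D \<theta>" unfolding r(2) by (simp add: scaleR_left_distrib)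
      have "Z \<theta> + h *\<^sub>R ?D \<theta> \<in> N" using h(2) interior_subset by blast
      then have "a + (r + h) *\<^sub>R ?D \<theta> \<in> N" unfolding e .
      then have v: "visible S a (a + (r + h) *\<^sub>R ?D \<theta>)" using N'[OF th', of "r + h"] r(1) h(1) by simp
      have "a + (r / (r + h)) *\<^sub>R ((a + (r + h) *\<^sub>R ?D \<theta>) - a) \<in> open_segment a (a + (r + h) *\<^sub>R ?D \<theta>)"
        using r(1) h(1) D0[of \<theta>] by (intro in_openI) auto
      then have "Z \<theta> \<in> open_segment a (a + (r + h) *\<^sub>R ?D \<theta>)" using r(1,2) h(1) by simp
      moreover have "t \<in> S" using t by (simp add: first_def)
      ultimately show False using v r(4) by (auto simp: visible_def obstacles_def)
    qed
    ultimately show ?thesis using r(4) closure_subset by (auto simp: frontier_def)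
  qed
  define I where "I = connected_component_set (seg t \<inter> frontier N) (Z \<theta>1)"
  have \<theta>1': "\<theta>1 \<in> {0<..<\<delta>}" using \<theta>1 by auto
  have I: "I \<in> components (seg t \<inter> frontier N)" unfolding I_def using front[OF \<theta>1'] by (rule componentsI)
  have ZI: "Z \<theta> \<in> I" if "\<theta> \<in> {0<..<\<delta>}" for \<theta>
  proof -
    have "Z ` {0<..<\<delta>} \<subseteq> I" unfolding I_def
      by (rule connected_component_maximal) (use \<theta>1' conn front in auto)
    then show ?thesis using that by blast
  qed
  have "closed (seg t \<inter> frontier N)" using seg_closed by (intro closed_Int) auto
  then have "closed I" using closed_components I by blast
  moreover have "I \<subseteq> seg t" using in_components_subset[OF I] by blast
  ultimately have "compact I" using compact_Int_closed[OF seg_compact[of t], of I] by (simp add: Int_absorb1)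
  then have comp: "compact (convex hull (insert a I))" by (intro compact_convex_hull compact_insert)
  have ncoll: "\<not> collinear (insert a I)"
  proof
    assume c: "collinear (insert a I)"
    define \<theta>2 where "\<theta>2 = \<delta> / 3"
    have \<theta>2: "\<theta>2 \<in> {0<..<\<delta>}" "\<theta>2 \<noteq> \<theta>1" using \<delta> by (auto simp: \<theta>2_def \<theta>1_def)
    have "collinear {a, Z \<theta>1, Z \<theta>2}" using c by (rule collinear_subset) (use ZI \<theta>1' \<theta>2 in auto)
    then have o: "ori a (Z \<theta>1) (Z \<theta>2) = 0" by (simp add: collinear_iff_ori)
    obtain r1 where r1: "1 \<le> r1" "Z \<theta>1 = a + r1 *\<^sub>R ?D \<theta>1" using Z[OF \<theta>1'] by blast
    obtain r2 where r2: "1 \<le> r2" "Z \<theta>2 = a + r2 *\<^sub>R ?D \<theta>2" using Z[OF \<theta>2(1)] by blast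
    have "ori a (Z \<theta>1) (Z \<theta>2) = r1 * (r2 * ((\<theta>2 - \<theta>1) * cross d n))"
      unfolding r1 r2 by (simp add: ori_simps algebra_simps)
    then show False using o r1 r2 \<theta>2(2) dn by simp
  qed
  have T: "convex hull (insert a I) \<in> fan S a N"
  proof -
    have "t \<in> S" using t by (simp add: first_def)
    then show ?thesis unfolding fan_def using I ncoll by blast
  qed
  have "a + ?D \<theta> \<in> convex hull (insert a I)" if th: "\<theta> \<in> {0<..<\<delta>}" for \<theta>
  proof -
    obtain r where r: "1 \<le> r" "Z \<theta> = a + r *\<^sub>R ?D \<theta>" using Z[OF th] by blast
    have "a + (1 / r) *\<^sub>R (Z \<theta> - a) \<in> closed_segment a (Z \<theta>)" using r(1) by (intro in_closedI) auto
    then have "a + ?D \<theta> \<in> closed_segment a (Z \<theta>)" using r by simp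
    moreover have "closed_segment a (Z \<theta>) \<subseteq> convex hull (insert a I)"
      using ZI[OF th] by (intro closed_segment_subset convex_convex_hull) (auto intro: hull_inc)
    ultimately show ?thesis by blast
  qed
  then have ev: "\<forall>\<^sub>F \<theta> in at_right 0. a + ?D \<theta> \<in> convex hull (insert a I)"
    unfolding eventually_at_right_field using \<delta> by auto
  \<comment> \<open>The triangle is closed, so it also contains the limit; the direction
    \<open>d\<close> itself may pass through endpoints.\<close>
  have "((\<lambda>\<theta>. a + ?D \<theta>) \<longlongrightarrow> a + ?D 0) (at_right 0)" by (intro tendsto_intros)
  then have "a + ?D 0 \<in> convex hull (insert a I)"
    using Lim_in_closed_set[OF compact_imp_closed[OF comp] ev] by simp
  then show ?thesis using T by auto
qed

end

text \<open>A segment touching \<open>s\<close> in \<open>a\<close> and rising to the left of the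
  line from \<open>a\<close> to \<open>y\<close> is what hides \<open>y\<close> from the points of
  \<open>s\<close> just before \<open>a\<close>. In contrast to \<open>jump_region\<close>, this is
  a sign condition on directions, invariant under scaling from \<open>a\<close>.\<close>

definition jump_cond :: "sgmt set \<Rightarrow> sgmt \<Rightarrow> pt \<Rightarrow> pt \<Rightarrow> bool" where
  "jump_cond S s a y \<longleftrightarrow>
     (\<exists>t\<in>S. \<exists>z\<in>seg t. a \<in> seg t \<and> 0 < ori (fst s) (snd s) z \<and> 0 < ori a y z)"

text \<open>"To the left of" is transitive for directions in one open half-plane; the half-plane is
  the one above \<open>s\<close>.\<close>

lemma left_trans:
  assumes "a \<in> seg s" "0 < ori (fst s) (snd s) p" "0 < ori (fst s) (snd s) v" "0 < ori (fst s) (snd s) z"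
    and "0 < ori a p v" "0 < ori a v z"
  shows "0 < ori a p z"
proof -
  let ?e = "snd s - fst s"
  have c: "ori (fst s) (snd s) y = cross ?e (y - a)" for y
  proof -
    have "ori (fst s) (snd s) y = cross ?e (y - a) + ori (fst s) (snd s) a"
      by (simp add: ori_simps algebra_simps)
    then show ?thesis using assms(1) by simp
  qed
  \<comment> \<open>The Pluecker relation for four vectors of the plane.\<close>
  have "cross ?e (v - a) * ori a p z = cross ?e (p - a) * ori a v z + cross ?e (z - a) * ori a p v"
    by (simp add: ori_simps algebra_simps)
  moreover have "0 < cross ?e (p - a) * ori a v z" "0 < cross ?e (z - a) * ori a p v"
    using assms c by simp_all
  ultimately have "0 < cross ?e (v - a) * ori a p z" by linarith
  then show ?thesis using assms(3) c by (simp add: zero_less_mult_iff)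
qed

lemma support_of_line:
  assumes "a \<noteq> p" "ori a p (fst t) = 0" "ori a p (snd t) = 0"
  shows "ori (fst t) (snd t) p = 0"
proof -
  obtain f where f: "fst t = a + f *\<^sub>R (p - a)" using ori_zeroD assms(1,2) by blast
  obtain g where g: "snd t = a + g *\<^sub>R (p - a)" using ori_zeroD assms(1,3) by blast
  show ?thesis unfolding f g by (simp add: ori_simps algebra_simps)
qed

lemma jump_cond_scale: "jump_cond S s a y \<Longrightarrow> 0 < l \<Longrightarrow> jump_cond S s a (a + l *\<^sub>R (y - a))"
  unfolding jump_cond_def ori_line2 ori_same by (fastforce simp: zero_less_mult_iff)

section \<open>Jumps at points where a segment touches from above\<close>

context scene
begin

lemma fst_left:
  assumes s: "s \<in> S" "a \<in> seg s" "a \<noteq> fst s" "0 < ori (fst s) (snd s) y"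
  obtains m where "0 < m" "fst s = a + (- m) *\<^sub>R (snd s - fst s)" "ori a y (fst s) = m * ori (fst s) (snd s) y"
proof -
  obtain m where m: "0 \<le> m" "a = fst s + m *\<^sub>R (snd s - fst s)"
    using s(2) unfolding seg_def in_closed_iff by blast
  have "m \<noteq> 0" using m(2) s(3) by auto
  then have "0 < m" using m(1) by simp
  moreover have e: "fst s = a + (- m) *\<^sub>R (snd s - fst s)" using m(2) by simp
  moreover have "ori a y (fst s) = m * ori (fst s) (snd s) y" using ori_along[OF s(2), of y "- m"] e by simp
  ultimately show ?thesis using that by blast
qed

text \<open>Only segments through \<open>a\<close> can obstruct arbitrarily short moves of the apex
  to the left. Where such a segment meets the new line of sight, it is above \<open>s\<close> and to
  the left of the line from \<open>a\<close> to \<open>y\<close>, which is a jump.\<close>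

lemma no_jump_visible:
  assumes s: "s \<in> S" "a \<in> seg s" "a \<noteq> fst s" "0 < ori (fst s) (snd s) y"
    and vis: "visible S a y" and no: "\<not> jump_cond S s a y"
  shows "\<forall>\<^sub>F h in at_right 0. visible S y (a + h *\<^sub>R (fst s - a))"
proof -
  have ay: "a \<noteq> y" using s by auto
  have o: "0 < ori a y (fst s)" using fst_left[OF s] s(4) by (metis mult_pos_pos)
  have lim: "((\<lambda>h. a + h *\<^sub>R (fst s - a)) \<longlongrightarrow> a) (at_right 0)" by (rule tendsto_scale_at_right)
  show ?thesis
  proof (rule eventually_visible[OF finite_S])
    fix t assume t: "t \<in> S"
    show "\<forall>\<^sub>F h in at_right 0. seg t \<inter> open_segment y (a + h *\<^sub>R (fst s - a)) = {}"
    proof (cases "seg t \<inter> closed_segment y a \<subseteq> {y}")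
      case True
      show ?thesis by (rule eventually_clear[OF True ay lim])
    next
      case False
      moreover have "seg t \<inter> open_segment y a = {}" using vis t
        by (auto simp: visible_def obstacles_def open_segment_commute)
      ultimately have at: "a \<in> seg t" by (auto simp: open_segment_def)
      from eventually_at_right_less[of "0::real"]
      show ?thesis
      proof eventually_elim
        case (elim h)
        show ?case
        proof (rule ccontr)
          assume "\<not> ?thesis"
          then obtain c where c: "c \<in> seg t" "c \<in> open_segment y (a + h *\<^sub>R (fst s - a))" by blast
          obtain k where k: "0 < k" "k < 1" "c = y + k *\<^sub>R ((a + h *\<^sub>R (fst s - a)) - y)" using c(2) by (rule in_openE)
          have "ori (fst s) (snd s) c = (1 - k) * ori (fst s) (snd s) y"
            unfolding k(3) ori_line3 using s(2) by (simp add: ori_line3)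
          moreover have "ori a y c = k * (h * ori a y (fst s))"
            unfolding k(3) ori_line3 by simp
          ultimately have "0 < ori (fst s) (snd s) c" "0 < ori a y c" using k s(4) o elim by simp_all
          then show False using no t at c(1) unfolding jump_cond_def by blast
        qed
      qed
    qed
  qed
qed

lemma jump_region_imp:
  assumes s: "s \<in> S" "a \<in> seg s" "a \<noteq> fst s" "0 < ori (fst s) (snd s) y"
    and y: "y \<in> jump_region S s a"
  shows "visible S a y" "jump_cond S s a y"
proof -
  show vis: "visible S a y" using y by (simp add: jump_region_def vis_above_iff)
  obtain e where e: "0 < e" "\<And>x. x \<in> seg s \<Longrightarrow> x $ 1 < a $ 1 \<Longrightarrow> dist x a < e \<Longrightarrow> \<not> visible S x y"
    using y unfolding jump_region_def by blast
  show "jump_cond S s a y"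
  proof (rule ccontr)
    assume "\<not> ?thesis"
    then have 1: "\<forall>\<^sub>F h in at_right 0. visible S y (a + h *\<^sub>R (fst s - a))"
      using no_jump_visible[OF s vis] by blast
    have 2: "\<forall>\<^sub>F h in at_right 0. dist (a + h *\<^sub>R (fst s - a)) a < e"
      using tendstoD[OF tendsto_scale_at_right e(1)] .
    have 3: "\<forall>\<^sub>F h in at_right 0. h < (1::real)"
      by (rule order_tendstoD(2)[OF tendsto_ident_at]) simp
    from 1 2 3 eventually_at_right_less[of "0::real"] have "\<forall>\<^sub>F h in at_right (0::real). False"
    proof eventually_elim
      case (elim h)
      have "a + h *\<^sub>R (fst s - a) \<in> closed_segment a (fst s)" using elim by (intro in_closedI) auto
      then have "a + h *\<^sub>R (fst s - a) \<in> seg s" using seg_sub[OF s(2) seg_ends(1)] by blast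
      moreover have "fst s $ 1 < a $ 1" using seg_bounds[OF s(1,2)] seg_eqI[OF s(1) seg_ends(1) s(2)] s(3)
        by (metis less_eq_real_def)
      then have "(a + h *\<^sub>R (fst s - a)) $ 1 < a $ 1" using elim by (simp add: mult_pos_neg)
      ultimately show False using e(2) elim visible_sym by blast
    qed
    then show False by simp
  qed
qed

text \<open>By the crossing test, the touching segment separates \<open>y\<close> from the points of
  \<open>s\<close> to the left of \<open>a\<close>; closeness to \<open>a\<close> is what keeps
  \<open>ori x y z\<close> positive.\<close>

lemma jump_hides:
  assumes s: "s \<in> S" "a \<in> seg s" "0 < ori (fst s) (snd s) y" and j: "jump_cond S s a y"
  shows "\<exists>e>0. \<forall>x\<in>seg s. x $ 1 < a $ 1 \<and> dist x a < e \<longrightarrow> \<not> visible S x y"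
proof -
  obtain t z where t: "t \<in> S" "z \<in> seg t" "a \<in> seg t" "0 < ori (fst s) (snd s) z" "0 < ori a y z"
    using j unfolding jump_cond_def by blast
  have "((\<lambda>x. ori x y z) \<longlongrightarrow> ori a y z) (nhds a)" by (intro tendsto_intros filterlim_ident)
  then have "\<forall>\<^sub>F x in nhds a. 0 < ori x y z" using t(5) by (rule order_tendstoD)
  then obtain e where e: "0 < e" "\<And>x. dist x a < e \<Longrightarrow> 0 < ori x y z"
    unfolding eventually_nhds_metric by blast
  have "\<not> visible S x y" if x: "x \<in> seg s" "x $ 1 < a $ 1" "dist x a < e" for x
  proof -
    obtain k where k: "x = a + k *\<^sub>R (snd s - fst s)" using seg_other[OF s(2) x(1)] .
    have "k * (snd s $ 1 - fst s $ 1) < 0" using x(2) unfolding k by simp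
    then have k0: "k < 0" using nonvert[OF s(1)] by (simp add: mult_less_0_iff)
    have "ori a z x = - k * ori (fst s) (snd s) z" using ori_along[OF s(2), of z k] k by simp
    then have 1: "0 < ori a z x" using k0 t(4) by (simp add: mult_neg_pos)
    have 2: "ori a z y < 0" using t(5) ori_swap(2)[of a z y] by simp
    have "ori a y x = - k * ori (fst s) (snd s) y" using ori_along[OF s(2), of y k] k by simp
    then have "0 < ori a y x" using k0 s(3) by (simp add: mult_neg_pos)
    moreover have "ori x y a = - ori a y x" by (simp add: ori_simps algebra_simps)
    ultimately have 3: "ori x y a < 0" by simp
    have "ori a z x * ori a z y < 0" "ori x y a * ori x y z < 0"
      using 1 2 3 e(2)[OF x(3)] by (simp_all add: mult_less_0_iff)
    then have "open_segment x y \<inter> open_segment a z \<noteq> {}" using segments_cross by blast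
    moreover have "open_segment a z \<subseteq> seg t" using seg_sub[OF t(3,2)] by (auto simp: open_segment_def)
    ultimately show ?thesis using t(1) by (auto simp: visible_def obstacles_def)
  qed
  then show ?thesis using e(1) by blast
qed

lemma fan_halfplane:
  assumes "s \<in> S" "a \<in> seg s" "T \<in> fan S a N" "N \<subseteq> {y. 0 \<le> ori (fst s) (snd s) y}" "p \<in> interior T"
  shows "0 < ori (fst s) (snd s) p"
proof (rule halfplane_interior[OF _ ends_neq[OF assms(1)] assms(5)])
  obtain t I where I: "I \<in> components (seg t \<inter> frontier N)"
    "\<And>y. y \<in> T \<Longrightarrow> y \<noteq> a \<Longrightarrow> \<exists>i\<in>I. \<exists>k. 0 < k \<and> k \<le> 1 \<and> y = a + k *\<^sub>R (i - a)"
    by (rule fanE[OF assms(3)]) blast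
  have "closed {y. 0 \<le> ori (fst s) (snd s) y}" by (intro closed_Collect_le continuous_intros)
  then have cl: "closure N \<subseteq> {y. 0 \<le> ori (fst s) (snd s) y}" using assms(4) by (rule closure_minimal[rotated])
  show "T \<subseteq> {y. 0 \<le> ori (fst s) (snd s) y}"
  proof
    fix y assume y: "y \<in> T"
    show "y \<in> {y. 0 \<le> ori (fst s) (snd s) y}"
    proof (cases "y = a")
      case True then show ?thesis using assms(2) by simp
    next
      case False
      then obtain i k where i: "i \<in> I" "0 < k" "y = a + k *\<^sub>R (i - a)" using I(2) y by blast
      have "i \<in> closure N" using i(1) in_components_subset[OF I(1)] frontier_in_closure by blast
      then have "0 \<le> ori (fst s) (snd s) i" using cl by blast
      then show ?thesis unfolding i(3) using i(2) assms(2) by (simp add: ori_line3)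
    qed
  qed
qed

lemma fan_start_sound:
  assumes g: "generic p" and s: "s \<in> S" "a \<in> seg s" and T: "T \<in> fan S a N" "p \<in> interior T"
    and N: "N \<subseteq> vis_above S s a"
  shows "0 < ori (fst s) (snd s) p" "visible S a p"
proof -
  show "0 < ori (fst s) (snd s) p"
    by (rule fan_halfplane[OF s T(1) _ T(2)]) (use N in \<open>auto simp: vis_above_iff\<close>)
  then have ap: "a \<noteq> p" using s by auto
  have "p \<in> interior T - {a}" using T(2) ap by blast
  moreover have "open (interior T - {a})" by (intro open_Diff) auto
  moreover have "interior T - {a} \<subseteq> closure (vis_region S a)"
    using fan_subset_closure[OF T(1)] N interior_subset by (fastforce simp: vis_above_def)
  ultimately have "p \<in> interior (closure (vis_region S a))" using interiorI by blast
  then show "visible S a p" using interior_closure_visible[OF g ap] by blast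
qed

text \<open>\<open>p\<close> is only a limit of points satisfying \<open>jump_cond\<close>, and this
  condition is not closed. So a point \<open>v\<close> satisfying it is chosen to the left of the
  line from \<open>a\<close> to \<open>p\<close>; what is left of the line to \<open>v\<close> is
  then left of the line to \<open>p\<close>, by \<open>left_trans\<close>.\<close>

lemma fan_jump_sound:
  assumes g: "generic p" and s: "s \<in> S" "a \<in> seg s" "a \<noteq> fst s"
    and T: "T \<in> fan S a (jump_region S s a)" "p \<in> interior T"
  shows "jump_cond S s a p"
proof -
  let ?A = "{y. 0 < ori (fst s) (snd s) y}"
  let ?V = "{y \<in> ?A. jump_cond S s a y}"
  have "jump_region S s a \<subseteq> vis_above S s a" by (auto simp: jump_region_def)
  then have above: "0 < ori (fst s) (snd s) p" using fan_start_sound[OF g s(1,2) T] by blast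
  have openA: "open ?A" by (intro open_Collect_less continuous_intros)
  obtain t I where I: "I \<in> components (seg t \<inter> frontier (jump_region S s a))"
    "\<And>y. y \<in> T \<Longrightarrow> y \<noteq> a \<Longrightarrow> \<exists>i\<in>I. \<exists>k. 0 < k \<and> k \<le> 1 \<and> y = a + k *\<^sub>R (i - a)"
    by (rule fanE[OF T(1)]) blast
  have "interior T \<inter> ?A \<subseteq> closure ?V"
  proof
    fix y assume y: "y \<in> interior T \<inter> ?A"
    then have "y \<noteq> a" using s(2) by auto
    moreover have "y \<in> T" using y interior_subset by blast
    ultimately obtain i k where i: "i \<in> I" "0 < k" "k \<le> 1" "y = a + k *\<^sub>R (i - a)" using I(2) by blast
    have "ori (fst s) (snd s) y = k * ori (fst s) (snd s) i" unfolding i(4) ori_line3 using s(2) by simp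
    then have "i \<in> ?A" using y i(2) by (simp add: zero_less_mult_iff)
    moreover have "i \<in> closure (jump_region S s a)"
      using i(1) in_components_subset[OF I(1)] frontier_in_closure by blast
    ultimately have ic: "i \<in> closure (?A \<inter> jump_region S s a)"
      using open_Int_closure_subset[OF openA] by blast
    show "y \<in> closure ?V" unfolding i(4)
    proof (rule star_closure[OF ic i(2,3)])
      fix v l assume v: "v \<in> ?A \<inter> jump_region S s a" "0 < l" "l \<le> (1::real)"
      have "jump_cond S s a v" using jump_region_imp[OF s] v by blast
      then have "jump_cond S s a (a + l *\<^sub>R (v - a))" using jump_cond_scale v(2) by blast
      moreover have "0 < ori (fst s) (snd s) (a + l *\<^sub>R (v - a))" unfolding ori_line3 using s(2) v by simp
      ultimately show "a + l *\<^sub>R (v - a) \<in> ?V" by blast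
    qed
  qed
  moreover have "open (interior T \<inter> ?A)" using openA by blast
  ultimately have p: "p \<in> interior (closure ?V)" using interiorI above T(2) by blast
  have o: "0 < ori a p (fst s)" using fst_left[OF s above] above by (metis mult_pos_pos)
  obtain v where v: "v \<in> ?V" "0 < ori a p (fst s) * ori a p v"
    using closure_side[OF p, of a "fst s" "\<lambda>_. True"] o by auto
  have v': "0 < ori a p v" using v(2) o by (simp add: zero_less_mult_iff)
  obtain t z where t: "t \<in> S" "z \<in> seg t" "a \<in> seg t" "0 < ori (fst s) (snd s) z" "0 < ori a v z"
    using v(1) unfolding jump_cond_def by blast
  have "0 < ori a p z" using left_trans[OF s(2) above _ t(4) v' t(5)] v(1) by blast
  then show ?thesis using t unfolding jump_cond_def by blast
qed

lemma free_interior: "p \<in> H \<Longrightarrow> p \<notin> obstacles S \<Longrightarrow> p \<in> interior H"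
  using frontier_H closure_subset[of H] by (auto simp: frontier_def)

lemma fan_cover_free:
  assumes p: "p \<in> H" "p \<notin> obstacles S" and dn: "cross (p - a) n \<noteq> 0" and vis: "visible S a p"
    and N: "\<forall>\<^sub>F \<theta> in at_right 0. \<forall>r>0. a + r *\<^sub>R ((p - a) + \<theta> *\<^sub>R n) \<in> N \<longleftrightarrow>
      visible S a (a + r *\<^sub>R ((p - a) + \<theta> *\<^sub>R n))"
  shows "\<exists>T\<in>fan S a N. p \<in> T"
proof -
  have ap: "p \<noteq> a" using dn by (auto simp: cross_def)
  have lim: "((\<lambda>\<theta>. a + ((p - a) + \<theta> *\<^sub>R n)) \<longlongrightarrow> p) (at_right 0)"
    by (rule tendsto_eq_intros | simp)+
  have 1: "\<forall>\<^sub>F \<theta> in at_right 0. visible S a (a + ((p - a) + \<theta> *\<^sub>R n))"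
    using eventually_visible_open[OF finite_S vis p(2) ap lim] .
  have "\<forall>\<^sub>F y in nhds p. y \<in> interior H" using free_interior[OF p] by (intro eventually_nhds_in_open) auto
  then have "\<forall>\<^sub>F \<theta> in at_right 0. a + ((p - a) + \<theta> *\<^sub>R n) \<in> interior H"
    using lim by (rule eventually_compose_filterlim)
  then have 2: "\<forall>\<^sub>F \<theta> in at_right 0. \<exists>r>0. a + r *\<^sub>R ((p - a) + \<theta> *\<^sub>R n) \<in> obstacles S"
  proof (rule eventually_mono)
    fix \<theta> assume "a + ((p - a) + \<theta> *\<^sub>R n) \<in> interior H"
    then have h: "a + ((p - a) + \<theta> *\<^sub>R n) \<in> H" using interior_subset by blast
    have "cross ((p - a) + \<theta> *\<^sub>R n) n = cross (p - a) n" by (simp add: cross_def algebra_simps)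
    moreover have "cross 0 n = 0" by (simp add: cross_def)
    ultimately have "(p - a) + \<theta> *\<^sub>R n \<noteq> 0" using dn by metis
    then obtain r where "1 \<le> r" "a + r *\<^sub>R ((p - a) + \<theta> *\<^sub>R n) \<in> obstacles S" using ray_hits[OF h] by blast
    then show "\<exists>r>0. a + r *\<^sub>R ((p - a) + \<theta> *\<^sub>R n) \<in> obstacles S" by (intro exI[of _ r]) auto
  qed
  have "\<exists>T\<in>fan S a N. a + (p - a) \<in> T" by (rule fan_cover[OF dn N 1 2])
  then show ?thesis by simp
qed

text \<open>The reason for tilting rays in the direction of \<open>s\<close>: the height above
  \<open>s\<close> does not change, so tilted rays stay above \<open>s\<close>.\<close>

lemma above_ray:
  assumes "a \<in> seg s"
  shows "ori (fst s) (snd s) (a + r *\<^sub>R ((p - a) + \<theta> *\<^sub>R (snd s - fst s))) = r * ori (fst s) (snd s) p"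
proof -
  have "ori (fst s) (snd s) (a + r *\<^sub>R ((p - a) + \<theta> *\<^sub>R (snd s - fst s))) =
      (1 - r) * ori (fst s) (snd s) a + r * ori (fst s) (snd s) p"
    by (simp add: ori_simps algebra_simps)
  then show ?thesis using assms by simp
qed

lemma cross_above:
  assumes "a \<in> seg s" "0 < ori (fst s) (snd s) p"
  shows "cross (p - a) (snd s - fst s) \<noteq> 0"
proof -
  have "cross (p - a) (snd s - fst s) = ori (fst s) (snd s) a - ori (fst s) (snd s) p"
    by (simp add: ori_simps algebra_simps)
  then show ?thesis using assms by simp
qed

lemma fan_start_cover:
  assumes g: "generic p" and s: "s \<in> S" "0 < ori (fst s) (snd s) p" "visible S (fst s) p"
  shows "\<exists>T\<in>fan S (fst s) (vis_above S s (fst s)). p \<in> T"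
proof -
  have p: "p \<in> H" "p \<notin> obstacles S" using g by (simp_all add: generic_def)
  show ?thesis
    using fan_cover_free[OF p cross_above[OF seg_ends(1) s(2)] s(3)] above_ray[OF seg_ends(1)] s(2)
    by (simp add: vis_above_iff)
qed

text \<open>\<open>jump_cond\<close> is an open condition on directions, so on slightly tilted rays
  \<open>jump_region\<close> and visibility from \<open>a\<close> coincide, as
  \<open>fan_cover_free\<close> requires.\<close>

lemma fan_jump_cover:
  assumes g: "generic p" and s: "s \<in> S" "a \<in> seg s" "0 < ori (fst s) (snd s) p" "visible S a p"
    and j: "jump_cond S s a p"
  shows "\<exists>T\<in>fan S a (jump_region S s a). p \<in> T"
proof (rule fan_cover_free[OF _ _ cross_above[OF s(2,3)] s(4)])
  show "p \<in> H" "p \<notin> obstacles S" using g by (simp_all add: generic_def)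
  let ?D = "\<lambda>\<theta>::real. (p - a) + \<theta> *\<^sub>R (snd s - fst s)"
  obtain t z where t: "t \<in> S" "z \<in> seg t" "a \<in> seg t" "0 < ori (fst s) (snd s) z" "0 < ori a p z"
    using j unfolding jump_cond_def by blast
  have "((\<lambda>\<theta>. ori a (a + ?D \<theta>) z) \<longlongrightarrow> ori a (a + ?D 0) z) (at_right 0)" by (intro tendsto_intros)
  then have "\<forall>\<^sub>F \<theta> in at_right 0. 0 < ori a (a + ?D \<theta>) z" by (rule order_tendstoD) (use t(5) in simp)
  then show "\<forall>\<^sub>F \<theta> in at_right 0. \<forall>r>0. a + r *\<^sub>R ?D \<theta> \<in> jump_region S s a \<longleftrightarrow> visible S a (a + r *\<^sub>R ?D \<theta>)"
  proof (rule eventually_mono, intro allI impI)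
    fix \<theta> r :: real assume o: "0 < ori a (a + ?D \<theta>) z" and r: "0 < r"
    have "ori a (a + r *\<^sub>R ?D \<theta>) z = r * ori a (a + ?D \<theta>) z" by (simp add: ori_simps algebra_simps)
    then have "0 < ori a (a + r *\<^sub>R ?D \<theta>) z" using o r by simp
    then have jc: "jump_cond S s a (a + r *\<^sub>R ?D \<theta>)" using t unfolding jump_cond_def by blast
    have ab: "0 < ori (fst s) (snd s) (a + r *\<^sub>R ?D \<theta>)" using above_ray[OF s(2)] r s(3) by simp
    show "a + r *\<^sub>R ?D \<theta> \<in> jump_region S s a \<longleftrightarrow> visible S a (a + r *\<^sub>R ?D \<theta>)"
      using jump_hides[OF s(1,2) ab jc] ab by (auto simp: jump_region_def vis_above_iff)
  qed
qed

end

section \<open>Triangles containing a generic point\<close>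

lemma eventually_not_finite:
  fixes x0 :: pt
  assumes "finite V" "v \<noteq> 0"
  shows "\<forall>\<^sub>F h in at_right 0. x0 + h *\<^sub>R v \<notin> V"
proof -
  have "finite (V - {x0})" using assms(1) by simp
  then have "open (- (V - {x0}))" by (intro open_Compl finite_imp_closed)
  then have "\<forall>\<^sub>F y in nhds x0. y \<in> - (V - {x0})" by (rule eventually_nhds_in_open) simp
  then have "\<forall>\<^sub>F h in at_right 0. x0 + h *\<^sub>R v \<in> - (V - {x0})"
    by (rule eventually_compose_filterlim) (rule tendsto_scale_at_right)
  with eventually_at_right_less[of "0::real"] show ?thesis
    by eventually_elim (use assms(2) in auto)
qed

context scene
begin

text \<open>The first obstacle beyond \<open>q\<close> is no endpoint, because its visibility edge
  to \<open>q\<close> would extend to \<open>x\<close>; and it is not on a segment lying in the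
  line, which would have been met earlier.\<close>

lemma first_crossing:
  assumes s: "s \<in> S" "x \<in> open_segment (fst s) (snd s)" and a: "act S s x q" and no: "\<not> evg_collinear S x q"
    and k: "0 < k" and c: "c \<in> open_segment q (q + k *\<^sub>R (q - x))" "c \<in> obstacles S"
  obtains z t e where "z \<in> open_segment q (q + k *\<^sub>R (q - x))" "t \<in> S" "z \<in> open_segment (fst t) (snd t)"
    "e \<in> seg t" "ori x q e \<noteq> 0"
proof -
  let ?b = "q + k *\<^sub>R (q - x)"
  have above: "0 < ori (fst s) (snd s) q" using a by (simp add: act_def)
  have xq: "x \<noteq> q" using x_neq_q[OF s above] .
  have qb: "q \<noteq> ?b" using k xq by simp
  have c': "c \<in> closed_segment q ?b" "c \<noteq> q" using c(1) by (auto simp: open_segment_def)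
  obtain z where z: "z \<in> closed_segment q ?b" "z \<noteq> q" "z \<in> obstacles S" "visible S q z"
    using first_obstacle[OF finite_S qb c' c(2) act_clear_ray[OF a]] by blast
  have "z \<noteq> ?b" using z(4) c by (auto simp: visible_def)
  then have zo: "z \<in> open_segment q ?b" using z(1,2) by (auto simp: open_segment_def)
  obtain m where m: "0 < m" "m < 1" "z = q + m *\<^sub>R (?b - q)" using zo by (rule in_openE)
  have zx: "z = x + (1 + m * k) *\<^sub>R (q - x)" unfolding m(3) by (simp add: algebra_simps)
  have mk: "0 < m * k" using m k by simp
  have "q = x + (1 / (1 + m * k)) *\<^sub>R (z - x)" unfolding zx using mk by simp
  moreover have "x \<noteq> z" using zx xq mk by simp
  ultimately have qo: "q \<in> open_segment x z" using in_openI[of x z "1 / (1 + m * k)"] mk by simp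
  have "z \<notin> endpoints S"
  proof
    assume "z \<in> endpoints S"
    then have "vg_edge S z q" using a z(2,4) visible_sym by (auto simp: vg_edge_def act_def)
    then show False using extension_evg[OF s above _ _ qo] no a by (simp add: act_def)
  qed
  then obtain t where t: "t \<in> S" "z \<in> open_segment (fst t) (snd t)"
    using z(3) endpoint_or_open[of z _ S] unfolding obstacles_def by blast
  have "\<exists>e\<in>seg t. ori x q e \<noteq> 0"
  proof (rule ccontr)
    assume "\<not> ?thesis"
    then have l: "ori x q e = 0" if "e \<in> seg t" for e using that by blast
    have "ori q ?b e = 0" if "e \<in> seg t" for e
    proof -
      have "ori q ?b e = k * ori x q e" by (simp add: ori_simps algebra_simps)
      then show ?thesis using l[OF that] by simp
    qed
    then have "open_segment q z \<inter> seg t \<noteq> {}" using collinear_open_near[OF t(2) z(1,2)] by blast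
    then show False using z(4) t(1) by (auto simp: visible_def obstacles_def)
  qed
  then show ?thesis using that zo t by blast
qed

lemma active_end:
  assumes "active_edge S s x q w"
  obtains k where "0 < k" "w = q + k *\<^sub>R (q - x)" "x \<noteq> q" "q \<noteq> w"
proof -
  have "q \<in> open_segment x w" using assms by (simp add: active_edge_def right_side_edge_iff)
  then obtain k where k: "0 < k" "k < 1" "q = x + k *\<^sub>R (w - x)" "x \<noteq> w" by (rule in_openE)
  have "q - x = k *\<^sub>R (w - x)" using k(3) by simp
  then have "((1 - k) / k) *\<^sub>R (q - x) = (1 - k) *\<^sub>R (w - x)" using k(1) by simp
  moreover have "q + (1 - k) *\<^sub>R (w - x) = w" by (subst k(3)) (simp add: algebra_simps)
  ultimately have w: "w = q + ((1 - k) / k) *\<^sub>R (q - x)" by simp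
  have "x \<noteq> q" "q \<noteq> w" using \<open>q \<in> open_segment x w\<close> by (auto simp: open_segment_def)
  moreover have "0 < (1 - k) / k" using k(1,2) by simp
  ultimately show ?thesis using that w by blast
qed

text \<open>A transversal crossing of the edge beyond \<open>q\<close> would have an end on the
  right side, contrary to \<open>rse_no_right\<close>.\<close>

lemma active_free:
  assumes s: "s \<in> S" "x \<in> open_segment (fst s) (snd s)" and no: "\<not> evg_collinear S x q"
    and active: "active_edge S s x q w"
  shows "visible S q w"
proof (rule ccontr)
  assume "\<not> visible S q w"
  then obtain c where c: "c \<in> open_segment q w" "c \<in> obstacles S" by (auto simp: visible_def)
  have a: "act S s x q" using active_imp_act[OF s active no] .
  obtain k where k: "0 < k" "w = q + k *\<^sub>R (q - x)" "x \<noteq> q" "q \<noteq> w" using active by (rule active_end)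
  obtain z t e where z: "z \<in> open_segment q w" "t \<in> S" "z \<in> open_segment (fst t) (snd t)"
    "e \<in> seg t" "ori x q e \<noteq> 0"
    using first_crossing[OF s a no k(1), of c] c unfolding k(2)[symmetric] by blast
  have rse: "right_side_edge S s x q w" using active by (simp add: active_edge_def)
  have ow: "ori x w y = (1 + k) * ori x q y" for y unfolding k(2) by (simp add: ori_simps algebra_simps)
  obtain m where m: "0 < m" "m < 1" "z = q + m *\<^sub>R (w - q)" using z(1) by (rule in_openE)
  have "ori x q z = 0" unfolding m(3) k(2) by (simp add: ori_simps algebra_simps)
  then have opp: "ori x q (fst t) * ori x q (snd t) < 0" using opposite_ends[OF z(3) _ z(4,5)] by blast
  have "q \<in> open_segment x w" using rse by (simp add: right_side_edge_iff)
  then have "closed_segment x q \<union> closed_segment q w = closed_segment x w" "x \<noteq> q"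
    by (auto intro!: Un_closed_segment simp: open_segment_def)
  then have "z \<in> closed_segment x w" using z(1) by (auto simp: open_segment_def)
  moreover have "z = x + (1 + m * k) *\<^sub>R (q - x)" unfolding m(3) k(2) by (simp add: algebra_simps)
  then have "z \<noteq> x" using k m by (auto simp: add_pos_pos less_imp_neq[symmetric])
  ultimately have zo: "z \<in> open_segment x w" using z(1) by (auto simp: open_segment_def)
  have zt: "z \<in> seg t" using open_in_seg z(3) .
  have "0 \<le> ori x w (fst t)" "0 \<le> ori x w (snd t)"
    using rse_no_right[OF rse z(2) zt zo] seg_ends by blast+
  then have "0 \<le> ori x q (fst t)" "0 \<le> ori x q (snd t)" using ow k(1) by (simp_all add: zero_le_mult_iff)
  then show False using opp by (simp add: mult_less_0_iff)
qed

text \<open>The swept set lies in the wedge at \<open>q\<close> opposite to \<open>a b\<close>. An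
  interior point \<open>p\<close> is strictly inside the wedge, so the line through \<open>p\<close>
  and \<open>q\<close> meets \<open>s\<close> at an inner point \<open>x\<close> of
  \<open>a b\<close>. An obstacle between \<open>q\<close> and \<open>p\<close> would be transversal
  and would hide a neighbourhood of points that are limits of swept points.\<close>

lemma swept_sound:
  assumes s: "s \<in> S" and i: "sweep_interval S s q a b" and p: "p \<in> interior (swept_triangle S s q a b)"
  obtains x where "x \<in> open_segment a b" "q \<in> open_segment x p" "open_segment x p \<inter> obstacles S = {q}"
    "act S s x q" "0 < ori (fst s) (snd s) p"
proof -
  note i' = i[unfolded sweep_interval_def]
  have ab: "a \<in> seg s" "b \<in> seg s" "a $ 1 < b $ 1" using i' by auto
  have act: "act S s x q" "\<not> evg_collinear S x q" if "x \<in> open_segment a b" for x using i' that by auto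
  have sub: "open_segment a b \<subseteq> open_segment (fst s) (snd s)" using open_between ab by blast
  have "a \<noteq> b" using ab by auto
  then obtain x1 where "x1 \<in> open_segment a b" by (metis all_not_in_conv open_segment_eq_empty)
  then have above: "0 < ori (fst s) (snd s) q" using act by (auto simp: act_def)
  obtain \<mu> where \<mu>: "b = a + \<mu> *\<^sub>R (snd s - fst s)" using seg_other[OF ab(1,2)] .
  have "0 < \<mu> * (snd s $ 1 - fst s $ 1)" using ab(3) unfolding \<mu> by simp
  then have \<mu>0: "0 < \<mu>" using nonvert[OF s] by (simp add: zero_less_mult_iff)
  \<comment> \<open>Twice the area of the triangle \<open>a b q\<close>, positive because
    \<open>q\<close> is above \<open>s\<close>.\<close>
  define C where "C = - ori a q b"
  have C: "0 < C" unfolding C_def using ori_along[OF ab(1), of q \<mu>] \<mu> \<mu>0 above by simp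
  define U where "U = (\<Union>x\<in>open_segment a b. \<Union>w\<in>{w. active_edge S s x q w}. closed_segment q w)"
  have U: "\<exists>x\<in>open_segment a b. \<exists>m\<ge>0. u = q + m *\<^sub>R (q - x) \<and> visible S q u" if u: "u \<in> U" for u
  proof -
    obtain x w where x: "x \<in> open_segment a b" "active_edge S s x q w" "u \<in> closed_segment q w"
      using u unfolding U_def by blast
    obtain k where k: "0 < k" "w = q + k *\<^sub>R (q - x)" using x(2) by (rule active_end)
    obtain m where m: "0 \<le> m" "u = q + m *\<^sub>R (w - q)" using x(3) unfolding in_closed_iff by blast
    have "visible S q w" using active_free[OF s _ act(2)[OF x(1)] x(2)] sub x(1) by blast
    then have "visible S q u" using x(3) visible_prefix by blast
    moreover have "u = q + (m * k) *\<^sub>R (q - x)" unfolding m(2) k(2) by simp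
    ultimately show ?thesis using x(1) m k by (intro bexI[of _ x] exI[of _ "m * k"]) auto
  qed
  have T: "swept_triangle S s q a b = closure U" by (simp add: swept_triangle_def U_def)
  have Ua: "U \<subseteq> {y. 0 \<le> ori a q y}" and Ub: "U \<subseteq> {y. 0 \<le> ori q b y}"
  proof (safe)
    fix u assume "u \<in> U"
    then obtain x m where x: "x \<in> open_segment a b" "0 \<le> m" "u = q + m *\<^sub>R (q - x)" using U by blast
    obtain k where k: "0 < k" "k < 1" "x = a + k *\<^sub>R (b - a)" using x(1) by (rule in_openE)
    have "ori a q u = m * (k * C)" unfolding x(3) k(3) C_def by (simp add: ori_simps algebra_simps)
    then show "0 \<le> ori a q u" using x(2) k(1) C by simp
    have "ori q b u = m * ((1 - k) * C)" unfolding x(3) k(3) C_def by (simp add: ori_simps algebra_simps)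
    then show "0 \<le> ori q b u" using x(2) k(2) C by simp
  qed
  have cl: "closed {y. 0 \<le> ori u v y}" for u v by (intro closed_Collect_le continuous_intros)
  have qa: "a \<noteq> q" "q \<noteq> b" using above ab by auto
  have pa: "0 < ori a q p" using halfplane_interior[OF _ qa(1) p[unfolded T]] closure_minimal[OF Ua cl] by blast
  have pb: "0 < ori q b p" using halfplane_interior[OF _ qa(2) p[unfolded T]] closure_minimal[OF Ub cl] by blast
  \<comment> \<open>Coordinates of \<open>p - q\<close> in the basis \<open>q - a\<close>,
    \<open>q - b\<close>, by Cramer's rule; they are positive because \<open>p\<close> is strictly
    inside the wedge.\<close>
  define \<alpha> \<beta> where "\<alpha> = ori q b p / C" and "\<beta> = ori a q p / C"
  have ab0: "0 < \<alpha>" "0 < \<beta>" using pa pb C by (auto simp: \<alpha>_def \<beta>_def)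
  have "C *\<^sub>R (p - q) = ori q b p *\<^sub>R (q - a) + ori a q p *\<^sub>R (q - b)"
    unfolding C_def by (simp add: vec_eq_iff forall_2 ori_simps algebra_simps)
  then have "(1 / C) *\<^sub>R (C *\<^sub>R (p - q)) = (1 / C) *\<^sub>R (ori q b p *\<^sub>R (q - a) + ori a q p *\<^sub>R (q - b))" by simp
  then have pq: "p - q = \<alpha> *\<^sub>R (q - a) + \<beta> *\<^sub>R (q - b)"
    using C by (simp add: \<alpha>_def \<beta>_def scaleR_right_distrib)
  define M where "M = \<alpha> + \<beta>"
  have M: "0 < M" using ab0 by (simp add: M_def)
  \<comment> \<open>The mean of \<open>a\<close> and \<open>b\<close> with weights
    \<open>\<alpha>\<close> and \<open>\<beta>\<close>, the only choice with
    \<open>p - q = M *\<^sub>R (q - x)\<close>.\<close>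
  define x where "x = a + (\<beta> / M) *\<^sub>R (b - a)"
  have x: "x \<in> open_segment a b" unfolding x_def using \<open>a \<noteq> b\<close> ab0 by (intro in_openI) (auto simp: M_def)
  have "M *\<^sub>R (q - x) = M *\<^sub>R (q - a) - \<beta> *\<^sub>R (b - a)"
    unfolding x_def using M by (simp add: scaleR_right_diff_distrib scaleR_right_distrib)
  also have "\<dots> = \<alpha> *\<^sub>R (q - a) + \<beta> *\<^sub>R (q - b)" unfolding M_def by (simp add: algebra_simps)
  finally have "M *\<^sub>R (q - x) = p - q" using pq by simp
  then have pM: "p = q + M *\<^sub>R (q - x)" by simp
  have xo: "x \<in> open_segment (fst s) (snd s)" using x sub by blast
  have xs: "x \<in> seg s" using open_in_seg xo .
  have xq: "x \<noteq> q" using x_neq_q[OF s xo above] .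
  have "\<forall>\<^sub>F y in nhds p. y \<in> interior (closure U)" using p[unfolded T] by (intro eventually_nhds_in_open) auto
  then have "\<forall>\<^sub>F h in at_right 0. p + h *\<^sub>R (q - x) \<in> interior (closure U)"
    by (rule eventually_compose_filterlim) (rule tendsto_scale_at_right)
  with eventually_at_right_less[of "0::real"]
  have "\<forall>\<^sub>F h in at_right (0::real). 0 < h \<and> p + h *\<^sub>R (q - x) \<in> interior (closure U)" by eventually_elim blast
  then obtain h where h: "0 < h" "p + h *\<^sub>R (q - x) \<in> interior (closure U)"
    using eventually_happens'[OF trivial_limit_at_right_real] by blast
  define k where "k = M + h"
  have k: "0 < k" "M < k" using M h by (auto simp: k_def)
  let ?p2 = "q + k *\<^sub>R (q - x)"
  have p2: "?p2 \<in> interior (closure U)" using h(2) by (simp add: pM k_def algebra_simps)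
  have free: "open_segment q ?p2 \<inter> obstacles S = {}"
  proof (rule ccontr)
    assume "\<not> ?thesis"
    then obtain c where c: "c \<in> open_segment q ?p2" "c \<in> obstacles S" by blast
    obtain z t e where z: "z \<in> open_segment q ?p2" "t \<in> S" "z \<in> open_segment (fst t) (snd t)"
      "e \<in> seg t" "ori x q e \<noteq> 0"
      by (rule first_crossing[OF s xo act[OF x] k(1) c])
    have "ori q ?p2 e = k * ori x q e" by (simp add: ori_simps algebra_simps)
    then have "ori q ?p2 e \<noteq> 0" using z(5) k(1) by simp
    then have "\<forall>\<^sub>F y in nhds ?p2. \<not> visible S q y"
      using eventually_hidden_behind[OF z(2,3,1,4)] by blast
    then obtain W where W: "open W" "?p2 \<in> W" "\<And>y. y \<in> W \<Longrightarrow> \<not> visible S q y"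
      unfolding eventually_nhds by blast
    have "?p2 \<in> closure U" using p2 interior_subset by blast
    then have "W \<inter> U \<noteq> {}" using W(1,2) open_Int_closure_eq_empty[of W U] by blast
    then show False using W(3) U by blast
  qed
  have qp: "q = x + (1 / (1 + M)) *\<^sub>R (p - x)"
  proof -
    have "p - x = (1 + M) *\<^sub>R (q - x)" unfolding pM by (simp add: algebra_simps)
    then show ?thesis using M by simp
  qed
  have "p - x = (1 + M) *\<^sub>R (q - x)" unfolding pM by (simp add: algebra_simps)
  then have "x \<noteq> p" using xq M by auto
  then have qo: "q \<in> open_segment x p"
    unfolding in_open_iff by (intro conjI exI[of _ "1 / (1 + M)"] qp) (use M in auto)
  have "p = q + (M / k) *\<^sub>R (?p2 - q)" unfolding pM using k by simp
  moreover have "q \<noteq> ?p2" using k xq by simp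
  ultimately have "p \<in> closed_segment q ?p2" using in_closedI[of "M / k" q ?p2] k M by simp
  then have "open_segment q p \<subseteq> open_segment q ?p2" by (rule open_sub_open_left)
  then have free': "open_segment q p \<inter> obstacles S = {}" using free by blast
  have "closed_segment x q \<union> closed_segment q p = closed_segment x p"
    using qo by (intro Un_closed_segment) (auto simp: open_segment_def)
  then have "open_segment x p \<subseteq> open_segment x q \<union> {q} \<union> open_segment q p"
    by (auto simp: open_segment_def)
  moreover have "open_segment x q \<inter> obstacles S = {}" using act(1)[OF x] by (simp add: act_def visible_def)
  moreover have "q \<in> obstacles S" using act(1)[OF x] endpoint_obstacle by (simp add: act_def)
  ultimately have "open_segment x p \<inter> obstacles S = {q}" using qo free' by blast
  moreover have "0 < ori (fst s) (snd s) p"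
  proof -
    have "ori (fst s) (snd s) p = (1 + M) * ori (fst s) (snd s) q - M * ori (fst s) (snd s) x"
      unfolding pM by (simp add: ori_simps algebra_simps)
    then show ?thesis using xs M above by simp
  qed
  ultimately show ?thesis using that x qo act(1)[OF x] by blast
qed

text \<open>Here \<open>p\<close> becomes visible just after \<open>x0\<close>. Let \<open>q\<close>
  be the obstacle nearest to \<open>p\<close> on the line to \<open>x0\<close>. All segments there
  stay to the left, since anything on the right would hide \<open>p\<close> from the points after
  \<open>x0\<close>, and genericity excludes tangent ones. So \<open>q\<close> is an endpoint and
  the lower end of an active edge right after \<open>x0\<close>; points on these edges converge to
  \<open>p\<close>.\<close>

lemma swept_cover:
  assumes g: "generic p" and s: "s \<in> S" "0 < ori (fst s) (snd s) p" "x0 \<in> seg s" "c \<in> seg s" "x0 $ 1 < c $ 1"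
    and vis: "\<And>x. x \<in> open_segment x0 c \<Longrightarrow> visible S x p" and nvis: "\<not> visible S x0 p"
  shows "\<exists>T\<in>cover_above S s. p \<in> T"
proof -
  let ?X = "\<lambda>h. x0 + h *\<^sub>R (c - x0)"
  have X: "(?X \<longlongrightarrow> x0) (at_right 0)" by (rule tendsto_scale_at_right)
  have xp: "x0 \<noteq> p" using s by auto
  have cx: "c \<noteq> x0" using s(5) by auto
  obtain \<mu> where \<mu>: "c = x0 + \<mu> *\<^sub>R (snd s - fst s)" using seg_other[OF s(3,4)] .
  have "0 < \<mu> * (snd s $ 1 - fst s $ 1)" using s(5) unfolding \<mu> by simp
  then have \<mu>0: "0 < \<mu>" using nonvert[OF s(1)] by (simp add: zero_less_mult_iff)
  have right: "ori x0 y c = - \<mu> * ori (fst s) (snd s) y" for y using ori_along[OF s(3), of y \<mu>] \<mu> by simp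
  have cp: "ori x0 p c < 0" using right \<mu>0 s(2) by (simp add: mult_pos_pos)
  have Xp: "ori x0 y (?X h) = h * ori x0 y c" for y h by (simp add: ori_line3)
  have ev1: "\<forall>\<^sub>F h in at_right 0. h < (1::real)" by (rule order_tendstoD(2)[OF tendsto_ident_at]) simp
  have Xo: "?X h \<in> open_segment x0 c" if "0 < h" "h < 1" for h using that cx by (intro in_openI) auto
  have Xvis: "\<forall>\<^sub>F h in at_right 0. visible S (?X h) p"
    using ev1 eventually_at_right_less[of "0::real"] by eventually_elim (use Xo vis in blast)
  \<comment> \<open>Seen from \<open>p\<close>, a segment that meets the line and reaches to the
    right hides the points of \<open>s\<close> just after \<open>x0\<close>.\<close>
  have one_sided: "0 \<le> ori x0 p e" if t: "t \<in> S" "z \<in> seg t" "z \<in> open_segment x0 p" "e \<in> seg t" for t z e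
  proof (rule ccontr)
    assume "\<not> ?thesis"
    then have neg: "ori x0 p e < 0" by simp
    have zo: "z \<in> open_segment p x0" using t(3) by (simp add: open_segment_commute)
    have "\<forall>\<^sub>F h in at_right 0. 0 < ori p x0 e * ori p x0 (?X h) \<longrightarrow> \<not> visible S p (?X h)"
      using hidden_side[OF t(1) zo t(2,4) X] .
    with Xvis eventually_at_right_less[of "0::real"] have "\<forall>\<^sub>F h in at_right (0::real). False"
    proof eventually_elim
      case (elim h)
      have "0 < ori p x0 e * ori p x0 (?X h)"
        unfolding ori_swap(1)[of p x0] Xp using neg cp elim(2) by (simp add: mult_pos_neg mult_neg_neg)
      then show False using elim visible_sym by blast
    qed
    then show False by simp
  qed
  have "\<not> visible S p x0" using nvis visible_sym by blast
  then obtain q t0 where q: "t0 \<in> S" "q \<in> seg t0" "q \<in> open_segment p x0" "visible S p q" "q \<noteq> x0"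
    by (rule generic_block[OF g])
  have qo: "q \<in> open_segment x0 p" using q(3) by (simp add: open_segment_commute)
  obtain k where k: "0 < k" "k < 1" "q = x0 + k *\<^sub>R (p - x0)" using qo by (rule in_openE)
  have oq: "ori x0 q y = k * ori x0 p y" for y using ori_ray[OF k(3)] .
  have above: "0 < ori (fst s) (snd s) q" unfolding k(3) ori_line3 using k s(2,3) by simp
  have off: "ori x0 p (fst t) \<noteq> 0 \<or> ori x0 p (snd t) \<noteq> 0" if t: "t \<in> S" "q \<in> seg t" for t
  proof -
    have "seg_visible S p t" using t q(4) by (auto simp: seg_visible_def)
    then show ?thesis using g t(1) support_of_line[OF xp] by (auto simp: generic_def)
  qed
  have strict: "0 < ori x0 q z" if t: "t \<in> S" "q \<in> seg t" "z \<in> seg t" "z \<noteq> q" for t z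
  proof -
    have "ori x0 p z \<noteq> 0"
    proof
      assume z: "ori x0 p z = 0"
      have "ori x0 p q = 0" unfolding k(3) ori_line3 by simp
      then have "ori x0 p e = 0" if "e \<in> seg t" for e
        using seg_subset_line[OF t(2,3) t(4)[symmetric] _ z that] by blast
      then show False using off[OF t(1,2)] seg_ends by blast
    qed
    then show ?thesis using one_sided[OF t(1,2) qo t(3)] oq k(1) by simp
  qed
  have end': "q = fst t \<or> q = snd t" if t: "t \<in> S" "q \<in> seg t" for t
  proof (rule ccontr)
    assume n: "\<not> ?thesis"
    then have o: "q \<in> open_segment (fst t) (snd t)" using t(2) by (auto simp: seg_def open_segment_def)
    have "0 < ori x0 q (fst t)" "0 < ori x0 q (snd t)" using strict[OF t] n seg_ends by metis+
    then show False using opposite_ends[OF o, of x0 q "fst t"] by (auto simp: mult_less_0_iff)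
  qed
  have qe: "q \<in> endpoints S" using end'[OF q(1,2)] q(1) by (auto simp: endpoints_def)
  have ev_strict: "\<forall>\<^sub>F h in at_right 0. \<forall>t\<in>S. q \<in> seg t \<longrightarrow> (\<forall>z\<in>seg t. z \<noteq> q \<longrightarrow> 0 < ori (?X h) q z)"
  proof (intro eventually_ball_finite finite_S ballI)
    fix t assume t: "t \<in> S"
    show "\<forall>\<^sub>F h in at_right 0. q \<in> seg t \<longrightarrow> (\<forall>z\<in>seg t. z \<noteq> q \<longrightarrow> 0 < ori (?X h) q z)"
    proof (cases "q \<in> seg t")
      case qt: True
      define e where "e = (if q = fst t then snd t else fst t)"
      have q': "q = fst t \<or> q = snd t" using end'[OF t qt] .
      have e: "e \<in> seg t" "e \<noteq> q" using q' ends_neq[OF t] by (auto simp: e_def)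
      have "((\<lambda>h. ori (?X h) q e) \<longlongrightarrow> ori x0 q e) (at_right 0)" by (intro tendsto_intros X)
      then have "\<forall>\<^sub>F h in at_right 0. 0 < ori (?X h) q e" using strict[OF t qt e] by (rule order_tendstoD)
      then show ?thesis
      proof (rule eventually_mono, intro impI ballI)
        fix h z assume y: "0 < ori (?X h) q e" and z: "z \<in> seg t" "z \<noteq> q"
        have "closed_segment q e = seg t" using q' closed_segment_commute by (auto simp: e_def seg_def)
        then have "z \<in> closed_segment q e" using z(1) by simp
        then obtain m where m: "0 \<le> m" "z = q + m *\<^sub>R (e - q)" unfolding in_closed_iff by blast
        have "m \<noteq> 0" using m z(2) by auto
        then show "0 < ori (?X h) q z" unfolding m(2) ori_line3 using m(1) y by simp
      qed
    qed simp
  qed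
  have ev_vis: "\<forall>\<^sub>F h in at_right 0. visible S q (?X h)"
  proof (rule eventually_visible[OF finite_S])
    fix t assume t: "t \<in> S"
    have right_free: "seg t \<inter> open_segment q (?X h) = {}"
      if l: "\<And>e. e \<in> seg t \<Longrightarrow> 0 \<le> ori x0 p e" and h: "0 < h" for h
    proof (rule ccontr)
      assume "\<not> ?thesis"
      then obtain d where d: "d \<in> seg t" "d \<in> open_segment q (?X h)" by blast
      obtain m where m: "0 < m" "m < 1" "d = q + m *\<^sub>R (?X h - q)" using d(2) by (rule in_openE)
      have "ori x0 p d = m * (h * ori x0 p c)" unfolding m(3) ori_line3 Xp by (simp add: k(3) ori_line3)
      then have "ori x0 p d < 0" using m h cp by (simp add: mult_pos_neg)
      then show False using l[OF d(1)] by simp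
    qed
    show "\<forall>\<^sub>F h in at_right 0. seg t \<inter> open_segment q (?X h) = {}"
    proof (cases "seg t \<inter> closed_segment q x0 \<subseteq> {q}")
      case True
      show ?thesis by (rule eventually_clear[OF True q(5)[symmetric] X])
    next
      case False
      then obtain y where y: "y \<in> seg t" "y \<in> closed_segment q x0" "y \<noteq> q" by blast
      show ?thesis
      proof (cases "y = x0")
        case False
        have "y \<in> closed_segment x0 q" using y(2) by (simp add: closed_segment_commute)
        then have "y \<in> open_segment x0 p" using closed_in_open[OF qo _ False] by blast
        then have "\<And>e. e \<in> seg t \<Longrightarrow> 0 \<le> ori x0 p e" using one_sided t y(1) by blast
        then have rf: "0 < h \<Longrightarrow> seg t \<inter> open_segment q (?X h) = {}" for h using right_free by blast
        from eventually_at_right_less[of "0::real"] show ?thesis by eventually_elim (rule rf)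
      next
        case True
        then have x0t: "x0 \<in> seg t" using y(1) by simp
        \<comment> \<open>A segment that touches \<open>s\<close> in \<open>x0\<close> and crosses a
          line from \<open>q\<close> to the right of \<open>x0\<close> would separate
          \<open>p\<close> from points of \<open>s\<close> closer to \<open>x0\<close>, which see
          \<open>p\<close>.\<close>
        have rf: "seg t \<inter> open_segment q (?X h) = {}" if h: "0 < h" "h < 1" for h
        proof (rule ccontr)
          assume "\<not> ?thesis"
          then obtain d where d: "d \<in> seg t" "d \<in> open_segment q (?X h)" by blast
          obtain m where m: "0 < m" "m < 1" "d = q + m *\<^sub>R (?X h - q)" using d(2) by (rule in_openE)
          have "ori x0 p d = m * (h * ori x0 p c)" unfolding m(3) ori_line3 Xp by (simp add: k(3) ori_line3)
          then have dr: "ori x0 p d < 0" using m h cp by (simp add: mult_pos_neg)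
          have "ori (fst s) (snd s) d = (1 - m) * ori (fst s) (snd s) q"
            unfolding m(3) ori_line3 using s(3,4) by (simp add: ori_line3)
          then have da: "0 < ori (fst s) (snd s) d" using m above by simp
          have dc: "ori x0 d c < 0" using right[of d] da \<mu>0 by (simp add: mult_pos_pos)
          have "((\<lambda>h. ori p (?X h) d) \<longlongrightarrow> ori p x0 d) (at_right 0)" by (intro tendsto_intros X)
          moreover have "0 < ori p x0 d" using dr ori_swap(1)[of p x0 d] by simp
          ultimately have "\<forall>\<^sub>F h in at_right 0. 0 < ori p (?X h) d" by (rule order_tendstoD)
          with Xvis eventually_at_right_less[of "0::real"] have "\<forall>\<^sub>F h in at_right (0::real). False"
          proof eventually_elim
            case (elim j)
            have "ori p (?X j) x0 = ori x0 p (?X j)" using ori_rotate[of x0 p "?X j"] by simp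
            then have "ori p (?X j) x0 < 0" using Xp elim(2) cp by (simp add: mult_pos_neg)
            then have 1: "ori p (?X j) x0 * ori p (?X j) d < 0" using elim(3) by (simp add: mult_neg_pos)
            have "ori x0 d p = - ori x0 p d" by (rule ori_swap)
            then have "0 < ori x0 d p" using dr by simp
            moreover have "ori x0 d (?X j) < 0" using Xp dc elim(2) by (simp add: mult_pos_neg)
            ultimately have "ori x0 d p * ori x0 d (?X j) < 0" by (simp add: mult_pos_neg)
            then have "open_segment p (?X j) \<inter> open_segment x0 d \<noteq> {}" using segments_cross 1 by blast
            moreover have "open_segment x0 d \<subseteq> seg t" using seg_sub[OF x0t d(1)] by (auto simp: open_segment_def)
            ultimately have "\<not> visible S p (?X j)" using t by (auto simp: visible_def obstacles_def)
            then show False using elim visible_sym by blast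
          qed
          then show False by simp
        qed
        from eventually_at_right_less[of "0::real"] ev1 show ?thesis by eventually_elim (rule rf)
      qed
    qed
  qed
  have "c - x0 \<noteq> 0" using cx by simp
  \<comment> \<open>Since there are finitely many vertices, apexes close to \<open>x0\<close> but
    different from it are no vertices and carry no event.\<close>
  then have ev_vert: "\<forall>\<^sub>F h in at_right 0. ?X h \<notin> vsp_vertices S"
    by (rule eventually_not_finite[OF finite_vsp])
  from ev_strict ev_vis ev_vert ev1
  have "\<forall>\<^sub>F h in at_right 0. h < 1 \<and> act S s (?X h) q \<and> \<not> evg_collinear S (?X h) q"
    by eventually_elim (use qe above visible_sym evg_collinear_vertex in \<open>auto simp: act_def\<close>)
  then obtain h0 where h0: "0 < h0"
    and good: "\<And>h. 0 < h \<Longrightarrow> h < h0 \<Longrightarrow> h < 1 \<and> act S s (?X h) q \<and> \<not> evg_collinear S (?X h) q"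
    unfolding eventually_at_right_field by blast
  define h1 where "h1 = h0 / 2"
  have h1: "0 < h1" "h1 < h0" "h1 < 1" using h0 good[of "h0 / 2"] by (auto simp: h1_def)
  have Xs: "?X h \<in> seg s" if "0 < h" "h < 1" for h
    using Xo[OF that] open_between[OF s(3,4)] open_in_seg by blast
  have X1: "(?X h) $ 1 = x0 $ 1 + h * (c $ 1 - x0 $ 1)" for h by simp
  have "x0 $ 1 < (?X h1) $ 1" unfolding X1 using h1 s(5) by simp
  moreover have "act S s x q" if xx: "x \<in> open_segment x0 (?X h1)" for x
  proof -
    obtain m where m: "0 < m" "m < 1" "x = x0 + m *\<^sub>R (?X h1 - x0)" using xx by (rule in_openE)
    have "x = ?X (m * h1)" unfolding m(3) by simp
    moreover have "m * h1 < h1" "0 < m * h1" using m h1 by simp_all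
    then have "m * h1 < h0" using h1 by linarith
    ultimately show ?thesis using good[OF \<open>0 < m * h1\<close>] by simp
  qed
  ultimately obtain d b where db: "d \<in> seg s" "b \<in> seg s" "d $ 1 \<le> x0 $ 1" "x0 $ 1 < b $ 1"
    "swept_triangle S s q d b \<in> sweep S s (\<lambda>_. fst s) (vertices_on S s)"
    using sweep_vertices_complete[OF s(1,3) Xs[OF h1(1,3)]] by blast
  \<comment> \<open>The factor by which the line from \<open>x0\<close> is prolonged beyond
    \<open>q\<close> to reach \<open>p\<close>.\<close>
  define \<kappa> where "\<kappa> = (1 - k) / k"
  have \<kappa>: "0 < \<kappa>" using k by (simp add: \<kappa>_def)
  let ?u = "\<lambda>h. q + \<kappa> *\<^sub>R (q - ?X h)"
  have "q - x0 = k *\<^sub>R (p - x0)" unfolding k(3) by simp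
  then have "\<kappa> *\<^sub>R (q - x0) = (1 - k) *\<^sub>R (p - x0)" using k by (simp add: \<kappa>_def)
  then have "q + \<kappa> *\<^sub>R (q - x0) = p" by (simp add: k(3) algebra_simps)
  moreover have "(?u \<longlongrightarrow> q + \<kappa> *\<^sub>R (q - x0)) (at_right 0)" by (intro tendsto_intros X)
  ultimately have u: "(?u \<longlongrightarrow> p) (at_right 0)" by simp
  have "p \<noteq> q" using qo by (auto simp: open_segment_def)
  then have ev_u: "\<forall>\<^sub>F h in at_right 0. visible S q (?u h)"
    using eventually_visible_open[OF finite_S _ _ _ u] q(4) visible_sym g by (auto simp: generic_def)
  have "((\<lambda>h. (?X h) $ 1) \<longlongrightarrow> x0 $ 1) (at_right 0)" using X by (rule tendsto_vec_nth)
  then have ev_b: "\<forall>\<^sub>F h in at_right 0. (?X h) $ 1 < b $ 1" using db(4) by (rule order_tendstoD)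
  have ev_h: "\<forall>\<^sub>F h in at_right (0::real). h < h0" by (rule order_tendstoD(2)[OF tendsto_ident_at]) (use h0 in simp)
  define U where "U = (\<Union>x\<in>open_segment d b. \<Union>w\<in>{w. active_edge S s x q w}. closed_segment q w)"
  have db': "d $ 1 < b $ 1" using db by simp
  from ev_u ev_b ev_h eventually_at_right_less[of "0::real"]
  have "\<forall>\<^sub>F h in at_right 0. ?u h \<in> closure U"
  proof eventually_elim
    case (elim h)
    have gh: "h < 1" "act S s (?X h) q" using good[of h] elim by auto
    have xs: "?X h \<in> seg s" using Xs elim gh by blast
    have "x0 $ 1 < (?X h) $ 1" unfolding X1 using elim s(5) by simp
    then have xdb: "?X h \<in> open_segment d b" using open_between_iff[OF s(1) db(1,2) db'] xs elim(2) db(3) by simp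
    then have xo: "?X h \<in> open_segment (fst s) (snd s)" using open_between[OF db(1,2)] by blast
    obtain w where w: "active_edge S s (?X h) q w" using act_imp_active[OF s(1) xo gh(2)] by blast
    have "right_side_edge S s (?X h) q (?u h)"
      using act_rse[OF s(1) xs gh(2) \<kappa>] elim(1) by (simp add: visible_def)
    then have "?u h \<in> closed_segment q w" using active_extends[OF w] by blast
    then have "?u h \<in> U" unfolding U_def using xdb w by blast
    then show ?case using closure_subset by blast
  qed
  then have "p \<in> closure U" using Lim_in_closed_set[OF closed_closure _ _ u] by simp
  then have "p \<in> swept_triangle S s q d b" by (simp add: swept_triangle_def U_def)
  then show ?thesis using db(5) unfolding cover_above_def by blast
qed

text \<open>From a visible point of \<open>s\<close> one moves left to the infimum of the visible
  interval. If \<open>p\<close> is hidden from there, a swept triangle contains \<open>p\<close>; if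
  the infimum is the left end of \<open>s\<close>, the initial fan does; otherwise a touching
  segment stopped the interval and the jump fan does.\<close>

lemma cover_visible:
  assumes g: "generic p" and s: "s \<in> S" "0 < ori (fst s) (snd s) p" and v: "seg_visible S p s"
  shows "\<exists>T\<in>cover_above S s. p \<in> T"
proof -
  let ?Y = "\<lambda>r. fst s + r *\<^sub>R (snd s - fst s)"
  let ?V = "\<lambda>r. visible S (?Y r) p"
  obtain x1 where x1: "x1 \<in> seg s" "visible S p x1" using v by (auto simp: seg_visible_def)
  then obtain r1 where r1: "0 \<le> r1" "r1 \<le> 1" "x1 = ?Y r1" unfolding seg_def in_closed_iff by blast
  \<comment> \<open>Visibility is required on the whole range up to \<open>r1\<close>, so the
    infimum belongs to the visible interval around \<open>x1\<close> and is not merely the leftmost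
    visible point.\<close>
  define A where "A = {r. 0 \<le> r \<and> r \<le> r1 \<and> (\<forall>r'. r \<le> r' \<and> r' \<le> r1 \<longrightarrow> ?V r')}"
  have r1A: "r1 \<in> A" using r1 x1(2) visible_sym by (auto simp: A_def)
  have bdd: "bdd_below A" unfolding A_def by (auto intro: bdd_belowI[of _ 0])
  define r0 where "r0 = Inf A"
  have "A \<noteq> {}" using r1A by blast
  have A0: "0 \<le> r" if "r \<in> A" for r using that by (simp add: A_def)
  have r0: "0 \<le> r0" "r0 \<le> r1"
    unfolding r0_def using cInf_greatest[OF \<open>A \<noteq> {}\<close> A0] cInf_lower[OF r1A bdd] by blast+
  have V: "?V r" if r: "r0 < r" "r \<le> r1" for r
  proof -
    obtain r' where r': "r' \<in> A" "r' < r" using cInf_less_iff[OF \<open>A \<noteq> {}\<close> bdd] r(1) unfolding r0_def by blast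
    from r'(1) have "\<forall>r''. r' \<le> r'' \<and> r'' \<le> r1 \<longrightarrow> ?V r''" unfolding A_def by blast
    then show ?thesis using r(2) r'(2) by simp
  qed
  have Ys: "?Y r \<in> seg s" if "0 \<le> r" "r \<le> 1" for r unfolding seg_def using that by (rule in_closedI)
  have x0s: "?Y r0 \<in> seg s" using Ys r0 r1 by auto
  show ?thesis
  proof (cases "?V r0")
    case False
    then have "r0 < r1" using r0 r1 x1(2) visible_sym by (metis less_eq_real_def)
    have "?Y r0 $ 1 < ?Y r1 $ 1" using \<open>r0 < r1\<close> nonvert[OF s(1)] by simp
    moreover have "visible S x p" if x: "x \<in> open_segment (?Y r0) (?Y r1)" for x
    proof -
      obtain m where m: "0 < m" "m < 1" "x = ?Y r0 + m *\<^sub>R (?Y r1 - ?Y r0)" using x by (rule in_openE)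
      have "x = ?Y (r0 + m * (r1 - r0))" unfolding m(3) by (simp add: algebra_simps)
      moreover have "0 < m * (r1 - r0)" "m * (r1 - r0) < 1 * (r1 - r0)"
        using m \<open>r0 < r1\<close> by (simp, intro mult_strict_right_mono) auto
      ultimately show ?thesis using V[of "r0 + m * (r1 - r0)"] by simp
    qed
    ultimately show ?thesis using swept_cover[OF g s x0s Ys[OF r1(1,2)]] False by blast
  next
    case True
    show ?thesis
    proof (cases "r0 = 0")
      case r00: True
      then have "visible S (fst s) p" using True by simp
      then show ?thesis using fan_start_cover[OF g s] unfolding cover_above_def by blast
    next
      case False
      then have r0': "0 < r0" using r0 by simp
      then have nf: "?Y r0 \<noteq> fst s" using ends_neq[OF s(1)] by simp
      \<comment> \<open>Without a jump the points just to the left would be visible too, contrary to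
        the choice of the infimum.\<close>
      have j: "jump_cond S s (?Y r0) p"
      proof (rule ccontr)
        assume "\<not> ?thesis"
        then have "\<forall>\<^sub>F h in at_right 0. visible S p (?Y r0 + h *\<^sub>R (fst s - ?Y r0))"
          using no_jump_visible[OF s(1) x0s nf s(2) True] by blast
        then obtain h0 where h0: "0 < h0" "\<And>h. 0 < h \<Longrightarrow> h < h0 \<Longrightarrow> visible S p (?Y r0 + h *\<^sub>R (fst s - ?Y r0))"
          unfolding eventually_at_right_field by blast
        have Yh: "?Y r0 + h *\<^sub>R (fst s - ?Y r0) = ?Y (r0 - h * r0)" for h by (simp add: algebra_simps)
        define h where "h = min (h0 / 2) 1"
        have h: "0 < h" "h < h0" "h \<le> 1" using h0(1) by (auto simp: h_def)
        have "r0 - h * r0 \<in> A" unfolding A_def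
        proof (intro CollectI conjI allI impI)
          show "0 \<le> r0 - h * r0" using h r0' by (simp add: mult_left_le_one_le)
          have "0 \<le> h * r0" using h r0' by simp
          then show "r0 - h * r0 \<le> r1" using r0 by linarith
          fix r assume r: "r0 - h * r0 \<le> r \<and> r \<le> r1"
          show "?V r"
          proof (cases "r < r0")
            case True
            define h' where "h' = (r0 - r) / r0"
            have "h' * r0 = r0 - r" using r0' by (simp add: h'_def)
            then have "h' * r0 \<le> h * r0" using r by simp
            then have "h' \<le> h" using r0' by simp
            moreover have "0 < h'" using True r0' by (simp add: h'_def)
            ultimately have "visible S p (?Y r0 + h' *\<^sub>R (fst s - ?Y r0))" using h0(2)[of h'] h(2) by simp
            then have "visible S p (?Y (r0 - h' * r0))" unfolding Yh .
            then show ?thesis using \<open>h' * r0 = r0 - r\<close> visible_sym by simp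
          next
            case False
            then show ?thesis using V[of r] \<open>?V r0\<close> r by (cases "r = r0") auto
          qed
        qed
        then have "r0 \<le> r0 - h * r0" unfolding r0_def by (rule cInf_lower[OF _ bdd])
        then show False using h r0' by (simp add: mult_le_0_iff)
      qed
      obtain T where T: "T \<in> fan S (?Y r0) (jump_region S s (?Y r0))" "p \<in> T"
        using fan_jump_cover[OF g s(1) x0s s(2) True j] by blast
      \<comment> \<open>Jump fans are taken at vertices only; at an inner point of \<open>s\<close>
        the touching segment ends, which makes it one.\<close>
      have "?Y r0 \<in> vsp_vertices S"
      proof (cases "?Y r0 = snd s")
        case True
        then show ?thesis using endpoint_vertex s(1) by (auto simp: endpoints_def)
      next
        case False
        then have o: "?Y r0 \<in> open_segment (fst s) (snd s)" using nf x0s by (auto simp: seg_def open_segment_def)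
        obtain t z where t: "t \<in> S" "z \<in> seg t" "?Y r0 \<in> seg t" "0 < ori (fst s) (snd s) z"
          using j unfolding jump_cond_def by blast
        have "t \<noteq> s" using t(2,4) by auto
        then have "?Y r0 \<in> endpoints S"
          using touching_endpoint[OF s(1) t(1) _ o t(3)] t(1) by (auto simp: endpoints_def)
        then show ?thesis by (rule endpoint_vertex)
      qed
      then have "?Y r0 \<in> set (vertices_on S s) - {fst s}" using vertices_on(1)[OF s(1)] x0s nf by blast
      then show ?thesis using T unfolding cover_above_def by blast
    qed
  qed
qed

end

section \<open>Charging triangles to visible segments\<close>

text \<open>\<open>start_point S p c e x q\<close>: seen from \<open>p\<close>, a visible interval of the segment from \<open>c\<close> to \<open>e\<close>,
  traversed counterclockwise around \<open>p\<close>, starts at \<open>x\<close>, and \<open>q\<close> is the point nearest to \<open>p\<close> on the line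
  of sight towards \<open>x\<close>. Either \<open>x = c\<close>, or the interval starts at a point \<open>x\<close> where another segment
  touches, or \<open>q\<close> hides the points before \<open>x\<close>.\<close>

definition start_point :: "sgmt set \<Rightarrow> pt \<Rightarrow> pt \<Rightarrow> pt \<Rightarrow> pt \<Rightarrow> pt \<Rightarrow> bool" where
  "start_point S p c e x q \<longleftrightarrow> 0 < ori c e p \<and>
     (x = c \<and> q = c \<and> visible S c p \<or>
      x = q \<and> x \<in> closed_segment c e \<and> x \<noteq> c \<and> visible S x p \<and>
        (\<exists>t\<in>S. \<exists>z\<in>seg t. x \<in> seg t \<and> 0 < ori c e z \<and> 0 < ori x p z) \<or>
      x \<in> open_segment c e \<and> q \<in> open_segment x p \<and> open_segment x p \<inter> obstacles S = {q} \<and>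
        (\<forall>t\<in>S. q \<in> seg t \<longrightarrow> (\<forall>z\<in>seg t. z \<noteq> q \<longrightarrow> 0 < ori x q z)))"

text \<open>The ends are ordered so that \<open>p\<close> lies to the left of the line from
  \<open>cw p s\<close> to \<open>ccw p s\<close>. In these terms the two sides of \<open>s\<close>
  need no separate treatment.\<close>

definition cw :: "pt \<Rightarrow> sgmt \<Rightarrow> pt" where
  "cw p s = (if 0 < ori (fst s) (snd s) p then fst s else snd s)"

definition ccw :: "pt \<Rightarrow> sgmt \<Rightarrow> pt" where
  "ccw p s = (if 0 < ori (fst s) (snd s) p then snd s else fst s)"

lemma seg_cw: "closed_segment (cw p s) (ccw p s) = seg s"
  by (auto simp: cw_def ccw_def seg_def closed_segment_commute)

lemma open_cw: "open_segment (cw p s) (ccw p s) = open_segment (fst s) (snd s)"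
  by (auto simp: cw_def ccw_def open_segment_commute)

text \<open>Both points lie on the ray from \<open>p\<close> through \<open>q\<close>, beyond
  \<open>q\<close>; if they differed, the nearer one would be a second obstacle on the line of sight
  to the other.\<close>

lemma same_first_hit:
  fixes q :: pt
  assumes q: "q \<in> open_segment y p" "q \<in> open_segment y' p"
    and free: "open_segment y p \<inter> A = {q}" "open_segment y' p \<inter> A = {q}"
    and y: "y \<in> A" "y' \<in> A" "y \<noteq> q" "y' \<noteq> q"
  shows "y = y'"
proof -
  obtain k where k: "0 < k" "k < 1" "q = y + k *\<^sub>R (p - y)" "y \<noteq> p" using q(1) by (rule in_openE)
  obtain l where l: "0 < l" "l < 1" "q = y' + l *\<^sub>R (p - y')" "y' \<noteq> p" using q(2) by (rule in_openE)
  define r where "r = (1 - k) / (1 - l)"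
  have r: "0 < r" using k l by (simp add: r_def)
  have "q - p = (1 - k) *\<^sub>R (y - p)" unfolding k(3) by (simp add: algebra_simps)
  moreover have "q - p = (1 - l) *\<^sub>R (y' - p)" unfolding l(3) by (simp add: algebra_simps)
  ultimately have "(1 / (1 - l)) *\<^sub>R ((1 - l) *\<^sub>R (y' - p)) = (1 / (1 - l)) *\<^sub>R ((1 - k) *\<^sub>R (y - p))" by simp
  then have e: "y' - p = r *\<^sub>R (y - p)" using l(2) by (simp add: r_def)
  have nr: "\<not> r < 1"
  proof
    assume "r < 1"
    then have "p + r *\<^sub>R (y - p) \<in> open_segment p y" using r k(4) by (intro in_openI) auto
    then have "y' \<in> open_segment y p" by (simp add: e[symmetric] open_segment_commute)
    then show False using free y by blast
  qed
  have "\<not> 1 < r"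
  proof
    assume r1: "1 < r"
    have "y - p = (1 / r) *\<^sub>R (y' - p)" unfolding e using r by simp
    moreover have "p + (1 / r) *\<^sub>R (y' - p) \<in> open_segment p y'" using r r1 l(4) by (intro in_openI) auto
    ultimately have "y \<in> open_segment y' p" by (metis add.commute diff_add_cancel open_segment_commute)
    then show False using free y by blast
  qed
  then have "r = 1" using nr by simp
  then show ?thesis using e by simp
qed

text \<open>The comparison of \<open>q\<close> with \<open>x\<close> tells fans from swept
  triangles, and \<open>x = fst s\<close> tells the initial fan from a jump. So \<open>x\<close> and
  \<open>q\<close> identify the triangle, up to the choice within one fan, which \<open>p\<close>
  settles.\<close>

definition produces :: "sgmt set \<Rightarrow> sgmt \<Rightarrow> pt \<Rightarrow> pt \<Rightarrow> pt set \<Rightarrow> bool" where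
  "produces S s x q T \<longleftrightarrow>
     x = fst s \<and> q = x \<and> T \<in> fan S x (vis_above S s x) \<or>
     x \<noteq> fst s \<and> q = x \<and> T \<in> fan S x (jump_region S s x) \<or>
     q \<noteq> x \<and> (\<exists>a b. sweep_interval S s q a b \<and> x \<in> open_segment a b \<and> T = swept_triangle S s q a b)"

text \<open>Among the segments at \<open>q\<close> that reach to the left of the ray from
  \<open>q\<close> to \<open>p\<close>, the first one met when turning counterclockwise from that
  ray.\<close>

definition front_of :: "sgmt set \<Rightarrow> pt \<Rightarrow> pt \<Rightarrow> sgmt \<Rightarrow> bool" where
  "front_of S p q t \<longleftrightarrow> t \<in> S \<and> q \<in> seg t \<and> (\<exists>z0\<in>seg t. 0 < ori q p z0 \<and>
     (\<forall>t'\<in>S. q \<in> seg t' \<longrightarrow> (\<forall>z\<in>seg t'. 0 < ori q p z \<longrightarrow> 0 \<le> ori q z0 z)))"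

definition front :: "sgmt set \<Rightarrow> pt \<Rightarrow> pt \<Rightarrow> sgmt" where
  "front S p q = (SOME t. front_of S p q t)"

text \<open>\<open>False\<close> is the clockwise side of a segment, \<open>True\<close> the
  counterclockwise one. A jump at the far end of \<open>s\<close> is charged to the counterclockwise
  side of \<open>s\<close> itself.\<close>

definition slot :: "sgmt set \<Rightarrow> pt \<Rightarrow> sgmt \<Rightarrow> pt \<Rightarrow> pt \<Rightarrow> sgmt \<times> bool" where
  "slot S p s x q = (if x = cw p s \<and> q = x then (s, False)
     else if x = ccw p s then (s, True) else (front S p q, True))"

section \<open>Injectivity of the charging\<close>

context scene
begin

lemma triangle_start:
  assumes g: "generic p" and s: "s \<in> S" and T: "T \<in> cover_above S s" "p \<in> interior T"
  shows "\<exists>x q. start_point S p (fst s) (snd s) x q \<and> produces S s x q T"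
proof -
  consider (first) "T \<in> fan S (fst s) (vis_above S s (fst s))"
    | (jump) a where "a \<in> set (vertices_on S s)" "a \<noteq> fst s" "T \<in> fan S a (jump_region S s a)"
    | (swept) "T \<in> sweep S s (\<lambda>_. fst s) (vertices_on S s)"
    using T(1) unfolding cover_above_def by blast
  then show ?thesis
  proof cases
    case first
    have "start_point S p (fst s) (snd s) (fst s) (fst s)"
      using fan_start_sound[OF g s seg_ends(1) first T(2) order_refl] by (simp add: start_point_def)
    moreover have "produces S s (fst s) (fst s) T" using first by (simp add: produces_def)
    ultimately show ?thesis by blast
  next
    case jump
    have a: "a \<in> seg s" using jump(1) vertices_on(1)[OF s] by blast
    have sub: "jump_region S s a \<subseteq> vis_above S s a" by (auto simp: jump_region_def)
    have "start_point S p (fst s) (snd s) a a"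
      using fan_start_sound[OF g s a jump(3) T(2) sub] fan_jump_sound[OF g s a jump(2,3) T(2)] a jump(2)
      unfolding start_point_def jump_cond_def seg_def by blast
    moreover have "produces S s a a T" using jump by (simp add: produces_def)
    ultimately show ?thesis by blast
  next
    case swept
    obtain q a b where i: "sweep_interval S s q a b" "T = swept_triangle S s q a b"
      using sweep_vertices_sound[OF s swept] .
    obtain x where x: "x \<in> open_segment a b" "q \<in> open_segment x p" "open_segment x p \<inter> obstacles S = {q}"
      "act S s x q" "0 < ori (fst s) (snd s) p"
      using swept_sound[OF s i(1) T(2)[unfolded i(2)]] .
    have "x \<in> open_segment (fst s) (snd s)"
      using x(1) open_between[of a s b] i(1) by (auto simp: sweep_interval_def)
    then have "start_point S p (fst s) (snd s) x q"
      unfolding start_point_def using x(2-5) by (simp add: act_def)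
    moreover have "q \<noteq> x" using x(2) by (auto simp: open_segment_def)
    then have "produces S s x q T" unfolding produces_def using i x(1) by blast
    ultimately show ?thesis by blast
  qed
qed

lemma produces_unique:
  assumes s: "s \<in> S" and 1: "produces S s x q T" "p \<in> interior T" and 2: "produces S s x q T'" "p \<in> interior T'"
    and px: "p \<noteq> x"
  shows "T = T'"
proof (cases "q = x")
  case True
  have "vis_above S s x \<subseteq> vis_region S x" "jump_region S s x \<subseteq> vis_region S x"
    by (auto simp: vis_above_def jump_region_def)
  then show ?thesis using 1 2 True px fan_unique unfolding produces_def by blast
next
  case False
  obtain a b where ab: "sweep_interval S s q a b" "x \<in> open_segment a b" "T = swept_triangle S s q a b"
    using 1(1) False unfolding produces_def by blast
  obtain a' b' where ab': "sweep_interval S s q a' b'" "x \<in> open_segment a' b'" "T' = swept_triangle S s q a' b'"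
    using 2(1) False unfolding produces_def by blast
  show ?thesis using sweep_interval_unique[OF s ab(1) ab'(1) ab(2) ab'(2)] ab(3) ab'(3) by simp
qed

text \<open>Angles at \<open>q\<close> are compared through their cotangents, which are constant
  along each segment issuing from \<open>q\<close>. Only endpoints have to be examined, so a maximum
  exists.\<close>

lemma front_exists:
  assumes t: "t \<in> S" "q \<in> seg t" "z \<in> seg t" "0 < ori q p z"
  shows "front_of S p q (front S p q)"
proof -
  let ?E = "{e \<in> endpoints S. 0 < ori q p e \<and> (\<exists>t\<in>S. q \<in> seg t \<and> e \<in> seg t)}"
  \<comment> \<open>The cotangent of the angle from \<open>p - q\<close> to \<open>e - q\<close>. It
    decreases on the angles between 0 and pi, so its maximum belongs to the front-most
    segment.\<close>
  define f where "f e = ((e - q) \<bullet> (p - q)) / ori q p e" for e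
  have left_end: "\<exists>e\<in>?E. e \<in> seg u" if u: "u \<in> S" "q \<in> seg u" "v \<in> seg u" "0 < ori q p v" for u v
  proof -
    have "0 < ori q p (fst u) \<or> 0 < ori q p (snd u)"
    proof (rule ccontr)
      assume "\<not> ?thesis"
      then have n: "ori q p (fst u) \<le> 0" "ori q p (snd u) \<le> 0" by auto
      obtain k where k: "0 \<le> k" "k \<le> 1" "v = fst u + k *\<^sub>R (snd u - fst u)"
        using u(3) unfolding seg_def in_closed_iff by blast
      have "ori q p v = (1 - k) * ori q p (fst u) + k * ori q p (snd u)" unfolding k(3) ori_line3 ..
      moreover have "(1 - k) * ori q p (fst u) \<le> 0" "k * ori q p (snd u) \<le> 0"
        using k n by (auto intro: mult_nonneg_nonpos)
      ultimately show False using u(4) by linarith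
    qed
    moreover have "fst u \<in> endpoints S" "snd u \<in> endpoints S" using u(1) by (simp_all add: endpoints_def)
    ultimately show ?thesis using u(1,2) seg_ends[of u] by blast
  qed
  have fin: "finite ?E" using finite_endpoints by simp
  have ne: "?E \<noteq> {}" using left_end[OF t] by blast
  then have "Max (f ` ?E) \<in> f ` ?E" using fin by (intro Max_in) auto
  then obtain e0 where e0: "e0 \<in> ?E" "f e0 = Max (f ` ?E)" by (metis (no_types, lifting) imageE)
  have max: "f e \<le> f e0" if "e \<in> ?E" for e unfolding e0(2) using fin that by (intro Max_ge) auto
  have pq: "p \<noteq> q" using t(4) by auto
  then have dd: "0 < (p - q) \<bullet> (p - q)" by simp
  have best: "0 \<le> ori q e0 v" if u: "u \<in> S" "q \<in> seg u" "v \<in> seg u" "0 < ori q p v" for u v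
  proof -
    obtain e where e: "e \<in> ?E" "e \<in> seg u" using left_end[OF u] by blast
    obtain \<alpha> where \<alpha>: "v = q + \<alpha> *\<^sub>R (snd u - fst u)" using seg_other[OF u(2,3)] .
    obtain \<beta> where \<beta>: "e = q + \<beta> *\<^sub>R (snd u - fst u)" using seg_other[OF u(2) e(2)] .
    define D where "D = cross (p - q) (snd u - fst u)"
    have o: "ori q p v = \<alpha> * D" "ori q p e = \<beta> * D" unfolding \<alpha> \<beta> D_def by (simp_all add: ori_cross_dir)
    have nz: "\<alpha> \<noteq> 0" "\<beta> \<noteq> 0" "D \<noteq> 0" using o u(4) e(1) by auto
    have "f v = f e" unfolding f_def o unfolding \<alpha> \<beta> using nz by simp
    then have "f v \<le> f e0" using max[OF e(1)] by simp
    define X Y where "X = ori q p e0" and "Y = ori q p v"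
    have XY: "0 < X" "0 < Y" using e0(1) u(4) by (auto simp: X_def Y_def)
    \<comment> \<open>The subtraction formula for the sine, multiplied by the lengths.\<close>
    have "ori q e0 v * ((p - q) \<bullet> (p - q)) = ((e0 - q) \<bullet> (p - q)) * Y - ((v - q) \<bullet> (p - q)) * X"
      unfolding X_def Y_def by (simp add: ori_simps inner_vec_def sum_2 algebra_simps)
    also have "(e0 - q) \<bullet> (p - q) = f e0 * X" using XY by (simp add: f_def X_def[symmetric])
    also have "(v - q) \<bullet> (p - q) = f v * Y" using XY by (simp add: f_def Y_def[symmetric])
    finally have "ori q e0 v * ((p - q) \<bullet> (p - q)) = (f e0 - f v) * (X * Y)" by (simp add: algebra_simps)
    moreover have "0 \<le> (f e0 - f v) * (X * Y)" using XY \<open>f v \<le> f e0\<close> by simp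
    ultimately have "0 \<le> ori q e0 v * ((p - q) \<bullet> (p - q))" by simp
    then show ?thesis using dd by (simp add: zero_le_mult_iff)
  qed
  obtain t0 where t0: "t0 \<in> S" "q \<in> seg t0" "e0 \<in> seg t0" "0 < ori q p e0" using e0(1) by blast
  have "front_of S p q t0" unfolding front_of_def using t0 best by blast
  then show ?thesis unfolding front_def by (rule someI)
qed

text \<open>A start of the second or third kind in the interior of a segment is charged to the front-most
  segment that ends in \<open>q\<close>.\<close>

lemma inner_start:
  assumes st: "start_point S p (cw p s) (ccw p s) x q" and s: "s \<in> S" and x: "x \<noteq> cw p s" "x \<noteq> ccw p s"
  shows "x \<in> open_segment (fst s) (snd s)" "front_of S p q (front S p q)" "visible S p q"
    and "q = ccw p (front S p q)"
proof -
  let ?c = "cw p s" and ?e = "ccw p s" and ?t = "front S p q"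
  have kinds: "x = q \<and> x \<in> closed_segment ?c ?e \<and> visible S x p \<and>
        (\<exists>t\<in>S. \<exists>z\<in>seg t. x \<in> seg t \<and> 0 < ori ?c ?e z \<and> 0 < ori x p z) \<or>
      x \<in> open_segment ?c ?e \<and> q \<in> open_segment x p \<and> open_segment x p \<inter> obstacles S = {q} \<and>
        (\<forall>t\<in>S. q \<in> seg t \<longrightarrow> (\<forall>z\<in>seg t. z \<noteq> q \<longrightarrow> 0 < ori x q z))" (is "?J \<or> ?W")
    using st x unfolding start_point_def by blast
  have above: "0 < ori ?c ?e p" using st by (simp add: start_point_def)
  have "x \<in> open_segment ?c ?e" using kinds x by (auto simp: open_segment_def)
  then show xo: "x \<in> open_segment (fst s) (snd s)" by (simp add: open_cw)
  have xs: "x \<in> seg s" using open_in_seg xo .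
  have W: "0 < ori q p z \<longleftrightarrow> 0 < ori x q z" if qo: "q \<in> open_segment x p" for z
  proof -
    obtain k where k: "0 < k" "k < 1" "q = x + k *\<^sub>R (p - x)" using qo by (rule in_openE)
    have "ori q p z = (1 - k) * ori x p z" unfolding k(3) ori_line1 by simp
    moreover have "ori x q z = k * ori x p z" using ori_ray[OF k(3)] .
    ultimately show ?thesis using k by (simp add: zero_less_mult_iff)
  qed
  have "\<exists>t\<in>S. \<exists>z\<in>seg t. q \<in> seg t \<and> 0 < ori q p z"
    using kinds
  proof
    assume ?J then show ?thesis by blast
  next
    assume w: ?W
    then have "q \<in> obstacles S" by blast
    then obtain t where t: "t \<in> S" "q \<in> seg t" by (auto simp: obstacles_def)
    have "\<exists>z\<in>seg t. z \<noteq> q" using ends_neq[OF t(1)] seg_ends by metis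
    then show ?thesis using w W t by blast
  qed
  then show fr: "front_of S p q ?t" using front_exists by blast
  have "visible S q p"
    using kinds
  proof
    assume ?J then show ?thesis by blast
  next
    assume w: ?W
    then have "q \<in> open_segment p x" by (simp add: open_segment_commute)
    then have "open_segment p q \<subseteq> open_segment p x" by (intro open_sub_open_left) (auto simp: open_segment_def)
    then have "open_segment q p \<subseteq> open_segment x p - {q}" by (auto simp: open_segment_commute open_segment_def)
    then show ?thesis using w unfolding visible_def by blast
  qed
  then show "visible S p q" by (simp add: visible_sym)
  obtain z0 where z0: "?t \<in> S" "q \<in> seg ?t" "z0 \<in> seg ?t" "0 < ori q p z0"
    "\<And>t z. t \<in> S \<Longrightarrow> q \<in> seg t \<Longrightarrow> z \<in> seg t \<Longrightarrow> 0 < ori q p z \<Longrightarrow> 0 \<le> ori q z0 z"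
    using fr unfolding front_of_def by blast
  have end': "q = fst ?t \<or> q = snd ?t"
    using kinds
  proof
    assume j: ?J
    then obtain t1 z1 where t1: "t1 \<in> S" "z1 \<in> seg t1" "x \<in> seg t1" "0 < ori ?c ?e z1" "0 < ori x p z1" by blast
    \<comment> \<open>The part of \<open>s\<close> left of the ray from \<open>x\<close> to
      \<open>p\<close> is the part before \<open>x\<close>, and the touching segment is in front of
      it.\<close>
    have "?t \<noteq> s"
    proof
      assume "?t = s"
      then have "z0 \<in> seg s" using z0(3) by simp
      then have zc: "z0 \<in> closed_segment ?c ?e" by (simp add: seg_cw)
      have qx: "q = x" using j by blast
      obtain k where k: "0 < k" "k < 1" "x = ?c + k *\<^sub>R (?e - ?c)" using \<open>x \<in> open_segment ?c ?e\<close> by (rule in_openE)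
      obtain l where l: "z0 = ?c + l *\<^sub>R (?e - ?c)" using zc unfolding in_closed_iff by blast
      have zx: "ori x p z0 = (k - l) * ori ?c ?e p" unfolding k(3) l by (simp add: ori_simps algebra_simps)
      then have "0 < k - l" using z0(4) qx above by (simp add: zero_less_mult_iff)
      have "ori x z0 z1 = - (k - l) * ori ?c ?e z1" unfolding k(3) l by (simp add: ori_simps algebra_simps)
      then have "ori x z0 z1 < 0" using \<open>0 < k - l\<close> t1(4) by (simp add: mult_neg_pos)
      moreover have "0 \<le> ori x z0 z1" using z0(5)[OF t1(1)] t1 qx by simp
      ultimately show False by simp
    qed
    moreover have "q = x" using j by blast
    ultimately show ?thesis using touching_endpoint[OF s z0(1) _ xo] z0(2) by simp
  next
    assume w: ?W
    show ?thesis
    proof (rule ccontr)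
      assume n: "\<not> ?thesis"
      then have o: "q \<in> open_segment (fst ?t) (snd ?t)" using z0(2) by (auto simp: seg_def open_segment_def)
      have "0 < ori x q (fst ?t)" "0 < ori x q (snd ?t)" using w z0(1,2) n seg_ends by metis+
      then show False using opposite_ends[OF o, of x q "fst ?t"] by (auto simp: mult_less_0_iff)
    qed
  qed
  \<comment> \<open>The other end of \<open>?t\<close>. It lies to the left of the ray from
    \<open>q\<close> to \<open>p\<close>, so \<open>q\<close> is the counterclockwise end.\<close>
  define e' where "e' = (if q = fst ?t then snd ?t else fst ?t)"
  have "closed_segment q e' = seg ?t" using end' by (auto simp: e'_def seg_def closed_segment_commute)
  then have "z0 \<in> closed_segment q e'" using z0(3) by simp
  then obtain m where m: "0 \<le> m" "z0 = q + m *\<^sub>R (e' - q)" unfolding in_closed_iff by blast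
  have "ori q p z0 = m * ori q p e'" unfolding m(2) by (simp add: ori_line3)
  then have e'0: "0 < ori q p e'" using z0(4) m(1) by (simp add: zero_less_mult_iff)
  show "q = ccw p ?t"
  proof (cases "q = fst ?t")
    case True
    then have "ori (fst ?t) (snd ?t) p = - ori q p e'" using ori_swap(2)[of q e' p] by (simp add: e'_def)
    then show ?thesis using e'0 True by (simp add: ccw_def)
  next
    case False
    then have "q = snd ?t" using end' by blast
    then have "ori (fst ?t) (snd ?t) p = ori q p e'" using False ori_rotate[of e' q p] by (simp add: e'_def)
    then show ?thesis using e'0 \<open>q = snd ?t\<close> by (simp add: ccw_def)
  qed
qed

text \<open>Only a jump can start an interval at the far end. The segment touching there is in front
  of \<open>s\<close>, so \<open>s\<close> is not front-most at \<open>q\<close>; this prevents a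
  clash with inner starts charged to the counterclockwise side of \<open>s\<close>.\<close>

lemma end_start:
  assumes st: "start_point S p (cw p s) (ccw p s) (ccw p s) q" and s: "s \<in> S"
  shows "q = ccw p s" "visible S p q" "\<not> front_of S p q s"
proof -
  let ?c = "cw p s" and ?e = "ccw p s"
  have ne: "?c \<noteq> ?e" using ends_neq[OF s] by (auto simp: cw_def ccw_def)
  then have k: "?e = q" "visible S ?e p" "\<exists>t\<in>S. \<exists>z\<in>seg t. ?e \<in> seg t \<and> 0 < ori ?c ?e z \<and> 0 < ori ?e p z"
  proof -
    have "?e \<notin> open_segment ?c ?e" by (simp add: open_segment_def)
    then have *: "?e = q \<and> visible S ?e p \<and> (\<exists>t\<in>S. \<exists>z\<in>seg t. ?e \<in> seg t \<and> 0 < ori ?c ?e z \<and> 0 < ori ?e p z)"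
      using st ne[symmetric] unfolding start_point_def by blast
    then show "?e = q" "visible S ?e p" "\<exists>t\<in>S. \<exists>z\<in>seg t. ?e \<in> seg t \<and> 0 < ori ?c ?e z \<and> 0 < ori ?e p z"
      by blast+
  qed
  show "q = ?e" "visible S p q" using k visible_sym by auto
  have above: "0 < ori ?c ?e p" using st by (simp add: start_point_def)
  obtain t1 z1 where t1: "t1 \<in> S" "z1 \<in> seg t1" "?e \<in> seg t1" "0 < ori ?c ?e z1" "0 < ori ?e p z1" using k(3) by blast
  show "\<not> front_of S p q s"
  proof
    assume "front_of S p q s"
    then obtain z0 where z0: "z0 \<in> seg s" "0 < ori q p z0" "0 \<le> ori q z0 z1"
      using t1 k(1) unfolding front_of_def by blast
    have "z0 \<in> closed_segment ?c ?e" using z0(1) by (simp add: seg_cw)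
    then obtain l where l: "z0 = ?c + l *\<^sub>R (?e - ?c)" unfolding in_closed_iff by blast
    have "ori ?e p z0 = (1 - l) * ori ?c ?e p" unfolding l by (simp add: ori_simps algebra_simps)
    then have "0 < 1 - l" using z0(2) k(1) above by (simp add: zero_less_mult_iff)
    have "ori ?e z0 z1 = - (1 - l) * ori ?c ?e z1" unfolding l by (simp add: ori_simps algebra_simps)
    then have "ori ?e z0 z1 < 0" using \<open>0 < 1 - l\<close> t1(4) by (simp add: mult_neg_pos)
    then show False using z0(3) k(1) by simp
  qed
qed

lemma slot_visible:
  assumes st: "start_point S p (cw p s) (ccw p s) x q" and s: "s \<in> S"
  shows "fst (slot S p s x q) \<in> {t \<in> S. seg_visible S p t}"
proof -
  have ends: "cw p s \<in> seg s" "ccw p s \<in> seg s" by (auto simp: cw_def ccw_def)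
  consider (first) "x = cw p s" "q = x" | (last) "x = ccw p s" | (inner) "x \<noteq> cw p s" "x \<noteq> ccw p s"
    using st unfolding start_point_def open_segment_def by blast
  then show ?thesis
  proof cases
    case first
    have "cw p s \<noteq> ccw p s" using ends_neq[OF s] by (auto simp: cw_def ccw_def)
    then have "visible S (cw p s) p" using st first unfolding start_point_def open_segment_def by auto
    then have "seg_visible S p s" using ends visible_sym by (auto simp: seg_visible_def)
    then show ?thesis using first s by (simp add: slot_def)
  next
    case last
    have "seg_visible S p s" using end_start[OF st[unfolded last] s] ends by (auto simp: seg_visible_def)
    then show ?thesis using s last by (simp add: slot_def)
  next
    case inner
    have "seg_visible S p (front S p q)" "front S p q \<in> S"
      using inner_start(2,3)[OF st s inner] by (auto simp: seg_visible_def front_of_def)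
    then show ?thesis using inner by (simp add: slot_def)
  qed
qed

text \<open>At a jump, \<open>q\<close> is an inner point of the segment that carries it; in the
  swept case no segment has \<open>q\<close> as an inner point. So starts with equal
  \<open>q\<close> are of the same kind, and two swept ones see the same first obstacle behind
  \<open>q\<close>.\<close>

lemma inner_start_unique:
  assumes 1: "start_point S p (cw p s) (ccw p s) x q" "s \<in> S" "x \<noteq> cw p s" "x \<noteq> ccw p s"
    and 2: "start_point S p (cw p s') (ccw p s') x' q" "s' \<in> S" "x' \<noteq> cw p s'" "x' \<noteq> ccw p s'"
  shows "s = s'" "x = x'"
proof -
  have W: "q \<in> open_segment x p \<and> open_segment x p \<inter> obstacles S = {q} \<and>
        (\<forall>t\<in>S. q \<in> seg t \<longrightarrow> (\<forall>z\<in>seg t. z \<noteq> q \<longrightarrow> 0 < ori x q z)) \<or> x = q"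
    if "start_point S p (cw p s) (ccw p s) x q" "x \<noteq> cw p s" for s x
    using that unfolding start_point_def by blast
  have xo: "x \<in> open_segment (fst s) (snd s)" using inner_start(1)[OF 1] .
  have xo': "x' \<in> open_segment (fst s') (snd s')" using inner_start(1)[OF 2] .
  have mixed: False if w: "\<forall>t\<in>S. q \<in> seg t \<longrightarrow> (\<forall>z\<in>seg t. z \<noteq> q \<longrightarrow> 0 < ori y q z)"
    and u: "u \<in> S" "q \<in> open_segment (fst u) (snd u)" for y u
  proof -
    have "q \<in> seg u" "q \<noteq> fst u" "q \<noteq> snd u" using u(2) open_in_seg by (auto simp: open_segment_def)
    then have "0 < ori y q (fst u)" "0 < ori y q (snd u)" using w u(1) seg_ends by metis+
    then show False using opposite_ends[OF u(2), of y q "fst u"] by (auto simp: mult_less_0_iff)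
  qed
  have ends: "x \<in> obstacles S" "x' \<in> obstacles S"
    using open_in_seg[OF xo] open_in_seg[OF xo'] 1(2) 2(2) unfolding obstacles_def by blast+
  show xx: "x = x'"
    using W[OF 1(1,3)] W[OF 2(1,3)]
  proof (elim disjE conjE)
    assume "x = q" "x' = q"
    then show ?thesis by simp
  next
    assume "x' = q" "\<forall>t\<in>S. q \<in> seg t \<longrightarrow> (\<forall>z\<in>seg t. z \<noteq> q \<longrightarrow> 0 < ori x q z)"
    then show ?thesis using mixed 2(2) xo' by blast
  next
    assume "x = q" "\<forall>t\<in>S. q \<in> seg t \<longrightarrow> (\<forall>z\<in>seg t. z \<noteq> q \<longrightarrow> 0 < ori x' q z)"
    then show ?thesis using mixed 1(2) xo by blast
  next
    assume w: "q \<in> open_segment x p" "open_segment x p \<inter> obstacles S = {q}"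
      "q \<in> open_segment x' p" "open_segment x' p \<inter> obstacles S = {q}"
    then have "x \<noteq> q" "x' \<noteq> q" by (auto simp: open_segment_def)
    then show ?thesis using same_first_hit[OF w(1,3,2,4) ends] by blast
  qed
  show "s = s'" using disj[OF 1(2) 2(2)] xo xo' xx by blast
qed

text \<open>The side separates starts at the clockwise end from all others. For an inner start,
  \<open>q\<close> is recovered as the counterclockwise end of the charged segment; a start at the
  far end differs from it because its segment is not front-most there.\<close>

lemma slot_inj:
  assumes 1: "start_point S p (cw p s) (ccw p s) x q" "s \<in> S"
    and 2: "start_point S p (cw p s') (ccw p s') x' q'" "s' \<in> S"
    and eq: "slot S p s x q = slot S p s' x' q'"
  shows "s = s'" "x = x'" "q = q'"
proof -
  have ne: "cw p u \<noteq> ccw p u" if "u \<in> S" for u using ends_neq[OF that] by (auto simp: cw_def ccw_def)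
  have kinds: "x = cw p s \<and> q = x \<or> x = ccw p s \<and> x \<noteq> cw p s \<or> x \<noteq> cw p s \<and> x \<noteq> ccw p s"
    if "start_point S p (cw p s) (ccw p s) x q" for s x q
    using that unfolding start_point_def open_segment_def by blast
  have inner: "q = ccw p (front S p q) \<and> front_of S p q (front S p q)"
    if "start_point S p (cw p s) (ccw p s) x q" "s \<in> S" "x \<noteq> cw p s" "x \<noteq> ccw p s" for s x q
    using inner_start(2,4)[OF that] by blast
  have mixed: False
    if a: "start_point S p (cw p s) (ccw p s) (ccw p s) q" "s \<in> S"
      and b: "start_point S p (cw p s') (ccw p s') x' q'" "s' \<in> S" "x' \<noteq> cw p s'" "x' \<noteq> ccw p s'"
      and f: "s = front S p q'" for s q s' x' q'
    using end_start[OF a] inner[OF b] f by simp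
  have "s = s' \<and> x = x' \<and> q = q'"
    using kinds[OF 1(1)] kinds[OF 2(1)]
  proof (elim disjE conjE)
    assume a: "x = cw p s" "q = x" and b: "x' = cw p s'" "q' = x'"
    then have "s = s'" using eq by (simp add: slot_def)
    then show ?thesis using a b by simp
  next
    assume a: "x = ccw p s" "x \<noteq> cw p s" and b: "x' = ccw p s'" "x' \<noteq> cw p s'"
    then have "s = s'" using eq by (simp add: slot_def)
    moreover have "q = x" "q' = x'" using end_start(1)[OF 1(1)[unfolded a(1)] 1(2)]
      end_start(1)[OF 2(1)[unfolded b(1)] 2(2)] a b by simp_all
    ultimately show ?thesis using a b by simp
  next
    assume a: "x = ccw p s" "x \<noteq> cw p s" and b: "x' \<noteq> cw p s'" "x' \<noteq> ccw p s'"
    then have "s = front S p q'" using eq by (simp add: slot_def)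
    then show ?thesis using mixed[OF 1(1)[unfolded a(1)] 1(2) 2 b] by blast
  next
    assume a: "x \<noteq> cw p s" "x \<noteq> ccw p s" and b: "x' = ccw p s'" "x' \<noteq> cw p s'"
    then have "s' = front S p q" using eq by (simp add: slot_def)
    then show ?thesis using mixed[OF 2(1)[unfolded b(1)] 2(2) 1 a] by blast
  next
    assume a: "x \<noteq> cw p s" "x \<noteq> ccw p s" and b: "x' \<noteq> cw p s'" "x' \<noteq> ccw p s'"
    then have "front S p q = front S p q'" using eq by (simp add: slot_def)
    then have qq: "q = q'" using inner[OF 1 a] inner[OF 2 b] by metis
    show ?thesis using inner_start_unique[OF 1 a 2(1)[folded qq] 2(2) b] qq by blast
  qed (use eq in \<open>auto simp: slot_def\<close>)
  then show "s = s'" "x = x'" "q = q'" by auto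
qed

end

section \<open>Half turn and genericity\<close>

lemma closed_segment_uminus: "closed_segment (- a) (- b) = uminus ` closed_segment a b" for a :: pt
  using closed_segment_linear_image[of uminus a b] by (simp add: linear_uminus)

lemma open_segment_uminus: "open_segment (- a) (- b) = uminus ` open_segment a b" for a :: pt
  using open_segment_linear_image[of uminus a b] by (simp add: linear_uminus)

lemma rot_simps [simp]: "fst (rot s) = - snd s" "snd (rot s) = - fst s" "rot (rot s) = s"
  by (simp_all add: rot_def)

lemma seg_rot: "seg (rot s) = uminus ` seg s"
  unfolding seg_def by (simp add: closed_segment_uminus[symmetric] closed_segment_commute)

lemma mem_seg_rot [simp]: "- x \<in> seg (rot s) \<longleftrightarrow> x \<in> seg s"
  by (auto simp: seg_rot)

lemma obstacles_rot: "obstacles (rot ` S) = uminus ` obstacles S"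
  by (auto simp: obstacles_def seg_rot)

lemma visible_rot [simp]: "visible (rot ` S) (- a) (- b) = visible S a b"
  by (auto simp: visible_def obstacles_rot open_segment_uminus)

lemma seg_visible_rot [simp]: "seg_visible (rot ` S) (- p) (rot s) = seg_visible S p s"
  by (auto simp: seg_visible_def seg_rot)

lemma start_point_rot:
  assumes "start_point (rot ` S) (- p) (- c) (- e) (- x) (- q)"
  shows "start_point S p c e x q"
proof -
  have ex: "(\<exists>t\<in>rot ` S. \<exists>z\<in>seg t. - x \<in> seg t \<and> 0 < ori (- c) (- e) z \<and> 0 < ori (- x) (- p) z) \<longleftrightarrow>
      (\<exists>t\<in>S. \<exists>z\<in>seg t. x \<in> seg t \<and> 0 < ori c e z \<and> 0 < ori x p z)"
    by (simp add: seg_rot image_iff)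
  have all: "(\<forall>t\<in>rot ` S. - q \<in> seg t \<longrightarrow> (\<forall>z\<in>seg t. z \<noteq> - q \<longrightarrow> 0 < ori (- x) (- q) z)) \<longleftrightarrow>
      (\<forall>t\<in>S. q \<in> seg t \<longrightarrow> (\<forall>z\<in>seg t. z \<noteq> q \<longrightarrow> 0 < ori x q z))"
    by (simp add: seg_rot image_iff)
  have int: "open_segment (- x) (- p) \<inter> obstacles (rot ` S) = {- q} \<longleftrightarrow> open_segment x p \<inter> obstacles S = {q}"
  proof -
    have "open_segment (- x) (- p) \<inter> obstacles (rot ` S) = uminus ` (open_segment x p \<inter> obstacles S)"
      unfolding obstacles_rot open_segment_uminus by auto
    moreover have "{- q} = uminus ` {q}" by simp
    ultimately show ?thesis by (metis inj_image_eq_iff inj_uminus)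
  qed
  have mem: "- x \<in> closed_segment (- c) (- e) \<longleftrightarrow> x \<in> closed_segment c e"
    "- x \<in> open_segment (- c) (- e) \<longleftrightarrow> x \<in> open_segment c e"
    "- q \<in> open_segment (- x) (- p) \<longleftrightarrow> q \<in> open_segment x p"
    unfolding closed_segment_uminus open_segment_uminus by auto
  show ?thesis using assms unfolding start_point_def ex all int mem by simp
qed

context scene
begin

text \<open>The half turn preserves \<open>ori\<close>; exchanging the ends reverses it, which swaps
  the two alternatives of \<open>inner_side\<close>.\<close>

lemma scene_rot: "scene (rot ` S) (uminus ` H)"
proof
  show "finite (rot ` S)" using finite_S by simp
  show "fst s $ 1 < snd s $ 1" if "s \<in> rot ` S" for s using that nonvert by auto
  show "open_segment (fst s) (snd s) \<inter> open_segment (fst t) (snd t) = {}"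
    if st: "s \<in> rot ` S" "t \<in> rot ` S" "s \<noteq> t" for s t
  proof -
    obtain s' t' where "s' \<in> S" "t' \<in> S" "s = rot s'" "t = rot t'" "s' \<noteq> t'" using st by blast
    then show ?thesis using disj[of s' t']
      by (auto simp: open_segment_uminus open_segment_commute[of "snd _"])
  qed
  show "convex (uminus ` H)" using convex_H by (rule convex_negations)
  show "bounded (uminus ` H)" using bounded_H by simp
  show "obstacles (rot ` S) \<subseteq> uminus ` H" unfolding obstacles_rot using obstacles_H by blast
  have "frontier (uminus ` H) = uminus ` frontier H"
    unfolding frontier_def interior_negations using closure_scaleR[of "-1" H] by (auto simp: image_image)
  then show "frontier (uminus ` H) \<subseteq> obstacles (rot ` S)" unfolding obstacles_rot using frontier_H by blast
  fix p assume "p \<in> obstacles (rot ` S)"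
  then obtain p' where p': "p' \<in> obstacles S" "p = - p'" unfolding obstacles_rot by blast
  obtain s where s: "s \<in> S" "p' \<in> seg s"
    "p' \<noteq> snd s \<and> (\<exists>m\<in>H. 0 < ori (fst s) (snd s) m) \<or> p' \<noteq> fst s \<and> (\<exists>m\<in>H. ori (fst s) (snd s) m < 0)"
    using inner_side[OF p'(1)] by blast
  have "p \<noteq> fst (rot s) \<and> (\<exists>m\<in>uminus ` H. ori (fst (rot s)) (snd (rot s)) m < 0) \<or>
    p \<noteq> snd (rot s) \<and> (\<exists>m\<in>uminus ` H. 0 < ori (fst (rot s)) (snd (rot s)) m)"
    using s(3) p'(2) ori_swap(1)[of "snd s" "fst s"] by auto
  then show "\<exists>s\<in>rot ` S. p \<in> seg s \<and> (p \<noteq> snd s \<and> (\<exists>m\<in>uminus ` H. 0 < ori (fst s) (snd s) m) \<or>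
       p \<noteq> fst s \<and> (\<exists>m\<in>uminus ` H. ori (fst s) (snd s) m < 0))"
    using s(1,2) p'(2) by (intro bexI[of _ "rot s"]) auto
qed

text \<open>Rays from \<open>fst t\<close> tilted slightly upwards are covered by the initial fan
  and converge to \<open>p\<close>. All triangles of that fan stay above the supporting line, so
  \<open>p\<close> cannot be interior to the one that contains it.\<close>

lemma support_frontier:
  assumes p: "p \<in> H" "p \<notin> obstacles S" and t: "t \<in> S" and pt: "p = fst t + k *\<^sub>R (snd t - fst t)" "k < 0"
    and vis: "visible S (fst t) p"
  shows "\<exists>T\<in>cover_above S t. p \<in> T \<and> p \<notin> interior T"
proof -
  \<comment> \<open>Straight up, since the direction of \<open>t\<close> would be parallel to
    \<open>p - fst t\<close>.\<close>
  let ?n = "vector [0, 1] :: pt"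
  have pa: "p - fst t = k *\<^sub>R (snd t - fst t)" using pt(1) by simp
  have "cross (p - fst t) ?n = k * (snd t $ 1 - fst t $ 1)" unfolding pa by (simp add: cross_def)
  then have dn: "cross (p - fst t) ?n \<noteq> 0" using pt(2) nonvert[OF t] by simp
  have o: "ori (fst t) (snd t) (fst t + r *\<^sub>R ((p - fst t) + \<theta> *\<^sub>R ?n)) = r * (\<theta> * (snd t $ 1 - fst t $ 1))" for r \<theta>
    unfolding pa by (simp add: ori_simps algebra_simps)
  have "\<exists>T\<in>fan S (fst t) (vis_above S t (fst t)). p \<in> T"
  proof (rule fan_cover_free[OF p dn vis])
    show "\<forall>\<^sub>F \<theta> in at_right 0. \<forall>r>0. fst t + r *\<^sub>R (p - fst t + \<theta> *\<^sub>R ?n) \<in> vis_above S t (fst t) \<longleftrightarrow>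
      visible S (fst t) (fst t + r *\<^sub>R (p - fst t + \<theta> *\<^sub>R ?n))"
      using eventually_at_right_less[of "0::real"]
      by eventually_elim (use nonvert[OF t] in \<open>simp add: vis_above_iff o\<close>)
  qed
  then obtain T where T: "T \<in> fan S (fst t) (vis_above S t (fst t))" "p \<in> T" by blast
  have "ori (fst t) (snd t) p = 0" unfolding pt(1) ori_line3 by simp
  moreover have "vis_above S t (fst t) \<subseteq> {y. 0 \<le> ori (fst t) (snd t) y}" by (auto simp: vis_above_iff)
  ultimately have "p \<notin> interior T" using fan_halfplane[OF t seg_ends(1) T(1)] by fastforce
  then show ?thesis using T unfolding cover_above_def by blast
qed

text \<open>From the last point \<open>a\<close> at or before \<open>p\<close> that is touched from
  above, or from the left end, the segment \<open>s\<close> is free on its upper side until beyond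
  \<open>p\<close>. So a fan with apex \<open>a\<close> has a triangle with a side along
  \<open>s\<close> through \<open>p\<close>, while all its triangles stay above
  \<open>s\<close>.\<close>

lemma obstacle_frontier:
  assumes s: "s \<in> S" "p \<in> seg s" "p \<noteq> snd s" and m: "m \<in> H" "0 < ori (fst s) (snd s) m"
  shows "\<exists>T\<in>cover_above S s. p \<in> T \<and> p \<notin> interior T"
proof -
  define touch where "touch x \<longleftrightarrow> (\<exists>t\<in>S. x \<in> seg t \<and> (\<exists>z\<in>seg t. 0 < ori (fst s) (snd s) z))" for x
  have touch_vertex: "x \<in> vsp_vertices S" if x: "touch x" "x \<in> seg s" for x
  proof -
    obtain t z where t: "t \<in> S" "x \<in> seg t" "z \<in> seg t" "0 < ori (fst s) (snd s) z"
      using x(1) unfolding touch_def by blast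
    have ts: "s \<noteq> t" using t(3,4) by auto
    consider "x = fst s" | "x = snd s" | "x \<in> open_segment (fst s) (snd s)"
      using x(2) by (auto simp: seg_def open_segment_def)
    then have "x \<in> endpoints S"
      using touching_endpoint[OF s(1) t(1) ts _ t(2)] s(1) t(1) by cases (auto simp: endpoints_def)
    then show ?thesis by (rule endpoint_vertex)
  qed
  define A where "A = {x \<in> vsp_vertices S \<inter> seg s. x $ 1 \<le> p $ 1 \<and> (x = fst s \<or> touch x)}"
  have finA: "finite A" using finite_vsp by (simp add: A_def)
  have "fst s \<in> A" using endpoint_vertex s(1) seg_bounds[OF s(1,2)] by (auto simp: A_def endpoints_def)
  then have "Max ((\<lambda>x. x $ 1) ` A) \<in> (\<lambda>x. x $ 1) ` A" using finA by (intro Max_in) auto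
  then obtain a where a: "a \<in> A" "a $ 1 = Max ((\<lambda>x. x $ 1) ` A)" by auto
  have amax: "x $ 1 \<le> a $ 1" if "x \<in> A" for x unfolding a(2) using finA that by (intro Max_ge) auto
  have as: "a \<in> seg s" "a $ 1 \<le> p $ 1" "a = fst s \<or> touch a" "a \<in> vsp_vertices S" using a(1) by (auto simp: A_def)
  have p_lt: "p $ 1 < snd s $ 1" using seg_bounds[OF s(1,2)] seg_eqI[OF s(1,2) seg_ends(2)] s(3) by force
  have "\<forall>\<^sub>F h in at_right (0::real). \<forall>x\<in>vsp_vertices S. p $ 1 < x $ 1 \<longrightarrow> (p + h *\<^sub>R (snd s - p)) $ 1 < x $ 1"
  proof (intro eventually_ball_finite finite_vsp ballI)
    fix x :: pt
    have "((\<lambda>h. (p + h *\<^sub>R (snd s - p)) $ 1) \<longlongrightarrow> p $ 1) (at_right 0)"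
      by (intro tendsto_vec_nth tendsto_scale_at_right)
    then show "\<forall>\<^sub>F h in at_right 0. p $ 1 < x $ 1 \<longrightarrow> (p + h *\<^sub>R (snd s - p)) $ 1 < x $ 1"
      by (cases "p $ 1 < x $ 1") (auto dest: order_tendstoD(2))
  qed
  moreover have "\<forall>\<^sub>F h in at_right 0. h < (1::real)" by (rule order_tendstoD(2)[OF tendsto_ident_at]) simp
  ultimately have "\<forall>\<^sub>F h in at_right (0::real). 0 < h \<and> h < 1 \<and>
      (\<forall>x\<in>vsp_vertices S. p $ 1 < x $ 1 \<longrightarrow> (p + h *\<^sub>R (snd s - p)) $ 1 < x $ 1)"
    using eventually_at_right_less[of "0::real"] by eventually_elim blast
  then obtain h where h: "0 < h" "h < 1"
    "\<forall>x\<in>vsp_vertices S. p $ 1 < x $ 1 \<longrightarrow> (p + h *\<^sub>R (snd s - p)) $ 1 < x $ 1"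
    using eventually_happens'[OF trivial_limit_at_right_real] by blast
  \<comment> \<open>Strictly to the right of \<open>p\<close> and before the next vertex, so that
    \<open>a p'\<close> is not degenerate even if \<open>p\<close> is \<open>a\<close>.\<close>
  define p' where "p' = p + h *\<^sub>R (snd s - p)"
  have p's: "p' \<in> seg s" using in_closedI[of h p "snd s"] h seg_sub[OF s(2) seg_ends(2)] by (auto simp: p'_def)
  have p'1: "p $ 1 < p' $ 1" unfolding p'_def using h p_lt by simp
  have ap': "a $ 1 < p' $ 1" using as(2) p'1 by simp
  have no_touch: "\<not> touch x" if x: "x \<in> seg s" "a $ 1 < x $ 1" "x $ 1 \<le> p' $ 1" for x
  proof
    assume t: "touch x"
    have v: "x \<in> vsp_vertices S" using touch_vertex[OF t x(1)] .
    show False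
    proof (cases "x $ 1 \<le> p $ 1")
      case True
      then have "x \<in> A" using v x(1) t by (simp add: A_def)
      then show False using amax x(2) by force
    next
      case False
      then have "p' $ 1 < x $ 1" using h(3) v by (simp add: p'_def)
      then show False using x(3) by simp
    qed
  qed
  obtain \<nu> where \<nu>: "p' = a + \<nu> *\<^sub>R (snd s - fst s)" using seg_other[OF as(1) p's] .
  have "0 < \<nu> * (snd s $ 1 - fst s $ 1)" using ap' unfolding \<nu> by simp
  then have \<nu>0: "0 < \<nu>" using nonvert[OF s(1)] by (simp add: zero_less_mult_iff)
  define d where "d = p' - a"
  have d: "d = \<nu> *\<^sub>R (snd s - fst s)" using \<nu> by (simp add: d_def)
  \<comment> \<open>Tilting towards the point \<open>m\<close> of \<open>H\<close> above
    \<open>s\<close> makes the rays run through \<open>H\<close>, so that they hit an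
    obstacle.\<close>
  define n where "n = m - a"
  have en: "cross (snd s - fst s) n = ori (fst s) (snd s) m"
  proof -
    have "cross (snd s - fst s) n = ori (fst s) (snd s) m - ori (fst s) (snd s) a"
      unfolding n_def by (simp add: ori_simps algebra_simps)
    then show ?thesis using as(1) by simp
  qed
  have dn: "cross d n \<noteq> 0"
  proof -
    have "cross d n = \<nu> * cross (snd s - fst s) n" unfolding d by (simp add: cross_def algebra_simps)
    then show ?thesis using \<nu>0 en m(2) by simp
  qed
  have above: "ori (fst s) (snd s) (a + r *\<^sub>R (d + \<theta> *\<^sub>R n)) = r * (\<theta> * ori (fst s) (snd s) m)" for r \<theta>
  proof -
    have "ori (fst s) (snd s) (a + r *\<^sub>R (d + \<theta> *\<^sub>R n)) =
        ori (fst s) (snd s) a + r * (\<theta> * cross (snd s - fst s) n)"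
      unfolding d by (simp add: ori_simps algebra_simps)
    then show ?thesis using as(1) en by simp
  qed
  have above1: "0 < ori (fst s) (snd s) (a + r *\<^sub>R (d + \<theta> *\<^sub>R n))" if "0 < r" "0 < \<theta>" for r \<theta>
    unfolding above using that m(2) by simp
  define N where "N = (if a = fst s then vis_above S s a else jump_region S s a)"
  have N: "\<forall>\<^sub>F \<theta> in at_right 0. \<forall>r>0. a + r *\<^sub>R (d + \<theta> *\<^sub>R n) \<in> N \<longleftrightarrow> visible S a (a + r *\<^sub>R (d + \<theta> *\<^sub>R n))"
  proof (cases "a = fst s")
    case True
    show ?thesis using eventually_at_right_less[of "0::real"]
      by eventually_elim (use above1 True in \<open>auto simp: N_def vis_above_iff less_imp_le\<close>)
  next
    case False
    then obtain t z where t: "t \<in> S" "a \<in> seg t" "z \<in> seg t" "0 < ori (fst s) (snd s) z"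
      using as(3) unfolding touch_def by blast
    have "ori a (a + (d + 0 *\<^sub>R n)) z = \<nu> * (ori (fst s) (snd s) z - ori (fst s) (snd s) a)"
      unfolding d by (simp add: ori_simps algebra_simps)
    then have pos: "0 < ori a (a + (d + 0 *\<^sub>R n)) z" using \<nu>0 t(4) as(1) by simp
    have "((\<lambda>\<theta>. ori a (a + (d + \<theta> *\<^sub>R n)) z) \<longlongrightarrow> ori a (a + (d + 0 *\<^sub>R n)) z) (at_right 0)"
      by (intro tendsto_intros)
    then have "\<forall>\<^sub>F \<theta> in at_right 0. 0 < ori a (a + (d + \<theta> *\<^sub>R n)) z" using pos by (rule order_tendstoD)
    then show ?thesis using eventually_at_right_less[of "0::real"]
    proof eventually_elim
      case (elim \<theta>)
      show ?case
      proof (intro allI impI)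
        fix r :: real assume r: "0 < r"
        have "ori a (a + r *\<^sub>R (d + \<theta> *\<^sub>R n)) z = r * ori a (a + (d + \<theta> *\<^sub>R n)) z"
          by (simp add: ori_simps algebra_simps)
        then have "0 < ori a (a + r *\<^sub>R (d + \<theta> *\<^sub>R n)) z" using elim(1) r by simp
        then have jc: "jump_cond S s a (a + r *\<^sub>R (d + \<theta> *\<^sub>R n))" using t unfolding jump_cond_def by blast
        have ab: "0 < ori (fst s) (snd s) (a + r *\<^sub>R (d + \<theta> *\<^sub>R n))" using above1 r elim(2) by blast
        show "a + r *\<^sub>R (d + \<theta> *\<^sub>R n) \<in> N \<longleftrightarrow> visible S a (a + r *\<^sub>R (d + \<theta> *\<^sub>R n))"
          using jump_hides[OF s(1) as(1) ab jc] ab False by (auto simp: N_def jump_region_def vis_above_iff)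
      qed
    qed
  qed
  have ad: "a + d = p'" by (simp add: d_def)
  have p'a: "p' \<noteq> a" using ap' by auto
  have lim: "((\<lambda>\<theta>. a + (d + \<theta> *\<^sub>R n)) \<longlongrightarrow> p') (at_right 0)"
    using tendsto_scale_at_right[of "p'" n] by (simp add: ad[symmetric] add.assoc)
  have vis: "\<forall>\<^sub>F \<theta> in at_right 0. visible S a (a + (d + \<theta> *\<^sub>R n))"
  proof (rule eventually_visible[OF finite_S])
    fix t assume t: "t \<in> S"
    show "\<forall>\<^sub>F \<theta> in at_right 0. seg t \<inter> open_segment a (a + (d + \<theta> *\<^sub>R n)) = {}"
    proof (cases "seg t \<inter> closed_segment a p' \<subseteq> {a}")
      case True
      show ?thesis by (rule eventually_clear[OF True p'a lim])
    next
      case False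
      then obtain y where y: "y \<in> seg t" "y \<in> closed_segment a p'" "y \<noteq> a" by blast
      have ys: "y \<in> seg s" using y(2) seg_sub[OF as(1) p's] by blast
      have "y = p' \<or> y \<in> open_segment a p'" using y(2,3) by (auto simp: open_segment_def)
      then have "a $ 1 < y $ 1" "y $ 1 \<le> p' $ 1"
        using ap' open_between_iff[OF s(1) as(1) p's ap', of y] by auto
      then have "\<not> touch y" using no_touch[OF ys] by blast
      then have low: "\<not> 0 < ori (fst s) (snd s) c" if "c \<in> seg t" for c
        using t y(1) that unfolding touch_def by blast
      show ?thesis using eventually_at_right_less[of "0::real"]
      proof eventually_elim
        case (elim \<theta>)
        show ?case
        proof (rule ccontr)
          assume "\<not> ?thesis"
          then obtain c where c: "c \<in> seg t" "c \<in> open_segment a (a + (d + \<theta> *\<^sub>R n))" by blast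
          obtain k where k: "0 < k" "c = a + k *\<^sub>R ((a + (d + \<theta> *\<^sub>R n)) - a)" using c(2) by (rule in_openE)
          have "c = a + k *\<^sub>R (d + \<theta> *\<^sub>R n)" using k(2) by simp
          then show False using low[OF c(1)] above1[OF k(1) elim] by simp
        qed
      qed
    qed
  qed
  have hits: "\<forall>\<^sub>F \<theta> in at_right 0. \<exists>r>0. a + r *\<^sub>R (d + \<theta> *\<^sub>R n) \<in> obstacles S"
    using eventually_at_right_less[of "0::real"]
  proof eventually_elim
    case (elim \<theta>)
    \<comment> \<open>With this scaling the point of the tilted ray is a convex combination of
      \<open>p'\<close> and \<open>m\<close>.\<close>
    define r where "r = 1 / (1 + \<theta>)"
    have r: "0 < r" using elim by (simp add: r_def)
    have r1: "r * (1 + \<theta>) = 1" using elim by (simp add: r_def)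
    have "a + r *\<^sub>R (d + \<theta> *\<^sub>R n) = (1 - r * (1 + \<theta>)) *\<^sub>R a + r *\<^sub>R p' + (r * \<theta>) *\<^sub>R m"
      unfolding d_def n_def by (simp add: algebra_simps)
    also have "\<dots> = r *\<^sub>R p' + (r * \<theta>) *\<^sub>R m" unfolding r1 by simp
    also have "\<dots> \<in> H"
    proof (rule convexD[OF convex_H])
      show "p' \<in> H" using p's seg_H[OF s(1)] by blast
      show "r + r * \<theta> = 1" using r1 by (simp add: algebra_simps)
    qed (use m r elim in auto)
    finally have inH: "a + r *\<^sub>R (d + \<theta> *\<^sub>R n) \<in> H" .
    have "cross (d + \<theta> *\<^sub>R n) n = cross d n" by (simp add: cross_def algebra_simps)
    moreover have "cross 0 n = 0" by (simp add: cross_def)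
    ultimately have "d + \<theta> *\<^sub>R n \<noteq> 0" using dn by metis
    then have "r *\<^sub>R (d + \<theta> *\<^sub>R n) \<noteq> 0" using r by simp
    then obtain k where "1 \<le> k" "a + k *\<^sub>R (r *\<^sub>R (d + \<theta> *\<^sub>R n)) \<in> obstacles S" using ray_hits[OF inH] by blast
    then show ?case using r by (intro exI[of _ "k * r"]) auto
  qed
  obtain T where T: "T \<in> fan S a N" "p' \<in> T" using fan_cover[OF dn N vis hits] ad by auto
  obtain t I where I: "T = convex hull (insert a I)" using fanE[OF T(1)] by metis
  have "p \<in> T"
  proof -
    have "p = a \<or> p \<in> open_segment a p'"
      using open_between_iff[OF s(1) as(1) p's ap', of p] s(2) as(2) p'1 seg_eqI[OF s(1,2) as(1)] by force
    then have "p \<in> closed_segment a p'" by (auto simp: open_segment_def)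
    moreover have "closed_segment a p' \<subseteq> T" unfolding I
      by (intro closed_segment_subset convex_convex_hull) (use T(2) I in \<open>auto intro: hull_inc\<close>)
    ultimately show ?thesis by blast
  qed
  moreover have "N \<subseteq> {y. 0 \<le> ori (fst s) (snd s) y}" by (auto simp: N_def vis_above_iff jump_region_def)
  then have "p \<notin> interior T" using fan_halfplane[OF s(1) as(1) T(1)] s(2) by fastforce
  moreover have "T \<in> cover_above S s"
  proof (cases "a = fst s")
    case True
    then show ?thesis using T(1) by (simp add: cover_above_def N_def)
  next
    case False
    then have "a \<in> set (vertices_on S s) - {fst s}" using vertices_on(1)[OF s(1)] as by blast
    then show ?thesis using T(1) False by (auto simp: cover_above_def N_def)
  qed
  ultimately show ?thesis by blast
qed

end

lemma interior_uminus: "- p \<in> interior (uminus ` T) \<longleftrightarrow> p \<in> interior T" for p :: pt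
  unfolding interior_negations by auto

lemma frontierI: "p \<in> T \<Longrightarrow> p \<notin> interior T \<Longrightarrow> p \<in> frontier T"
  using closure_subset by (auto simp: frontier_def)

context scene
begin

text \<open>Each failure of genericity puts \<open>p\<close> on the frontier of a triangle, directly
  or after a half turn. If \<open>p\<close> is on the supporting line of a segment it sees, it also
  sees the nearer end of that segment.\<close>

lemma generic_if_off_frontiers:
  assumes p: "p \<in> H" and off: "\<And>s T. s \<in> S \<Longrightarrow> T \<in> cover S s \<Longrightarrow> p \<notin> frontier T"
  shows "generic p"
proof -
  interpret r: scene "rot ` S" "uminus ` H" by (rule scene_rot)
  have up: False if s: "s \<in> S" "\<exists>T\<in>cover_above S s. p \<in> T \<and> p \<notin> interior T" for s
  proof -
    obtain T where T: "T \<in> cover_above S s" "p \<in> T" "p \<notin> interior T" using s(2) by blast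
    then have "T \<in> cover S s" by (simp add: cover_def)
    then show False using off[OF s(1)] frontierI[OF T(2,3)] by blast
  qed
  have down: False if s: "s \<in> S" "\<exists>T\<in>cover_above (rot ` S) (rot s). - p \<in> T \<and> - p \<notin> interior T" for s
  proof -
    obtain T where T: "T \<in> cover_above (rot ` S) (rot s)" "- p \<in> T" "- p \<notin> interior T" using s(2) by blast
    have "p \<in> uminus ` T" using T(2) by (metis image_eqI minus_minus)
    moreover have "p \<notin> interior (uminus ` T)" using T(3) interior_uminus[of "- p" T] by simp
    ultimately have "p \<in> frontier (uminus ` T)" by (rule frontierI)
    moreover have "uminus ` T \<in> cover S s" using T(1) by (auto simp: cover_def cover_below_def)
    ultimately show False using off[OF s(1)] by blast
  qed
  have free: "p \<notin> obstacles S"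
  proof
    assume "p \<in> obstacles S"
    then obtain s where s: "s \<in> S" "p \<in> seg s"
      "p \<noteq> snd s \<and> (\<exists>m\<in>H. 0 < ori (fst s) (snd s) m) \<or> p \<noteq> fst s \<and> (\<exists>m\<in>H. ori (fst s) (snd s) m < 0)"
      using inner_side by blast
    from s(3) show False
    proof
      assume "p \<noteq> snd s \<and> (\<exists>m\<in>H. 0 < ori (fst s) (snd s) m)"
      then show False using up[OF s(1)] obstacle_frontier[OF s(1,2)] by blast
    next
      assume "p \<noteq> fst s \<and> (\<exists>m\<in>H. ori (fst s) (snd s) m < 0)"
      then obtain m where m: "p \<noteq> fst s" "m \<in> H" "ori (fst s) (snd s) m < 0" by blast
      have "0 < ori (fst (rot s)) (snd (rot s)) (- m)" using m(3) ori_swap(1)[of "snd s" "fst s" m] by simp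
      then show False
        using down[OF s(1)] r.obstacle_frontier[of "rot s" "- p" "- m"] s(1,2) m by simp
    qed
  qed
  have "ori (fst t) (snd t) p \<noteq> 0" if t: "t \<in> S" "seg_visible S p t" for t
  proof
    assume o: "ori (fst t) (snd t) p = 0"
    obtain q where q: "q \<in> seg t" "visible S p q" using t(2) by (auto simp: seg_visible_def)
    obtain k where k: "p = fst t + k *\<^sub>R (snd t - fst t)" using ori_zeroD[OF o ends_neq[OF t(1)]] .
    obtain l where l: "0 \<le> l" "l \<le> 1" "q = fst t + l *\<^sub>R (snd t - fst t)"
      using q(1) unfolding seg_def in_closed_iff by blast
    have "p \<notin> seg t" using free t(1) by (auto simp: obstacles_def)
    then have "k < 0 \<or> 1 < k" using k in_closedI[of k "fst t" "snd t"] unfolding seg_def by fastforce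
    then show False
    proof
      assume k0: "k < 0"
      have lk: "0 < l - k" using k0 l by linarith
      \<comment> \<open>On the supporting line \<open>p\<close> has parameter \<open>k\<close> and
        \<open>q\<close> has parameter \<open>l\<close>; this is the position of
        \<open>fst t\<close>, parameter 0, between them.\<close>
      have "0 \<le> - k / (l - k)" "- k / (l - k) \<le> 1" using lk k0 l by (simp_all add: field_simps)
      then have "p + (- k / (l - k)) *\<^sub>R (q - p) \<in> closed_segment p q" by (rule in_closedI)
      moreover have "q - p = (l - k) *\<^sub>R (snd t - fst t)" unfolding k l(3) by (simp add: algebra_simps)
      then have "(- k / (l - k)) *\<^sub>R (q - p) = - k *\<^sub>R (snd t - fst t)" using lk by simp
      then have "p + (- k / (l - k)) *\<^sub>R (q - p) = fst t" by (simp add: k)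
      ultimately have "visible S p (fst t)" using visible_prefix[OF q(2)] by simp
      then show False using up[OF t(1)] support_frontier[OF p free t(1) k k0] visible_sym by blast
    next
      assume k1: "1 < k"
      have kl: "0 < k - l" using k1 l by linarith
      have "0 \<le> (k - 1) / (k - l)" "(k - 1) / (k - l) \<le> 1" using kl k1 l by (simp_all add: field_simps)
      then have "p + ((k - 1) / (k - l)) *\<^sub>R (q - p) \<in> closed_segment p q" by (rule in_closedI)
      moreover have "q - p = (k - l) *\<^sub>R (fst t - snd t)" unfolding k l(3) by (simp add: algebra_simps)
      then have "p + ((k - 1) / (k - l)) *\<^sub>R (q - p) = p + (k - 1) *\<^sub>R (fst t - snd t)" using kl by simp
      then have "p + ((k - 1) / (k - l)) *\<^sub>R (q - p) = snd t" by (simp add: k algebra_simps)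
      ultimately have v: "visible S (snd t) p" using visible_prefix[OF q(2)] visible_sym by metis
      have pk: "- p = fst (rot t) + (1 - k) *\<^sub>R (snd (rot t) - fst (rot t))" unfolding k by (simp add: algebra_simps)
      have "- p \<in> uminus ` H" "- p \<notin> obstacles (rot ` S)" "rot t \<in> rot ` S" "1 - k < 0"
        using free p t(1) k1 by (auto simp: obstacles_rot)
      moreover have "visible (rot ` S) (fst (rot t)) (- p)" using v by simp
      ultimately have "\<exists>T\<in>cover_above (rot ` S) (rot t). - p \<in> T \<and> - p \<notin> interior T"
        using r.support_frontier[OF _ _ _ pk] by blast
      then show False using down[OF t(1)] by blast
    qed
  qed
  then show ?thesis using p free by (simp add: generic_def)
qed

end

section \<open>The bounding rectangle\<close>

text \<open>Lagrange's identity for two vectors of the plane.\<close>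

lemma orthogonal_cross:
  assumes "u \<bullet> v = 0" "u \<noteq> 0" "v \<noteq> 0"
  shows "cross u v \<noteq> 0"
proof -
  have "cross u v * cross u v + (u \<bullet> v) * (u \<bullet> v) = (u \<bullet> u) * (v \<bullet> v)"
    by (simp add: cross_def inner_vec_def sum_2 algebra_simps)
  moreover have "0 < (u \<bullet> u) * (v \<bullet> v)" using assms by simp
  ultimately show ?thesis using assms(1) by auto
qed

lemma parallelogram_hull:
  assumes K: "cross u v \<noteq> 0"
  shows "convex hull {A, A + u, A + u + v, A + v} = {A + a *\<^sub>R u + b *\<^sub>R v | a b. 0 \<le> a \<and> a \<le> 1 \<and> 0 \<le> b \<and> b \<le> 1}"
    (is "?H = ?P")
proof
  show "?H \<subseteq> ?P"
  proof (rule hull_minimal)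
    have "A = A + 0 *\<^sub>R u + 0 *\<^sub>R v" "A + u = A + 1 *\<^sub>R u + 0 *\<^sub>R v"
      "A + u + v = A + 1 *\<^sub>R u + 1 *\<^sub>R v" "A + v = A + 0 *\<^sub>R u + 1 *\<^sub>R v" by simp_all
    then show "{A, A + u, A + u + v, A + v} \<subseteq> ?P"
      by (smt (verit, best) empty_subsetI insert_subset mem_Collect_eq zero_le_one order_refl)
    show "convex ?P"
    proof (rule convexI)
      fix x y s t assume x: "x \<in> ?P" and y: "y \<in> ?P" and st: "0 \<le> s" "0 \<le> t" "s + t = (1::real)"
      obtain a b where x': "0 \<le> a" "a \<le> 1" "0 \<le> b" "b \<le> 1" "x = A + a *\<^sub>R u + b *\<^sub>R v" using x by blast
      obtain c d where y': "0 \<le> c" "c \<le> 1" "0 \<le> d" "d \<le> 1" "y = A + c *\<^sub>R u + d *\<^sub>R v" using y by blast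
      have s: "s = 1 - t" using st by simp
      have "s *\<^sub>R x + t *\<^sub>R y = A + (s * a + t * c) *\<^sub>R u + (s * b + t * d) *\<^sub>R v"
        unfolding x'(5) y'(5) s by (simp add: algebra_simps)
      moreover have "0 \<le> s * a + t * c" "0 \<le> s * b + t * d" using x' y' st by simp_all
      moreover have "s * a + t * c \<le> s * 1 + t * 1" "s * b + t * d \<le> s * 1 + t * 1"
        using x' y' st by (intro add_mono mult_left_mono; simp)+
      ultimately show "s *\<^sub>R x + t *\<^sub>R y \<in> ?P" using st(3) by auto
    qed
  qed
  show "?P \<subseteq> ?H"
  proof
    fix x assume "x \<in> ?P"
    then obtain a b where x: "0 \<le> a" "a \<le> 1" "0 \<le> b" "b \<le> 1" "x = A + a *\<^sub>R u + b *\<^sub>R v" by blast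
    have c: "convex ?H" by (rule convex_convex_hull)
    have in': "A \<in> ?H" "A + u \<in> ?H" "A + u + v \<in> ?H" "A + v \<in> ?H" by (auto intro: hull_inc)
    have seg: "p + k *\<^sub>R (q - p) \<in> ?H" if "p \<in> ?H" "q \<in> ?H" "0 \<le> k" "k \<le> 1" for p q k
      using in_closedI[OF that(3,4)] closed_segment_subset[OF that(1,2) c] by blast
    have "A + a *\<^sub>R u \<in> ?H" using seg[OF in'(1,2) x(1,2)] by simp
    moreover have "(A + v) + a *\<^sub>R u \<in> ?H" using seg[OF in'(4,3) x(1,2)] by (simp add: algebra_simps)
    ultimately have "(A + a *\<^sub>R u) + b *\<^sub>R (((A + v) + a *\<^sub>R u) - (A + a *\<^sub>R u)) \<in> ?H"
      using seg x(3,4) by blast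
    then show "x \<in> ?H" by (simp add: x(5))
  qed
qed

lemma parallelogram_frontier:
  assumes K: "cross u v \<noteq> 0"
  shows "frontier (convex hull {A, A + u, A + u + v, A + v}) \<subseteq>
    closed_segment A (A + u) \<union> closed_segment (A + u) (A + u + v) \<union>
    closed_segment (A + u + v) (A + v) \<union> closed_segment (A + v) A" (is "frontier ?H \<subseteq> ?B")
proof
  fix x assume x: "x \<in> frontier ?H"
  have "compact ?H" by (intro compact_convex_hull finite_imp_compact) simp
  then have "x \<in> ?H" using x compact_imp_closed frontier_subset_closed by blast
  then obtain a b where ab: "0 \<le> a" "a \<le> 1" "0 \<le> b" "b \<le> 1" "x = A + a *\<^sub>R u + b *\<^sub>R v"
    unfolding parallelogram_hull[OF K] by blast
  \<comment> \<open>Coordinates with respect to \<open>u\<close> and \<open>v\<close>, by Cramer's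
    rule; where all four bounds are strict, the point is interior.\<close>
  define f g where "f y = cross (y - A) v / cross u v" and "g y = cross u (y - A) / cross u v" for y
  have fg: "y = A + f y *\<^sub>R u + g y *\<^sub>R v" for y
  proof -
    have "cross u v *\<^sub>R (y - A) = cross (y - A) v *\<^sub>R u + cross u (y - A) *\<^sub>R v"
      by (simp add: vec_eq_iff forall_2 cross_def algebra_simps)
    then have "(1 / cross u v) *\<^sub>R (cross u v *\<^sub>R (y - A)) =
        (1 / cross u v) *\<^sub>R (cross (y - A) v *\<^sub>R u + cross u (y - A) *\<^sub>R v)" by simp
    then have "y - A = f y *\<^sub>R u + g y *\<^sub>R v" using K by (simp add: f_def g_def scaleR_right_distrib)
    then show ?thesis by (simp add: algebra_simps)
  qed
  have fx: "f x = a" "g x = b"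
    unfolding f_def g_def ab(5) using K by (simp_all add: cross_def field_simps)
  have "a = 0 \<or> a = 1 \<or> b = 0 \<or> b = 1"
  proof (rule ccontr)
    assume "\<not> ?thesis"
    then have s: "0 < a" "a < 1" "0 < b" "b < 1" using ab by auto
    let ?O = "{y. 0 < f y} \<inter> {y. f y < 1} \<inter> {y. 0 < g y} \<inter> {y. g y < 1}"
    have "continuous_on UNIV f" "continuous_on UNIV g" unfolding f_def g_def cross_def
      by (intro continuous_intros; use K in \<open>simp add: cross_def\<close>)+
    then have "open ?O" by (intro open_Int open_Collect_less continuous_on_const)
    moreover have "x \<in> ?O" using s fx by simp
    moreover have "?O \<subseteq> ?H"
    proof
      fix y assume "y \<in> ?O"
      then have "0 \<le> f y" "f y \<le> 1" "0 \<le> g y" "g y \<le> 1" by auto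
      then show "y \<in> ?H" unfolding parallelogram_hull[OF K] using fg[of y] by blast
    qed
    ultimately have "x \<in> interior ?H" by (rule interiorI)
    then show False using x by (simp add: frontier_def)
  qed
  then show "x \<in> ?B"
  proof (elim disjE)
    assume "a = 0"
    then have "x = A + b *\<^sub>R ((A + v) - A)" using ab(5) by simp
    then have "x \<in> closed_segment A (A + v)" using in_closedI[OF ab(3,4)] by metis
    then show ?thesis by (simp add: closed_segment_commute)
  next
    assume "a = 1"
    then have "x = (A + u) + b *\<^sub>R ((A + u + v) - (A + u))" using ab(5) by simp
    then show ?thesis using in_closedI[OF ab(3,4)] by (metis UnI1 UnI2)
  next
    assume "b = 0"
    then have "x = A + a *\<^sub>R ((A + u) - A)" using ab(5) by simp
    then show ?thesis using in_closedI[OF ab(1,2)] by (metis UnI1)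
  next
    assume "b = 1"
    then have "x = (A + v) + a *\<^sub>R ((A + u + v) - (A + v))" using ab(5) by (simp add: algebra_simps)
    then have "x \<in> closed_segment (A + v) (A + u + v)" using in_closedI[OF ab(1,2)] by metis
    then show ?thesis by (simp add: closed_segment_commute)
  qed
qed

text \<open>A side is known as a point set, while its element of \<open>S\<close> lists the ends
  from left to right; both orientations have to be matched.\<close>

lemma side_inner:
  assumes "closed_segment P Q \<in> seg ` S" "p \<in> closed_segment P Q" "p \<noteq> Q" "m \<in> H" "0 < ori P Q m"
  shows "\<exists>s\<in>S. p \<in> seg s \<and>
      (p \<noteq> snd s \<and> (\<exists>m\<in>H. 0 < ori (fst s) (snd s) m) \<or>
       p \<noteq> fst s \<and> (\<exists>m\<in>H. ori (fst s) (snd s) m < 0))"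
proof -
  obtain s where s: "s \<in> S" "seg s = closed_segment P Q" using assms(1) by auto
  then have "{fst s, snd s} = {P, Q}" unfolding seg_def by simp
  then consider "fst s = P" "snd s = Q" | "fst s = Q" "snd s = P" by (auto simp: doubleton_eq_iff)
  then show ?thesis
  proof cases
    case 1
    then show ?thesis using s assms(2-5) by (intro bexI[of _ s]) auto
  next
    case 2
    have "ori Q P m < 0" using assms(5) ori_swap(1)[of Q P m] by simp
    then show ?thesis using 2 s assms(2-4) by (intro bexI[of _ s]) auto
  qed
qed

text \<open>The far corner of one side is the near corner of the next, so following the boundary in
  one direction serves every point including the corners.\<close>

lemma corner_inner:
  assumes "closed_segment P Q \<in> seg ` S" "closed_segment Q R \<in> seg ` S" "p \<in> closed_segment P Q"
    and "m \<in> H" "0 < ori P Q m" "0 < ori Q R m"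
  shows "\<exists>s\<in>S. p \<in> seg s \<and>
      (p \<noteq> snd s \<and> (\<exists>m\<in>H. 0 < ori (fst s) (snd s) m) \<or>
       p \<noteq> fst s \<and> (\<exists>m\<in>H. ori (fst s) (snd s) m < 0))"
proof (cases "p = Q")
  case False
  show ?thesis by (rule side_inner[OF assms(1,3) False assms(4,5)])
next
  case True
  have "Q \<noteq> R" using assms(6) by auto
  then have "p \<noteq> R" "p \<in> closed_segment Q R" using True by simp_all
  then show ?thesis using side_inner[OF assms(2) _ _ assms(4,6)] by blast
qed

lemma scene_of_rectangle:
  assumes fin: "finite S" and nv: "\<forall>s\<in>S. nonvertical s" and dj: "disjoint_interiors S"
    and rect: "bounding_rectangle S A B C D"
  shows "scene S (convex hull {A, B, C, D})"
proof -
  let ?H = "convex hull {A, B, C, D}"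
  define u v where "u = B - A" and "v = D - A"
  have B: "B = A + u" and D: "D = A + v" by (simp_all add: u_def v_def)
  define R where "R = {closed_segment A B, closed_segment B C, closed_segment C D, closed_segment D A}"
  have r: "B \<noteq> A" "D \<noteq> A" "(B - A) \<bullet> (D - A) = 0" "C = B + (D - A)" "R \<subseteq> seg ` S"
    "\<And>s. s \<in> S \<Longrightarrow> seg s \<notin> R \<Longrightarrow> seg s \<subseteq> interior ?H"
    using rect unfolding bounding_rectangle_def Let_def R_def by blast+
  have C: "C = A + u + v" using r(4) by (simp add: B D)
  have K: "cross u v \<noteq> 0" using orthogonal_cross[of u v] r(1-3) by (simp add: u_def v_def)
  have corners: "A \<in> ?H" "B \<in> ?H" "C \<in> ?H" "D \<in> ?H" by (auto intro: hull_inc)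
  have RH: "X \<subseteq> ?H" if "X \<in> R" for X
    using that corners unfolding R_def by (auto dest: closed_segment_subset[OF _ _ convex_convex_hull])
  have segH: "seg s \<subseteq> ?H" if "s \<in> S" for s
    using r(6)[OF that] RH interior_subset by blast
  show ?thesis
  proof
    show "finite S" by (rule fin)
    show "fst s $ 1 < snd s $ 1" if "s \<in> S" for s using nv that by (auto simp: nonvertical_def)
    show "open_segment (fst s) (snd s) \<inter> open_segment (fst t) (snd t) = {}"
      if "s \<in> S" "t \<in> S" "s \<noteq> t" for s t
      using dj that unfolding disjoint_interiors_def pairwise_def by blast
    show "convex ?H" by (rule convex_convex_hull)
    show "bounded ?H" by (intro bounded_convex_hull finite_imp_bounded) simp
    show "obstacles S \<subseteq> ?H" using segH by (auto simp: obstacles_def)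
    have "frontier ?H \<subseteq> \<Union> R"
      using parallelogram_frontier[OF K, of A] unfolding R_def B C D by (simp add: Un_assoc)
    then show "frontier ?H \<subseteq> obstacles S" using r(5) unfolding obstacles_def by blast
    fix p assume "p \<in> obstacles S"
    then obtain s where s: "s \<in> S" "p \<in> seg s" by (auto simp: obstacles_def)
    show "\<exists>s\<in>S. p \<in> seg s \<and>
        (p \<noteq> snd s \<and> (\<exists>m\<in>?H. 0 < ori (fst s) (snd s) m) \<or>
         p \<noteq> fst s \<and> (\<exists>m\<in>?H. ori (fst s) (snd s) m < 0))"
    proof (cases "seg s \<in> R")
      case True
      \<comment> \<open>The centre of the rectangle, which lies on the inner side of all four
        sides.\<close>
      define m where "m = A + (1/2) *\<^sub>R u + (1/2) *\<^sub>R v"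
      have m: "m \<in> ?H"
        unfolding B C D parallelogram_hull[OF K] m_def by (intro CollectI exI[of _ "1/2"] conjI) auto
      have sides: "closed_segment A B \<in> seg ` S" "closed_segment B C \<in> seg ` S"
        "closed_segment C D \<in> seg ` S" "closed_segment D A \<in> seg ` S"
        using r(5) unfolding R_def by auto
      have p: "p \<in> closed_segment A B \<or> p \<in> closed_segment B C \<or> p \<in> closed_segment C D \<or> p \<in> closed_segment D A"
        using True s(2) unfolding R_def by auto
      have o: "ori A B m = cross u v / 2" "ori B C m = cross u v / 2" "ori C D m = cross u v / 2" "ori D A m = cross u v / 2"
        unfolding B C D m_def by (simp_all add: ori_simps field_simps)
      have o': "ori B A m = - cross u v / 2" "ori C B m = - cross u v / 2" "ori D C m = - cross u v / 2" "ori A D m = - cross u v / 2"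
        unfolding B C D m_def by (simp_all add: ori_simps field_simps)
      show ?thesis
      proof (cases "0 < cross u v")
        case True
        then have pos: "0 < ori A B m" "0 < ori B C m" "0 < ori C D m" "0 < ori D A m" unfolding o by simp_all
        show ?thesis using p corner_inner[OF sides(1,2) _ m pos(1,2)] corner_inner[OF sides(2,3) _ m pos(2,3)]
            corner_inner[OF sides(3,4) _ m pos(3,4)] corner_inner[OF sides(4,1) _ m pos(4,1)] by blast
      next
        case False
        \<comment> \<open>The corners are listed clockwise in this case, so the boundary is followed
          backwards.\<close>
        then have pos: "0 < ori B A m" "0 < ori C B m" "0 < ori D C m" "0 < ori A D m" unfolding o' using K by simp_all
        have sides'': "closed_segment B A \<in> seg ` S" "closed_segment C B \<in> seg ` S"
          "closed_segment D C \<in> seg ` S" "closed_segment A D \<in> seg ` S"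
          using sides by (metis closed_segment_commute)+
        have p'': "p \<in> closed_segment B A \<or> p \<in> closed_segment C B \<or> p \<in> closed_segment D C \<or> p \<in> closed_segment A D"
          using p by (metis closed_segment_commute)
        show ?thesis using p'' corner_inner[OF sides''(1,4) _ m pos(1,4)] corner_inner[OF sides''(4,3) _ m pos(4,3)]
            corner_inner[OF sides''(3,2) _ m pos(3,2)] corner_inner[OF sides''(2,1) _ m pos(2,1)] by blast
      qed
    next
      case False
      then have pi: "p \<in> interior ?H" using r(6)[OF s(1)] s(2) by blast
      have ne: "fst s \<noteq> snd s" using nv s(1) by (auto simp: nonvertical_def)
      define n :: pt where "n = vector [0, 1]"
      have n: "0 < cross (snd s - fst s) n" using nv s(1) by (auto simp: nonvertical_def cross_def n_def)
      have "\<forall>\<^sub>F y in nhds p. y \<in> interior ?H" using pi by (intro eventually_nhds_in_open) auto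
      then have "\<forall>\<^sub>F h in at_right 0. p + h *\<^sub>R w \<in> interior ?H" for w
        by (rule eventually_compose_filterlim) (rule tendsto_scale_at_right)
      from this[of n] this[of "- n"] eventually_at_right_less[of "0::real"]
      have "\<forall>\<^sub>F h in at_right (0::real). 0 < h \<and> p + h *\<^sub>R n \<in> interior ?H \<and> p + h *\<^sub>R (- n) \<in> interior ?H"
        by eventually_elim blast
      then obtain h where h: "0 < h" "p + h *\<^sub>R n \<in> interior ?H" "p + h *\<^sub>R (- n) \<in> interior ?H"
        using eventually_happens'[OF trivial_limit_at_right_real] by blast
      have o: "ori (fst s) (snd s) (p + k *\<^sub>R w) = k * cross (snd s - fst s) w" for k w
        unfolding ori_cross_dir using s(2) by simp
      have cm: "cross (snd s - fst s) (- n) = - cross (snd s - fst s) n" by (simp add: cross_def)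
      have "0 < ori (fst s) (snd s) (p + h *\<^sub>R n)" "ori (fst s) (snd s) (p + h *\<^sub>R (- n)) < 0"
        unfolding o cm using h(1) n by (simp_all add: mult_pos_neg)
      moreover have "p + h *\<^sub>R n \<in> ?H" "p + h *\<^sub>R (- n) \<in> ?H"
        using subsetD[OF interior_subset h(2)] subsetD[OF interior_subset h(3)] .
      moreover have "p \<noteq> snd s \<or> p \<noteq> fst s" using ne by auto
      ultimately show ?thesis by (intro bexI[OF _ s(1)] conjI s(2)) blast
    qed
  qed
qed

section \<open>Counting\<close>

context scene
begin

text \<open>For \<open>p\<close> below \<open>s\<close> the construction takes place in the rotated
  plane; signs are chosen so that \<open>x\<close> and \<open>q\<close> always refer to the original
  one.\<close>

definition triangle_at :: "pt \<Rightarrow> sgmt \<Rightarrow> pt set \<Rightarrow> pt \<Rightarrow> pt \<Rightarrow> bool" where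
  "triangle_at p s T x q \<longleftrightarrow>
     0 < ori (fst s) (snd s) p \<and> produces S s x q T \<or>
     ori (fst s) (snd s) p < 0 \<and> produces (rot ` S) (rot s) (- x) (- q) (uminus ` T)"

lemma triangle_at_exists:
  assumes g: "generic p" and s: "s \<in> S" and T: "T \<in> cover S s" "p \<in> interior T"
  shows "\<exists>x q. start_point S p (cw p s) (ccw p s) x q \<and> triangle_at p s T x q"
proof -
  interpret r: scene "rot ` S" "uminus ` H" by (rule scene_rot)
  have rg: "r.generic (- p)"
    using g unfolding generic_def r.generic_def by (auto simp: obstacles_rot ori_swap(1)[of "snd _" "fst _"])
  from T(1) show ?thesis unfolding cover_def
  proof
    assume "T \<in> cover_above S s"
    then obtain x q where xq: "start_point S p (fst s) (snd s) x q" "produces S s x q T"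
      using triangle_start[OF g s _ T(2)] by blast
    then have "0 < ori (fst s) (snd s) p" by (simp add: start_point_def)
    then show ?thesis using xq by (intro exI[of _ x] exI[of _ q]) (simp add: cw_def ccw_def triangle_at_def)
  next
    assume "T \<in> cover_below S s"
    then obtain T' where T': "T' \<in> cover_above (rot ` S) (rot s)" "T = uminus ` T'" by (auto simp: cover_below_def)
    have "- p \<in> interior T'" using T(2) interior_uminus[of "- p" T'] unfolding T'(2) by simp
    then obtain x q where xq: "start_point (rot ` S) (- p) (fst (rot s)) (snd (rot s)) x q"
      "produces (rot ` S) (rot s) x q T'"
      using r.triangle_start[OF rg _ T'(1)] s by blast
    have sp: "start_point S p (snd s) (fst s) (- x) (- q)"
      using start_point_rot[of S p "snd s" "fst s" "- x" "- q"] xq(1) by simp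
    then have neg: "ori (fst s) (snd s) p < 0"
      using ori_swap(1)[of "snd s" "fst s" p] by (simp add: start_point_def)
    have "T' = uminus ` T" unfolding T'(2) by (simp add: image_image)
    then show ?thesis using sp neg xq(2)
      by (intro exI[of _ "- x"] exI[of _ "- q"]) (simp add: cw_def ccw_def triangle_at_def)
  qed
qed

lemma triangle_at_unique:
  assumes g: "generic p" and s: "s \<in> S" and x: "start_point S p (cw p s) (ccw p s) x q"
    and T: "triangle_at p s T x q" "p \<in> interior T" and T': "triangle_at p s T' x q" "p \<in> interior T'"
  shows "T = T'"
proof -
  interpret r: scene "rot ` S" "uminus ` H" by (rule scene_rot)
  have "x \<in> closed_segment (cw p s) (ccw p s)" using x by (auto simp: start_point_def open_segment_def)
  then have "x \<in> obstacles S" unfolding seg_cw using s by (auto simp: obstacles_def)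
  then have px: "p \<noteq> x" using g by (auto simp: generic_def)
  show ?thesis
  proof (cases "0 < ori (fst s) (snd s) p")
    case True
    then show ?thesis using produces_unique[OF s _ T(2) _ T'(2) px] T(1) T'(1) by (simp add: triangle_at_def)
  next
    case False
    then have pr: "produces (rot ` S) (rot s) (- x) (- q) (uminus ` T)"
      "produces (rot ` S) (rot s) (- x) (- q) (uminus ` T')"
      using T(1) T'(1) by (simp_all add: triangle_at_def)
    have "- p \<in> interior (uminus ` T)" "- p \<in> interior (uminus ` T')" using T(2) T'(2) interior_uminus by blast+
    then have "uminus ` T = uminus ` T'" using r.produces_unique[OF _ pr(1) _ pr(2)] s px by simp
    then show ?thesis by (metis inj_image_eq_iff inj_uminus)
  qed
qed

lemma cover_contains:
  assumes g: "generic p" and s: "s \<in> S" "seg_visible S p s"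
  shows "\<exists>T\<in>cover S s. p \<in> T"
proof -
  interpret r: scene "rot ` S" "uminus ` H" by (rule scene_rot)
  have rg: "r.generic (- p)"
    using g unfolding generic_def r.generic_def by (auto simp: obstacles_rot ori_swap(1)[of "snd _" "fst _"])
  have "ori (fst s) (snd s) p \<noteq> 0" using g s by (simp add: generic_def)
  then consider "0 < ori (fst s) (snd s) p" | "ori (fst s) (snd s) p < 0" by linarith
  then show ?thesis
  proof cases
    case 1
    then show ?thesis using cover_visible[OF g s(1) _ s(2)] by (auto simp: cover_def)
  next
    case 2
    then have "0 < ori (fst (rot s)) (snd (rot s)) (- p)" using ori_swap(1)[of "snd s" "fst s" p] by simp
    then obtain T where T: "T \<in> cover_above (rot ` S) (rot s)" "- p \<in> T"
      using r.cover_visible[OF rg, of "rot s"] s by auto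
    have "p \<in> uminus ` T" using T(2) by (metis image_eqI minus_minus)
    then show ?thesis using T(1) by (auto simp: cover_def cover_below_def)
  qed
qed

lemma triangle_count:
  assumes p: "p \<in> H" and off: "\<forall>(s, T)\<in>all_triangles S. p \<notin> frontier T"
  shows "card {s\<in>S. seg_visible S p s} \<le> card {(s, T)\<in>all_triangles S. p \<in> T} \<and>
         card {(s, T)\<in>all_triangles S. p \<in> T} \<le> 2 * card {s\<in>S. seg_visible S p s}"
proof -
  let ?V = "{s\<in>S. seg_visible S p s}" and ?Q = "{(s, T)\<in>all_triangles S. p \<in> T}"
  have off': "p \<notin> frontier T" if "s \<in> S" "T \<in> cover S s" for s T
    using off that by (auto simp: all_triangles_def)
  have g: "generic p" using generic_if_off_frontiers[OF p off'] .
  have Q: "s \<in> S \<and> T \<in> cover S s \<and> p \<in> interior T" if "(s, T) \<in> ?Q" for s T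
  proof -
    have st: "s \<in> S" "T \<in> cover S s" "p \<in> T" using that by (auto simp: all_triangles_def)
    then show ?thesis using off'[OF st(1,2)] frontierI[of p T] by blast
  qed
  let ?X = "\<lambda>z y. start_point S p (cw p (fst z)) (ccw p (fst z)) (fst y) (snd y) \<and>
    triangle_at p (fst z) (snd z) (fst y) (snd y)"
  have "\<forall>z\<in>?Q. \<exists>y. ?X z y"
  proof
    fix z assume "z \<in> ?Q"
    then have "(fst z, snd z) \<in> ?Q" by simp
    from Q[OF this] obtain x q where "?X z (x, q)"
      using triangle_at_exists[OF g, of "fst z" "snd z"] by auto
    then show "\<exists>y. ?X z y" by blast
  qed
  from bchoice[OF this] obtain f where f: "\<And>z. z \<in> ?Q \<Longrightarrow> ?X z (f z)" by blast
  define c where "c z = slot S p (fst z) (fst (f z)) (snd (f z))" for z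
  have QS: "fst z \<in> S" "p \<in> interior (snd z)" if "z \<in> ?Q" for z
    using Q[of "fst z" "snd z"] that by auto
  have finV: "finite (?V \<times> (UNIV :: bool set))" using finite_S by simp
  have sub: "c ` ?Q \<subseteq> ?V \<times> UNIV"
  proof
    fix y assume "y \<in> c ` ?Q"
    then obtain z where z: "z \<in> ?Q" "y = c z" by blast
    have "fst y \<in> ?V" unfolding z(2) c_def using slot_visible[OF conjunct1[OF f[OF z(1)]] QS(1)[OF z(1)]] .
    then show "y \<in> ?V \<times> UNIV" by (simp add: mem_Times_iff)
  qed
  have inj: "inj_on c ?Q"
  proof (rule inj_onI)
    fix z z' assume z: "z \<in> ?Q" and z': "z' \<in> ?Q" and eq: "c z = c z'"
    have e: "fst z = fst z'" "fst (f z) = fst (f z')" "snd (f z) = snd (f z')"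
      using slot_inj[OF conjunct1[OF f[OF z]] QS(1)[OF z] conjunct1[OF f[OF z']] QS(1)[OF z'] eq[unfolded c_def]]
      by auto
    have "snd z = snd z'"
      using triangle_at_unique[OF g QS(1)[OF z] conjunct1[OF f[OF z]] conjunct2[OF f[OF z]] QS(2)[OF z], of "snd z'"]
        conjunct2[OF f[OF z']] QS(2)[OF z'] e by simp
    then show "z = z'" using e(1) by (rule prod_eqI[rotated])
  qed
  \<comment> \<open>Finiteness of the set of triangles comes with the charging; the lower bound
    relies on it, since an infinite set has cardinality 0.\<close>
  have finQ: "finite ?Q" using inj_on_finite[OF inj sub finV] .
  have "card ?Q \<le> card (?V \<times> (UNIV :: bool set))" using card_inj_on_le[OF inj sub finV] .
  then have upper: "card ?Q \<le> 2 * card ?V" by (simp add: card_cartesian_product)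
  have "\<forall>s\<in>?V. \<exists>T. (s, T) \<in> ?Q" using cover_contains[OF g] by (fastforce simp: all_triangles_def)
  from bchoice[OF this] obtain h where h: "\<And>s. s \<in> ?V \<Longrightarrow> (s, h s) \<in> ?Q" by blast
  have "card ?V \<le> card ?Q"
    by (rule card_inj_on_le[of "\<lambda>s. (s, h s)"]) (use h finQ in \<open>auto intro: inj_onI\<close>)
  with upper show ?thesis by blast
qed

end

theorem lemma3:
  fixes S :: "sgmt set" and A B C D p :: pt
  assumes "finite S"
    and "\<forall>s\<in>S. nonvertical s"
    and "disjoint_interiors S"
    and "bounding_rectangle S A B C D"
    and "p \<in> convex hull {A, B, C, D}"
    and "\<forall>(s, T)\<in>all_triangles S. p \<notin> frontier T"
  shows "card {s\<in>S. seg_visible S p s} \<le> card {(s, T)\<in>all_triangles S. p \<in> T} \<and>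
         card {(s, T)\<in>all_triangles S. p \<in> T} \<le> 2 * card {s\<in>S. seg_visible S p s}"
proof -
  interpret scene S "convex hull {A, B, C, D}" using scene_of_rectangle assms(1-4) by blast
  show ?thesis using triangle_count assms(5,6) by blast
qed

end
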